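(* Let $\varepsilon\in\{0,1\}$, $\psi=\psi^\varepsilon$, $K_m=K^\varepsilon_m$. Let $\mu$ be a character of $F^\times$ and $\eta$ a character of $\mathcal{O}^\times$. (1) If $\eta(-1)\ne\mu(-1)$, then $\pi_\psi(\mu)^{K_m}_\eta=\{0\}$ for all $m\ge0$. (2) Assume $\eta(-1)=\mu(-1)$. If $c(\mu)=c(\eta)=m=0$, then $\pi_\psi(\mu)^{K_0}_1$ is $1$-dimensional. Otherwise, $\dim_{\mathbb{C}}\pi_\psi(\mu)^{K_m}_\eta$ equals $0$ if $m<c(\mu)$; equals $2\big((m-c(\mu)-c(\eta\mu)+1)^++(m-c(\mu)-c(\eta\mu^{-1})+1)^+\big)-\delta_{c(\eta\mu)}-\delta_{c(\eta\mu^{-1})}$ if $c(\mu)\le m<2c(\mu)$; and equals $2(m-c(\eta\mu)-c(\eta\mu^{-1})+1)^+-\delta_{c(\eta\mu)}-\delta_{c(\eta\mu^{-1})}$ if $2c(\mu)\le m$, where $r^+=\max(0,r)$ and $\delta_s=1$ if $s=0$ and $\delta_s=0$ otherwise. In particular, $c^\varepsilon_{\min}(\pi_\psi(\mu))=c^\varepsilon_\eta(\pi_\psi(\mu))$ if and only if $\eta=\mu^{\pm1}|_{\mathcal{O}^\times}$, and $c^\varepsilon_{\min}(\pi_\psi(\mu))=c(\mu)$.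
   Context: $F$ is a non-archimedean local field of characteristic $0$ with odd residual characteristic; $\mathcal{O}$, $\mathfrak{p}$, $\varpi$, $q$ its ring of integers, maximal ideal, uniformizer, residue cardinality; $|\cdot|$ the absolute value with $|\varpi|=q^{-1}$; $(\cdot,\cdot)_2$ the quadratic Hilbert symbol. For a nontrivial additive character $\psi$ of $F$: $c(\psi)$ is the least $c$ with $\psi|_{\mathfrak{p}^c}=1$; $\psi_a(x)=\psi(ax)$; $\gamma_F(\psi)$ is the Weil index of $x\mapsto\psi(x^2)$ and $\gamma_F(a,\psi)=\gamma_F(\psi_a)/\gamma_F(\psi)$. For a nontrivial character $\eta$ of $\mathcal{O}^\times$, $c(\eta)$ is the least $c\ge1$ with $\eta|_{1+\mathfrak{p}^c}=1$, $c(1)=0$; for a character $\mu$ of $F^\times$, $c(\mu)=c(\mu|_{\mathcal{O}^\times})$, and $\eta\mu$ means $\eta\cdot\mu|_{\mathcal{O}^\times}$. $G=\mathrm{SL}_2(F)$; $\widetilde G=G\times\{\pm1\}$ with product $(g_1,\epsilon_1)(g_2,\epsilon_2)=(g_1g_2,\epsilon_1\epsilon_2\mathbf{c}(g_1,g_2))$, $\mathbf{c}(g_1,g_2)=(\mathbf{x}(g_1)/\mathbf{x}(g_1g_2),\mathbf{x}(g_2)/\mathbf{x}(g_1g_2))_2$, where $\mathbf{x}\begin{pmatrix}a&b\\c&d\end{pmatrix}=c$ if $c\ne0$ and $=d$ if $c=0$. Put $t(a)=\mathrm{diag}(a,a^{-1})$, $n(b)=\begin{pmatrix}1&b\\0&1\end{pmatrix}$,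 $n^{\mathrm{op}}(c)=\begin{pmatrix}1&0\\c&1\end{pmatrix}$, $w=\begin{pmatrix}0&1\\-1&0\end{pmatrix}$. Fix additive characters $\psi^0,\psi^1$ with $c(\psi^0)=0$, $c(\psi^1)=-1$. For $\varepsilon\in\{0,1\}$, $m\ge0$: $K^\varepsilon_m=\{\begin{pmatrix}a&b\\c&d\end{pmatrix}\in G:a,d\in\mathcal{O},b\in\mathfrak{p}^{-\varepsilon},c\in\mathfrak{p}^{m+\varepsilon}\}$, $K^\varepsilon=K^\varepsilon_0$; it is regarded as a subgroup of $\widetilde G$ via the splitting $x\mapsto(x,\mathbf{s}^\varepsilon(x))$ determined by $\mathbf{s}^\varepsilon(n(b))=1$ ($b\in\mathfrak{p}^{-\varepsilon}$), $\mathbf{s}^\varepsilon(t(a))=\gamma_F(a,\psi^\varepsilon)$ ($a\in\mathcal{O}^\times$), $\mathbf{s}^\varepsilon(n^{\mathrm{op}}(c))=1$ ($c\in\mathfrak{p}^\varepsilon$), $\mathbf{s}^\varepsilon(wt(\varpi^\varepsilon))=1$. For a representation $(\pi,V)$ of $\widetilde G$ and a character $\eta$ of $\mathcal{O}^\times$: $\pi^{K^\varepsilon_m}_\eta=\{v\in V:\pi(k)v=\eta(d)v\text{ for all }k=\begin{pmatrix}a&b\\c&d\end{pmatrix}\in K^\varepsilon_m\}$ if $m\ge c(\eta)$, and $\{0\}$ if $m<c(\eta)$. For nontrivial $\psi$, the central element $-1_\psi=(-1_2,\gamma_F(-1,\psi))$ acts on an irreducible $\pi$ by a sign $z_\psi(\pi)$.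 For $\eta$ with $\eta(-1)=z_{\psi^\varepsilon}(\pi)$: $c^\varepsilon_\eta(\pi)=\min\{m\ge0:\pi^{K^\varepsilon_m}_\eta\ne\{0\}\}$ ($+\infty$ if none), and $c^\varepsilon_{\min}(\pi)$ is the minimum of $c^\varepsilon_\eta(\pi)$ over such $\eta$. Principal series: $\chi_\psi((t(a),\epsilon))=\epsilon\gamma_F(a,\psi)^{-1}$; for a character $\mu$ of $F^\times$, $\pi_\psi(\mu)$ is the representation of $\widetilde G$ by right translation on locally constant $f:\widetilde G\to\mathbb{C}$ with $f((t(a),\epsilon)(n(b),1)g)=|a|\mu(a)\chi_\psi((t(a),\epsilon))f(g)$ for all $a\in F^\times,\epsilon\in\{\pm1\},b\in F,g\in\widetilde G$. *)

theory Defs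
  imports "HOL-Analysis.Analysis" "HOL-Library.Function_Algebras" "HOL-Library.Extended_Nat"
begin

section \<open>Non-archimedean local fields of characteristic zero\<close>

class absval = minus +
  fixes absv :: "'a \<Rightarrow> real"

definition (in absval) residue_field :: "'a set set" where
  "residue_field = {x. absv x \<le> 1} // {(x, y). absv x \<le> 1 \<and> absv y \<le> 1 \<and> absv (x - y) < 1}"

text \<open>The absolute value is normalised: that of a uniformiser is the inverse of the residue
  cardinality. Its definiteness and non-negativity follow from its inducing the metric.
  The library's \<open>norm\<close> is not usable here, being tied to real vector spaces.\<close>

class nonarch_local_field = field_char_0 + complete_space + absval +
  assumes nlf_dist: "dist x y = absv (x - y)"
    and nlf_absv_mult: "absv (x * y) = absv x * absv y"
    and nlf_absv_add: "absv (x + y) \<le> max (absv x) (absv y)"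
    and nlf_finite_residue_field: "finite (residue_field :: 'a set set)"
    and nlf_uniformizer: "\<exists>w::'a. absv w = 1 / real (card (residue_field :: 'a set set)) \<and>
          (\<forall>x. x \<noteq> 0 \<longrightarrow> (\<exists>k::int. absv x = absv w powi k))"

definition residue_card :: "'a::nonarch_local_field itself \<Rightarrow> nat" where
  "residue_card _ = card (residue_field :: 'a set set)"

definition residue_char :: "'a::nonarch_local_field itself \<Rightarrow> nat" where
  "residue_char _ = (LEAST p. p > 0 \<and> absv (of_nat p :: 'a) < 1)"

definition ring_of_integers :: "'a::nonarch_local_field set" where
  "ring_of_integers = {x. absv x \<le> 1}"

definition integer_units :: "'a::nonarch_local_field set" where
  "integer_units = {x. absv x = 1}"

definition prime_power :: "int \<Rightarrow> 'a::nonarch_local_field set" where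
  "prime_power n = {x. absv x \<le> (1 / real (residue_card TYPE('a))) powi n}"

definition uniformizer :: "'a::nonarch_local_field \<Rightarrow> bool" where
  "uniformizer w \<longleftrightarrow> absv w = 1 / real (residue_card TYPE('a))"

definition hilbert :: "'a::nonarch_local_field \<Rightarrow> 'a \<Rightarrow> complex" where
  "hilbert a b = (if \<exists>x y z. (x, y, z) \<noteq> (0, 0, 0) \<and> z\<^sup>2 = a * x\<^sup>2 + b * y\<^sup>2 then 1 else -1)"

section \<open>Characters and conductors\<close>

definition add_char :: "('a::nonarch_local_field \<Rightarrow> complex) \<Rightarrow> bool" where
  "add_char \<psi> \<longleftrightarrow> continuous_on UNIV \<psi> \<and> (\<forall>x. norm (\<psi> x) = 1) \<and> (\<forall>x y. \<psi> (x + y) = \<psi> x * \<psi> y)"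

text \<open>Multiplicative characters of a subgroup \<open>S\<close> of the multiplicative group are
  functions on the whole field of which only the values on \<open>S\<close> matter; they need not be unitary.\<close>

definition mult_char_on :: "'a::nonarch_local_field set \<Rightarrow> ('a \<Rightarrow> complex) \<Rightarrow> bool" where
  "mult_char_on S \<eta> \<longleftrightarrow> continuous_on S \<eta> \<and> (\<forall>x\<in>S. \<eta> x \<noteq> 0) \<and>
     (\<forall>x\<in>S. \<forall>y\<in>S. \<eta> (x * y) = \<eta> x * \<eta> y)"

definition add_cond :: "('a::nonarch_local_field \<Rightarrow> complex) \<Rightarrow> int" where
  "add_cond \<psi> = (LEAST c. \<forall>x\<in>prime_power c. \<psi> x = 1)"

definition mult_cond :: "('a::nonarch_local_field \<Rightarrow> complex) \<Rightarrow> nat" where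
  "mult_cond \<eta> = (if \<forall>u\<in>integer_units. \<eta> u = 1 then 0
     else (LEAST c. c \<ge> 1 \<and> (\<forall>x\<in>prime_power (int c). \<eta> (1 + x) = 1)))"

section \<open>The Weil index\<close>

definition schwartz :: "('a::nonarch_local_field \<Rightarrow> complex) \<Rightarrow> bool" where
  "schwartz \<phi> \<longleftrightarrow> (\<forall>x. \<exists>U. open U \<and> x \<in> U \<and> (\<forall>y\<in>U. \<phi> y = \<phi> x)) \<and> compact (closure {x. \<phi> x \<noteq> 0})"

text \<open>Haar integral of a Schwartz--Bruhat function, the ring of integers having volume \<open>1\<close>:
  the Riemann sums over the cosets of the \<open>n\<close>-th power of the maximal ideal have finitely many
  terms and are eventually constant in \<open>n\<close>. Only used for Schwartz--Bruhat functions.\<close>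

definition haar_integral :: "('a::nonarch_local_field \<Rightarrow> complex) \<Rightarrow> complex" where
  "haar_integral \<phi> = lim (\<lambda>n::nat. (\<Sum>C | C \<in> UNIV // {(x, y). x - y \<in> prime_power (int n)} \<and> (\<exists>x\<in>C. \<phi> x \<noteq> 0).
      \<phi> (SOME x. x \<in> C)) / of_nat (residue_card TYPE('a)) ^ n)"

text \<open>Weil's definition for a non-degenerate character of second degree \<open>f\<close>: the integral of the
  convolution of \<open>\<phi>\<close> with \<open>f\<close> is \<open>\<gamma>\<close> times a positive constant times the integral of \<open>\<phi>\<close>, where
  \<open>\<gamma>\<close> has absolute value \<open>1\<close>. The convolution is again a Schwartz--Bruhat function.
  The positive constant \<open>r\<close> depends on the normalisation of the Haar measure, \<open>\<gamma>\<close> does not.\<close>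

definition weil_index :: "('a::nonarch_local_field \<Rightarrow> complex) \<Rightarrow> complex" where
  "weil_index f = (THE \<gamma>. norm \<gamma> = 1 \<and> (\<exists>r::real. r > 0 \<and> (\<forall>\<phi>. schwartz \<phi> \<longrightarrow>
     haar_integral (\<lambda>x. haar_integral (\<lambda>y. \<phi> (x - y) * f y)) = \<gamma> * of_real r * haar_integral \<phi>)))"

definition weil_gamma :: "('a::nonarch_local_field \<Rightarrow> complex) \<Rightarrow> complex" where
  "weil_gamma \<psi> = weil_index (\<lambda>x. \<psi> (x\<^sup>2))"

definition weil_ratio :: "'a::nonarch_local_field \<Rightarrow> ('a \<Rightarrow> complex) \<Rightarrow> complex" where
  "weil_ratio a \<psi> = weil_gamma (\<lambda>x. \<psi> (a * x)) / weil_gamma \<psi>"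

section \<open>The metaplectic group\<close>

type_synonym 'a mp = "('a^2^2) \<times> complex"

definition mat2 :: "'a::nonarch_local_field \<Rightarrow> 'a \<Rightarrow> 'a \<Rightarrow> 'a \<Rightarrow> 'a^2^2" where
  "mat2 a b c d = vector [vector [a, b], vector [c, d]]"

definition t_mat :: "'a::nonarch_local_field \<Rightarrow> 'a^2^2" where
  "t_mat a = mat2 a 0 0 (inverse a)"

definition n_mat :: "'a::nonarch_local_field \<Rightarrow> 'a^2^2" where
  "n_mat b = mat2 1 b 0 1"

definition nop_mat :: "'a::nonarch_local_field \<Rightarrow> 'a^2^2" where
  "nop_mat c = mat2 1 0 c 1"

definition w_mat :: "'a::nonarch_local_field^2^2" where
  "w_mat = mat2 0 1 (-1) 0"

definition x_fun :: "'a::nonarch_local_field^2^2 \<Rightarrow> 'a" where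
  "x_fun g = (if g$2$1 \<noteq> 0 then g$2$1 else g$2$2)"

definition cocycle :: "'a::nonarch_local_field^2^2 \<Rightarrow> 'a^2^2 \<Rightarrow> complex" where
  "cocycle g h = hilbert (x_fun g / x_fun (g ** h)) (x_fun h / x_fun (g ** h))"

definition Mp :: "'a::nonarch_local_field mp set" where
  "Mp = {(g, e). det g = 1 \<and> e \<in> {1, -1}}"

definition mp_mult :: "'a::nonarch_local_field mp \<Rightarrow> 'a mp \<Rightarrow> 'a mp" (infixl "\<odot>" 70) where
  "x \<odot> y = (fst x ** fst y, snd x * snd y * cocycle (fst x) (fst y))"

definition K_grp :: "nat \<Rightarrow> nat \<Rightarrow> ('a::nonarch_local_field^2^2) set" where
  "K_grp \<epsilon> m = {g. det g = 1 \<and> g$1$1 \<in> ring_of_integers \<and> g$2$2 \<in> ring_of_integers \<and>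
      g$1$2 \<in> prime_power (- int \<epsilon>) \<and> g$2$1 \<in> prime_power (int (m + \<epsilon>))}"

text \<open>The value \<open>1\<close> outside of \<open>K_grp \<epsilon> 0\<close> is a convention making the total function unique.\<close>

definition splitting :: "nat \<Rightarrow> ('a::nonarch_local_field \<Rightarrow> complex) \<Rightarrow> 'a \<Rightarrow> 'a^2^2 \<Rightarrow> complex" where
  "splitting \<epsilon> \<psi> \<pi> = (THE s.
     (\<forall>k\<in>K_grp \<epsilon> 0. s k \<in> {1, -1}) \<and>
     (\<forall>k. k \<notin> K_grp \<epsilon> 0 \<longrightarrow> s k = 1) \<and>
     (\<forall>k\<in>K_grp \<epsilon> 0. \<forall>l\<in>K_grp \<epsilon> 0. (k, s k) \<odot> (l, s l) = (k ** l, s (k ** l))) \<and>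
     (\<forall>b\<in>prime_power (- int \<epsilon>). s (n_mat b) = 1) \<and>
     (\<forall>a\<in>integer_units. s (t_mat a) = weil_ratio a \<psi>) \<and>
     (\<forall>c\<in>prime_power (int \<epsilon>). s (nop_mat c) = 1) \<and>
     s (w_mat ** t_mat (\<pi> ^ \<epsilon>)) = 1)"

text \<open>The topology of the covering group: the lifts of small neighbourhoods of \<open>1\<close> under the
  splitting form a neighbourhood basis of the identity. This is not the product topology, for
  which the multiplication is not continuous.\<close>

definition Mp_topology :: "nat \<Rightarrow> ('a::nonarch_local_field \<Rightarrow> complex) \<Rightarrow> 'a \<Rightarrow> 'a mp topology" where
  "Mp_topology \<epsilon> \<psi> \<pi> = topology (\<lambda>U. U \<subseteq> Mp \<and> (\<forall>g\<in>U. \<exists>W. open W \<and> mat 1 \<in> W \<and>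
      (\<forall>k\<in>K_grp \<epsilon> 0 \<inter> W. g \<odot> (k, splitting \<epsilon> \<psi> \<pi> k) \<in> U)))"

lemma openin_Mp_topology:
  "openin (Mp_topology \<epsilon> \<psi> \<pi>) U \<longleftrightarrow> U \<subseteq> Mp \<and> (\<forall>g\<in>U. \<exists>W. open W \<and> mat 1 \<in> W \<and>
      (\<forall>k\<in>K_grp \<epsilon> 0 \<inter> W. g \<odot> (k, splitting \<epsilon> \<psi> \<pi> k) \<in> U))"
proof -
  let ?P = "\<lambda>U. U \<subseteq> Mp \<and> (\<forall>g\<in>U. \<exists>W. open W \<and> mat 1 \<in> W \<and>
      (\<forall>k\<in>K_grp \<epsilon> 0 \<inter> W. g \<odot> (k, splitting \<epsilon> \<psi> \<pi> k) \<in> U))"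
  have "istopology ?P"
    unfolding istopology_def
  proof (intro conjI allI impI)
    fix S T assume S: "?P S" and T: "?P T"
    show "S \<inter> T \<subseteq> Mp" using S by blast
    show "\<forall>g\<in>S \<inter> T. \<exists>W. open W \<and> mat 1 \<in> W \<and>
      (\<forall>k\<in>K_grp \<epsilon> 0 \<inter> W. g \<odot> (k, splitting \<epsilon> \<psi> \<pi> k) \<in> S \<inter> T)"
    proof
      fix g assume g: "g \<in> S \<inter> T"
      from S g have "\<exists>V. open V \<and> mat 1 \<in> V \<and> (\<forall>k\<in>K_grp \<epsilon> 0 \<inter> V. g \<odot> (k, splitting \<epsilon> \<psi> \<pi> k) \<in> S)"
        by simp
      then obtain V where V: "open V" "mat 1 \<in> V" "\<And>k. k \<in> K_grp \<epsilon> 0 \<inter> V \<Longrightarrow> g \<odot> (k, splitting \<epsilon> \<psi> \<pi> k) \<in> S"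
        by (elim exE conjE) simp
      from T g have "\<exists>W. open W \<and> mat 1 \<in> W \<and> (\<forall>k\<in>K_grp \<epsilon> 0 \<inter> W. g \<odot> (k, splitting \<epsilon> \<psi> \<pi> k) \<in> T)"
        by simp
      then obtain W where W: "open W" "mat 1 \<in> W" "\<And>k. k \<in> K_grp \<epsilon> 0 \<inter> W \<Longrightarrow> g \<odot> (k, splitting \<epsilon> \<psi> \<pi> k) \<in> T"
        by (elim exE conjE) simp
      show "\<exists>W. open W \<and> mat 1 \<in> W \<and>
          (\<forall>k\<in>K_grp \<epsilon> 0 \<inter> W. g \<odot> (k, splitting \<epsilon> \<psi> \<pi> k) \<in> S \<inter> T)"
        by (intro exI[of _ "V \<inter> W"] conjI ballI IntI open_Int V W) simp_all
    qed
  next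
    fix \<K> assume "\<forall>U\<in>\<K>. ?P U"
    then have K: "?P U" if "U \<in> \<K>" for U using that by (rule bspec)
    show "\<Union>\<K> \<subseteq> Mp" using K by (intro Union_least) simp
    show "\<forall>g\<in>\<Union>\<K>. \<exists>W. open W \<and> mat 1 \<in> W \<and>
      (\<forall>k\<in>K_grp \<epsilon> 0 \<inter> W. g \<odot> (k, splitting \<epsilon> \<psi> \<pi> k) \<in> \<Union>\<K>)"
    proof
      fix g assume "g \<in> \<Union>\<K>"
      then obtain U where U: "U \<in> \<K>" "g \<in> U" by (rule UnionE)
      from K[OF U(1)] U(2) have "\<exists>W. open W \<and> mat 1 \<in> W \<and> (\<forall>k\<in>K_grp \<epsilon> 0 \<inter> W. g \<odot> (k, splitting \<epsilon> \<psi> \<pi> k) \<in> U)"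
        by simp
      then obtain W where W: "open W" "mat 1 \<in> W" "\<And>k. k \<in> K_grp \<epsilon> 0 \<inter> W \<Longrightarrow> g \<odot> (k, splitting \<epsilon> \<psi> \<pi> k) \<in> U"
        by (elim exE conjE) simp
      show "\<exists>W. open W \<and> mat 1 \<in> W \<and>
          (\<forall>k\<in>K_grp \<epsilon> 0 \<inter> W. g \<odot> (k, splitting \<epsilon> \<psi> \<pi> k) \<in> \<Union>\<K>)"
        by (intro exI[of _ W] conjI ballI UnionI[OF U(1)] W)
    qed
  qed
  then show ?thesis
    unfolding Mp_topology_def by (simp add: topology_inverse')
qed

section \<open>Representations\<close>

record ('g, 'v) crep =
  rep_scale :: "complex \<Rightarrow> 'v \<Rightarrow> 'v"
  rep_space :: "'v set"
  rep_act :: "'g \<Rightarrow> 'v \<Rightarrow> 'v"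

text \<open>Finite dimensionality is part of the notion: the library's \<open>dim\<close> also is \<open>0\<close> for spaces
  of infinite dimension.\<close>

definition has_dim :: "(complex \<Rightarrow> 'v::ab_group_add \<Rightarrow> 'v) \<Rightarrow> 'v set \<Rightarrow> nat \<Rightarrow> bool" where
  "has_dim sc V d \<longleftrightarrow> (\<exists>B. finite B \<and> \<not> module.dependent sc B \<and> module.span sc B = V \<and> card B = d)"

definition central_sign :: "('a::nonarch_local_field \<Rightarrow> complex) \<Rightarrow> ('a mp, 'v) crep \<Rightarrow> complex" where
  "central_sign \<psi> R = (THE z. \<forall>v\<in>rep_space R. rep_act R (mat (-1), weil_ratio (-1) \<psi>) v = rep_scale R z v)"

text \<open>If \<open>m \<ge> 1\<close>, the entry \<open>d\<close> of an element of \<open>K_grp \<epsilon> m\<close> is a unit. If \<open>m = 0\<close>, it need not be,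
  but then \<open>m \<ge> mult_cond \<eta>\<close> forces \<open>\<eta>\<close> to be trivial and \<open>\<eta>(d)\<close> is to be read as \<open>1\<close>.\<close>

definition isotypic :: "nat \<Rightarrow> ('a::nonarch_local_field \<Rightarrow> complex) \<Rightarrow> 'a \<Rightarrow> ('a mp, 'v::zero) crep \<Rightarrow>
    ('a \<Rightarrow> complex) \<Rightarrow> nat \<Rightarrow> 'v set" where
  "isotypic \<epsilon> \<psi> \<pi> R \<eta> m = (if mult_cond \<eta> \<le> m
     then {v \<in> rep_space R. \<forall>k\<in>K_grp \<epsilon> m. rep_act R (k, splitting \<epsilon> \<psi> \<pi> k) v =
             rep_scale R (if k$2$2 \<in> integer_units then \<eta> (k$2$2) else 1) v}
     else {0})"

definition cond_eta :: "nat \<Rightarrow> ('a::nonarch_local_field \<Rightarrow> complex) \<Rightarrow> 'a \<Rightarrow> ('a mp, 'v::zero) crep \<Rightarrow>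
    ('a \<Rightarrow> complex) \<Rightarrow> enat" where
  "cond_eta \<epsilon> \<psi> \<pi> R \<eta> = Inf {enat m | m. isotypic \<epsilon> \<psi> \<pi> R \<eta> m \<noteq> {0}}"

definition cond_min :: "nat \<Rightarrow> ('a::nonarch_local_field \<Rightarrow> complex) \<Rightarrow> 'a \<Rightarrow> ('a mp, 'v::zero) crep \<Rightarrow> enat" where
  "cond_min \<epsilon> \<psi> \<pi> R = Inf {cond_eta \<epsilon> \<psi> \<pi> R \<eta> | \<eta>.
     mult_char_on integer_units \<eta> \<and> \<eta> (-1) = central_sign \<psi> R}"

section \<open>Principal series\<close>

definition fun_scale :: "complex \<Rightarrow> ('g \<Rightarrow> complex) \<Rightarrow> 'g \<Rightarrow> complex" where
  "fun_scale c f = (\<lambda>g. c * f g)"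

lemma vector_space_fun_scale: "vector_space fun_scale"
  by unfold_locales (auto simp: fun_scale_def fun_eq_iff algebra_simps)

definition chi_psi :: "('a::nonarch_local_field \<Rightarrow> complex) \<Rightarrow> 'a \<Rightarrow> complex \<Rightarrow> complex" where
  "chi_psi \<psi> a e = e * inverse (weil_ratio a \<psi>)"

text \<open>Functions on the metaplectic group are represented by their extension by zero. The parameters
  \<open>\<epsilon>\<close> and \<open>\<pi>\<close> only enter through the topology.\<close>

definition principal_series :: "nat \<Rightarrow> ('a::nonarch_local_field \<Rightarrow> complex) \<Rightarrow> 'a \<Rightarrow> ('a \<Rightarrow> complex) \<Rightarrow>
    ('a mp, 'a mp \<Rightarrow> complex) crep" where
  "principal_series \<epsilon> \<psi> \<pi> \<mu> = \<lparr>
     rep_scale = fun_scale,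
     rep_space = {f. (\<forall>g. g \<notin> Mp \<longrightarrow> f g = 0) \<and>
       (\<forall>g\<in>Mp. \<exists>U. openin (Mp_topology \<epsilon> \<psi> \<pi>) U \<and> g \<in> U \<and> (\<forall>h\<in>U. f h = f g)) \<and>
       (\<forall>a. a \<noteq> 0 \<longrightarrow> (\<forall>e\<in>{1, -1}. \<forall>b. \<forall>g\<in>Mp.
          f ((t_mat a, e) \<odot> (n_mat b, 1) \<odot> g) = of_real (absv a) * \<mu> a * chi_psi \<psi> a e * f g))},
     rep_act = (\<lambda>h f g. f (g \<odot> h)) \<rparr>"

end

theory Submission
  imports Defs
begin

text \<open>Restricting a function of the principal series to the split compact group \<open>K\<^sup>\<epsilon>\<close> removes the cocycle:
  by the Iwasawa decomposition the space becomes that of the functions on primitive rows \<open>(c, d)\<close> over \<open>\<O>\<close>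
  that transform under units by \<open>\<mu>\<^sup>-\<^sup>1\<close>, with the linear action of \<open>SL\<^sub>2(\<O>)\<close>. For this one needs that
  \<open>a \<mapsto> |a| \<mu>(a) \<gamma>(a, \<psi>)\<^sup>-\<^sup>1\<close> is multiplicative up to the Hilbert symbol, which is a computation with Gauss sums
  as the residual characteristic is odd, and that the splitting and the cocycle are as claimed, which reduces to
  bimultiplicativity of the Hilbert symbol and the Steinberg relation.

  The dimension is then the number of orbits of the congruence subgroup on primitive rows up to units on whose
  stabilisers \<open>\<eta>\<close> and \<open>\<mu>\<close> are compatible. Representatives are \<open>(X, 1)\<close> with \<open>X\<close> in \<open>{1, 0}\<close> or
  \<open>X = \<pi>\<^sup>i u\<close>, \<open>0 < i < m\<close> and \<open>u\<close> a unit modulo squares. Compatibility at \<open>(X, 1)\<close> only depends on \<open>i\<close> and is a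
  condition on the conductors of \<open>\<eta>\<close>, \<open>\<eta>\<mu>\<close> and \<open>\<eta>\<mu>\<^sup>-\<^sup>1\<close>; counting the \<open>i\<close> satisfying it gives the formula.\<close>

section \<open>The absolute value and conductors\<close>

text \<open>In the comments P^n abbreviates \<open>prime_power n\<close>. The obstacle throughout is
  that \<open>weil_index\<close>, \<open>splitting\<close> and \<open>central_sign\<close> are
  definite descriptions and \<open>haar_integral\<close> is a limit, so each has a usable value only
  after existence and uniqueness, or convergence, are proved. The topology of the covering group is
  itself defined through the splitting, so local constancy is out of reach before
  \<open>splitting_eq\<close>. The dimension formula has the following origin. Let a matrix of level
  m send (X, 1) to v (X, 1), with X of valuation i < m. Its entry d = v - X b lies within P^i of v,
  its entry a within P^(m-i) of v, and v - 1/v is the sum of the two deviations. As 2 is a unit, v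
  is congruent to 1 or -1 modulo the larger of these ideals, and parity makes the sign harmless. So
  \<eta>\<mu>^-1 is tested at level i in the lower half of the range and \<eta>\<mu> at level m - i
  in the upper half. For m >= 1, the levels 0 and m carry one orbit instead of two; with c(\<eta>)
  <= m they are admissible exactly if \<eta>\<mu>^-1, respectively \<eta>\<mu>, is trivial on units.
  This gives the two deltas.\<close>

lemma absv_0 [simp]: "absv (0::'a::nonarch_local_field) = 0"
  using nlf_dist[of "0::'a" 0] by simp

lemma absv_eq_dist: "absv (x::'a::nonarch_local_field) = dist x 0"
  using nlf_dist[of x 0] by simp

lemma absv_nonneg [simp]: "0 \<le> absv (x::'a::nonarch_local_field)"
  by (simp add: absv_eq_dist)

lemma absv_eq_0_iff [simp]: "absv (x::'a::nonarch_local_field) = 0 \<longleftrightarrow> x = 0"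
  by (simp add: absv_eq_dist)

lemma absv_pos_iff [simp]: "0 < absv (x::'a::nonarch_local_field) \<longleftrightarrow> x \<noteq> 0"
  by (simp add: absv_eq_dist)

lemma absv_1 [simp]: "absv (1::'a::nonarch_local_field) = 1"
proof -
  have "absv (1::'a) * absv (1::'a) = absv (1::'a)" using nlf_absv_mult[of "1::'a" 1] by simp
  moreover have "absv (1::'a) \<noteq> 0" by simp
  ultimately show ?thesis by simp
qed

lemma absv_minus [simp]: "absv (- x) = absv (x::'a::nonarch_local_field)"
proof -
  have "absv (-1::'a) * absv (-1::'a) = 1" using nlf_absv_mult[of "-1::'a" "-1"] by simp
  hence "absv (-1::'a) = 1"
    by (metis absv_nonneg abs_of_nonneg real_sqrt_abs2 real_sqrt_one)
  thus ?thesis using nlf_absv_mult[of "-1" x] by simp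
qed

lemma absv_diff: "absv (x - y) \<le> max (absv x) (absv (y::'a::nonarch_local_field))"
  using nlf_absv_add[of x "- y"] by simp

definition qinv :: "'a::nonarch_local_field itself \<Rightarrow> real" where
  "qinv T = 1 / real (residue_card T)"

lemma residue_card_ge_2: "residue_card TYPE('a::nonarch_local_field) \<ge> 2"
proof -
  let ?R = "{(x, y). absv x \<le> 1 \<and> absv (y::'a) \<le> 1 \<and> absv (x - y) < (1::real)}"
  have "?R `` {0} \<in> (residue_field :: 'a set set)" "?R `` {1} \<in> (residue_field :: 'a set set)"
    unfolding residue_field_def by (intro quotientI; simp)+
  moreover have "?R `` {0} \<noteq> ?R `` {1}"
  proof -
    have "(0::'a) \<in> ?R `` {0}" "(0::'a) \<notin> ?R `` {1}" by auto
    thus ?thesis by blast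
  qed
  ultimately have "card {?R `` {0}, ?R `` {1}} \<le> card (residue_field :: 'a set set)"
    by (intro card_mono nlf_finite_residue_field) auto
  thus ?thesis using \<open>?R `` {0} \<noteq> ?R `` {1}\<close> by (simp add: residue_card_def)
qed

lemma qinv_bounds: "0 < qinv TYPE('a::nonarch_local_field)" "qinv TYPE('a) < 1" "qinv TYPE('a) \<noteq> 0"
  using residue_card_ge_2[where 'a='a] by (auto simp: qinv_def)

lemma qinv_powi_le_iff: "qinv TYPE('a::nonarch_local_field) powi m \<le> qinv TYPE('a) powi n \<longleftrightarrow> n \<le> m"
  using qinv_bounds[where 'a='a]
  by (meson linorder_not_le order_less_imp_le power_int_strict_decreasing power_int_decreasing)

lemma qinv_powi_eq_iff: "qinv TYPE('a::nonarch_local_field) powi m = qinv TYPE('a) powi n \<longleftrightarrow> m = n"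
  by (metis qinv_powi_le_iff order.antisym order.refl)

lemma ex_absv_eq:
  assumes "x \<noteq> (0::'a::nonarch_local_field)"
  shows "\<exists>k. absv x = qinv TYPE('a) powi k"
proof -
  obtain w :: 'a where "absv w = qinv TYPE('a)" "\<forall>x::'a. x \<noteq> 0 \<longrightarrow> (\<exists>k::int. absv x = absv w powi k)"
    using nlf_uniformizer[where 'a='a] unfolding qinv_def residue_card_def by blast
  thus ?thesis using assms by metis
qed

text \<open>The normalised valuation. No exponent fits at 0, so \<open>oval 0\<close> is an
  unspecified integer, which is why lemmas such as \<open>prime_power_iff\<close> treat 0
  apart.\<close>

definition oval :: "'a::nonarch_local_field \<Rightarrow> int" where
  "oval x = (THE k. absv x = qinv TYPE('a) powi k)"

lemma absv_oval: "x \<noteq> 0 \<Longrightarrow> absv x = qinv TYPE('a) powi oval (x::'a::nonarch_local_field)"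
  unfolding oval_def using ex_absv_eq[of x] by (metis (mono_tags, lifting) qinv_powi_eq_iff theI_unique)

lemma oval_unique: "absv x = qinv TYPE('a) powi k \<Longrightarrow> oval (x::'a::nonarch_local_field) = k"
  unfolding oval_def by (rule the_equality) (auto simp: qinv_powi_eq_iff)

lemma oval_mult: "x \<noteq> 0 \<Longrightarrow> y \<noteq> 0 \<Longrightarrow> oval (x * y) = oval x + oval (y::'a::nonarch_local_field)"
  by (rule oval_unique) (simp add: nlf_absv_mult absv_oval power_int_add qinv_bounds)

lemma oval_1 [simp]: "oval (1::'a::nonarch_local_field) = 0"
  by (rule oval_unique) simp

lemma oval_uminus [simp]: "oval (- x) = oval (x::'a::nonarch_local_field)"
  by (simp add: oval_def)

lemma oval_inverse: "x \<noteq> 0 \<Longrightarrow> oval (inverse x) = - oval (x::'a::nonarch_local_field)"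
  using oval_mult[of x "inverse x"] by simp

lemma oval_divide: "x \<noteq> 0 \<Longrightarrow> y \<noteq> 0 \<Longrightarrow> oval (x / y) = oval x - oval (y::'a::nonarch_local_field)"
  by (simp add: divide_inverse oval_mult oval_inverse)

lemma oval_power: "x \<noteq> 0 \<Longrightarrow> oval (x ^ n) = int n * oval (x::'a::nonarch_local_field)"
  by (induction n) (simp_all add: oval_mult algebra_simps)

lemma oval_power_int: "x \<noteq> 0 \<Longrightarrow> oval (x powi n) = n * oval (x::'a::nonarch_local_field)"
  by (simp add: power_int_def oval_power oval_inverse)

lemma uniformizer_iff: "uniformizer x \<longleftrightarrow> x \<noteq> 0 \<and> oval (x::'a::nonarch_local_field) = 1"
proof
  assume "uniformizer x"
  hence "absv x = qinv TYPE('a) powi 1" by (simp add: uniformizer_def qinv_def)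
  thus "x \<noteq> 0 \<and> oval x = 1" using oval_unique[of x 1] qinv_bounds[where 'a='a] by auto
next
  assume "x \<noteq> 0 \<and> oval x = 1"
  thus "uniformizer x" using absv_oval[of x] by (simp add: uniformizer_def qinv_def)
qed

lemma prime_power_iff: "x \<in> prime_power n \<longleftrightarrow> x = 0 \<or> n \<le> oval (x::'a::nonarch_local_field)"
proof (cases "x = 0")
  case False
  thus ?thesis by (simp add: prime_power_def qinv_def[symmetric] absv_oval qinv_powi_le_iff)
next
  case True
  thus ?thesis using qinv_bounds[where 'a='a] by (simp add: prime_power_def qinv_def[symmetric])
qed

lemma prime_power_absv: "x \<in> prime_power n \<longleftrightarrow> absv (x::'a::nonarch_local_field) \<le> qinv TYPE('a) powi n"
  by (simp add: prime_power_def qinv_def)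

lemma ring_of_integers_eq: "ring_of_integers = (prime_power 0 :: 'a::nonarch_local_field set)"
  by (auto simp: prime_power_absv ring_of_integers_def)

lemma integer_units_iff: "x \<in> integer_units \<longleftrightarrow> x \<noteq> 0 \<and> oval (x::'a::nonarch_local_field) = 0"
  using qinv_powi_eq_iff[of "oval x" 0, where 'a='a] by (cases "x = 0") (auto simp: integer_units_def absv_oval)

lemma pp_0 [simp]: "0 \<in> prime_power n"
  by (simp add: prime_power_iff)

lemma pp_1 [simp]: "(1::'a::nonarch_local_field) \<in> prime_power n \<longleftrightarrow> n \<le> 0"
  by (simp add: prime_power_iff)

lemma pp_add: "x \<in> prime_power n \<Longrightarrow> y \<in> prime_power n \<Longrightarrow> x + y \<in> prime_power n"
  unfolding prime_power_absv using nlf_absv_add[of x y] by linarith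

lemma pp_uminus [simp]: "- x \<in> prime_power n \<longleftrightarrow> x \<in> prime_power n"
  by (simp add: prime_power_absv)

lemma pp_diff: "x \<in> prime_power n \<Longrightarrow> y \<in> prime_power n \<Longrightarrow> x - y \<in> prime_power n"
  unfolding prime_power_absv using absv_diff[of x y] by linarith

lemma pp_diff_commute: "x - y \<in> prime_power n \<longleftrightarrow> y - x \<in> prime_power n"
  by (metis minus_diff_eq pp_uminus)

lemma pp_trans: "x - y \<in> prime_power n \<Longrightarrow> y - z \<in> prime_power n \<Longrightarrow> x - z \<in> prime_power n"
  using pp_add[of "x - y" n "y - z"] by simp

lemma pp_mult: "x \<in> prime_power m \<Longrightarrow> y \<in> prime_power n \<Longrightarrow> x * y \<in> prime_power (m + n)"
  by (cases "x = 0"; cases "y = 0") (auto simp: prime_power_iff oval_mult)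

lemma pp_mult_0: "x \<in> prime_power 0 \<Longrightarrow> y \<in> prime_power n \<Longrightarrow> x * y \<in> prime_power n"
  using pp_mult[of x 0 y n] by simp

lemma pp_mono: "m \<le> n \<Longrightarrow> x \<in> prime_power n \<Longrightarrow> x \<in> prime_power m"
  by (auto simp: prime_power_iff)

lemma pp_mult_iff: "x \<noteq> 0 \<Longrightarrow> x * y \<in> prime_power n \<longleftrightarrow> y \<in> prime_power (n - oval x)"
  by (cases "y = 0") (auto simp: prime_power_iff oval_mult)

lemma units_pp0: "x \<in> integer_units \<Longrightarrow> x \<in> prime_power 0"
  by (auto simp: integer_units_iff prime_power_iff)

lemma units_iff_pp: "x \<in> integer_units \<longleftrightarrow> x \<in> prime_power 0 \<and> x \<notin> prime_power 1"
  by (auto simp: integer_units_iff prime_power_iff)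

lemma units_nz: "x \<in> integer_units \<Longrightarrow> x \<noteq> 0"
  by (auto simp: integer_units_iff)

lemma units_1 [simp]: "1 \<in> integer_units" by (simp add: integer_units_iff)

lemma units_uminus [simp]: "- x \<in> integer_units \<longleftrightarrow> x \<in> integer_units"
  by (simp add: integer_units_iff)

lemma units_mult: "x \<in> integer_units \<Longrightarrow> y \<in> integer_units \<Longrightarrow> x * y \<in> integer_units"
  by (auto simp: integer_units_iff oval_mult)

lemma units_inverse [simp]: "inverse x \<in> integer_units \<longleftrightarrow> x \<in> integer_units"
  by (cases "x = 0") (auto simp: integer_units_iff oval_inverse)

lemma units_power: "x \<in> integer_units \<Longrightarrow> x ^ n \<in> integer_units"
  by (auto simp: integer_units_iff oval_power)

lemma units_divide: "x \<in> integer_units \<Longrightarrow> y \<in> integer_units \<Longrightarrow> x / y \<in> integer_units"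
  by (simp add: divide_inverse units_mult)

lemma units_add_pp: "x \<in> integer_units \<Longrightarrow> y \<in> prime_power 1 \<Longrightarrow> x + y \<in> integer_units"
  by (metis add_diff_cancel_right' pp_add pp_diff pp_mono units_iff_pp zero_le_one)

lemma units_pp_mult_iff: "u \<in> integer_units \<Longrightarrow> u * y \<in> prime_power n \<longleftrightarrow> y \<in> prime_power n"
  by (simp add: integer_units_iff pp_mult_iff)

lemma units_mult_iff: "x \<in> prime_power 0 \<Longrightarrow> y \<in> prime_power 0 \<Longrightarrow> x * y \<in> integer_units \<longleftrightarrow> x \<in> integer_units \<and> y \<in> integer_units"
  by (cases "x = 0 \<or> y = 0") (auto simp: integer_units_iff prime_power_iff oval_mult)

lemma ex_pp_subset_ball: "e > 0 \<Longrightarrow> \<exists>n::nat. \<forall>x\<in>prime_power (int n). absv (x::'a::nonarch_local_field) < e"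
proof -
  assume "e > 0"
  then obtain n where "qinv TYPE('a) ^ n < e"
    using real_arch_pow_inv[of e "qinv TYPE('a)"] qinv_bounds by blast
  thus ?thesis by (intro exI[of _ n]) (auto simp: prime_power_absv)
qed

lemma ball_subset_pp: "\<exists>e>0. \<forall>x::'a::nonarch_local_field. absv x < e \<longrightarrow> x \<in> prime_power n"
  using qinv_bounds[where 'a='a] by (intro exI[of _ "qinv TYPE('a) powi n"]) (auto simp: prime_power_absv)

lemma bounded_pp: "\<exists>n::int. \<forall>x::'a::nonarch_local_field. absv x \<le> B \<longrightarrow> x \<in> prime_power n"
proof -
  obtain n where "B < (1 / qinv TYPE('a)) ^ n"
    using real_arch_pow[of "1 / qinv TYPE('a)" B] qinv_bounds[where 'a='a] by auto
  hence "B \<le> qinv TYPE('a) powi (- int n)"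
    by (simp add: power_int_minus power_inverse divide_inverse)
  thus ?thesis by (intro exI[of _ "- int n"]) (auto simp: prime_power_absv)
qed

lemma open_pp_coset: "open {y. y - z \<in> prime_power n}" for z :: "'a::nonarch_local_field"
proof -
  obtain e where e: "e > 0" "\<And>x::'a. absv x < e \<Longrightarrow> x \<in> prime_power n"
    using ball_subset_pp by blast
  show ?thesis
    unfolding open_dist
  proof (intro ballI exI conjI allI impI)
    fix x y assume "x \<in> {y. y - z \<in> prime_power n}" "dist y x < e"
    hence "y - x \<in> prime_power n" using e(2) by (simp add: nlf_dist)
    thus "y \<in> {y. y - z \<in> prime_power n}" using \<open>x \<in> _\<close> pp_trans by blast
  qed (use e in auto)
qed

lemma closed_pp: "closed (prime_power n :: 'a::nonarch_local_field set)"
proof -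
  have eq: "prime_power n = cball (0::'a) (qinv TYPE('a) powi n)"
    by (auto simp: prime_power_absv nlf_dist)
  show ?thesis unfolding eq by (rule closed_cball)
qed

text \<open>Near 1 squaring expands: the distance to 1 is multiplied by |x + 1|, which is at least
  3/2. An element whose iterated squares all stay within 1/2 of 1 is therefore 1. Squaring being the
  only operation involved, the statement serves additive and multiplicative characters, unitary or
  not, and turns continuity into triviality near the identity.\<close>

lemma no_small_subgroups:
  fixes S :: "complex set"
  assumes "\<And>x. x \<in> S \<Longrightarrow> x ^ 2 \<in> S" "\<And>x. x \<in> S \<Longrightarrow> norm (x - 1) \<le> 1 / 2" "z \<in> S"
  shows "z = 1"
proof -
  have *: "norm (x - 1) \<le> (2 / 3) ^ n * (1 / 2)" if "x \<in> S" for x n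
    using that
  proof (induction n arbitrary: x)
    case 0 thus ?case using assms(2) by simp
  next
    case (Suc n)
    have "norm (x + 1) \<ge> 3 / 2"
      using assms(2)[OF Suc.prems] norm_triangle_ineq2[of 2 "1 - x"]
      by (simp add: norm_minus_commute add.commute)
    moreover have "norm (x\<^sup>2 - 1) = norm (x - 1) * norm (x + 1)"
      by (simp flip: norm_mult add: power2_eq_square algebra_simps)
    ultimately have "norm (x - 1) * (3 / 2) \<le> norm (x\<^sup>2 - 1)"
      using mult_left_mono[of "3 / 2" "norm (x + 1)" "norm (x - 1)"] by simp
    also have "\<dots> \<le> (2 / 3) ^ n * (1 / 2)" using Suc assms(1) by blast
    finally show ?case by simp
  qed
  have "(\<lambda>n. (2 / 3 :: real) ^ n * (1 / 2)) \<longlonglongrightarrow> 0 * (1 / 2)"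
    by (intro tendsto_mult tendsto_const LIMSEQ_realpow_zero) auto
  hence "norm (z - 1) \<le> 0"
    by (intro LIMSEQ_le_const[where X = "\<lambda>n. (2 / 3) ^ n * (1 / 2)"]) (use * assms(3) in auto)
  thus ?thesis by simp
qed

section \<open>Additive characters and their conductors\<close>

lemma add_char_0:
  assumes "add_char \<psi>"
  shows "\<psi> 0 = 1"
proof -
  have "\<psi> (0 + 0) = \<psi> 0 * \<psi> 0" "norm (\<psi> 0) = 1" using assms by (simp_all only: add_char_def)
  thus ?thesis by auto
qed

lemma add_char_add: "add_char \<psi> \<Longrightarrow> \<psi> (x + y) = \<psi> x * \<psi> y"
  by (simp add: add_char_def)

lemma add_char_trivial_ex:
  assumes "add_char (\<psi> :: 'a::nonarch_local_field \<Rightarrow> complex)"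
  shows "\<exists>n::nat. \<forall>x\<in>prime_power (int n). \<psi> x = 1"
proof -
  have "continuous_on UNIV \<psi>" using assms by (simp add: add_char_def)
  then obtain e where e: "e > 0" "\<And>x. dist x 0 < e \<Longrightarrow> dist (\<psi> x) (\<psi> 0) < 1 / 2"
    unfolding continuous_on_iff by (metis UNIV_I zero_less_divide_1_iff zero_less_numeral)
  obtain n :: nat where n: "\<forall>x\<in>prime_power (int n). absv (x::'a) < e"
    using ex_pp_subset_ball e(1) by blast
  have "\<psi> x = 1" if "x \<in> prime_power (int n)" for x
  proof (rule no_small_subgroups)
    show "\<psi> x \<in> \<psi> ` prime_power (int n)" using that by blast
    show "norm (z - 1) \<le> 1 / 2" if "z \<in> \<psi> ` prime_power (int n)" for z
      using that n e(2) add_char_0[OF assms] by (force simp: dist_norm nlf_dist)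
    show "z\<^sup>2 \<in> \<psi> ` prime_power (int n)" if "z \<in> \<psi> ` prime_power (int n)" for z
    proof -
      from that obtain x where "x \<in> prime_power (int n)" "z = \<psi> x" by blast
      thus ?thesis using add_char_add[OF assms, of x x] pp_add[of x _ x] by (simp add: power2_eq_square) (metis imageI)
    qed
  qed
  thus ?thesis by blast
qed

text \<open>A \<open>LEAST\<close> over the integers has its usual meaning once the predicate is
  bounded below; shifting by the bound \<open>b\<close> reduces it to the naturals. The second
  conclusion is minimality in the form used for conductors.\<close>

lemma int_LeastI:
  fixes P :: "int \<Rightarrow> bool"
  assumes "P n" "\<And>m. P m \<Longrightarrow> b \<le> m"
  shows "P (LEAST m. P m)" "\<not> P ((LEAST m. P m) - 1)"
proof -
  define k where "k = (LEAST k. P (b + int k))"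
  have "P (b + int (nat (n - b)))" using assms by simp
  hence k: "P (b + int k)" unfolding k_def by (rule LeastI)
  have "b + int k \<le> m" if "P m" for m
  proof -
    have "P (b + int (nat (m - b)))" using that assms by simp
    hence "k \<le> nat (m - b)" unfolding k_def by (rule Least_le)
    thus ?thesis using assms(2)[OF that] by linarith
  qed
  note * = this
  hence eq: "(LEAST m. P m) = b + int k" using k by (intro Least_equality) auto
  show "P (LEAST m. P m)" "\<not> P ((LEAST m. P m) - 1)"
    using k * by (auto simp: eq) fastforce
qed

lemma add_cond_spec:
  assumes "add_char (\<psi> :: 'a::nonarch_local_field \<Rightarrow> complex)" "\<exists>x. \<psi> x \<noteq> 1"
  shows "\<forall>x\<in>prime_power (add_cond \<psi>). \<psi> x = 1" "\<exists>x\<in>prime_power (add_cond \<psi> - 1). \<psi> x \<noteq> 1"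
proof -
  obtain n where n: "\<forall>x\<in>prime_power (int n). \<psi> x = 1" using add_char_trivial_ex[OF assms(1)] by blast
  obtain y where y: "\<psi> y \<noteq> 1" using assms by blast
  hence "y \<noteq> 0" using add_char_0[OF assms(1)] by auto
  \<comment> \<open>An ideal on which \<psi> is trivial cannot contain y, which bounds the possible
    exponents from below.\<close>
  have "oval y + 1 \<le> m" if "\<forall>x\<in>prime_power m. \<psi> x = 1" for m
    using that y by (force simp: prime_power_iff)
  note L = int_LeastI[where P = "\<lambda>c. \<forall>x\<in>prime_power c. \<psi> x = 1", OF n this]
  show "\<forall>x\<in>prime_power (add_cond \<psi>). \<psi> x = 1" using L(1) by (simp add: add_cond_def)
  show "\<exists>x\<in>prime_power (add_cond \<psi> - 1). \<psi> x \<noteq> 1" using L(2) by (simp add: add_cond_def)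
qed

section \<open>The unit filtration and multiplicative conductors\<close>

definition unit_level :: "nat \<Rightarrow> 'a::nonarch_local_field set" where
  "unit_level n = {u \<in> integer_units. u - 1 \<in> prime_power (int n)}"

lemma unit_level_0: "unit_level 0 = integer_units"
  using pp_diff[of _ 0 1] units_pp0 by (auto simp: unit_level_def)

lemma unit_level_pos: "n > 0 \<Longrightarrow> unit_level n = {1 + x | x. x \<in> prime_power (int n)}"
proof -
  assume "n > 0"
  hence "1 + x \<in> integer_units" if "x \<in> prime_power (int n)" for x :: 'a
    using that by (intro units_add_pp) (auto intro: pp_mono[rotated])
  thus ?thesis unfolding unit_level_def
    by (auto intro: exI[of _ "_ - 1"])
qed

lemma unit_level_mult: "x \<in> unit_level n \<Longrightarrow> y \<in> unit_level n \<Longrightarrow> x * y \<in> unit_level n"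
proof -
  assume *: "x \<in> unit_level n" "y \<in> unit_level n"
  have "x * y - 1 = x * (y - 1) + (x - 1)" by (simp add: algebra_simps)
  moreover have "x * (y - 1) + (x - 1) \<in> prime_power (int n)"
    using * by (intro pp_add pp_mult_0) (auto simp: unit_level_def units_pp0)
  ultimately have "x * y - 1 \<in> prime_power (int n)" by (simp only:)
  thus ?thesis using * by (simp add: unit_level_def units_mult)
qed

lemma unit_level_mono: "m \<le> n \<Longrightarrow> unit_level n \<subseteq> unit_level m"
  unfolding unit_level_def using pp_mono[of "int m" "int n"] by auto

lemma mult_char_1: "mult_char_on S \<eta> \<Longrightarrow> 1 \<in> S \<Longrightarrow> \<eta> 1 = 1"
  unfolding mult_char_on_def by (metis mult_cancel_left2 mult.right_neutral)

lemma mult_char_inverse: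
  assumes "mult_char_on integer_units \<eta>" "x \<in> integer_units"
  shows "\<eta> (inverse x) = inverse (\<eta> x)"
proof -
  have "\<eta> x * \<eta> (inverse x) = 1"
    using assms mult_char_1[OF assms(1)] units_nz[OF assms(2)]
    unfolding mult_char_on_def by (metis right_inverse units_1 units_inverse)
  thus ?thesis by (simp add: inverse_unique)
qed

lemma mult_char_trivial_ex:
  assumes "mult_char_on integer_units (\<eta> :: 'a::nonarch_local_field \<Rightarrow> complex)"
  shows "\<exists>n::nat. n \<ge> 1 \<and> (\<forall>u\<in>unit_level n. \<eta> u = 1)"
proof -
  have "continuous_on integer_units \<eta>" using assms by (simp add: mult_char_on_def)
  then obtain e where e: "e > 0" "\<And>x. x \<in> integer_units \<Longrightarrow> dist x 1 < e \<Longrightarrow> dist (\<eta> x) (\<eta> 1) < 1 / 2"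
    unfolding continuous_on_iff by (metis units_1 zero_less_divide_1_iff zero_less_numeral)
  obtain n :: nat where n: "\<forall>x\<in>prime_power (int n). absv (x::'a) < e"
    using ex_pp_subset_ball e(1) by blast
  have "\<eta> u = 1" if "u \<in> unit_level (Suc n)" for u
  proof (rule no_small_subgroups)
    show "\<eta> u \<in> \<eta> ` unit_level (Suc n)" using that by blast
    show "norm (z - 1) \<le> 1 / 2" if "z \<in> \<eta> ` unit_level (Suc n)" for z
    proof -
      from that obtain x where x: "x \<in> unit_level (Suc n)" "z = \<eta> x" by blast
      hence "absv (x - 1) < e" using n pp_mono[of "int n" "int (Suc n)"] by (auto simp: unit_level_def)
      thus ?thesis using e(2)[of x] x mult_char_1[OF assms]
        by (auto simp: dist_norm nlf_dist[where 'a='a] unit_level_def)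
    qed
    show "z\<^sup>2 \<in> \<eta> ` unit_level (Suc n)" if "z \<in> \<eta> ` unit_level (Suc n)" for z
    proof -
      from that obtain x where x: "x \<in> unit_level (Suc n)" "z = \<eta> x" by blast
      hence "\<eta> (x * x) = z\<^sup>2" using assms by (simp add: mult_char_on_def unit_level_def power2_eq_square)
      thus ?thesis using unit_level_mult[OF x(1) x(1)] by (metis imageI)
    qed
  qed
  thus ?thesis by (intro exI[of _ "Suc n"]) auto
qed

text \<open>Since \<open>unit_level 0\<close> is the full unit group, the exceptional value 0 of
  \<open>mult_cond\<close> fits the same pattern as the positive levels, and conductor bounds can be
  checked on one unit level without separating trivial characters.\<close>

lemma mult_cond_le_iff:
  assumes "mult_char_on integer_units (\<eta> :: 'a::nonarch_local_field \<Rightarrow> complex)"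
  shows "mult_cond \<eta> \<le> n \<longleftrightarrow> (\<forall>u\<in>unit_level n. \<eta> u = 1)"
proof (cases "\<forall>u\<in>integer_units. \<eta> u = 1")
  case True
  thus ?thesis by (simp add: mult_cond_def unit_level_def)
next
  case False
  let ?P = "\<lambda>c::nat. c \<ge> 1 \<and> (\<forall>x\<in>prime_power (int c). \<eta> (1 + x) = 1)"
  have P: "?P c \<longleftrightarrow> c \<ge> 1 \<and> (\<forall>u\<in>unit_level c. \<eta> u = 1)" for c
  proof (cases "c \<ge> 1")
    case True
    thus ?thesis using unit_level_pos[of c, where 'a='a] by auto
  qed auto
  have eq: "mult_cond \<eta> = (LEAST c. ?P c)" using False unfolding mult_cond_def by (rule if_not_P)
  have ex: "\<exists>c. ?P c" using mult_char_trivial_ex[OF assms] unfolding P .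
  have sp: "?P (mult_cond \<eta>)" unfolding eq by (rule LeastI_ex[OF ex])
  show ?thesis
  proof
    assume "mult_cond \<eta> \<le> n"
    thus "\<forall>u\<in>unit_level n. \<eta> u = 1" using sp unfolding P using unit_level_mono[of "mult_cond \<eta>" n] by blast
  next
    assume *: "\<forall>u\<in>unit_level n. \<eta> u = 1"
    hence "n \<noteq> 0" using False unit_level_0[where 'a='a] by metis
    hence "?P n" using * unfolding P by simp
    thus "mult_cond \<eta> \<le> n" unfolding eq by (rule Least_le)
  qed
qed

section \<open>Sums over quotients of fractional ideals\<close>

text \<open>Complete systems of representatives of P^l modulo P^n. They keep finite sums on field
  elements instead of cosets; \<open>pinv\<close> then says that a function descends to the
  quotient.\<close>

definition is_reps :: "'a::nonarch_local_field set \<Rightarrow> int \<Rightarrow> int \<Rightarrow> bool" where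
  "is_reps R l n \<longleftrightarrow> R \<subseteq> prime_power l \<and> (\<forall>x\<in>prime_power l. \<exists>!r. r \<in> R \<and> x - r \<in> prime_power n)"

definition pinv :: "('a::nonarch_local_field \<Rightarrow> 'b) \<Rightarrow> int \<Rightarrow> int \<Rightarrow> bool" where
  "pinv \<phi> l n \<longleftrightarrow> (\<forall>x\<in>prime_power l. \<forall>y\<in>prime_power l. x - y \<in> prime_power n \<longrightarrow> \<phi> x = \<phi> y)"

lemma pinvD: "pinv \<phi> l n \<Longrightarrow> x \<in> prime_power l \<Longrightarrow> y \<in> prime_power l \<Longrightarrow> x - y \<in> prime_power n \<Longrightarrow> \<phi> x = \<phi> y"
  unfolding pinv_def by blast

lemma is_repsD: "is_reps R l n \<Longrightarrow> r \<in> R \<Longrightarrow> r \<in> prime_power l"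
  by (auto simp: is_reps_def)

lemma is_reps_ex: "is_reps R l n \<Longrightarrow> x \<in> prime_power l \<Longrightarrow> \<exists>r\<in>R. x - r \<in> prime_power n"
  by (metis is_reps_def)

lemma is_reps_unique:
  assumes "is_reps R l n" "r \<in> R" "s \<in> R" "r - s \<in> prime_power n"
  shows "r = s"
proof -
  have "r \<in> prime_power l" using is_repsD assms by blast
  moreover have "r - r \<in> prime_power n" by simp
  ultimately show ?thesis using assms unfolding is_reps_def by metis
qed

lemma is_repsI:
  fixes R :: "'a::nonarch_local_field set"
  assumes "\<And>r. r \<in> R \<Longrightarrow> r \<in> prime_power l" "\<And>x. x \<in> prime_power l \<Longrightarrow> \<exists>r\<in>R. x - r \<in> prime_power n"
    "\<And>r s. r \<in> R \<Longrightarrow> s \<in> R \<Longrightarrow> r - s \<in> prime_power n \<Longrightarrow> r = s"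
  shows "is_reps R l n"
  unfolding is_reps_def
proof (intro conjI ballI ex_ex1I)
  show "R \<subseteq> prime_power l" using assms(1) by blast
  fix x :: 'a assume "x \<in> prime_power l"
  thus "\<exists>r. r \<in> R \<and> x - r \<in> prime_power n" using assms(2) by blast
next
  fix x r s :: 'a assume "r \<in> R \<and> x - r \<in> prime_power n" "s \<in> R \<and> x - s \<in> prime_power n"
  thus "r = s" using assms(3) pp_trans pp_diff_commute by metis
qed

lemma is_reps_bij:
  assumes "is_reps R l n" "is_reps S l n"
  obtains f where "bij_betw f R S" "\<And>r. r \<in> R \<Longrightarrow> r - f r \<in> prime_power n"
proof -
  have "\<forall>r\<in>R. \<exists>s\<in>S. r - s \<in> prime_power n" using is_reps_ex[OF assms(2)] is_repsD[OF assms(1)] by blast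
  then obtain f where f: "\<And>r. r \<in> R \<Longrightarrow> f r \<in> S \<and> r - f r \<in> prime_power n" by metis
  have "inj_on f R"
  proof (rule inj_onI)
    fix x y assume "x \<in> R" "y \<in> R" "f x = f y"
    thus "x = y" using f is_reps_unique[OF assms(1)] pp_trans pp_diff_commute by metis
  qed
  moreover have "f ` R = S"
  proof (intro equalityI subsetI)
    fix s assume s: "s \<in> S"
    then obtain r where r: "r \<in> R" "s - r \<in> prime_power n" using is_reps_ex[OF assms(1)] is_repsD[OF assms(2)] by blast
    hence "s - f r \<in> prime_power n" using f pp_trans by blast
    thus "s \<in> f ` R" using is_reps_unique[OF assms(2) s] f r by blast
  qed (use f in auto)
  ultimately show ?thesis using that f by (metis bij_betw_def)
qed

lemma is_reps_sum_eq:
  assumes "is_reps R l n" "is_reps S l n" "pinv \<phi> l n"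
  shows "sum \<phi> R = sum \<phi> S"
proof -
  obtain f where f: "bij_betw f R S" "\<And>r. r \<in> R \<Longrightarrow> r - f r \<in> prime_power n"
    using is_reps_bij[OF assms(1,2)] by metis
  have "sum \<phi> S = (\<Sum>r\<in>R. \<phi> (f r))" using f(1) by (rule sum.reindex_bij_betw[symmetric])
  also have "\<dots> = sum \<phi> R"
  proof (rule sum.cong)
    fix r assume r: "r \<in> R"
    hence "f r \<in> S" using f(1) by (auto simp: bij_betw_def)
    thus "\<phi> (f r) = \<phi> r" using pinvD[OF assms(3), of r "f r"] f(2)[OF r] is_repsD[OF assms(1) r] is_repsD[OF assms(2)] by simp
  qed simp
  finally show ?thesis by simp
qed

lemma ex_uniformizer: "\<exists>w::'a::nonarch_local_field. w \<noteq> 0 \<and> oval w = 1"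
proof -
  obtain w :: 'a where "absv w = 1 / real (card (residue_field :: 'a set set))" using nlf_uniformizer[where 'a='a] by blast
  hence "uniformizer w" by (simp add: uniformizer_def residue_card_def)
  thus ?thesis by (auto simp: uniformizer_iff)
qed

lemma pp1_absv: "x \<in> prime_power 1 \<longleftrightarrow> absv (x::'a::nonarch_local_field) < 1"
proof (cases "x = 0")
  case False
  have "absv x < 1 \<longleftrightarrow> \<not> qinv TYPE('a) powi 0 \<le> qinv TYPE('a) powi (oval x)"
    using absv_oval[OF False] by (simp add: not_le)
  thus ?thesis unfolding qinv_powi_le_iff using False by (auto simp: prime_power_iff)
qed simp

text \<open>Links the quotient set \<open>residue_field\<close>, whose cardinality normalises the
  absolute value, with explicit representatives: one element is chosen from each class.\<close>

lemma is_reps_residue: "\<exists>R::'a::nonarch_local_field set. is_reps R 0 1 \<and> finite R \<and> card R = residue_card TYPE('a)"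
proof -
  let ?E = "{(x, y). absv x \<le> 1 \<and> absv (y::'a) \<le> 1 \<and> absv (x - y) < (1::real)}"
  have pp0: "absv x \<le> 1 \<longleftrightarrow> x \<in> prime_power 0" for x :: 'a by (simp add: prime_power_absv)
  have E: "?E = {(x, y). x \<in> prime_power 0 \<and> y \<in> prime_power 0 \<and> x - y \<in> prime_power 1}"
    by (simp add: pp0 pp1_absv)
  have eq: "equiv (prime_power 0) ?E"
    unfolding E
  proof (rule equivI)
    show "refl_on (prime_power 0) {(x, y). x \<in> prime_power 0 \<and> y \<in> prime_power 0 \<and> x - y \<in> prime_power 1}"
      by (auto simp: refl_on_def)
    show "sym {(x, y). x \<in> prime_power 0 \<and> y \<in> prime_power 0 \<and> x - y \<in> prime_power 1}"
      by (auto simp: sym_def pp_diff_commute)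
    show "trans {(x, y). x \<in> prime_power 0 \<and> y \<in> prime_power 0 \<and> x - y \<in> prime_power 1}"
      using pp_trans by (fastforce simp: trans_def)
  qed auto
  have rf: "(residue_field :: 'a set set) = prime_power 0 // ?E"
  proof -
    have "{x::'a. absv x \<le> 1} = prime_power 0" by (auto simp: prime_power_absv)
    thus ?thesis unfolding residue_field_def by (rule arg_cong)
  qed
  define f where "f C = (SOME y::'a. y \<in> C)" for C
  have f: "f C \<in> C" if "C \<in> residue_field" for C :: "'a set"
  proof -
    have "C \<noteq> {}" using that in_quotient_imp_non_empty[OF eq] unfolding rf by simp
    thus ?thesis unfolding f_def by (simp add: some_in_eq)
  qed
  have sub: "C \<subseteq> prime_power 0" if "C \<in> residue_field" for C :: "'a set"
    using in_quotient_imp_subset[OF eq] that unfolding rf by simp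
  have same: "C = D" if CD: "C \<in> residue_field" "D \<in> residue_field" "x \<in> C" "y \<in> D" "x - y \<in> prime_power 1" for C D and x y :: 'a
  proof -
    have "(x, y) \<in> ?E" unfolding E using CD sub[OF CD(1)] sub[OF CD(2)] by auto
    thus ?thesis using quotient_eqI[OF eq CD(1,2)[unfolded rf] CD(3,4)] by simp
  qed
  have "inj_on f residue_field"
  proof (rule inj_onI)
    fix C D :: "'a set" assume CD: "C \<in> residue_field" "D \<in> residue_field" "f C = f D"
    thus "C = D" using same[OF CD(1,2) f[OF CD(1)] f[OF CD(2)]] by simp
  qed
  hence "card (f ` residue_field) = residue_card TYPE('a)" by (simp add: card_image residue_card_def)
  moreover have "is_reps (f ` residue_field) 0 1"
  proof (rule is_repsI)
    show "r \<in> prime_power 0" if "r \<in> f ` residue_field" for r using that f sub by auto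
    show "r = s" if rs: "r \<in> f ` residue_field" "s \<in> f ` residue_field" "r - s \<in> prime_power 1" for r s
    proof -
      obtain C D where CD: "C \<in> residue_field" "D \<in> residue_field" "r = f C" "s = f D" using rs(1,2) by auto
      thus ?thesis using same[OF CD(1,2) f[OF CD(1)] f[OF CD(2)]] rs(3) by simp
    qed
    show "\<exists>r\<in>f ` residue_field. x - r \<in> prime_power 1" if "x \<in> prime_power 0" for x
    proof -
      have C: "?E `` {x} \<in> residue_field" using that unfolding rf by (rule quotientI)
      have "f (?E `` {x}) \<in> ?E `` {x}" using f[OF C] .
      hence "x - f (?E `` {x}) \<in> prime_power 1" unfolding E by auto
      thus ?thesis using C by blast
    qed
  qed
  ultimately show ?thesis using nlf_finite_residue_field[where 'a='a] by blast
qed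

lemma is_reps_scale:
  assumes "is_reps R l n" "c \<noteq> 0"
  shows "is_reps ((*) c ` R) (l + oval c) (n + oval c)"
proof (rule is_repsI)
  show "r \<in> prime_power (l + oval c)" if "r \<in> (*) c ` R" for r
    using that is_repsD[OF assms(1)] assms(2) by (auto simp: pp_mult_iff)
  show "\<exists>r\<in>(*) c ` R. x - r \<in> prime_power (n + oval c)" if "x \<in> prime_power (l + oval c)" for x
  proof -
    have xc: "x = c * (x / c)" using assms(2) by simp
    hence "c * (x / c) \<in> prime_power (l + oval c)" using that by simp
    hence "x / c \<in> prime_power l" using assms(2) pp_mult_iff[of c "x / c"] by simp
    then obtain r where r: "r \<in> R" "x / c - r \<in> prime_power n" using is_reps_ex[OF assms(1)] by blast
    hence "c * (x / c - r) \<in> prime_power (n + oval c)" using assms(2) pp_mult_iff[of c "x / c - r"] by simp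
    hence "x - c * r \<in> prime_power (n + oval c)" using assms(2) by (simp add: right_diff_distrib)
    thus ?thesis using r by blast
  qed
  show "r = s" if rs: "r \<in> (*) c ` R" "s \<in> (*) c ` R" "r - s \<in> prime_power (n + oval c)" for r s
  proof -
    obtain r' s' where *: "r = c * r'" "s = c * s'" "r' \<in> R" "s' \<in> R" using rs(1,2) by blast
    hence "c * (r' - s') \<in> prime_power (n + oval c)" using rs by (simp add: right_diff_distrib)
    hence "r' - s' \<in> prime_power n" using assms(2) pp_mult_iff[of c "r' - s'"] by simp
    thus ?thesis using is_reps_unique[OF assms(1)] * by blast
  qed
qed

text \<open>P^l / P^k is an extension of P^l / P^n by P^n / P^k. This yields both the cardinalities
  in \<open>ex_reps\<close> and the iterated sums in \<open>qsum_split\<close>.\<close>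

lemma is_reps_plus:
  assumes "is_reps R l n" "is_reps S n k" "l \<le> n" "n \<le> k"
  shows "is_reps ((\<lambda>(r, s). r + s) ` (R \<times> S)) l k" "inj_on (\<lambda>(r, s). r + s) (R \<times> S)"
proof -
  have inj: "r = r' \<and> s = s'" if rs: "r \<in> R" "r' \<in> R" "s \<in> S" "s' \<in> S" "(r + s) - (r' + s') \<in> prime_power k" for r s r' s'
  proof -
    have "r - r' = ((r + s) - (r' + s')) - (s - s')" by simp
    also have "\<dots> \<in> prime_power n"
      using pp_mono[OF assms(4) rs(5)] is_repsD[OF assms(2)] rs by (intro pp_diff[of "r + s - (r' + s')"] pp_diff[of s]) auto
    finally have "r = r'" using is_reps_unique[OF assms(1)] rs by blast
    moreover have "s - s' \<in> prime_power k" using rs(5) \<open>r = r'\<close> by simp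
    ultimately show ?thesis using is_reps_unique[OF assms(2)] rs by blast
  qed
  thus "inj_on (\<lambda>(r, s). r + s) (R \<times> S)"
    by (auto intro!: inj_onI)
  show "is_reps ((\<lambda>(r, s). r + s) ` (R \<times> S)) l k"
  proof (rule is_repsI)
    show "r \<in> prime_power l" if "r \<in> (\<lambda>(r, s). r + s) ` (R \<times> S)" for r
      using that is_repsD[OF assms(1)] is_repsD[OF assms(2)] pp_mono[OF assms(3)] pp_add by fastforce
    show "r = s" if "r \<in> (\<lambda>(r, s). r + s) ` (R \<times> S)" "s \<in> (\<lambda>(r, s). r + s) ` (R \<times> S)"
      "r - s \<in> prime_power k" for r s
      using that inj by auto
    show "\<exists>r\<in>(\<lambda>(r, s). r + s) ` (R \<times> S). x - r \<in> prime_power k" if x: "x \<in> prime_power l" for x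
    proof -
      obtain r where r: "r \<in> R" "x - r \<in> prime_power n" using is_reps_ex[OF assms(1) x] by blast
      obtain s where s: "s \<in> S" "(x - r) - s \<in> prime_power k" using is_reps_ex[OF assms(2) r(2)] by blast
      hence "x - (r + s) \<in> prime_power k" by (simp add: diff_diff_eq)
      thus ?thesis using r s by force
    qed
  qed
qed

lemma ex_reps:
  assumes "l \<le> n"
  shows "\<exists>R::'a::nonarch_local_field set. is_reps R l n \<and> finite R \<and> card R = residue_card TYPE('a) ^ nat (n - l)"
  using assms
proof (induction n rule: int_ge_induct)
  case base
  have "is_reps {0::'a} l l" by (rule is_repsI) auto
  thus ?case by (intro exI[of _ "{0}"]) auto
next
  case (step n)
  then obtain R :: "'a set" where R: "is_reps R l n" "finite R" "card R = residue_card TYPE('a) ^ nat (n - l)" by blast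
  obtain S :: "'a set" where S: "is_reps S 0 1" "finite S" "card S = residue_card TYPE('a)" using is_reps_residue by blast
  obtain w :: 'a where w: "w \<noteq> 0" "oval w = 1" using ex_uniformizer by blast
  define c where "c = w powi n"
  have c: "c \<noteq> 0" "oval c = n" using w by (auto simp: c_def oval_power_int)
  have S': "is_reps ((*) c ` S) n (n + 1)" using is_reps_scale[OF S(1) c(1)] c(2) by (simp add: add.commute)
  have cS': "card ((*) c ` S) = residue_card TYPE('a)" using S(3) c(1) by (simp add: card_image inj_on_def)
  have "nat (n + 1 - l) = Suc (nat (n - l))" using step.hyps by simp
  hence "card ((\<lambda>(r, s). r + s) ` (R \<times> (*) c ` S)) = residue_card TYPE('a) ^ nat (n + 1 - l)"
    using is_reps_plus(2)[OF R(1) S'] step.hyps R(3) cS' by (simp add: card_image card_cartesian_product)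
  thus ?case using is_reps_plus(1)[OF R(1) S'] step.hyps R(2) S(2) by (metis finite_cartesian_product finite_imageI zle_add1_eq_le less_add_one order_less_imp_le)
qed

definition reps :: "int \<Rightarrow> int \<Rightarrow> 'a::nonarch_local_field set" where
  "reps l n = (SOME R. is_reps R l n \<and> finite R \<and> card R = residue_card TYPE('a) ^ nat (n - l))"

lemma reps:
  assumes "l \<le> n"
  shows "is_reps (reps l n :: 'a::nonarch_local_field set) l n" "finite (reps l n :: 'a set)"
    "card (reps l n :: 'a set) = residue_card TYPE('a) ^ nat (n - l)"
  using someI_ex[OF ex_reps[OF assms, where 'a='a]] unfolding reps_def by blast+

text \<open>The sum over P^l / P^n. The fixed system \<open>reps l n\<close> makes it a total
  function; on functions with \<open>pinv\<close> every other system gives the same value by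
  \<open>qsum_eq\<close>.\<close>

definition qsum :: "int \<Rightarrow> int \<Rightarrow> ('a::nonarch_local_field \<Rightarrow> complex) \<Rightarrow> complex" where
  "qsum l n \<phi> = sum \<phi> (reps l n)"

lemma qsum_eq: "l \<le> n \<Longrightarrow> is_reps R l n \<Longrightarrow> pinv \<phi> l n \<Longrightarrow> sum \<phi> R = qsum l n \<phi>"
  unfolding qsum_def by (rule is_reps_sum_eq) (use reps in auto)

lemma qsum_cong: "l \<le> n \<Longrightarrow> (\<And>x. x \<in> prime_power l \<Longrightarrow> \<phi> x = \<phi>' x) \<Longrightarrow> qsum l n \<phi> = qsum l n \<phi>'"
  unfolding qsum_def using is_repsD[OF reps(1)] by (intro sum.cong) auto

lemma qsum_split:
  assumes "l \<le> n" "n \<le> k" "pinv (\<phi> :: 'a::nonarch_local_field \<Rightarrow> complex) l k"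
  shows "qsum l k \<phi> = qsum l n (\<lambda>r. qsum n k (\<lambda>s. \<phi> (r + s)))"
proof -
  note R = reps[OF assms(1), where 'a='a] and S = reps[OF assms(2), where 'a='a]
  have "qsum l k \<phi> = sum \<phi> ((\<lambda>(r, s). r + s) ` (reps l n \<times> reps n k))"
    using assms is_reps_plus(1)[OF R(1) S(1)] by (intro qsum_eq[symmetric]) auto
  also have "\<dots> = (\<Sum>(r, s)\<in>reps l n \<times> reps n k. \<phi> (r + s))"
    using is_reps_plus(2)[OF R(1) S(1)] assms by (subst sum.reindex) (auto simp: case_prod_unfold o_def)
  finally show ?thesis by (simp add: qsum_def sum.cartesian_product)
qed

lemma qsum_shift:
  fixes \<phi> :: "'a::nonarch_local_field \<Rightarrow> complex"
  assumes "l \<le> n" "pinv \<phi> l n" "z \<in> prime_power l"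
  shows "qsum l n (\<lambda>x. \<phi> (x + z)) = qsum l n \<phi>"
proof -
  note R = reps[OF assms(1), where 'a='a]
  have "is_reps ((\<lambda>x. x + z) ` reps l n) l n"
  proof (rule is_repsI)
    show "r \<in> prime_power l" if "r \<in> (\<lambda>x. x + z) ` reps l n" for r
      using that is_repsD[OF R(1)] assms(3) by (auto intro!: pp_add)
    show "r = s" if "r \<in> (\<lambda>x. x + z) ` reps l n" "s \<in> (\<lambda>x. x + z) ` reps l n" "r - s \<in> prime_power n" for r s
      using that is_reps_unique[OF R(1)] by auto
    show "\<exists>r\<in>(\<lambda>x. x + z) ` reps l n. x - r \<in> prime_power n" if x: "x \<in> prime_power l" for x
    proof -
      obtain r where r: "r \<in> reps l n" "(x - z) - r \<in> prime_power n"
        using is_reps_ex[OF R(1) pp_diff[OF x assms(3)]] by blast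
      hence "x - (r + z) \<in> prime_power n" by (simp add: algebra_simps)
      thus ?thesis using r by blast
    qed
  qed
  hence "qsum l n \<phi> = sum \<phi> ((\<lambda>x. x + z) ` reps l n)" using assms qsum_eq by metis
  also have "\<dots> = qsum l n (\<lambda>x. \<phi> (x + z))"
    by (subst sum.reindex) (auto simp: qsum_def o_def)
  finally show ?thesis by simp
qed

lemma qsum_scale:
  fixes \<phi> :: "'a::nonarch_local_field \<Rightarrow> complex"
  assumes "l \<le> n" "c \<noteq> 0" "pinv \<phi> (l + oval c) (n + oval c)"
  shows "qsum l n (\<lambda>x. \<phi> (c * x)) = qsum (l + oval c) (n + oval c) \<phi>"
proof -
  have "qsum (l + oval c) (n + oval c) \<phi> = sum \<phi> ((*) c ` reps l n)"
    using is_reps_scale[OF reps(1)[OF assms(1)] assms(2)] assms qsum_eq[of "l + oval c" "n + oval c" _ \<phi>] by simp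
  also have "\<dots> = qsum l n (\<lambda>x. \<phi> (c * x))"
    using assms(2) by (subst sum.reindex) (auto simp: qsum_def o_def inj_on_def)
  finally show ?thesis by simp
qed

lemma qsum_const: "l \<le> n \<Longrightarrow> qsum l n (\<lambda>_::'a::nonarch_local_field. c) = of_nat (residue_card TYPE('a) ^ nat (n - l)) * c"
  by (simp add: qsum_def reps(3))

lemma qsum_mult_left: "qsum l n (\<lambda>x. c * \<phi> x) = c * qsum l n \<phi>"
  by (simp add: qsum_def sum_distrib_left)

lemma qsum_restrict:
  fixes \<phi> :: "'a::nonarch_local_field \<Rightarrow> complex"
  assumes "l \<le> n" "n \<le> k" "pinv \<phi> n k"
  shows "qsum l k (\<lambda>x. if x \<in> prime_power n then \<phi> x else 0) = qsum n k \<phi>"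
proof -
  have lk: "l \<le> k" using assms by simp
  note R = reps[OF lk, where 'a='a]
  have "is_reps {r \<in> reps l k. (r::'a) \<in> prime_power n} n k"
  proof (rule is_repsI)
    show "\<exists>r\<in>{r \<in> reps l k. r \<in> prime_power n}. x - r \<in> prime_power k" if x: "x \<in> prime_power n" for x :: 'a
    proof -
      obtain r where r: "r \<in> reps l k" "x - r \<in> prime_power k"
        using is_reps_ex[OF R(1) pp_mono[OF assms(1) x]] by blast
      have "x - (x - r) \<in> prime_power n" by (rule pp_diff[OF x pp_mono[OF assms(2) r(2)]])
      thus ?thesis using r by auto
    qed
    show "r = s" if "r \<in> {r \<in> reps l k. r \<in> prime_power n}" "s \<in> {r \<in> reps l k. r \<in> prime_power n}"
      "r - s \<in> prime_power k" for r s :: 'a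
      using that is_reps_unique[OF R(1)] by auto
  qed auto
  hence "qsum n k \<phi> = sum \<phi> {r \<in> reps l k. r \<in> prime_power n}" using assms qsum_eq by metis
  thus ?thesis using R(2) by (simp add: qsum_def sum.If_cases Int_def)
qed

text \<open>Orthogonality: translating by z multiplies the sum by \<phi> z, so it vanishes as soon
  as some value differs from 1.\<close>

lemma qsum_char:
  assumes "l \<le> n" "\<And>x y. x \<in> prime_power l \<Longrightarrow> y \<in> prime_power l \<Longrightarrow> \<phi> (x + y) = \<phi> x * \<phi> y"
    "\<And>x. x \<in> prime_power n \<Longrightarrow> \<phi> x = (1::complex)"
  shows "qsum l n \<phi> = (if \<forall>x\<in>prime_power l. \<phi> x = 1 then of_nat (residue_card TYPE('a::nonarch_local_field) ^ nat (n - l)) else 0)"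
    and "pinv (\<phi> :: 'a \<Rightarrow> complex) l n"
proof -
  show inv: "pinv \<phi> l n"
    unfolding pinv_def
  proof (intro ballI impI)
    fix x y :: 'a assume "x \<in> prime_power l" "y \<in> prime_power l" "x - y \<in> prime_power n"
    thus "\<phi> x = \<phi> y" using assms(2)[of y "x - y"] assms(3)[of "x - y"] pp_mono[OF assms(1), of "x - y"] by simp
  qed
  show "qsum l n \<phi> = (if \<forall>x\<in>prime_power l. \<phi> x = 1 then of_nat (residue_card TYPE('a) ^ nat (n - l)) else 0)"
  proof (cases "\<forall>x\<in>prime_power l. \<phi> x = 1")
    case True
    hence "qsum l n \<phi> = qsum l n (\<lambda>_::'a. 1)" using assms(1) by (intro qsum_cong) auto
    thus ?thesis using True qsum_const[OF assms(1), where 'a='a] by simp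
  next
    case False
    then obtain z where z: "z \<in> prime_power l" "\<phi> z \<noteq> 1" by blast
    have "qsum l n \<phi> = qsum l n (\<lambda>x. \<phi> (x + z))" using qsum_shift[OF assms(1) inv z(1)] by simp
    also have "\<dots> = qsum l n (\<lambda>x. \<phi> z * \<phi> x)"
      using assms(1,2) z by (intro qsum_cong) (auto simp: mult.commute)
    also have "\<dots> = \<phi> z * qsum l n \<phi>" by (rule qsum_mult_left)
    finally have "qsum l n \<phi> = 0" using z(2) by (simp add: mult_cancel_right1)
    thus ?thesis using False by (subst if_not_P)
  qed
qed

section \<open>Squares and the Hilbert symbol\<close>

lemma of_nat_pp0: "(of_nat n :: 'a::nonarch_local_field) \<in> prime_power 0"
  by (induction n) (auto intro: pp_add)

text \<open>The \<open>LEAST\<close> in \<open>residue_char\<close> is attained because two distinct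
  naturals must fall into the same one of finitely many residue classes.\<close>

lemma residue_char_spec:
  defines "p \<equiv> residue_char TYPE('a::nonarch_local_field)"
  shows "p > 0" "absv (of_nat p :: 'a) < 1" "\<And>n. n > 0 \<Longrightarrow> absv (of_nat n :: 'a) < 1 \<Longrightarrow> p \<le> n"
proof -
  have "\<exists>f. \<forall>n. f n \<in> reps 0 1 \<and> (of_nat n :: 'a) - f n \<in> prime_power 1"
    using is_reps_ex[OF reps(1)[of 0 1] of_nat_pp0, where 'a='a] by (intro choice) auto
  then obtain f where f: "\<And>n. f n \<in> reps 0 1" "\<And>n. (of_nat n :: 'a) - f n \<in> prime_power 1" by blast
  have "finite (range f)" using f(1) reps(2)[of 0 1, where 'a='a] by (meson finite_subset image_subsetI zero_le_one)
  hence "\<not> inj f" using finite_imageD infinite_UNIV_nat by blast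
  then obtain i j where "i \<noteq> j" "f i = f j" by (auto simp: inj_def)
  then obtain i j where ij: "i < j" "f i = f j" by (metis linorder_neqE_nat)
  hence "(of_nat j :: 'a) - of_nat i \<in> prime_power 1" using f(2) pp_trans pp_diff_commute by metis
  hence "(of_nat (j - i) :: 'a) \<in> prime_power 1" using ij by (simp add: of_nat_diff)
  hence "absv (of_nat (j - i) :: 'a) \<le> qinv TYPE('a)" by (simp add: prime_power_absv)
  hence "absv (of_nat (j - i) :: 'a) < 1" using qinv_bounds(2)[where 'a='a] by linarith
  hence "\<exists>p>0. absv (of_nat p :: 'a) < 1" using ij by (intro exI[of _ "j - i"]) auto
  hence "p > 0 \<and> absv (of_nat p :: 'a) < 1" unfolding p_def residue_char_def by (rule LeastI_ex)
  thus "p > 0" "absv (of_nat p :: 'a) < 1" by auto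
  show "p \<le> n" if "n > 0" "absv (of_nat n :: 'a) < 1" for n
    unfolding p_def residue_char_def using that by (intro Least_le) auto
qed

lemma oval_add_eq:
  assumes "x \<in> prime_power (oval y + 1)" "y \<noteq> (0::'a::nonarch_local_field)"
  shows "x + y \<noteq> 0" "oval (x + y) = oval y"
proof -
  have "x + y \<notin> prime_power (oval y + 1)"
  proof
    assume "x + y \<in> prime_power (oval y + 1)"
    hence "y \<in> prime_power (oval y + 1)" using pp_diff[OF _ assms(1), of "x + y"] by simp
    thus False using assms(2) by (simp add: prime_power_iff)
  qed
  moreover have "x + y \<in> prime_power (oval y)"
    by (intro pp_add pp_mono[OF _ assms(1)]) (simp_all add: prime_power_iff)
  ultimately show "x + y \<noteq> 0" "oval (x + y) = oval y" by (auto simp: prime_power_iff)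
qed

section \<open>Formal properties of the Hilbert symbol\<close>

lemma hilbert_cases: "hilbert a b = 1 \<or> hilbert a b = -1"
  by (simp add: hilbert_def)

lemma hilbert_sq_1 [simp]: "hilbert a b * hilbert a b = 1"
  using hilbert_cases[of a b] by auto

lemma hilbert_nz [simp]: "hilbert a b \<noteq> 0"
  using hilbert_cases[of a b] by auto

lemma hilbert_eq_1_iff: "hilbert a b = 1 \<longleftrightarrow> (\<exists>x y z. (x, y, z) \<noteq> (0, 0, 0) \<and> z\<^sup>2 = a * x\<^sup>2 + b * y\<^sup>2)"
  by (simp add: hilbert_def)

lemma hilbert_eqI: "hilbert a b = 1 \<longleftrightarrow> hilbert c d = 1 \<Longrightarrow> hilbert a b = hilbert c d"
  using hilbert_cases by metis

lemma hilbert_sym: "hilbert a b = hilbert b (a::'a::nonarch_local_field)"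
proof (rule hilbert_eqI)
  have *: "hilbert b a = 1" if h: "hilbert a b = 1" for a b :: 'a
  proof -
    obtain x y z where "(x, y, z) \<noteq> (0, 0, 0)" "z\<^sup>2 = a * x\<^sup>2 + b * y\<^sup>2"
      using h unfolding hilbert_eq_1_iff by blast
    hence "(y, x, z) \<noteq> (0, 0, 0)" "z\<^sup>2 = b * y\<^sup>2 + a * x\<^sup>2" by (auto simp: add.commute)
    thus ?thesis unfolding hilbert_eq_1_iff by blast
  qed
  show "hilbert a b = 1 \<longleftrightarrow> hilbert b a = 1" using * by blast
qed

lemma hilbert_sq_right:
  assumes "c \<noteq> (0::'a::nonarch_local_field)"
  shows "hilbert a (b * c\<^sup>2) = hilbert a b"
proof (rule hilbert_eqI)
  have *: "hilbert a b' = 1" if h: "hilbert a (b' * d\<^sup>2) = 1" and d: "d \<noteq> 0" for b' d :: 'a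
  proof -
    obtain x y z where "(x, y, z) \<noteq> (0, 0, 0)" "z\<^sup>2 = a * x\<^sup>2 + b' * d\<^sup>2 * y\<^sup>2"
      using h unfolding hilbert_eq_1_iff by blast
    hence "(x, d * y, z) \<noteq> (0, 0, 0)" "z\<^sup>2 = a * x\<^sup>2 + b' * (d * y)\<^sup>2"
      using d by (auto simp: power_mult_distrib)
    thus ?thesis unfolding hilbert_eq_1_iff by blast
  qed
  show "hilbert a (b * c\<^sup>2) = 1 \<longleftrightarrow> hilbert a b = 1"
    using *[of b c] *[of "b * c\<^sup>2" "inverse c"] assms by (auto simp: field_simps)
qed

lemma hilbert_sq_left: "c \<noteq> (0::'a::nonarch_local_field) \<Longrightarrow> hilbert (a * c\<^sup>2) b = hilbert a b"
  using hilbert_sq_right hilbert_sym by metis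

lemma hilbert_1_right [simp]: "hilbert a 1 = 1"
  unfolding hilbert_eq_1_iff by (intro exI[of _ 0] exI[of _ 1]) auto

lemma hilbert_1_left [simp]: "hilbert 1 a = 1"
  using hilbert_1_right hilbert_sym by metis

lemma hilbert_square_right: "c \<noteq> (0::'a::nonarch_local_field) \<Longrightarrow> hilbert a (c\<^sup>2) = 1"
  using hilbert_sq_right[of c a 1] by simp

lemma hilbert_square_left: "c \<noteq> (0::'a::nonarch_local_field) \<Longrightarrow> hilbert (c\<^sup>2) a = 1"
  using hilbert_square_right hilbert_sym by metis

lemma hilbert_steinberg: "a + b = 1 \<Longrightarrow> hilbert a b = 1"
  unfolding hilbert_eq_1_iff by (intro exI[of _ 1]) auto

lemma hilbert_minus: "hilbert a (- a) = 1"
  unfolding hilbert_eq_1_iff by (intro exI[of _ 1] exI[of _ 0]) auto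

text \<open>Multiplying the equation by \<open>a\<close> turns a solution (x, y, z) into (z, y, a
  x). This special case of multiplicativity uses no arithmetic of the field and is available before
  multiplicativity itself, which it helps to prove through \<open>hilbert_pi_pi\<close>.\<close>

lemma hilbert_neg_mult:
  assumes "a \<noteq> (0::'a::nonarch_local_field)" "b \<noteq> 0"
  shows "hilbert a (- a * b) = hilbert a b"
proof (rule hilbert_eqI)
  have *: "hilbert a (- a * b') = 1" if h: "hilbert a b' = 1" for b'
  proof -
    obtain x y z where xyz: "(x, y, z) \<noteq> (0, 0, 0)" "z\<^sup>2 = a * x\<^sup>2 + b' * y\<^sup>2"
      using h unfolding hilbert_eq_1_iff by blast
    have "(z, y, a * x) \<noteq> (0, 0, 0)" using xyz assms by auto
    moreover have "(a * x)\<^sup>2 = a * z\<^sup>2 + (- a * b') * y\<^sup>2" unfolding xyz(2) by (simp add: power2_eq_square algebra_simps)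
    ultimately show ?thesis unfolding hilbert_eq_1_iff by blast
  qed
  have "- a * (- a * b) = b * a\<^sup>2" by (simp add: power2_eq_square)
  thus "hilbert a (- a * b) = 1 \<longleftrightarrow> hilbert a b = 1"
    using *[of b] *[of "- a * b"] hilbert_sq_right[OF assms(1), of a b] by metis
qed

text \<open>On units this is the quadratic residue symbol: in odd residual characteristic, being a
  square depends only on the residue class, see \<open>square_cong\<close>.\<close>

definition rho :: "'a::nonarch_local_field \<Rightarrow> complex" where
  "rho u = (if \<exists>y. u = y\<^sup>2 then 1 else -1)"

lemma rho_cases: "rho u = 1 \<or> rho u = -1" by (simp add: rho_def)

section \<open>Squares in odd residual characteristic\<close>

locale odd_local_field =
  fixes \<pi> :: "'a::nonarch_local_field"
  assumes odd_residue: "odd (residue_char TYPE('a))"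
    and unif: "uniformizer \<pi>"
begin

lemma pi_nz [simp]: "\<pi> \<noteq> 0" and oval_pi [simp]: "oval \<pi> = 1"
  using unif by (auto simp: uniformizer_iff)

text \<open>A non-unit 2 would make the residue characteristic at most 2; the value 1 is impossible
  because 1 has absolute value 1, and 2 is excluded by oddness.\<close>

lemma unit_2: "(2::'a) \<in> integer_units"
proof (rule ccontr)
  assume "(2::'a) \<notin> integer_units"
  moreover have "(2::'a) \<in> prime_power 0" using of_nat_pp0[of 2, where 'a='a] by simp
  ultimately have "absv (2::'a) < 1" by (simp add: units_iff_pp pp1_absv)
  hence le: "residue_char TYPE('a) \<le> 2" using residue_char_spec(3)[of 2, where 'a='a] by simp
  have "residue_char TYPE('a) \<noteq> 1" using residue_char_spec(2)[where 'a='a] by auto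
  moreover have "residue_char TYPE('a) \<noteq> 2" using odd_residue by auto
  ultimately show False using le residue_char_spec(1)[where 'a='a] by linarith
qed

lemma pp_mult2_iff: "2 * x \<in> prime_power n \<longleftrightarrow> (x::'a) \<in> prime_power n"
  by (rule units_pp_mult_iff[OF unit_2])

text \<open>The root is sought as 1 + y with y in P^1. The equation (1 + y)^2 = w is the fixed point
  equation of \<open>T\<close>, and T x - T y = ((y + x) / 2) (y - x) makes \<open>T\<close> a
  contraction of P^1 with factor \<open>qinv\<close>.\<close>

lemma hensel_sqrt:
  assumes "w - 1 \<in> prime_power 1"
  obtains y :: 'a where "y - 1 \<in> prime_power 1" "y\<^sup>2 = w"
proof -
  define T where "T y = (w - 1 - y\<^sup>2) / 2" for y :: 'a
  have half: "x / 2 \<in> prime_power n" if "x \<in> prime_power n" for x :: 'a and n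
    using pp_mult2_iff[of "x / 2"] that unit_2 units_nz by simp
  have "\<exists>!y\<in>prime_power 1. T y = y"
  proof (rule Banach_fix[where c = "qinv TYPE('a)"])
    show "complete (prime_power 1 :: 'a set)" using closed_pp complete_eq_closed by blast
    show "prime_power 1 \<noteq> ({}::'a set)" using pp_0 by blast
    show "0 \<le> qinv TYPE('a)" "qinv TYPE('a) < 1" using qinv_bounds[where 'a='a] by auto
    show "T ` prime_power 1 \<subseteq> prime_power 1"
    proof
      fix z assume "z \<in> T ` prime_power 1"
      then obtain y where y: "y \<in> prime_power 1" "z = T y" by blast
      have "y * y \<in> prime_power (1 + 1)" using pp_mult[OF y(1) y(1)] .
      hence "y\<^sup>2 \<in> prime_power 1" using pp_mono[of 1 "1 + 1"] by (simp add: power2_eq_square)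
      thus "z \<in> prime_power 1" unfolding y(2) T_def by (intro half pp_diff[OF assms])
    qed
    fix x y :: 'a assume xy: "x \<in> prime_power 1" "y \<in> prime_power 1"
    have "T x - T y = ((y + x) / 2) * (y - x)"
      by (simp add: T_def power2_eq_square algebra_simps diff_divide_distrib add_divide_distrib)
    hence "absv (T x - T y) = absv ((y + x) / 2) * absv (y - x)"
      by (simp only: nlf_absv_mult)
    moreover have "absv (y - x) = absv (x - y)" using absv_minus[of "x - y"] by simp
    moreover have "absv ((y + x) / 2) \<le> qinv TYPE('a)"
      using half[OF pp_add[OF xy(2,1)]] by (simp add: prime_power_absv)
    ultimately show "dist (T x) (T y) \<le> qinv TYPE('a) * dist x y"
      by (simp add: nlf_dist mult_right_mono)
  qed
  then obtain y where y: "y \<in> prime_power 1" "T y = y" by blast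
  hence "w - 1 - y\<^sup>2 = 2 * y" using units_nz[OF unit_2] by (simp add: T_def field_simps)
  hence "(1 + y)\<^sup>2 = w" by (simp add: power2_eq_square algebra_simps)
  thus ?thesis using that[of "1 + y"] y by simp
qed

lemma square_cong:
  assumes "u \<in> integer_units" "v \<in> integer_units" "u - v \<in> prime_power 1"
  shows "(\<exists>y. u = y\<^sup>2) \<longleftrightarrow> (\<exists>y. v = (y::'a)\<^sup>2)"
proof -
  have *: "\<exists>y. u = y\<^sup>2" if uv: "u \<in> integer_units" "v \<in> integer_units" "u - v \<in> prime_power 1" "v = y\<^sup>2" for u v y :: 'a
  proof -
    have "u / v - 1 = inverse v * (u - v)" using units_nz[OF uv(2)] by (simp add: field_simps)
    also have "\<dots> \<in> prime_power 1" using uv by (intro pp_mult_0) (auto simp: units_pp0)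
    finally obtain z where "z\<^sup>2 = u / v" using hensel_sqrt by metis
    hence "u = (z * y)\<^sup>2" using units_nz[OF uv(2)] uv(4) by (simp add: power_mult_distrib)
    thus ?thesis by blast
  qed
  show ?thesis using *[OF assms] *[of v u] assms pp_diff_commute by metis
qed

lemma rho_cong: "u \<in> integer_units \<Longrightarrow> v \<in> integer_units \<Longrightarrow> u - v \<in> prime_power 1 \<Longrightarrow> rho u = rho (v::'a)"
  unfolding rho_def using square_cong by metis

definition res :: "'a \<Rightarrow> 'a" where
  "res x = (THE r. r \<in> reps 0 1 \<and> x - r \<in> prime_power 1)"

lemma res: "x \<in> prime_power 0 \<Longrightarrow> res x \<in> reps 0 1 \<and> x - res x \<in> prime_power 1"
  unfolding res_def by (rule theI') (use reps(1)[of 0 1, where 'a='a] in \<open>auto simp: is_reps_def\<close>)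

lemma res_pp0: "x \<in> prime_power 0 \<Longrightarrow> res x \<in> prime_power 0"
  using res is_repsD[OF reps(1)[of 0 1, where 'a='a]] by simp

lemma res_eq_iff:
  assumes "x \<in> prime_power 0" "y \<in> prime_power 0"
  shows "res x = res y \<longleftrightarrow> x - y \<in> prime_power 1"
proof
  assume "res x = res y"
  thus "x - y \<in> prime_power 1" using res[OF assms(1)] res[OF assms(2)] pp_trans pp_diff_commute by metis
next
  assume "x - y \<in> prime_power 1"
  hence "res x - res y \<in> prime_power 1"
    using res[OF assms(1)] res[OF assms(2)] pp_trans pp_diff_commute by metis
  thus "res x = res y" using res assms is_reps_unique[OF reps(1)[of 0 1, where 'a='a]] by simp
qed

lemma res_id: "r \<in> reps 0 1 \<Longrightarrow> res r = r"
  using res[of r] is_repsD[OF reps(1)[of 0 1, where 'a='a], of r]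
    is_reps_unique[OF reps(1)[of 0 1, where 'a='a], of "res r" r] pp_diff_commute by (metis zero_le_one)

lemma res_unit_iff: "x \<in> prime_power 0 \<Longrightarrow> res x \<in> integer_units \<longleftrightarrow> x \<in> integer_units"
  using res[of x] units_add_pp[of x "res x - x"] units_add_pp[of "res x" "x - res x"] pp_diff_commute[of x "res x"] by auto

text \<open>\<open>Ured\<close>, \<open>Sred\<close> and \<open>Nred\<close> model the nonzero
  elements, the nonzero squares and the nonsquares of the residue field by fixed representatives; by
  Hensel, a unit is a square in the field exactly if its residue class is one.\<close>

definition Ured :: "'a set" where "Ured = {r \<in> reps 0 1. r \<in> integer_units}"
definition Sred :: "'a set" where "Sred = {r \<in> Ured. \<exists>y. r = y\<^sup>2}"
definition Nred :: "'a set" where "Nred = {r \<in> Ured. \<nexists>y. r = y\<^sup>2}"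

lemma finite_red: "finite Ured" "finite Sred" "finite Nred"
  using reps(2)[of 0 1, where 'a='a] by (auto simp: Ured_def Sred_def Nred_def)

lemma res_Ured: "u \<in> integer_units \<Longrightarrow> res u \<in> Ured"
  using res[of u] res_unit_iff[of u] by (auto simp: Ured_def units_pp0)

lemma res_Sred: "u \<in> integer_units \<Longrightarrow> res u \<in> Sred \<longleftrightarrow> (\<exists>y. u = y\<^sup>2)"
  using res_Ured[of u] square_cong[of u "res u"] res[of u] res_unit_iff[of u] by (auto simp: Sred_def units_pp0)

lemma res_Nred: "u \<in> integer_units \<Longrightarrow> res u \<in> Nred \<longleftrightarrow> (\<nexists>y. u = y\<^sup>2)"
  using res_Ured[of u] res_Sred[of u] by (auto simp: Sred_def Nred_def)

lemma square_root_unit: "u \<in> integer_units \<Longrightarrow> u = y\<^sup>2 \<Longrightarrow> y \<in> integer_units"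
  by (cases "y = 0") (auto simp: integer_units_iff oval_power)

text \<open>The residue field is a domain in which 2 is invertible, so a nonzero square has
  precisely the two distinct roots y and -y.\<close>

lemma square_fiber:
  assumes "s \<in> Sred"
  shows "card {r \<in> Ured. res (r\<^sup>2) = s} = 2"
proof -
  obtain y where y: "s = y\<^sup>2" "s \<in> integer_units" "s \<in> reps 0 1" using assms by (auto simp: Sred_def Ured_def)
  have yu: "y \<in> integer_units" using square_root_unit y by blast
  have "{r \<in> Ured. res (r\<^sup>2) = s} = {res y, res (- y)}"
  proof (intro equalityI subsetI)
    fix r assume "r \<in> {r \<in> Ured. res (r\<^sup>2) = s}"
    hence r: "r \<in> integer_units" "r \<in> reps 0 1" "res (r\<^sup>2) = s" by (auto simp: Ured_def)
    have "r\<^sup>2 - s \<in> prime_power 1" using res[of "r\<^sup>2"] units_pp0[OF units_power[OF r(1)]] r(3) by auto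
    hence "(r - y) * (r - - y) \<in> prime_power 1" by (simp add: y(1) power2_eq_square algebra_simps)
    moreover have "r - y \<in> prime_power 0" "r - - y \<in> prime_power 0"
      by (intro pp_diff units_pp0; use r yu in simp)+
    ultimately have "r - y \<in> prime_power 1 \<or> r - - y \<in> prime_power 1"
      using units_mult_iff[of "r - y" "r - - y"] units_iff_pp by blast
    hence "res r = res y \<or> res r = res (- y)" using r yu by (auto simp: res_eq_iff units_pp0)
    thus "r \<in> {res y, res (- y)}" using res_id[OF r(2)] by simp
  next
    have *: "res (res z ^ 2) = s" if z: "z \<in> integer_units" "z\<^sup>2 = s" for z
    proof -
      have "z + res z \<in> prime_power 0" using units_pp0[OF z(1)] res_pp0 by (intro pp_add) auto
      hence "(z + res z) * (z - res z) \<in> prime_power 1" using res[of z] units_pp0[OF z(1)] by (intro pp_mult_0) auto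
      hence "s - (res z)\<^sup>2 \<in> prime_power 1" unfolding z(2)[symmetric] by (simp add: power2_eq_square algebra_simps)
      hence "res ((res z)\<^sup>2) = res s"
        using y(2) res_pp0[OF units_pp0[OF z(1)]] pp_mult_0[of "res z" "res z" 0]
        by (subst res_eq_iff) (auto simp: units_pp0 pp_diff_commute power2_eq_square)
      thus ?thesis using res_id[OF y(3)] by simp
    qed
    fix r assume "r \<in> {res y, res (- y)}"
    thus "r \<in> {r \<in> Ured. res (r\<^sup>2) = s}" using *[of y] *[of "- y"] yu y(1) res_Ured by auto
  qed
  moreover have "res y \<noteq> res (- y)"
  proof -
    have "2 * y \<in> integer_units" using units_mult[OF unit_2 yu] .
    moreover have "y - - y = 2 * y" by simp
    ultimately have "y - - y \<notin> prime_power 1" unfolding units_iff_pp by simp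
    thus ?thesis using yu by (simp add: res_eq_iff units_pp0)
  qed
  ultimately show ?thesis by simp
qed

text \<open>Squaring is two-to-one on nonzero residues. The values lie in a general semiring because
  the lemma serves over the naturals for counting and over the complex numbers for Gauss
  sums.\<close>

lemma sum_squares:
  fixes \<phi> :: "'a \<Rightarrow> 'c::comm_semiring_1"
  assumes "pinv \<phi> 0 1"
  shows "(\<Sum>y\<in>Ured. \<phi> (y\<^sup>2)) = 2 * sum \<phi> Sred"
proof -
  have im: "(\<lambda>r. res (r\<^sup>2)) ` Ured \<subseteq> Sred"
    by (auto simp: Ured_def intro!: res_Sred[THEN iffD2] units_power)
  have "(\<Sum>y\<in>Ured. \<phi> (y\<^sup>2)) = (\<Sum>y\<in>Ured. \<phi> (res (y\<^sup>2)))"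
  proof (rule sum.cong)
    fix y assume "y \<in> Ured"
    hence "y\<^sup>2 \<in> prime_power 0" by (auto simp: Ured_def intro: units_pp0 units_power)
    thus "\<phi> (y\<^sup>2) = \<phi> (res (y\<^sup>2))" using res res_pp0 by (intro pinvD[OF assms]) auto
  qed simp
  also have "\<dots> = (\<Sum>s\<in>Sred. \<Sum>y\<in>{r \<in> Ured. res (r\<^sup>2) = s}. \<phi> (res (y\<^sup>2)))"
    by (rule sum.group[symmetric]) (use finite_red im in auto)
  also have "\<dots> = (\<Sum>s\<in>Sred. 2 * \<phi> s)"
    by (intro sum.cong) (auto simp: square_fiber)
  finally show ?thesis by (simp add: sum_distrib_left)
qed

lemma card_Ured: "card Ured = 2 * card Sred"
  using sum_squares[of "\<lambda>_. 1::nat"] by (simp add: pinv_def)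

lemma card_Nred: "card Nred = card Sred"
proof -
  have "Ured = Sred \<union> Nred" "Sred \<inter> Nred = {}" by (auto simp: Sred_def Nred_def)
  hence "card Ured = card Sred + card Nred" using finite_red card_Un_disjoint by metis
  thus ?thesis using card_Ured by simp
qed

lemma reps01_eq: "reps 0 1 = insert (res 0) Ured"
proof (intro equalityI subsetI)
  fix r :: 'a assume r: "r \<in> reps 0 1"
  hence r0: "r \<in> prime_power 0" using is_repsD[OF reps(1)[of 0 1]] by simp
  show "r \<in> insert (res 0) Ured"
  proof (cases "r \<in> integer_units")
    case False
    hence "res r = res 0" using r0 by (simp add: res_eq_iff units_iff_pp)
    thus ?thesis using res_id[OF r] by simp
  qed (use r in \<open>auto simp: Ured_def\<close>)
qed (use res[of 0] in \<open>auto simp: Ured_def\<close>)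

lemma res_0_nonunit: "res 0 \<notin> Ured"
  using res_unit_iff[of 0] by (auto simp: Ured_def integer_units_iff)

lemma card_reps01: "card (reps 0 1 :: 'a set) = 2 * card Sred + 1"
  using reps01_eq res_0_nonunit card_Ured finite_red by simp

text \<open>Multiplication by a nonsquare is injective and avoids the squares; as squares and
  nonsquares are equinumerous, it is onto the nonsquares. This is what makes the product of two
  nonsquare units a square.\<close>

lemma nonsquare_bij:
  assumes "u \<in> integer_units" "\<nexists>y. u = (y::'a)\<^sup>2"
  shows "bij_betw (\<lambda>s. res (u * s)) Sred Nred"
proof -
  have unit: "u * s \<in> integer_units" if "s \<in> Sred" for s
    using that assms(1) by (auto simp: Sred_def Ured_def intro: units_mult)
  have inj: "inj_on (\<lambda>s. res (u * s)) Sred"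
  proof (rule inj_onI)
    fix s t assume st: "s \<in> Sred" "t \<in> Sred" "res (u * s) = res (u * t)"
    hence "u * (s - t) \<in> prime_power 1" using unit res_eq_iff units_pp0 by (metis right_diff_distrib)
    hence "s - t \<in> prime_power 1" using units_pp_mult_iff[OF assms(1)] by blast
    thus "s = t" using st is_reps_unique[OF reps(1)[of 0 1, where 'a='a]] by (auto simp: Sred_def Ured_def)
  qed
  have "(\<lambda>s. res (u * s)) ` Sred \<subseteq> Nred"
  proof
    fix r assume "r \<in> (\<lambda>s. res (u * s)) ` Sred"
    then obtain s where s: "s \<in> Sred" "r = res (u * s)" by blast
    then obtain y where y: "s = y\<^sup>2" by (auto simp: Sred_def)
    have "y \<noteq> 0" using s y units_nz[of s] by (auto simp: Sred_def Ured_def)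
    have "\<nexists>z. u * s = z\<^sup>2"
    proof
      assume "\<exists>z. u * s = z\<^sup>2"
      then obtain z where "u * s = z\<^sup>2" by blast
      hence "u = (z / y)\<^sup>2" using \<open>y \<noteq> 0\<close> by (simp add: y power_divide field_simps)
      thus False using assms by blast
    qed
    thus "r \<in> Nred" using res_Nred[OF unit[OF s(1)]] s(2) by simp
  qed
  moreover have "card ((\<lambda>s. res (u * s)) ` Sred) = card Nred" using inj by (simp add: card_image card_Nred)
  ultimately have "(\<lambda>s. res (u * s)) ` Sred = Nred" using finite_red card_subset_eq by blast
  thus ?thesis using inj by (simp add: bij_betw_def)
qed

lemma nonsquare_mult:
  assumes "u \<in> integer_units" "\<nexists>y. u = (y::'a)\<^sup>2" "v \<in> integer_units" "\<nexists>y. v = (y::'a)\<^sup>2"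
  shows "\<exists>y. u * v = y\<^sup>2"
proof -
  have "res v \<in> Nred" using res_Nred assms by simp
  then obtain s where s: "s \<in> Sred" "res v = res (u * s)" using nonsquare_bij[OF assms(1,2)] by (auto simp: bij_betw_def)
  then obtain y where y: "s = y\<^sup>2" "s \<in> integer_units" by (auto simp: Sred_def Ured_def)
  have "v - u * s \<in> prime_power 1" using s(2) assms y by (subst (asm) res_eq_iff) (auto intro: units_pp0 units_mult)
  hence "u * (v - u * s) \<in> prime_power 1" using units_pp_mult_iff[OF assms(1)] by blast
  hence "u * v - u * (u * s) \<in> prime_power 1" by (simp add: right_diff_distrib)
  moreover have "u * (u * s) = (u * y)\<^sup>2" by (simp add: y power2_eq_square algebra_simps)
  ultimately show ?thesis using square_cong[of "u * v" "u * (u * s)"] assms y units_mult by metis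
qed

lemma rho_mult:
  assumes "u \<in> integer_units" "v \<in> integer_units"
  shows "rho (u * v) = rho u * rho (v::'a)"
proof -
  have *: "(\<exists>y. u * v = y\<^sup>2) \<longleftrightarrow> (\<exists>y. v = y\<^sup>2)" if "u = z\<^sup>2" "z \<noteq> 0" for u v z :: 'a
  proof
    assume "\<exists>y. u * v = y\<^sup>2"
    then obtain y where "u * v = y\<^sup>2" by blast
    hence "v = (y / z)\<^sup>2" using that by (simp add: power_divide field_simps)
    thus "\<exists>y. v = y\<^sup>2" by blast
  next
    assume "\<exists>y. v = y\<^sup>2"
    then obtain y where "v = y\<^sup>2" by blast
    hence "u * v = (z * y)\<^sup>2" using that by (simp add: power_mult_distrib)
    thus "\<exists>y. u * v = y\<^sup>2" by blast
  qed
  show ?thesis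
  proof (cases "\<exists>z. u = z\<^sup>2")
    case True
    then obtain z where "u = z\<^sup>2" by blast
    moreover have "z \<noteq> 0" using calculation assms(1) units_nz by fastforce
    ultimately show ?thesis using * unfolding rho_def by auto
  next
    case F: False
    show ?thesis
    proof (cases "\<exists>z. v = z\<^sup>2")
      case True
      then obtain z where "v = z\<^sup>2" by blast
      moreover have "z \<noteq> 0" using calculation assms(2) units_nz by fastforce
      ultimately show ?thesis using *[of v z u] unfolding rho_def by (auto simp: mult.commute)
    next
      case False
      thus ?thesis using F nonsquare_mult[OF assms(1) F assms(2) False] unfolding rho_def by simp
    qed
  qed
qed

lemma ex_nonsquare_unit: "\<exists>u::'a. u \<in> integer_units \<and> rho u = -1"
proof -
  have "res 1 \<in> Sred" by (auto simp: res_Sred intro!: exI[of _ 1])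
  hence "card Sred \<noteq> 0" using finite_red by auto
  hence "Nred \<noteq> {}" using card_Nred by auto
  thus ?thesis by (auto simp: Nred_def Ured_def rho_def)
qed

text \<open>Pigeonhole in the residue field with q elements: u s and 1 - v t, for s and t running
  over the squares including 0, take (q + 1) / 2 values each, so they meet. The resulting solution
  of u y^2 + v z^2 = 1 modulo P^1 lifts by \<open>hensel_sqrt\<close>.\<close>

lemma hilbert_units:
  assumes "u \<in> integer_units" "v \<in> integer_units"
  shows "hilbert u (v::'a) = 1"
proof -
  define S0 where "S0 = insert (res 0) Sred"
  have r0: "res 0 \<notin> Sred" using res_unit_iff[of 0] by (auto simp: Ured_def Sred_def integer_units_iff)
  have S0: "s \<in> reps 0 1" "s \<in> prime_power 0" "\<exists>y. y \<in> prime_power 0 \<and> s - y\<^sup>2 \<in> prime_power 1" if "s \<in> S0" for s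
  proof -
    show "s \<in> reps 0 1" using that res[of 0] by (auto simp: S0_def Sred_def Ured_def)
    thus "s \<in> prime_power 0" using is_repsD[OF reps(1)[of 0 1, where 'a='a]] by simp
    show "\<exists>y. y \<in> prime_power 0 \<and> s - y\<^sup>2 \<in> prime_power 1"
    proof (cases "s = res 0")
      case True
      thus ?thesis using res[of 0] by (intro exI[of _ 0]) auto
    next
      case False
      hence "s \<in> Sred" using \<open>s \<in> S0\<close> by (simp add: S0_def)
      then obtain y where "s = y\<^sup>2" "s \<in> integer_units" unfolding Sred_def Ured_def by blast
      thus ?thesis using square_root_unit units_pp0 by (intro exI[of _ y]) auto
    qed
  qed
  have cS0: "card S0 = card Sred + 1" using r0 finite_red by (simp add: S0_def)
  have up: "u * s \<in> prime_power 0" "1 - v * s \<in> prime_power 0" if "s \<in> S0" for s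
    using S0(2)[OF that] units_pp0[OF assms(1)] units_pp0[OF assms(2)] by (auto intro!: pp_diff pp_mult_0)
  have eqS: "s = t" if "s \<in> S0" "t \<in> S0" "s - t \<in> prime_power 1" for s t
    using that S0(1) is_reps_unique[OF reps(1)[of 0 1, where 'a='a]] by simp
  have "inj_on (\<lambda>s. res (u * s)) S0"
  proof (rule inj_onI)
    fix s t assume st: "s \<in> S0" "t \<in> S0" "res (u * s) = res (u * t)"
    hence "u * (s - t) \<in> prime_power 1" using up res_eq_iff by (metis right_diff_distrib)
    thus "s = t" using units_pp_mult_iff[OF assms(1)] eqS st by blast
  qed
  hence c1: "card ((\<lambda>s. res (u * s)) ` S0) = card Sred + 1" using cS0 by (simp add: card_image)
  have "inj_on (\<lambda>s. res (1 - v * s)) S0"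
  proof (rule inj_onI)
    fix s t assume st: "s \<in> S0" "t \<in> S0" "res (1 - v * s) = res (1 - v * t)"
    hence "(1 - v * s) - (1 - v * t) \<in> prime_power 1" using up res_eq_iff by blast
    hence "v * (t - s) \<in> prime_power 1" by (simp add: right_diff_distrib)
    thus "s = t" using units_pp_mult_iff[OF assms(2)] eqS st by blast
  qed
  hence c2: "card ((\<lambda>s. res (1 - v * s)) ` S0) = card Sred + 1" using cS0 by (simp add: card_image)
  have "(\<lambda>s. res (u * s)) ` S0 \<inter> (\<lambda>s. res (1 - v * s)) ` S0 \<noteq> {}"
  proof
    assume dis: "(\<lambda>s. res (u * s)) ` S0 \<inter> (\<lambda>s. res (1 - v * s)) ` S0 = {}"
    have "finite S0" using finite_red by (simp add: S0_def)
    hence "card ((\<lambda>s. res (u * s)) ` S0 \<union> (\<lambda>s. res (1 - v * s)) ` S0) = 2 * card Sred + 2"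
      using c1 c2 dis by (subst card_Un_disjoint) auto
    moreover have "(\<lambda>s. res (u * s)) ` S0 \<union> (\<lambda>s. res (1 - v * s)) ` S0 \<subseteq> reps 0 1"
      using up res by auto
    hence "card ((\<lambda>s. res (u * s)) ` S0 \<union> (\<lambda>s. res (1 - v * s)) ` S0) \<le> 2 * card Sred + 1"
      using card_mono[OF reps(2)[of 0 1, where 'a='a]] card_reps01 by fastforce
    ultimately show False by simp
  qed
  then obtain s t where st: "s \<in> S0" "t \<in> S0" "res (u * s) = res (1 - v * t)" by blast
  obtain y where y: "y \<in> prime_power 0" "s - y\<^sup>2 \<in> prime_power 1" using S0(3)[OF st(1)] by blast
  obtain z where z: "z \<in> prime_power 0" "t - z\<^sup>2 \<in> prime_power 1" using S0(3)[OF st(2)] by blast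
  have "u * s - (1 - v * t) \<in> prime_power 1" using st up res_eq_iff by blast
  moreover have "u * (s - y\<^sup>2) \<in> prime_power 1" "v * (t - z\<^sup>2) \<in> prime_power 1"
    using y z units_pp_mult_iff assms by auto
  ultimately have "u * s - (1 - v * t) - u * (s - y\<^sup>2) - v * (t - z\<^sup>2) \<in> prime_power 1"
    using pp_diff by blast
  hence "(u * y\<^sup>2 + v * z\<^sup>2) - 1 \<in> prime_power 1" by (simp add: algebra_simps)
  then obtain w where w: "w - 1 \<in> prime_power 1" "w\<^sup>2 = u * y\<^sup>2 + v * z\<^sup>2" using hensel_sqrt by metis
  have "w \<noteq> 0"
  proof
    assume "w = 0"
    hence "(1::'a) \<in> prime_power 1" using w(1) by (metis diff_0 pp_uminus)
    thus False by simp
  qed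
  thus ?thesis unfolding hilbert_eq_1_iff using w(2) by (intro exI[of _ y] exI[of _ z] exI[of _ w]) auto
qed

text \<open>For a nonsquare u a solution is refuted by valuations. If x = 0, the two sides have
  valuations of different parity. Otherwise divide by x^2: for integral Y, the square Z^2 is
  congruent to u, which makes u a square; for other Y the term \<pi> v Y^2 dominates and its
  valuation is odd.\<close>

lemma hilbert_unit_pi:
  assumes "u \<in> integer_units" "v \<in> integer_units"
  shows "hilbert u (\<pi> * v) = rho u"
proof (cases "\<exists>y. u = y\<^sup>2")
  case True
  thus ?thesis using hilbert_square_left units_nz[OF assms(1)] by (auto simp: rho_def)
next
  case False
  have "hilbert u (\<pi> * v) \<noteq> 1"
  proof
    assume "hilbert u (\<pi> * v) = 1"
    then obtain x y z where xyz: "(x, y, z) \<noteq> (0, 0, 0)" "z\<^sup>2 = u * x\<^sup>2 + \<pi> * v * y\<^sup>2"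
      unfolding hilbert_eq_1_iff by blast
    have ov: "oval (\<pi> * v * y\<^sup>2) = 1 + 2 * oval y" "\<pi> * v * y\<^sup>2 \<noteq> 0" if "y \<noteq> 0" for y
      using assms(2) that by (auto simp: integer_units_iff oval_mult oval_power)
    show False
    proof (cases "x = 0")
      case True
      have "y \<noteq> 0" using True xyz by auto
      hence "oval (z\<^sup>2) = 1 + 2 * oval y" "z\<^sup>2 \<noteq> 0" using True xyz ov by auto
      hence "2 * oval z = 1 + 2 * oval y" by (simp add: oval_power)
      thus False by presburger
    next
      case x: False
      define Z Y where "Z = z / x" and "Y = y / x"
      have eq: "Z\<^sup>2 = u + \<pi> * v * Y\<^sup>2" using xyz(2) x by (simp add: Z_def Y_def power_divide field_simps)
      show False
      proof (cases "Y \<in> prime_power 0")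
        case True
        have "\<pi> * v \<in> prime_power 1" using assms(2) by (simp add: prime_power_iff integer_units_iff oval_mult)
        hence *: "\<pi> * v * Y\<^sup>2 \<in> prime_power 1" using pp_mult[of "\<pi> * v" 1 "Y\<^sup>2" 0] pp_mult_0[OF True True] by (simp add: power2_eq_square)
        hence "Z\<^sup>2 \<in> integer_units" unfolding eq using assms(1) units_add_pp by blast
        moreover have "Z\<^sup>2 - u \<in> prime_power 1" using * eq by simp
        ultimately show False using square_cong[of "Z\<^sup>2" u] assms(1) False by blast
      next
        case F: False
        hence Y: "Y \<noteq> 0" "oval Y < 0" by (auto simp: prime_power_iff)
        have "u \<in> prime_power (oval (\<pi> * v * Y\<^sup>2) + 1)"
          using assms(1) Y ov(1)[OF Y(1)] by (simp add: prime_power_iff integer_units_iff)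
        from oval_add_eq[OF this] have "Z\<^sup>2 \<noteq> 0" "oval (Z\<^sup>2) = 1 + 2 * oval Y" using ov[OF Y(1)] eq by auto
        hence "2 * oval Z = 1 + 2 * oval Y" by (simp add: oval_power)
        thus False by presburger
      qed
    qed
  qed
  thus ?thesis using False hilbert_cases[of u "\<pi> * v"] by (auto simp: rho_def)
qed

lemma square_class:
  assumes "x \<noteq> (0::'a)"
  obtains u c where "u \<in> integer_units" "c \<noteq> 0" "even (oval x) \<and> x = u * c\<^sup>2 \<or> odd (oval x) \<and> x = \<pi> * u * c\<^sup>2"
proof (cases "even (oval x)")
  case True
  define c where "c = \<pi> powi (oval x div 2)"
  have c: "c \<noteq> 0" "oval c = oval x div 2" by (auto simp: c_def oval_power_int)
  have "x / c\<^sup>2 \<in> integer_units" using c assms True by (simp add: integer_units_iff oval_divide oval_power)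
  thus ?thesis using that[of "x / c\<^sup>2" c] c True by simp
next
  case False
  define c where "c = \<pi> powi (oval x div 2)"
  have c: "c \<noteq> 0" "oval c = oval x div 2" by (auto simp: c_def oval_power_int)
  have "oval x = 1 + 2 * (oval x div 2)" using False by presburger
  hence "x / (\<pi> * c\<^sup>2) \<in> integer_units" using c assms by (simp add: integer_units_iff oval_divide oval_power oval_mult)
  thus ?thesis using that[of "x / (\<pi> * c\<^sup>2)" c] c False by simp
qed

lemma hilbert_pi_unit: "u \<in> integer_units \<Longrightarrow> v \<in> integer_units \<Longrightarrow> hilbert (\<pi> * v) u = rho u"
  using hilbert_unit_pi hilbert_sym by metis

lemma hilbert_pi_pi:
  assumes "u \<in> integer_units" "v \<in> integer_units"
  shows "hilbert (\<pi> * u) (\<pi> * v) = rho (- u * v)"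
proof -
  have nz: "u \<noteq> 0" "v \<noteq> 0" using assms units_nz by auto
  have "hilbert (\<pi> * u) (\<pi> * v) = hilbert (\<pi> * u) (- (\<pi> * u) * (\<pi> * v))"
    using hilbert_neg_mult[of "\<pi> * u" "\<pi> * v"] nz by simp
  also have "- (\<pi> * u) * (\<pi> * v) = (- u * v) * \<pi>\<^sup>2" by (simp add: power2_eq_square algebra_simps)
  also have "hilbert (\<pi> * u) \<dots> = hilbert (\<pi> * u) (- u * v)" by (rule hilbert_sq_right) simp
  also have "\<dots> = rho (- u * v)" using assms by (intro hilbert_pi_unit) (auto intro: units_mult)
  finally show ?thesis .
qed

text \<open>By \<open>square_class\<close> each argument is a unit or \<pi> times a unit, up to
  squares. The eight resulting cases follow from the table of values of the symbol and
  \<open>rho_mult\<close>.\<close>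

lemma hilbert_mult_right:
  assumes "a \<noteq> 0" "b \<noteq> 0" "c \<noteq> (0::'a)"
  shows "hilbert a (b * c) = hilbert a b * hilbert a c"
proof -
  obtain u d where a: "u \<in> integer_units" "d \<noteq> 0" "a = u * d\<^sup>2 \<or> a = \<pi> * u * d\<^sup>2" using square_class[OF assms(1)] by metis
  obtain v e where b: "v \<in> integer_units" "e \<noteq> 0" "b = v * e\<^sup>2 \<or> b = \<pi> * v * e\<^sup>2" using square_class[OF assms(2)] by metis
  obtain w f where c: "w \<in> integer_units" "f \<noteq> 0" "c = w * f\<^sup>2 \<or> c = \<pi> * w * f\<^sup>2" using square_class[OF assms(3)] by metis
  have r: "rho x * rho x = 1" "rho x * (rho x * y) = y" for x :: 'a and y using rho_cases[of x] by auto
  have mu: "rho (- u * v) = rho (-1::'a) * rho u * rho v" if "u \<in> integer_units" "v \<in> integer_units" for u v :: 'a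
    using rho_mult[of "-1 * u" v] rho_mult[of "-1::'a" u] that by simp
  have hr: "hilbert x (z * (e * f)\<^sup>2) = hilbert x z" for x z :: 'a using b c by (intro hilbert_sq_right) simp
  have hr2: "hilbert x (z * (\<pi> * (e * f))\<^sup>2) = hilbert x z" for x z :: 'a using b c by (intro hilbert_sq_right) simp
  have e1: "v * e\<^sup>2 * (w * f\<^sup>2) = (v * w) * (e * f)\<^sup>2" "\<pi> * v * e\<^sup>2 * (w * f\<^sup>2) = (\<pi> * (v * w)) * (e * f)\<^sup>2"
    "v * e\<^sup>2 * (\<pi> * w * f\<^sup>2) = (\<pi> * (v * w)) * (e * f)\<^sup>2" "\<pi> * v * e\<^sup>2 * (\<pi> * w * f\<^sup>2) = (v * w) * (\<pi> * (e * f))\<^sup>2"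
    by (simp_all add: power2_eq_square algebra_simps)
  note s = hilbert_sq_left[OF a(2)] hilbert_sq_right[OF b(2)] hilbert_sq_right[OF c(2)] hr hr2

  have uvw: "v * w \<in> integer_units" using b c units_mult by blast
  show ?thesis
    using a(3) b(3) c(3)
    by (elim disjE; hypsubst;
        (simp only: e1 s hilbert_units hilbert_unit_pi hilbert_pi_unit hilbert_pi_pi a(1) b(1) c(1) uvw mu rho_mult mult_1);
        (simp add: r mult_ac)?)
qed

lemma hilbert_mult_left:
  assumes "a \<noteq> 0" "b \<noteq> 0" "c \<noteq> (0::'a)"
  shows "hilbert (a * b) c = hilbert a c * hilbert b c"
  using hilbert_mult_right[OF assms(3,1,2)] by (simp add: hilbert_sym)

lemma hilbert_inverse_right: "a \<noteq> 0 \<Longrightarrow> b \<noteq> (0::'a) \<Longrightarrow> hilbert a (inverse b) = hilbert a b"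
  using hilbert_sq_right[of b a "inverse b"] by (simp add: power2_eq_square flip: mult.assoc)

lemma hilbert_inverse_left: "a \<noteq> 0 \<Longrightarrow> b \<noteq> (0::'a) \<Longrightarrow> hilbert (inverse a) b = hilbert a b"
  using hilbert_inverse_right hilbert_sym by metis

lemma hilbert_self: "a \<noteq> (0::'a) \<Longrightarrow> hilbert a a = hilbert a (-1)"
  using hilbert_mult_right[of a "-1" "-a"] hilbert_minus[of a] by simp

end

section \<open>The Weil index\<close>

lemma residue_card_qinv: "complex_of_nat (residue_card TYPE('a::nonarch_local_field)) = of_real (inverse (qinv TYPE('a)))"
  by (simp add: qinv_def)

lemma of_nat_residue_powi: "n \<le> k \<Longrightarrow> complex_of_nat (residue_card TYPE('a::nonarch_local_field) ^ nat (k - n)) = of_real (qinv TYPE('a) powi (n - k))"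
proof -
  assume "n \<le> k"
  have "complex_of_nat (residue_card TYPE('a) ^ nat (k - n)) = of_real (inverse (qinv TYPE('a)) ^ nat (k - n))"
    by (simp add: qinv_def)
  also have "inverse (qinv TYPE('a)) ^ nat (k - n) = qinv TYPE('a) powi (n - k)"
    using \<open>n \<le> k\<close> power_int_minus[of "qinv TYPE('a)" "k - n"] by (simp add: power_int_def power_inverse)
  finally show ?thesis .
qed

section \<open>Haar integrals of Schwartz-Bruhat functions\<close>

definition finv :: "('a::nonarch_local_field \<Rightarrow> complex) \<Rightarrow> int \<Rightarrow> bool" where
  "finv \<phi> n \<longleftrightarrow> (\<forall>x y. x - y \<in> prime_power n \<longrightarrow> \<phi> x = \<phi> y)"

lemma finvD: "finv \<phi> n \<Longrightarrow> x - y \<in> prime_power n \<Longrightarrow> \<phi> x = \<phi> y"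
  unfolding finv_def by blast

lemma finv_pinv: "finv \<phi> n \<Longrightarrow> pinv \<phi> l n"
  unfolding finv_def pinv_def by blast

lemma pinv_mult_right: "pinv \<phi> l n \<Longrightarrow> pinv (\<lambda>x. \<phi> x * c) l n"
  unfolding pinv_def by metis

lemma finv_mono: "finv \<phi> n \<Longrightarrow> n \<le> k \<Longrightarrow> finv \<phi> k"
  unfolding finv_def using pp_mono by blast

lemma qsum_refine:
  fixes \<phi> :: "'a::nonarch_local_field \<Rightarrow> complex"
  assumes "l \<le> n" "n \<le> k" "finv \<phi> n"
  shows "qsum l k \<phi> = of_real (qinv TYPE('a) powi (n - k)) * qsum l n \<phi>"
proof -
  have "qsum l k \<phi> = qsum l n (\<lambda>r. qsum n k (\<lambda>s. \<phi> (r + s)))"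
    using assms finv_pinv[OF finv_mono[OF assms(3,2)]] by (intro qsum_split) auto
  also have "\<dots> = qsum l n (\<lambda>r. of_real (qinv TYPE('a) powi (n - k)) * \<phi> r)"
  proof (rule qsum_cong[OF assms(1)])
    fix r :: 'a
    have "qsum n k (\<lambda>s. \<phi> (r + s)) = qsum n k (\<lambda>_::'a. \<phi> r)"
      by (rule qsum_cong[OF assms(2)], rule finvD[OF assms(3)]) simp
    thus "qsum n k (\<lambda>s. \<phi> (r + s)) = of_real (qinv TYPE('a) powi (n - k)) * \<phi> r"
      using qsum_const[OF assms(2), where 'a='a] of_nat_residue_powi[OF assms(2), where 'a='a] by simp
  qed
  finally show ?thesis by (simp add: qsum_mult_left)
qed

text \<open>Each coset that meets the support contains exactly one representative from P^l, and
  invariance makes the value at the \<open>SOME\<close> element independent of the choice.\<close>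

lemma haar_coset_sum:
  fixes \<phi> :: "'a::nonarch_local_field \<Rightarrow> complex"
  assumes supp: "\<And>x. \<phi> x \<noteq> 0 \<Longrightarrow> x \<in> prime_power l" and inv: "finv \<phi> n" and "l \<le> n"
  shows "(\<Sum>C | C \<in> UNIV // {(x, y). x - y \<in> prime_power n} \<and> (\<exists>x\<in>C. \<phi> x \<noteq> 0). \<phi> (SOME x. x \<in> C)) = qsum l n \<phi>"
proof -
  note R = reps[OF assms(3), where 'a='a]
  define g where "g r = {(x, y). x - y \<in> prime_power n} `` {r::'a}" for r
  have g: "y \<in> g r \<longleftrightarrow> r - y \<in> prime_power n" for y r by (simp add: g_def)
  have g_eq: "g r = g s" if "r - s \<in> prime_power n" for r s
    using that g pp_trans pp_diff_commute by blast
  have val: "\<phi> (SOME x. x \<in> g r) = \<phi> r" for r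
  proof -
    have "r \<in> g r" by (simp add: g)
    hence "(SOME x. x \<in> g r) \<in> g r" by (rule someI)
    thus ?thesis using finvD[OF inv] g by metis
  qed
  have "bij_betw g {r \<in> reps l n. \<phi> r \<noteq> 0} {C \<in> UNIV // {(x, y). x - y \<in> prime_power n}. \<exists>x\<in>C. \<phi> x \<noteq> 0}"
    unfolding bij_betw_def
  proof (intro conjI inj_onI equalityI subsetI)
    fix r s assume "r \<in> {r \<in> reps l n. \<phi> r \<noteq> 0}" "s \<in> {r \<in> reps l n. \<phi> r \<noteq> 0}" "g r = g s"
    moreover have "s \<in> g s" by (simp add: g)
    ultimately show "r = s" using g is_reps_unique[OF R(1)] by blast
  next
    fix C assume "C \<in> g ` {r \<in> reps l n. \<phi> r \<noteq> 0}"
    then obtain r where r: "C = g r" "\<phi> r \<noteq> 0" by blast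
    have "r \<in> g r" by (simp add: g)
    thus "C \<in> {C \<in> UNIV // {(x, y). x - y \<in> prime_power n}. \<exists>x\<in>C. \<phi> x \<noteq> 0}"
      using r \<open>r \<in> g r\<close> quotientI[of r UNIV "{(x, y). x - y \<in> prime_power n}"] unfolding g_def by blast
  next
    fix C assume C: "C \<in> {C \<in> UNIV // {(x, y). x - y \<in> prime_power n}. \<exists>x\<in>C. \<phi> x \<noteq> 0}"
    then obtain z where z: "C = g z" by (auto simp: g_def quotient_def)
    obtain x where x: "x \<in> g z" "\<phi> x \<noteq> 0" using C z by blast
    obtain r where r: "r \<in> reps l n" "x - r \<in> prime_power n" using is_reps_ex[OF R(1) supp[OF x(2)]] by blast
    have "z - r \<in> prime_power n" using x(1) r(2) g pp_trans by blast
    hence "C = g r" using g_eq z by blast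
    moreover have "\<phi> r \<noteq> 0" using finvD[OF inv r(2)] x(2) by simp
    ultimately show "C \<in> g ` {r \<in> reps l n. \<phi> r \<noteq> 0}" using r(1) by blast
  qed
  from sum.reindex_bij_betw[OF this, of "\<lambda>C. \<phi> (SOME x. x \<in> C)"]
  have "(\<Sum>C | C \<in> UNIV // {(x, y). x - y \<in> prime_power n} \<and> (\<exists>x\<in>C. \<phi> x \<noteq> 0). \<phi> (SOME x. x \<in> C)) =
    (\<Sum>r | r \<in> reps l n \<and> \<phi> r \<noteq> 0. \<phi> r)" by (simp add: val)
  also have "\<dots> = qsum l n \<phi>" unfolding qsum_def using R(2) by (intro sum.mono_neutral_left) auto
  finally show ?thesis .
qed

text \<open>Beyond level n, refining the cosets multiplies the sum of values and the denominator by
  the same power of q, so the sequence is constant from n on and \<open>lim\<close> returns its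
  value.\<close>

lemma haar_integral_eq:
  fixes \<phi> :: "'a::nonarch_local_field \<Rightarrow> complex"
  assumes supp: "\<And>x. \<phi> x \<noteq> 0 \<Longrightarrow> x \<in> prime_power l" and inv: "finv \<phi> n" and "l \<le> n"
  shows "haar_integral \<phi> = of_real (qinv TYPE('a) powi n) * qsum l n \<phi>"
proof -
  have "(\<Sum>C | C \<in> UNIV // {(x, y). x - y \<in> prime_power (int N)} \<and> (\<exists>x\<in>C. \<phi> x \<noteq> 0). \<phi> (SOME x. x \<in> C))
     / of_nat (residue_card TYPE('a)) ^ N = of_real (qinv TYPE('a) powi n) * qsum l n \<phi>" if N: "n \<le> int N" for N
  proof -
    have "(\<Sum>C | C \<in> UNIV // {(x, y). x - y \<in> prime_power (int N)} \<and> (\<exists>x\<in>C. \<phi> x \<noteq> 0). \<phi> (SOME x. x \<in> C)) = qsum l (int N) \<phi>"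
      using N assms(3) by (intro haar_coset_sum supp finv_mono[OF inv]) auto
    also have "\<dots> = of_real (qinv TYPE('a) powi (n - int N)) * qsum l n \<phi>"
      using qsum_refine[OF assms(3) N inv] .
    also have "\<dots> / of_nat (residue_card TYPE('a)) ^ N = of_real (qinv TYPE('a) powi (n - int N) * qinv TYPE('a) ^ N) * qsum l n \<phi>"
      by (simp add: residue_card_qinv field_simps)
    also have "qinv TYPE('a) powi (n - int N) * qinv TYPE('a) ^ N = qinv TYPE('a) powi n"
      using power_int_add[of "qinv TYPE('a)" "n - int N" "int N"] qinv_bounds[where 'a='a] by simp
    finally show ?thesis .
  qed
  hence "eventually (\<lambda>N. (\<Sum>C | C \<in> UNIV // {(x, y). x - y \<in> prime_power (int N)} \<and> (\<exists>x\<in>C. \<phi> x \<noteq> 0). \<phi> (SOME x. x \<in> C))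
     / of_nat (residue_card TYPE('a)) ^ N = of_real (qinv TYPE('a) powi n) * qsum l n \<phi>) sequentially"
    unfolding eventually_sequentially by (intro exI[of _ "nat n"]) auto
  thus ?thesis unfolding haar_integral_def by (intro limI tendsto_eventually)
qed

text \<open>Compactness makes local constancy uniform: a Lebesgue number for the cover of the
  support by open sets on which \<phi> is constant gives the level n, and boundedness of the support
  gives l.\<close>

lemma schwartz_level:
  fixes \<phi> :: "'a::nonarch_local_field \<Rightarrow> complex"
  assumes "schwartz \<phi>"
  shows "\<exists>l n. (\<forall>x. \<phi> x \<noteq> 0 \<longrightarrow> x \<in> prime_power l) \<and> finv \<phi> n"
proof -
  define K where "K = closure {x. \<phi> x \<noteq> 0}"
  have K: "compact K" using assms by (simp add: schwartz_def K_def)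
  have sub: "x \<in> K" if "\<phi> x \<noteq> 0" for x using that closure_subset[of "{x. \<phi> x \<noteq> 0}"] by (auto simp: K_def)
  obtain B where B: "\<And>x. x \<in> K \<Longrightarrow> dist 0 x \<le> B"
    using compact_imp_bounded[OF K] unfolding bounded_any_center[of _ 0] by blast
  obtain l where l: "\<And>x::'a. absv x \<le> B \<Longrightarrow> x \<in> prime_power l" using bounded_pp by blast
  have s: "x \<in> prime_power l" if "\<phi> x \<noteq> 0" for x
    using l B[OF sub[OF that]] by (simp add: absv_eq_dist dist_commute)
  define \<G> where "\<G> = {U. open U \<and> (\<forall>x\<in>U. \<forall>y\<in>U. \<phi> x = \<phi> y)}"
  have "K \<subseteq> \<Union>\<G>"
  proof
    fix x assume "x \<in> K"
    obtain U where U: "open U" "x \<in> U" "\<forall>y\<in>U. \<phi> y = \<phi> x" using assms unfolding schwartz_def by blast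
    have "\<forall>a\<in>U. \<forall>b\<in>U. \<phi> a = \<phi> b"
      by (intro ballI) (rule trans[OF bspec[OF U(3)] bspec[OF U(3), symmetric]])
    hence "U \<in> \<G>" unfolding \<G>_def using U(1) by blast
    thus "x \<in> \<Union>\<G>" using U(2) by blast
  qed
  moreover have "open G" if "G \<in> \<G>" for G using that unfolding \<G>_def by blast
  ultimately obtain e where e: "0 < e" "\<And>x. x \<in> K \<Longrightarrow> \<exists>G\<in>\<G>. ball x e \<subseteq> G"
    using Heine_Borel_lemma[OF K, of \<G>] by blast
  have loc: "\<phi> y = \<phi> x" if xy: "x \<in> K" "dist x y < e" for x y
  proof -
    obtain G where "G \<in> \<G>" "ball x e \<subseteq> G" using e(2)[OF xy(1)] by blast
    moreover have "x \<in> ball x e" "y \<in> ball x e" using xy(2) e(1) by auto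
    ultimately show ?thesis unfolding \<G>_def by blast
  qed
  obtain n :: nat where n: "\<forall>x\<in>prime_power (int n). absv (x::'a) < e" using ex_pp_subset_ball e(1) by blast
  have "finv \<phi> (int n)"
    unfolding finv_def
  proof (intro allI impI)
    fix x y :: 'a assume "x - y \<in> prime_power (int n)"
    hence d: "dist x y < e" "dist y x < e" using n by (auto simp: nlf_dist pp_diff_commute)
    show "\<phi> x = \<phi> y"
    proof (cases "x \<in> K \<or> y \<in> K")
      case True
      thus ?thesis using loc d by metis
    next
      case False
      thus ?thesis using sub by metis
    qed
  qed
  thus ?thesis using s by blast
qed

lemma compact_pp: "compact (prime_power l :: 'a::nonarch_local_field set)"
  unfolding compact_eq_totally_bounded
proof (intro conjI allI impI)
  show "complete (prime_power l :: 'a set)" using closed_pp complete_eq_closed by blast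
  fix e :: real assume "e > 0"
  then obtain n :: nat where n: "\<forall>x\<in>prime_power (int n). absv (x::'a) < e" using ex_pp_subset_ball by blast
  define k where "k = max l (int n)"
  have lk: "l \<le> k" by (simp add: k_def)
  have "prime_power l \<subseteq> (\<Union>x\<in>reps l k. ball x e :: 'a set)"
  proof
    fix x :: 'a assume "x \<in> prime_power l"
    then obtain r where r: "r \<in> reps l k" "x - r \<in> prime_power k" using is_reps_ex[OF reps(1)[OF lk]] by blast
    hence "x - r \<in> prime_power (int n)" using pp_mono[of "int n" k] by (simp add: k_def)
    hence "dist x r < e" using n by (simp add: nlf_dist)
    hence "dist r x < e" by (simp add: dist_commute)
    thus "x \<in> (\<Union>x\<in>reps l k. ball x e)" using r by auto
  qed
  thus "\<exists>k. finite k \<and> prime_power l \<subseteq> (\<Union>x\<in>k. ball x e :: 'a set)" using reps(2)[OF lk] by blast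
qed

text \<open>The test function, of integral 1, that pins down the Weil index in
  \<open>weil_gamma_eq\<close>.\<close>

lemma schwartz_indicator: "schwartz (\<lambda>x::'a::nonarch_local_field. if x \<in> prime_power 0 then 1 else 0)"
  unfolding schwartz_def
proof (intro conjI allI)
  have "{x::'a. (if x \<in> prime_power 0 then 1 else 0 :: complex) \<noteq> 0} = prime_power 0" by auto
  thus "compact (closure {x::'a. (if x \<in> prime_power 0 then 1 else 0 :: complex) \<noteq> 0})"
    using compact_pp[of 0, where 'a='a] closure_closed[OF closed_pp[of 0, where 'a='a]] by simp
  fix x :: 'a
  have *: "(if y \<in> prime_power 0 then 1 else 0 :: complex) = (if x \<in> prime_power 0 then 1 else 0)" if "y - x \<in> prime_power 0" for y
    using that pp_add[of "y - x" 0 x] pp_diff[of y 0 "y - x"] by auto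
  show "\<exists>U. open U \<and> x \<in> U \<and> (\<forall>y\<in>U. (if y \<in> prime_power 0 then 1 else 0 :: complex) = (if x \<in> prime_power 0 then 1 else 0))"
    by (rule exI[of _ "{y. y - x \<in> prime_power 0}"], intro conjI ballI open_pp_coset *) simp_all
qed

lemma haar_indicator: "haar_integral (\<lambda>x::'a::nonarch_local_field. if x \<in> prime_power 0 then 1 else 0) = 1"
proof -
  let ?f = "\<lambda>x::'a. if x \<in> prime_power 0 then 1 else 0 :: complex"
  have "finv ?f 0"
    unfolding finv_def
  proof (intro allI impI)
    fix x y :: 'a assume "x - y \<in> prime_power 0"
    hence "x \<in> prime_power 0 \<longleftrightarrow> y \<in> prime_power 0"
      using pp_add[of "x - y" 0 y] pp_diff[of x 0 "x - y"] by auto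
    thus "?f x = ?f y" by simp
  qed
  hence "haar_integral ?f = of_real (qinv TYPE('a) powi 0) * qsum 0 0 ?f"
    by (intro haar_integral_eq) (auto split: if_splits)
  also have "qsum 0 0 ?f = qsum 0 0 (\<lambda>_::'a. 1)" by (rule qsum_cong) auto
  finally show ?thesis by (simp add: qsum_const)
qed

section \<open>Gauss sums and the Weil index of a quadratic character\<close>

context odd_local_field
begin

text \<open>A relational form of \<open>add_cond\<close> that includes nontriviality; it passes to x
  -> \<tau> (a x) with a shift by the valuation of a, see \<open>has_cond_scale\<close>.\<close>

definition has_cond :: "('a \<Rightarrow> complex) \<Rightarrow> int \<Rightarrow> bool" where
  "has_cond \<tau> c \<longleftrightarrow> add_char \<tau> \<and> (\<forall>x\<in>prime_power c. \<tau> x = 1) \<and> (\<exists>x\<in>prime_power (c - 1). \<tau> x \<noteq> 1)"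

lemma has_cond_scale:
  assumes "has_cond \<tau> c" "a \<noteq> 0"
  shows "has_cond (\<lambda>x. \<tau> (a * x)) (c - oval a)"
proof -
  have "continuous_on UNIV (\<lambda>x. \<tau> (a * x))"
  proof -
    have "continuous_on UNIV (\<lambda>x::'a. a * x)"
      unfolding continuous_on_iff
    proof (intro ballI allI impI)
      fix x :: 'a and e :: real assume "e > 0"
      thus "\<exists>d>0. \<forall>x'\<in>UNIV. dist x' x < d \<longrightarrow> dist (a * x') (a * x) < e"
        using assms(2) by (intro exI[of _ "e / absv a"])
          (auto simp: nlf_dist nlf_absv_mult pos_less_divide_eq mult.commute[of _ "absv a"] simp flip: right_diff_distrib)
    qed
    moreover have "continuous_on UNIV \<tau>" using assms(1) by (simp add: has_cond_def add_char_def)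
    ultimately show ?thesis using continuous_on_compose2[of UNIV \<tau> UNIV "\<lambda>x. a * x"] by simp
  qed
  hence "add_char (\<lambda>x. \<tau> (a * x))"
    using assms(1) by (simp add: has_cond_def add_char_def distrib_left)
  moreover obtain z where z: "z \<in> prime_power (c - 1)" "\<tau> z \<noteq> 1" using assms(1) by (auto simp: has_cond_def)
  hence "z / a \<in> prime_power (c - oval a - 1)" "\<tau> (a * (z / a)) \<noteq> 1"
    using pp_mult_iff[OF assms(2), of "z / a" "c - 1"] assms(2) by (simp_all add: algebra_simps)
  ultimately show ?thesis using assms pp_mult_iff[OF assms(2)] unfolding has_cond_def by blast
qed

lemma chi_sq:
  assumes "has_cond \<tau> c" "x - y \<in> prime_power k" "x \<in> prime_power l" "y \<in> prime_power l" "c \<le> k + l"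
  shows "\<tau> (x\<^sup>2) = \<tau> (y\<^sup>2)"
proof -
  have "(x - y) * (x + y) \<in> prime_power (k + l)" using assms by (intro pp_mult pp_add)
  hence "\<tau> ((x - y) * (x + y)) = 1" using assms pp_mono by (auto simp: has_cond_def)
  moreover have "x\<^sup>2 = (x - y) * (x + y) + y\<^sup>2" by (simp add: power2_eq_square algebra_simps)
  ultimately show ?thesis using assms(1) by (simp add: has_cond_def add_char_add)
qed

text \<open>The cross term \<open>\<tau> (2 r t)\<close> is a character of \<open>t\<close>, so that only the \<open>r\<close> in its annihilator contribute.\<close>

lemma gauss_inner:
  assumes \<tau>: "has_cond \<tau> c" and "r \<in> prime_power l" "c \<le> k + l" "n \<le> k" "c \<le> 2 * n"
  shows "qsum n k (\<lambda>t. \<tau> ((r + t)\<^sup>2)) = (if r \<in> prime_power (c - n) then \<tau> (r\<^sup>2) * of_real (qinv TYPE('a) powi (n - k)) else 0)"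
proof -
  have "qsum n k (\<lambda>t. \<tau> ((r + t)\<^sup>2)) = qsum n k (\<lambda>t. \<tau> (r\<^sup>2) * \<tau> (2 * r * t))"
  proof (rule qsum_cong[OF assms(4)])
    fix t :: 'a assume t: "t \<in> prime_power n"
    have "t\<^sup>2 \<in> prime_power c"
      using pp_mult[OF t t] pp_mono[of c "n + n"] assms(5) by (simp add: power2_eq_square)
    hence "\<tau> (t\<^sup>2) = 1" using \<tau> by (simp add: has_cond_def)
    moreover have "(r + t)\<^sup>2 = r\<^sup>2 + (2 * r * t + t\<^sup>2)" by (simp add: power2_eq_square algebra_simps)
    ultimately show "\<tau> ((r + t)\<^sup>2) = \<tau> (r\<^sup>2) * \<tau> (2 * r * t)" using \<tau> by (simp add: has_cond_def add_char_add)
  qed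
  also have "\<dots> = \<tau> (r\<^sup>2) * qsum n k (\<lambda>t. \<tau> (2 * r * t))" by (rule qsum_mult_left)
  also have "qsum n k (\<lambda>t. \<tau> (2 * r * t)) = (if \<forall>t\<in>prime_power n. \<tau> (2 * r * t) = 1 then of_nat (residue_card TYPE('a) ^ nat (k - n)) else 0)"
  proof (rule qsum_char(1)[OF assms(4)])
    show "\<tau> (2 * r * (x + y)) = \<tau> (2 * r * x) * \<tau> (2 * r * y)" for x y
      using \<tau> by (simp add: has_cond_def add_char_add distrib_left)
    fix x :: 'a assume "x \<in> prime_power k"
    hence "2 * (r * x) \<in> prime_power c"
      using pp_mult[OF assms(2), of x k] pp_mono[of c "l + k"] assms(3) by (simp add: pp_mult2_iff add.commute)
    thus "\<tau> (2 * r * x) = 1" using \<tau> by (simp add: has_cond_def mult.assoc)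
  qed
  also have "(\<forall>t\<in>prime_power n. \<tau> (2 * r * t) = 1) \<longleftrightarrow> r \<in> prime_power (c - n)"
  proof
    assume r: "r \<in> prime_power (c - n)"
    show "\<forall>t\<in>prime_power n. \<tau> (2 * r * t) = 1"
    proof
      fix t :: 'a assume "t \<in> prime_power n"
      hence "2 * (r * t) \<in> prime_power c" using pp_mult[OF r, of t n] by (simp add: pp_mult2_iff)
      thus "\<tau> (2 * r * t) = 1" using \<tau> by (simp add: has_cond_def mult.assoc)
    qed
  next
    assume *: "\<forall>t\<in>prime_power n. \<tau> (2 * r * t) = 1"
    show "r \<in> prime_power (c - n)"
    proof (rule ccontr)
      assume "r \<notin> prime_power (c - n)"
      hence r: "r \<noteq> 0" "oval r < c - n" by (auto simp: prime_power_iff)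
      obtain z where z: "z \<in> prime_power (c - 1)" "\<tau> z \<noteq> 1" using \<tau> by (auto simp: has_cond_def)
      have e: "2 * r * (z / (2 * r)) = z" using r units_nz[OF unit_2] by simp
      have o2: "oval (2 * r) = oval r" "2 * r \<noteq> 0" using r unit_2 by (auto simp: oval_mult integer_units_iff)
      have "2 * r * (z / (2 * r)) \<in> prime_power (c - 1)" unfolding e by (rule z(1))
      hence "z / (2 * r) \<in> prime_power (c - 1 - oval r)" unfolding pp_mult_iff[OF o2(2)] o2(1) .
      hence "z / (2 * r) \<in> prime_power n" using pp_mono[of n "c - 1 - oval r"] r by simp
      thus False using * e z by metis
    qed
  qed
  finally show ?thesis using of_nat_residue_powi[OF assms(4), where 'a='a] by simp
qed

text \<open>The integral of \<tau> (y^2) over P^(c-s), where the integrand is invariant under P^s.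
  By \<open>gauss_stable\<close> it does not depend on s once c <= 2 s, so it is a regularised
  integral over the whole field.\<close>

definition gauss :: "('a \<Rightarrow> complex) \<Rightarrow> int \<Rightarrow> int \<Rightarrow> complex" where
  "gauss \<tau> c s = of_real (qinv TYPE('a) powi s) * qsum (c - s) s (\<lambda>y. \<tau> (y\<^sup>2))"

lemma chi_sq_pinv:
  assumes "has_cond \<tau> c" "c \<le> l + n"
  shows "pinv (\<lambda>y. \<tau> (y\<^sup>2)) l n"
  using chi_sq[OF assms(1), of _ _ n l] assms(2) by (simp add: pinv_def add.commute)

text \<open>Passing from the domain P^(c-s) to the larger P^(c-n) adds only classes on which the
  inner sum of \<open>gauss_inner\<close> vanishes.\<close>

lemma gauss_stable:
  assumes \<tau>: "has_cond \<tau> c" and "c \<le> 2 * s" "s \<le> n"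
  shows "gauss \<tau> c n = gauss \<tau> c s"
proof -
  have "qsum (c - n) n (\<lambda>y. \<tau> (y\<^sup>2)) = qsum (c - n) s (\<lambda>r. qsum s n (\<lambda>t. \<tau> ((r + t)\<^sup>2)))"
    using assms by (intro qsum_split chi_sq_pinv[OF \<tau>]) auto
  also have "\<dots> = qsum (c - n) s (\<lambda>r. if r \<in> prime_power (c - s) then \<tau> (r\<^sup>2) * of_real (qinv TYPE('a) powi (s - n)) else 0)"
    using assms by (intro qsum_cong gauss_inner[OF \<tau>, where l = "c - n"]) auto
  also have "\<dots> = qsum (c - s) s (\<lambda>r. \<tau> (r\<^sup>2) * of_real (qinv TYPE('a) powi (s - n)))"
    using assms by (intro qsum_restrict pinv_mult_right chi_sq_pinv[OF \<tau>]) auto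
  also have "\<dots> = of_real (qinv TYPE('a) powi (s - n)) * qsum (c - s) s (\<lambda>r. \<tau> (r\<^sup>2))"
    by (subst qsum_mult_left[symmetric]) (simp add: mult.commute)
  finally have "gauss \<tau> c n = of_real (qinv TYPE('a) powi n * qinv TYPE('a) powi (s - n)) * qsum (c - s) s (\<lambda>r. \<tau> (r\<^sup>2))"
    by (simp add: gauss_def)
  also have "qinv TYPE('a) powi n * qinv TYPE('a) powi (s - n) = qinv TYPE('a) powi s"
    using power_int_add[of "qinv TYPE('a)" n "s - n"] qinv_bounds[where 'a='a] by simp
  finally show ?thesis by (simp add: gauss_def)
qed

text \<open>The set on which the integrand lives moves with x. Since \<phi> is constant on the
  classes of P^n, summing over such a class leaves the oscillating sum of
  \<open>gauss_inner\<close>, which vanishes outside P^(c-n). The domain of integration thereby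
  becomes independent of x.\<close>

lemma weil_convolution:
  assumes \<tau>: "has_cond \<tau> c" and "c \<le> 2 * n" "l \<le> c - n"
    and supp: "\<And>x. \<phi> x \<noteq> 0 \<Longrightarrow> x \<in> prime_power l" and inv: "finv \<phi> n"
  shows "haar_integral (\<lambda>y. \<phi> (x - y) * \<tau> (y\<^sup>2)) =
    of_real (qinv TYPE('a) powi n) * qsum (c - n) n (\<lambda>y. \<tau> (y\<^sup>2) * \<phi> (x - y))"
proof -
  \<comment> \<open>P^l' contains x and the support of \<phi>, hence every y that contributes;
    \<open>k\<close> is then large enough for \<tau> (y^2) to be invariant under P^k on it.\<close>
  define l' where "l' = min l (oval x)"
  have x: "x \<in> prime_power l'" by (simp add: l'_def prime_power_iff)
  have l': "l' \<le> l" by (simp add: l'_def)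
  define k where "k = max n (c - l')"
  have k: "n \<le> k" "c \<le> k + l'" by (auto simp: k_def)
  let ?F = "\<lambda>y. \<phi> (x - y) * \<tau> (y\<^sup>2)"
  have s: "y \<in> prime_power l'" if "\<phi> (x - y) \<noteq> 0" for y
    using pp_diff[OF x pp_mono[OF l' supp[OF that]]] by simp
  have inv': "\<phi> (x - y) = \<phi> (x - z)" if "y - z \<in> prime_power n" for y z
    using that by (intro finvD[OF inv]) (simp add: pp_diff_commute[of z])
  have "finv ?F k"
    unfolding finv_def
  proof (intro allI impI)
    fix y z :: 'a assume yz: "y - z \<in> prime_power k"
    have e: "\<phi> (x - y) = \<phi> (x - z)" using inv' yz pp_mono k by blast
    show "?F y = ?F z"
    proof (cases "\<phi> (x - y) = 0")
      case False
      hence "y \<in> prime_power l'" "z \<in> prime_power l'" using s e by auto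
      thus ?thesis using chi_sq[OF \<tau> yz] k e by simp
    qed (use e in simp)
  qed
  hence "haar_integral ?F = of_real (qinv TYPE('a) powi k) * qsum l' k ?F"
    using l' k assms s by (intro haar_integral_eq) auto
  also have "qsum l' k ?F = qsum l' n (\<lambda>r. qsum n k (\<lambda>t. ?F (r + t)))"
    using l' k assms finv_pinv[OF \<open>finv ?F k\<close>] by (intro qsum_split) auto
  also have "\<dots> = qsum l' n (\<lambda>r. if r \<in> prime_power (c - n) then of_real (qinv TYPE('a) powi (n - k)) * (\<tau> (r\<^sup>2) * \<phi> (x - r)) else 0)"
  proof (rule qsum_cong)
    show "l' \<le> n" using l' assms by simp
    fix r :: 'a assume r: "r \<in> prime_power l'"
    have "qsum n k (\<lambda>t. ?F (r + t)) = qsum n k (\<lambda>t. \<phi> (x - r) * \<tau> ((r + t)\<^sup>2))"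
    proof (rule qsum_cong[OF k(1)])
      fix t :: 'a assume "t \<in> prime_power n"
      thus "?F (r + t) = \<phi> (x - r) * \<tau> ((r + t)\<^sup>2)" using inv'[of "r + t" r] by simp
    qed
    also have "\<dots> = \<phi> (x - r) * qsum n k (\<lambda>t. \<tau> ((r + t)\<^sup>2))" by (rule qsum_mult_left)
    finally show "qsum n k (\<lambda>t. ?F (r + t)) = (if r \<in> prime_power (c - n) then of_real (qinv TYPE('a) powi (n - k)) * (\<tau> (r\<^sup>2) * \<phi> (x - r)) else 0)"
      using gauss_inner[OF \<tau> r k(2,1) assms(2)] by simp
  qed
  also have "\<dots> = qsum (c - n) n (\<lambda>r. of_real (qinv TYPE('a) powi (n - k)) * (\<tau> (r\<^sup>2) * \<phi> (x - r)))"
  proof (rule qsum_restrict)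
    show "pinv (\<lambda>r. of_real (qinv TYPE('a) powi (n - k)) * (\<tau> (r\<^sup>2) * \<phi> (x - r))) (c - n) n"
      unfolding pinv_def
    proof (intro ballI impI)
      fix y z :: 'a assume "y \<in> prime_power (c - n)" "z \<in> prime_power (c - n)" "y - z \<in> prime_power n"
      hence "\<tau> (y\<^sup>2) = \<tau> (z\<^sup>2)" "\<phi> (x - y) = \<phi> (x - z)" using chi_sq[OF \<tau>, of y z n "c - n"] inv' by auto
      thus "of_real (qinv TYPE('a) powi (n - k)) * (\<tau> (y\<^sup>2) * \<phi> (x - y)) = of_real (qinv TYPE('a) powi (n - k)) * (\<tau> (z\<^sup>2) * \<phi> (x - z))"
        by simp
    qed
  qed (use l' assms in auto)
  also have "\<dots> = of_real (qinv TYPE('a) powi (n - k)) * qsum (c - n) n (\<lambda>r. \<tau> (r\<^sup>2) * \<phi> (x - r))"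
    by (rule qsum_mult_left)
  also have "of_real (qinv TYPE('a) powi k) * (of_real (qinv TYPE('a) powi (n - k)) * qsum (c - n) n (\<lambda>r. \<tau> (r\<^sup>2) * \<phi> (x - r))) =
     of_real (qinv TYPE('a) powi n) * qsum (c - n) n (\<lambda>r. \<tau> (r\<^sup>2) * \<phi> (x - r))"
  proof -
    have "of_real (qinv TYPE('a) powi k) * of_real (qinv TYPE('a) powi (n - k)) = (of_real (qinv TYPE('a) powi n) :: complex)"
      unfolding of_real_mult[symmetric] using power_int_add[of "qinv TYPE('a)" k "n - k"] qinv_bounds[where 'a='a] by simp
    thus ?thesis by (simp only: mult.assoc[symmetric])
  qed
  finally show ?thesis .
qed

text \<open>With the domain of y fixed by \<open>weil_convolution\<close>, the double sum can be
  interchanged, and translating x by y decouples the variables. The remaining factor is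
  \<open>gauss\<close> at a fine level, brought back to s by \<open>gauss_stable\<close>.\<close>

lemma weil_integral:
  assumes \<tau>: "has_cond \<tau> c" and "c \<le> 2 * s" and "schwartz \<phi>"
  shows "haar_integral (\<lambda>x. haar_integral (\<lambda>y. \<phi> (x - y) * \<tau> (y\<^sup>2))) = gauss \<tau> c s * haar_integral \<phi>"
proof -
  obtain l0 n0 where l0: "\<And>x. \<phi> x \<noteq> 0 \<Longrightarrow> x \<in> prime_power l0" and n0: "finv \<phi> n0"
    using schwartz_level[OF assms(3)] by blast
  define n where "n = max n0 s"
  define l where "l = min l0 (c - n)"
  have n: "s \<le> n" "c \<le> 2 * n" and l: "l \<le> c - n" using assms(2) by (auto simp: n_def l_def)
  have supp: "x \<in> prime_power l" if "\<phi> x \<noteq> 0" for x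
    using l0[OF that] pp_mono[of l l0] by (simp add: l_def)
  have inv: "finv \<phi> n" using finv_mono[OF n0] by (simp add: n_def)
  have cn: "c - n \<le> n" "l \<le> n" using n l by auto
  let ?a = "of_real (qinv TYPE('a) powi n) :: complex"
  let ?H = "\<lambda>x. ?a * qsum (c - n) n (\<lambda>y. \<tau> (y\<^sup>2) * \<phi> (x - y))"
  have "haar_integral (\<lambda>x. haar_integral (\<lambda>y. \<phi> (x - y) * \<tau> (y\<^sup>2))) = haar_integral ?H"
    by (simp add: weil_convolution[OF \<tau> n(2) l supp inv])
  also have "\<dots> = ?a * qsum l n ?H"
  proof (rule haar_integral_eq)
    show "finv ?H n"
      unfolding finv_def
    proof (intro allI impI)
      fix x z :: 'a assume "x - z \<in> prime_power n"
      hence "\<phi> (x - y) = \<phi> (z - y)" for y by (intro finvD[OF inv]) simp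
      thus "?H x = ?H z" by simp
    qed
    fix x :: 'a assume "?H x \<noteq> 0"
    hence "(\<Sum>y\<in>reps (c - n) n. \<tau> (y\<^sup>2) * \<phi> (x - y)) \<noteq> 0" by (auto simp: qsum_def)
    hence "\<exists>y\<in>reps (c - n) n. \<tau> (y\<^sup>2) * \<phi> (x - y) \<noteq> 0"
      by (meson sum.neutral)
    then obtain y where y: "y \<in> reps (c - n) n" "\<phi> (x - y) \<noteq> 0" by auto
    have "y \<in> prime_power l" by (rule pp_mono[OF l is_repsD[OF reps(1)[OF cn(1)] y(1)]])
    thus "x \<in> prime_power l" using pp_add[OF supp[OF y(2)], of y] by simp
  qed (use cn in auto)
  also have "qsum l n ?H = ?a * (\<Sum>y\<in>reps (c - n) n. \<tau> (y\<^sup>2) * qsum l n (\<lambda>x. \<phi> (x - y)))"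
    unfolding qsum_def sum_distrib_left[symmetric] by (subst sum.swap) (simp add: sum_distrib_left)
  also have "(\<Sum>y\<in>reps (c - n) n. \<tau> (y\<^sup>2) * qsum l n (\<lambda>x. \<phi> (x - y))) = (\<Sum>y\<in>reps (c - n) n. \<tau> (y\<^sup>2) * qsum l n \<phi>)"
  proof (rule sum.cong)
    fix y :: 'a assume "y \<in> reps (c - n) n"
    hence "- y \<in> prime_power l" using pp_mono[OF l is_repsD[OF reps(1)[OF cn(1)]]] by simp
    from qsum_shift[OF cn(2) finv_pinv[OF inv] this]
    show "\<tau> (y\<^sup>2) * qsum l n (\<lambda>x. \<phi> (x - y)) = \<tau> (y\<^sup>2) * qsum l n \<phi>" by simp
  qed simp
  also have "\<dots> = qsum (c - n) n (\<lambda>y. \<tau> (y\<^sup>2)) * qsum l n \<phi>" by (simp add: qsum_def sum_distrib_right)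
  also have "?a * (?a * (qsum (c - n) n (\<lambda>y. \<tau> (y\<^sup>2)) * qsum l n \<phi>)) = gauss \<tau> c n * (?a * qsum l n \<phi>)"
    by (simp add: gauss_def)
  also have "?a * qsum l n \<phi> = haar_integral \<phi>"
    using haar_integral_eq[OF supp inv cn(2)] by simp
  finally show ?thesis using gauss_stable[OF \<tau> assms(2) n(1)] by simp
qed

text \<open>For uniqueness, the indicator of the integers gives \<gamma> r =
  \<open>gauss \<tau> c s\<close>, and taking norms separates the positive r from \<gamma>.\<close>

lemma weil_gamma_eq:
  assumes \<tau>: "has_cond \<tau> c" and "c \<le> 2 * s" and nz: "gauss \<tau> c s \<noteq> 0"
  shows "weil_gamma \<tau> = gauss \<tau> c s / of_real (norm (gauss \<tau> c s))"
  unfolding weil_gamma_def weil_index_def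
proof (rule the_equality)
  let ?A = "gauss \<tau> c s"
  show "norm (?A / of_real (norm ?A)) = 1 \<and> (\<exists>r>0. \<forall>\<phi>. schwartz \<phi> \<longrightarrow>
     haar_integral (\<lambda>x. haar_integral (\<lambda>y. \<phi> (x - y) * \<tau> (y\<^sup>2))) = ?A / of_real (norm ?A) * of_real r * haar_integral \<phi>)"
    using nz weil_integral[OF \<tau> assms(2)] by (intro conjI exI[of _ "norm ?A"]) (auto simp: norm_divide)
  fix \<gamma> assume "norm \<gamma> = 1 \<and> (\<exists>r>0. \<forall>\<phi>. schwartz \<phi> \<longrightarrow>
     haar_integral (\<lambda>x. haar_integral (\<lambda>y. \<phi> (x - y) * \<tau> (y\<^sup>2))) = \<gamma> * of_real r * haar_integral \<phi>)"
  then obtain r where r: "norm \<gamma> = 1" "r > 0" "\<And>\<phi>. schwartz \<phi> \<Longrightarrow>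
     haar_integral (\<lambda>x. haar_integral (\<lambda>y. \<phi> (x - y) * \<tau> (y\<^sup>2))) = \<gamma> * of_real r * haar_integral \<phi>" by blast
  have "?A = \<gamma> * of_real r"
    using r(3)[OF schwartz_indicator] weil_integral[OF \<tau> assms(2) schwartz_indicator] haar_indicator[where 'a='a] by simp
  moreover from this have "norm ?A = r" using r by (simp add: norm_mult)
  ultimately show "\<gamma> = ?A / of_real (norm ?A)" using r(2) by simp
qed

lemma qsum_single: "qsum s s \<phi> = \<phi> (0::'a)" if "pinv \<phi> s s"
proof -
  have "is_reps {0::'a} s s" by (rule is_repsI) auto
  from qsum_eq[OF _ this that] show ?thesis by simp
qed

lemma gauss_even:
  assumes \<tau>: "has_cond \<tau> (2 * s)"
  shows "gauss \<tau> (2 * s) s = of_real (qinv TYPE('a) powi s)"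
proof -
  have "qsum s s (\<lambda>y. \<tau> (y\<^sup>2)) = 1"
    using \<tau> chi_sq_pinv[OF \<tau>, of s s] by (subst qsum_single) (auto simp: has_cond_def add_char_0)
  thus ?thesis by (simp add: gauss_def)
qed

lemma weil_gamma_even:
  assumes \<tau>: "has_cond \<tau> c" and "even c"
  shows "weil_gamma \<tau> = 1"
proof -
  define s where "s = c div 2"
  have c: "c = 2 * s" using assms(2) by (simp add: s_def)
  have "gauss \<tau> c s = of_real (qinv TYPE('a) powi s)" using gauss_even \<tau> unfolding c .
  moreover have "qinv TYPE('a) powi s > 0" using qinv_bounds[where 'a='a] by simp
  ultimately show ?thesis using weil_gamma_eq[OF \<tau>, of s] c qinv_bounds(3)[where 'a='a]
    by (auto simp add: norm_power_int simp del: of_real_power_int)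
qed

text \<open>The quadratic Gauss sum over the residue field, when \<phi> has conductor 1.\<close>

definition gsum :: "('a \<Rightarrow> complex) \<Rightarrow> complex" where
  "gsum \<phi> = qsum 0 1 (\<lambda>y. \<phi> (y\<^sup>2))"

text \<open>Scaling by \<pi>^(s-1) carries the residue field to P^(s-1) / P^s; the square of this
  factor is the \<pi>^(2s-2) inside \<tau>.\<close>

lemma gauss_odd:
  assumes \<tau>: "has_cond \<tau> (2 * s - 1)"
  shows "gauss \<tau> (2 * s - 1) s = of_real (qinv TYPE('a) powi s) * gsum (\<lambda>x. \<tau> (\<pi> powi (2 * s - 2) * x))"
proof -
  let ?p = "\<pi> powi (s - 1)"
  have p: "?p \<noteq> 0" "oval ?p = s - 1" by (auto simp: oval_power_int)
  have "gsum (\<lambda>x. \<tau> (\<pi> powi (2 * s - 2) * x)) = qsum 0 1 (\<lambda>y. \<tau> ((?p * y)\<^sup>2))"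
  proof -
    have "\<pi> powi (2 * s - 2) = ?p\<^sup>2"
      using power_int_mult[of \<pi> "s - 1" 2] by (simp add: algebra_simps)
    thus ?thesis by (simp add: gsum_def power_mult_distrib)
  qed
  also have "\<dots> = qsum (s - 1) s (\<lambda>y. \<tau> (y\<^sup>2))"
    using qsum_scale[OF _ p(1), of 0 1 "\<lambda>y. \<tau> (y\<^sup>2)"] chi_sq_pinv[OF \<tau>, of "s - 1" s] p by simp
  finally show ?thesis by (simp add: gauss_def)
qed

lemma sum_reps01: "(\<Sum>y\<in>reps 0 1. \<phi> y) = \<phi> (res 0) + (\<Sum>y\<in>Ured. \<phi> y)" for \<phi> :: "'a \<Rightarrow> complex"
  using reps01_eq res_0_nonunit finite_red by simp

text \<open>The sums for \<phi> and for x -> \<phi> (u x) together run twice over the whole residue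
  field, where a nontrivial character sums to 0.\<close>

lemma gsum_nonsquare:
  assumes \<phi>: "has_cond \<phi> 1" and u: "u \<in> integer_units" "\<nexists>y. u = (y::'a)\<^sup>2"
  shows "gsum (\<lambda>x. \<phi> (u * x)) = - gsum \<phi>"
proof -
  have inv: "pinv (\<lambda>x. \<psi> x) 0 1" if "has_cond \<psi> 1" for \<psi> :: "'a \<Rightarrow> complex"
    using that by (intro qsum_char(2)) (auto simp: has_cond_def add_char_add)
  have \<phi>u: "has_cond (\<lambda>x. \<phi> (u * x)) 1" using has_cond_scale[OF \<phi> units_nz[OF u(1)]] u(1) by (simp add: integer_units_iff)
  have r0: "res 0 \<in> prime_power 1" using res[of 0] by simp
  have g: "gsum \<psi> = 1 + 2 * sum \<psi> Sred" if "has_cond \<psi> 1" for \<psi> :: "'a \<Rightarrow> complex"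
  proof -
    have "(res 0)\<^sup>2 \<in> prime_power 1" using pp_mult_0[of "res 0" "res 0" 1] r0 res_pp0[of 0] by (simp add: power2_eq_square)
    thus ?thesis unfolding gsum_def qsum_def sum_reps01 using sum_squares[OF inv[OF that]] that by (simp add: has_cond_def)
  qed
  have "sum (\<lambda>x. \<phi> (u * x)) Sred = (\<Sum>s\<in>Sred. \<phi> (res (u * s)))"
  proof (rule sum.cong)
    fix s assume "s \<in> Sred"
    hence "u * s \<in> prime_power 0" using u by (auto simp: Sred_def Ured_def intro!: units_pp0 units_mult)
    thus "\<phi> (u * s) = \<phi> (res (u * s))" using res res_pp0 by (intro pinvD[OF inv[OF \<phi>]]) auto
  qed simp
  also have "\<dots> = sum \<phi> Nred" by (rule sum.reindex_bij_betw[OF nonsquare_bij[OF u]])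
  finally have "gsum \<phi> + gsum (\<lambda>x. \<phi> (u * x)) = 2 * (1 + (sum \<phi> Sred + sum \<phi> Nred))"
    using g[OF \<phi>] g[OF \<phi>u] by simp
  also have "sum \<phi> Sred + sum \<phi> Nred = sum \<phi> Ured"
  proof -
    have "Ured = Sred \<union> Nred" "Sred \<inter> Nred = {}" by (auto simp: Sred_def Nred_def)
    thus ?thesis using finite_red sum.union_disjoint by metis
  qed
  also have "1 + sum \<phi> Ured = qsum 0 1 \<phi>"
    unfolding qsum_def sum_reps01 using r0 \<phi> by (simp add: has_cond_def)
  also have "qsum 0 1 \<phi> = 0"
  proof -
    have "\<not> (\<forall>x\<in>prime_power 0. \<phi> x = 1)" using \<phi> by (auto simp: has_cond_def)
    thus ?thesis using \<phi> by (subst qsum_char) (auto simp: has_cond_def add_char_add)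
  qed
  finally show ?thesis by (simp add: add_eq_0_iff)
qed

text \<open>Substituting x + y for x turns \<phi> (x^2 - y^2) into \<phi> (x^2) \<phi> (2 x y);
  summing over y first leaves only the class x = 0.\<close>

lemma gsum_norm:
  assumes \<phi>: "has_cond \<phi> 1"
  shows "gsum \<phi> * gsum (\<lambda>x. \<phi> (- x)) = of_nat (residue_card TYPE('a))"
proof -
  have a: "\<phi> (x + y) = \<phi> x * \<phi> y" for x y using \<phi> by (simp add: has_cond_def add_char_add)
  have inv: "pinv (\<lambda>x. \<phi> (x\<^sup>2)) 0 1" using chi_sq_pinv[OF \<phi>] by simp
  have "gsum \<phi> * gsum (\<lambda>x. \<phi> (- x)) = (\<Sum>y\<in>reps 0 1. qsum 0 1 (\<lambda>x. \<phi> (x\<^sup>2)) * \<phi> (- y\<^sup>2))"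
    by (simp add: gsum_def qsum_def sum_distrib_left)
  also have "\<dots> = (\<Sum>y\<in>reps 0 1. \<Sum>x\<in>reps 0 1. \<phi> (x\<^sup>2) * \<phi> (2 * x * y))"
  proof (rule sum.cong)
    fix y :: 'a assume "y \<in> reps 0 1"
    hence "y \<in> prime_power 0" using is_repsD[OF reps(1)[of 0 1]] by simp
    from qsum_shift[OF _ inv this] have "qsum 0 1 (\<lambda>x. \<phi> (x\<^sup>2)) = qsum 0 1 (\<lambda>x. \<phi> ((x + y)\<^sup>2))" by simp
    hence "qsum 0 1 (\<lambda>x. \<phi> (x\<^sup>2)) * \<phi> (- y\<^sup>2) = (\<Sum>x\<in>reps 0 1. \<phi> ((x + y)\<^sup>2) * \<phi> (- y\<^sup>2))"
      by (simp add: qsum_def sum_distrib_right)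
    also have "\<dots> = (\<Sum>x\<in>reps 0 1. \<phi> (x\<^sup>2) * \<phi> (2 * x * y))"
      unfolding a[symmetric] by (simp add: power2_eq_square algebra_simps)
    finally show "qsum 0 1 (\<lambda>x. \<phi> (x\<^sup>2)) * \<phi> (- y\<^sup>2) = (\<Sum>x\<in>reps 0 1. \<phi> (x\<^sup>2) * \<phi> (2 * x * y))" .
  qed simp
  also have "\<dots> = (\<Sum>x\<in>reps 0 1. \<phi> (x\<^sup>2) * qsum 0 1 (\<lambda>y. \<phi> (2 * x * y)))"
    by (subst sum.swap) (simp add: qsum_def sum_distrib_left)
  also have "\<dots> = (\<Sum>x\<in>reps 0 1. if x = res 0 then of_nat (residue_card TYPE('a)) else 0)"
  proof (rule sum.cong)
    fix x :: 'a assume x: "x \<in> reps 0 1"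
    hence x0: "x \<in> prime_power 0" using is_repsD[OF reps(1)[of 0 1]] by simp
    show "\<phi> (x\<^sup>2) * qsum 0 1 (\<lambda>y. \<phi> (2 * x * y)) = (if x = res 0 then of_nat (residue_card TYPE('a)) else 0)"
    proof (cases "x \<in> integer_units")
      case True
      hence u: "2 * x \<in> integer_units" using unit_2 units_mult by blast
      hence h: "has_cond (\<lambda>y. \<phi> (2 * x * y)) 1"
        using has_cond_scale[OF \<phi> units_nz[OF u]] by (simp add: integer_units_iff)
      have "x \<noteq> res 0" using True res_unit_iff[of 0] by (auto simp: integer_units_iff)
      moreover have "qsum 0 1 (\<lambda>y. \<phi> (2 * x * y)) = 0"
      proof -
        have "\<not> (\<forall>y\<in>prime_power 0. \<phi> (2 * x * y) = 1)" using h by (auto simp: has_cond_def)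
        thus ?thesis using h by (subst qsum_char) (auto simp: has_cond_def a distrib_left)
      qed
      ultimately show ?thesis by simp
    next
      case False
      hence x1: "x \<in> prime_power 1" using x0 units_iff_pp by blast
      hence "res x = res 0" by (simp add: res_eq_iff x0)
      hence "x = res 0" using res_id[OF x] by simp
      moreover have "\<phi> (x\<^sup>2) = 1" using pp_mult_0[OF x0 x1] \<phi> by (simp add: has_cond_def power2_eq_square)
      moreover have "qsum 0 1 (\<lambda>y. \<phi> (2 * x * y)) = qsum 0 1 (\<lambda>y::'a. 1)"
      proof (rule qsum_cong)
        fix y :: 'a assume "y \<in> prime_power 0"
        hence "2 * (y * x) \<in> prime_power 1" using pp_mult_0[OF _ x1] by (simp add: pp_mult2_iff)
        thus "\<phi> (2 * x * y) = 1" using \<phi> by (simp add: has_cond_def mult_ac)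
      qed simp
      ultimately show ?thesis by (simp add: qsum_const)
    qed
  qed simp
  also have "\<dots> = of_nat (residue_card TYPE('a))"
    using reps(2)[of 0 1, where 'a='a] res[of 0] by (simp add: sum.delta')
  finally show ?thesis .
qed

lemma gsum_nz: "has_cond \<phi> 1 \<Longrightarrow> gsum \<phi> \<noteq> 0"
  using gsum_norm[of \<phi>] residue_card_ge_2[where 'a='a] by auto

lemma has_cond_pi:
  assumes "has_cond \<tau> (2 * s - 1)"
  shows "has_cond (\<lambda>x. \<tau> (\<pi> powi (2 * s - 2) * x)) 1"
  using has_cond_scale[OF assms, of "\<pi> powi (2 * s - 2)"] by (simp add: oval_power_int)

lemma weil_gamma_odd:
  assumes "has_cond \<tau> (2 * s - 1)"
  defines "\<phi> \<equiv> \<lambda>x. \<tau> (\<pi> powi (2 * s - 2) * x)"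
  shows "weil_gamma \<tau> = gsum \<phi> / of_real (norm (gsum \<phi>))"
proof -
  have q: "qinv TYPE('a) powi s > 0" using qinv_bounds[where 'a='a] by simp
  have nz: "gsum \<phi> \<noteq> 0" unfolding \<phi>_def by (rule gsum_nz[OF has_cond_pi[OF assms(1)]])
  have g: "gauss \<tau> (2 * s - 1) s = of_real (qinv TYPE('a) powi s) * gsum \<phi>"
    unfolding \<phi>_def by (rule gauss_odd[OF assms(1)])
  hence "gauss \<tau> (2 * s - 1) s \<noteq> 0" using qinv_bounds(3)[where 'a='a] nz by auto
  from weil_gamma_eq[OF assms(1) _ this] have "weil_gamma \<tau> = gauss \<tau> (2 * s - 1) s / of_real (norm (gauss \<tau> (2 * s - 1) s))" by simp
  also have "norm (gauss \<tau> (2 * s - 1) s) = qinv TYPE('a) powi s * norm (gsum \<phi>)"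
    unfolding g norm_mult norm_of_real using q by simp
  also have "gauss \<tau> (2 * s - 1) s / of_real (qinv TYPE('a) powi s * norm (gsum \<phi>)) = gsum \<phi> / of_real (norm (gsum \<phi>))"
    unfolding g of_real_mult using q by (metis mult_divide_mult_cancel_left of_real_eq_0_iff order_less_irrefl)
  finally show ?thesis .
qed

lemma gauss_nz:
  assumes \<tau>: "has_cond \<tau> c"
  obtains s where "c \<le> 2 * s" "gauss \<tau> c s \<noteq> 0"
proof (cases "even c")
  case True
  then obtain s where c: "c = 2 * s" by blast
  have "gauss \<tau> c s \<noteq> 0" using gauss_even[OF \<tau>[unfolded c]] qinv_bounds(3)[where 'a='a] by (simp add: c)
  thus ?thesis using that[of s] c by simp
next
  case False
  define s where "s = (c + 1) div 2"
  have c: "c = 2 * s - 1" using False unfolding s_def by presburger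
  have "gauss \<tau> c s \<noteq> 0"
    using gauss_odd[OF \<tau>[unfolded c]] gsum_nz[OF has_cond_pi[OF \<tau>[unfolded c]]] qinv_bounds[where 'a='a] c by simp
  thus ?thesis using that[of s] c by simp
qed

text \<open>Scaling the variable by d multiplies \<open>gauss\<close> by a positive real number,
  which disappears in the normalisation.\<close>

lemma weil_gamma_square:
  assumes \<tau>: "has_cond \<tau> c" and "d \<noteq> 0"
  shows "weil_gamma (\<lambda>x. \<tau> (d\<^sup>2 * x)) = weil_gamma \<tau>"
proof -
  obtain s where s: "c \<le> 2 * s" "gauss \<tau> c s \<noteq> 0" using gauss_nz[OF \<tau>] .
  define v where "v = oval d"
  have \<tau>': "has_cond (\<lambda>x. \<tau> (d\<^sup>2 * x)) (c - 2 * v)"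
    using has_cond_scale[OF \<tau>, of "d\<^sup>2"] assms(2) by (simp add: oval_power v_def)
  have "qsum (c - s - v) (s - v) (\<lambda>x. \<tau> ((d * x)\<^sup>2)) = qsum (c - s) s (\<lambda>x. \<tau> (x\<^sup>2))"
    using qsum_scale[OF _ assms(2), of "c - s - v" "s - v" "\<lambda>x. \<tau> (x\<^sup>2)"] s(1) chi_sq_pinv[OF \<tau>, of "c - s" s]
    by (simp add: v_def)
  hence "gauss (\<lambda>x. \<tau> (d\<^sup>2 * x)) (c - 2 * v) (s - v) = of_real (qinv TYPE('a) powi (s - v)) * qsum (c - s) s (\<lambda>x. \<tau> (x\<^sup>2))"
    by (simp add: gauss_def power_mult_distrib algebra_simps)
  also have "qinv TYPE('a) powi (s - v) = qinv TYPE('a) powi (- v) * qinv TYPE('a) powi s"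
    using power_int_add[of "qinv TYPE('a)" "- v" s] qinv_bounds[where 'a='a] by simp
  finally have g: "gauss (\<lambda>x. \<tau> (d\<^sup>2 * x)) (c - 2 * v) (s - v) = of_real (qinv TYPE('a) powi (- v)) * gauss \<tau> c s"
    by (simp add: gauss_def)
  have q: "qinv TYPE('a) powi (- v) > 0" using qinv_bounds[where 'a='a] by (simp add: power_int_minus)
  have nz: "gauss (\<lambda>x. \<tau> (d\<^sup>2 * x)) (c - 2 * v) (s - v) \<noteq> 0" unfolding g using qinv_bounds(3)[where 'a='a] s(2) by auto
  have n: "norm (gauss (\<lambda>x. \<tau> (d\<^sup>2 * x)) (c - 2 * v) (s - v)) = qinv TYPE('a) powi (- v) * norm (gauss \<tau> c s)"
    unfolding g norm_mult norm_of_real using q by simp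
  have "weil_gamma (\<lambda>x. \<tau> (d\<^sup>2 * x)) = gauss \<tau> c s / of_real (norm (gauss \<tau> c s))"
    using weil_gamma_eq[OF \<tau>' _ nz] s(1) unfolding n unfolding g of_real_mult
    using q by (metis mult_divide_mult_cancel_left of_real_eq_0_iff order_less_irrefl diff_left_mono right_diff_distrib diff_right_mono)
  thus ?thesis using weil_gamma_eq[OF \<tau> s] by simp
qed

lemma weil_gamma_unit:
  assumes \<tau>: "has_cond \<tau> c" and "odd c" and u: "u \<in> integer_units"
  shows "weil_gamma (\<lambda>x. \<tau> (u * x)) = rho u * weil_gamma \<tau>"
proof (cases "\<exists>y. u = y\<^sup>2")
  case True
  then obtain y where y: "u = y\<^sup>2" by blast
  hence "y \<noteq> 0" using units_nz[OF u] by auto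
  thus ?thesis using weil_gamma_square[OF \<tau>] True y by (auto simp: rho_def)
next
  case False
  define s where "s = (c + 1) div 2"
  have c: "c = 2 * s - 1" using assms(2) unfolding s_def by presburger
  have "has_cond (\<lambda>x. \<tau> (u * x)) (2 * s - 1)"
    using has_cond_scale[OF \<tau> units_nz[OF u]] u c by (simp add: integer_units_iff)
  note * = weil_gamma_odd[OF this] weil_gamma_odd[OF \<tau>[unfolded c]]
  have "gsum (\<lambda>x. \<tau> (u * (\<pi> powi (2 * s - 2) * x))) = - gsum (\<lambda>x. \<tau> (\<pi> powi (2 * s - 2) * x))"
    using gsum_nonsquare[OF has_cond_pi[OF \<tau>[unfolded c]] u False] by (simp add: mult.left_commute)
  thus ?thesis using False unfolding * by (simp add: rho_def)
qed

text \<open>For odd conductor the two Gauss sums multiply to q by \<open>gsum_norm\<close>, a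
  positive number; for even conductor both indices are 1.\<close>

lemma weil_gamma_uminus:
  assumes \<tau>: "has_cond \<tau> c"
  shows "weil_gamma \<tau> * weil_gamma (\<lambda>x. \<tau> (- x)) = 1"
proof -
  have \<tau>': "has_cond (\<lambda>x. \<tau> (- x)) c" using has_cond_scale[OF \<tau>, of "-1"] by simp
  show ?thesis
  proof (cases "even c")
    case True
    thus ?thesis using weil_gamma_even[OF \<tau>] weil_gamma_even[OF \<tau>'] by simp
  next
    case False
    define s where "s = (c + 1) div 2"
    have c: "c = 2 * s - 1" using False unfolding s_def by presburger
    note * = weil_gamma_odd[OF \<tau>[unfolded c]] weil_gamma_odd[OF \<tau>'[unfolded c]]
    define G G' where "G = gsum (\<lambda>x. \<tau> (\<pi> powi (2 * s - 2) * x))" and "G' = gsum (\<lambda>x. \<tau> (- (\<pi> powi (2 * s - 2) * x)))"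
    have GG: "G * G' = of_nat (residue_card TYPE('a))"
      using gsum_norm[OF has_cond_pi[OF \<tau>[unfolded c]]] by (simp add: G_def G'_def)
    hence "norm G * norm G' = real (residue_card TYPE('a))" by (metis norm_mult norm_of_nat)
    hence "of_real (norm G) * of_real (norm G') = (of_nat (residue_card TYPE('a)) :: complex)"
      by (metis of_real_mult of_real_of_nat_eq)
    moreover have "residue_card TYPE('a) \<noteq> 0" using residue_card_ge_2[where 'a='a] by simp
    ultimately have "G / of_real (norm G) * (G' / of_real (norm G')) = 1" using GG by simp
    thus ?thesis unfolding * G_def G'_def .
  qed
qed

section \<open>The Weil ratio on square classes\<close>

lemma rho_1: "rho (1::'a) = 1"
  unfolding rho_def using power_one by metis

text \<open>The character x -> \<psi> (a x) has conductor - \<epsilon> - oval a. For even conductor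
  its Weil index is 1; for odd conductor it is a normalised Gauss sum, which a unit u changes by
  \<open>rho u\<close>. So \<epsilon> decides whether the classes of units or those of \<pi> times
  units carry the Gauss sum. Accordingly \<open>\<kappa>\<close> is its value at \<pi> or the
  inverse of its value at 1, and the square of \<open>\<kappa>\<close> comes from
  \<open>weil_gamma_uminus\<close>.\<close>

lemma weil_ratio_square_class:
  assumes \<psi>: "has_cond \<psi> (- int \<epsilon>)" and \<epsilon>: "\<epsilon> \<in> {0, 1}"
  obtains \<kappa> where "\<kappa> * \<kappa> = rho (-1::'a)"
    "\<And>u d. u \<in> integer_units \<Longrightarrow> d \<noteq> 0 \<Longrightarrow> weil_ratio (u * d\<^sup>2) \<psi> = (if \<epsilon> = 0 then 1 else rho u)"
    "\<And>u d. u \<in> integer_units \<Longrightarrow> d \<noteq> 0 \<Longrightarrow> weil_ratio (\<pi> * u * d\<^sup>2) \<psi> = (if \<epsilon> = 0 then rho u else 1) * \<kappa>"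
proof -
  define G where "G a = weil_gamma (\<lambda>x. \<psi> (a * x))" for a
  have G_sq: "G (a * d\<^sup>2) = G a" if "a \<noteq> 0" "d \<noteq> 0" for a d
    using weil_gamma_square[OF has_cond_scale[OF \<psi> that(1)] that(2)] by (simp add: G_def mult_ac)
  have G_even: "G a = 1" if "a \<noteq> 0" "even (int \<epsilon> + oval a)" for a
    using weil_gamma_even[OF has_cond_scale[OF \<psi> that(1)]] that(2) by (simp add: G_def)
  have G_unit: "G (a * u) = rho u * G a" if "a \<noteq> 0" "odd (int \<epsilon> + oval a)" "u \<in> integer_units" for a u
    using weil_gamma_unit[OF has_cond_scale[OF \<psi> that(1)] _ that(3)] that(2) by (simp add: G_def mult_ac)
  have G_minus: "G a * G (- a) = 1" if "a \<noteq> 0" for a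
    using weil_gamma_uminus[OF has_cond_scale[OF \<psi> that]] by (simp add: G_def)
  have r1: "rho (-1::'a) * rho (-1::'a) = 1" using rho_cases[of "-1::'a"] by auto
  have G_two: "G a * G a = rho (-1::'a)" "G a \<noteq> 0" if "a \<noteq> 0" "odd (int \<epsilon> + oval a)" for a
  proof -
    have "G a * (rho (-1::'a) * G a) = 1" using G_minus[OF that(1)] G_unit[OF that, of "-1"] by simp
    thus "G a * G a = rho (-1::'a)" using r1 by (metis mult.left_commute mult.right_neutral)
    thus "G a \<noteq> 0" using r1 by auto
  qed
  have ratio: "weil_ratio a \<psi> = G a / G 1" for a by (simp add: weil_ratio_def G_def)
  show ?thesis
  proof (cases "\<epsilon> = 0")
    case True
    have 1: "G 1 = 1" using G_even[of 1] True by simp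
    show ?thesis
    proof (rule that[of "G \<pi>"])
      show "G \<pi> * G \<pi> = rho (-1::'a)" using G_two(1)[of \<pi>] True by simp
      fix u d :: 'a assume ud: "u \<in> integer_units" "d \<noteq> 0"
      have u: "u \<noteq> 0" "oval u = 0" using ud(1) by (auto simp: integer_units_iff)
      show "weil_ratio (u * d\<^sup>2) \<psi> = (if \<epsilon> = 0 then 1 else rho u)"
        using G_sq[OF u(1) ud(2)] G_even[OF u(1)] True 1 u by (simp add: ratio)
      show "weil_ratio (\<pi> * u * d\<^sup>2) \<psi> = (if \<epsilon> = 0 then rho u else 1) * G \<pi>"
        using G_sq[of "\<pi> * u" d] G_unit[of \<pi> u] ud u True 1 by (simp add: ratio)
    qed
  next
    case False
    hence e: "\<epsilon> = 1" using \<epsilon> by simp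
    have 1: "G 1 * G 1 = rho (-1::'a)" "G 1 \<noteq> 0" using G_two[of 1] e by auto
    show ?thesis
    proof (rule that[of "inverse (G 1)"])
      have "inverse (G 1) * inverse (G 1) = inverse (rho (-1::'a))" using 1 by (metis nonzero_inverse_mult_distrib)
      thus "inverse (G 1) * inverse (G 1) = rho (-1::'a)" using r1 by (simp add: inverse_unique)
      fix u d :: 'a assume ud: "u \<in> integer_units" "d \<noteq> 0"
      have u: "u \<noteq> 0" "oval u = 0" using ud(1) by (auto simp: integer_units_iff)
      show "weil_ratio (u * d\<^sup>2) \<psi> = (if \<epsilon> = 0 then 1 else rho u)"
        using G_sq[OF u(1) ud(2)] G_unit[of 1 u] e 1 ud by (simp add: ratio)
      show "weil_ratio (\<pi> * u * d\<^sup>2) \<psi> = (if \<epsilon> = 0 then rho u else 1) * inverse (G 1)"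
        using G_sq[of "\<pi> * u" d] G_even[of "\<pi> * u"] ud u e 1 by (simp add: ratio oval_mult divide_inverse)
    qed
  qed
qed

lemma weil_ratio_unit:
  assumes \<psi>: "has_cond \<psi> (- int \<epsilon>)" and \<epsilon>: "\<epsilon> \<in> {0, 1}" and u: "u \<in> integer_units"
  shows "weil_ratio u \<psi> = hilbert u (\<pi> ^ \<epsilon>)"
proof -
  have "weil_ratio (u * 1\<^sup>2) \<psi> = (if \<epsilon> = 0 then 1 else rho u)"
    using weil_ratio_square_class[OF \<psi> \<epsilon>] u by (metis one_neq_zero)
  thus ?thesis using \<epsilon> hilbert_unit_pi[OF u units_1] by auto
qed

text \<open>The values on square classes are compared; for two arguments of odd valuation the
  identity rests on the square of \<open>\<kappa>\<close> being \<open>rho (-1)\<close>, which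
  matches the sign in \<open>hilbert_pi_pi\<close>.\<close>

lemma weil_ratio_mult:
  assumes \<psi>: "has_cond \<psi> (- int \<epsilon>)" and \<epsilon>: "\<epsilon> \<in> {0, 1}" and "a \<noteq> 0" "b \<noteq> 0"
  shows "weil_ratio (a * b) \<psi> = weil_ratio a \<psi> * weil_ratio b \<psi> * hilbert a b"
proof -
  obtain \<kappa> where \<kappa>: "\<kappa> * \<kappa> = rho (-1::'a)"
    and w0: "\<And>u d. u \<in> integer_units \<Longrightarrow> d \<noteq> 0 \<Longrightarrow> weil_ratio (u * d\<^sup>2) \<psi> = (if \<epsilon> = 0 then 1 else rho u)"
    and w1: "\<And>u d. u \<in> integer_units \<Longrightarrow> d \<noteq> 0 \<Longrightarrow> weil_ratio (\<pi> * u * d\<^sup>2) \<psi> = (if \<epsilon> = 0 then rho u else 1) * \<kappa>"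
    using weil_ratio_square_class[OF \<psi> \<epsilon>] by metis
  obtain u d where a: "u \<in> integer_units" "d \<noteq> 0" "a = u * d\<^sup>2 \<or> a = \<pi> * u * d\<^sup>2" using square_class[OF assms(3)] by metis
  obtain v e where b: "v \<in> integer_units" "e \<noteq> 0" "b = v * e\<^sup>2 \<or> b = \<pi> * v * e\<^sup>2" using square_class[OF assms(4)] by metis
  have uv: "u * v \<in> integer_units" using a b units_mult by blast
  have e1: "u * d\<^sup>2 * (v * e\<^sup>2) = (u * v) * (d * e)\<^sup>2" "\<pi> * u * d\<^sup>2 * (v * e\<^sup>2) = \<pi> * (u * v) * (d * e)\<^sup>2"
    "u * d\<^sup>2 * (\<pi> * v * e\<^sup>2) = \<pi> * (u * v) * (d * e)\<^sup>2" "\<pi> * u * d\<^sup>2 * (\<pi> * v * e\<^sup>2) = (u * v) * (\<pi> * (d * e))\<^sup>2"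
    by (simp_all add: power2_eq_square algebra_simps)
  have de: "d * e \<noteq> 0" "\<pi> * (d * e) \<noteq> 0" using a b by auto
  have mu: "rho (- u * v) = rho (-1::'a) * rho u * rho v"
    using rho_mult[of "-1 * u" v] rho_mult[of "-1::'a" u] a b by simp
  have r: "rho x * rho x = 1" "rho x * (rho x * y) = y" for x :: 'a and y using rho_cases[of x] by auto
  have k: "\<kappa> * (\<kappa> * y) = rho (-1::'a) * y" for y using \<kappa> by (metis mult.assoc)
  show ?thesis
    using a(3) b(3)
    by (elim disjE; hypsubst;
        (simp only: e1 w0[OF uv de(1)] w0[OF uv de(2)] w1[OF uv de(1)] w0[OF a(1,2)] w0[OF b(1,2)] w1[OF a(1,2)] w1[OF b(1,2)]
          hilbert_sq_left[OF a(2)] hilbert_sq_right[OF b(2)] hilbert_units hilbert_unit_pi hilbert_pi_unit hilbert_pi_pi a(1) b(1) mu rho_mult);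
        (simp add: r k \<kappa> mult_ac)?)
qed

end

section \<open>The cocycle\<close>

lemma mat2_nth [simp]:
  "mat2 a b c d $ 1 $ 1 = a" "mat2 a b c d $ 1 $ 2 = b" "mat2 a b c d $ 2 $ 1 = c" "mat2 a b c d $ 2 $ 2 = d"
  by (simp_all add: mat2_def)

lemma mat2_eq_iff [simp]: "mat2 a b c d = mat2 a' b' c' d' \<longleftrightarrow> a = a' \<and> b = b' \<and> c = c' \<and> d = d'"
  using mat2_nth by metis

lemma mat2_expand: "g = mat2 (g$1$1) (g$1$2) (g$2$1) (g$2$2)"
  by (simp add: vec_eq_iff forall_2)

lemma mat2_cases: obtains a b c d where "g = mat2 a b c d"
  using mat2_expand by blast

lemma det_mat2: "det (mat2 a b c d) = a * d - b * c"
  by (simp add: det_2)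

lemma mat2_mult: "mat2 a b c d ** mat2 a' b' c' d' = mat2 (a * a' + b * c') (a * b' + b * d') (c * a' + d * c') (c * b' + d * d')"
  by (subst mat2_expand) (simp add: matrix_matrix_mult_def sum_2)

lemma mat_eq_mat2: "mat x = mat2 x 0 0 (x::'a::nonarch_local_field)"
  by (subst mat2_expand) (simp add: mat_def)

lemma x_fun_mat2 [simp]: "x_fun (mat2 a b c d) = (if c \<noteq> 0 then c else d)"
  by (simp add: x_fun_def)

lemma x_fun_nz: "det g = 1 \<Longrightarrow> x_fun g \<noteq> 0"
  by (cases g rule: mat2_cases) (auto simp: det_mat2)

lemma cocycle_cases: "cocycle g h = 1 \<or> cocycle g h = -1"
  unfolding cocycle_def by (rule hilbert_cases)

lemma Mp_iff: "x \<in> Mp \<longleftrightarrow> det (fst x) = 1 \<and> (snd x = 1 \<or> snd x = -1)"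
  by (cases x) (auto simp: Mp_def)

lemma Mp_mult: "x \<in> Mp \<Longrightarrow> y \<in> Mp \<Longrightarrow> x \<odot> y \<in> Mp"
  using cocycle_cases[of "fst x" "fst y"] by (auto simp: Mp_iff mp_mult_def det_mul)

context odd_local_field
begin

text \<open>Bilinear expansion of the definition. The symbol of \<open>x_fun (g ** h)\<close> with
  itself is its symbol with -1, whence the minus sign in the second factor.\<close>

lemma cocycle_hilbert:
  assumes "det g = 1" "det (h::'a^2^2) = 1"
  shows "cocycle g h = hilbert (x_fun g) (x_fun h) * hilbert (- x_fun g * x_fun h) (x_fun (g ** h))"
proof -
  have nz: "x_fun g \<noteq> 0" "x_fun h \<noteq> 0" "x_fun (g ** h) \<noteq> 0"
    using assms by (auto intro!: x_fun_nz simp: det_mul)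
  let ?a = "x_fun g" and ?b = "x_fun h" and ?c = "x_fun (g ** h)"
  have e: "- ?a * ?b = -1 * (?a * ?b)" by simp
  have "cocycle g h = hilbert ?a ?b * (hilbert ?a ?c * (hilbert ?b ?c * hilbert (-1) ?c))"
    unfolding cocycle_def divide_inverse using nz
    by (simp add: hilbert_mult_left hilbert_mult_right hilbert_inverse_left hilbert_inverse_right hilbert_self
        hilbert_sym mult_ac)
  also have "\<dots> = hilbert ?a ?b * hilbert (- ?a * ?b) ?c"
    unfolding e using nz by (subst hilbert_mult_left | simp add: mult_ac)+
  finally show ?thesis .
qed

lemma eq_if_involution: "l * r = 1 \<Longrightarrow> r * r = 1 \<Longrightarrow> l = (r::complex)"
  by (metis mult_right_cancel mult_zero_right zero_neq_one)

text \<open>The product of the two sides collapses to \<open>hilbert (\<alpha> * \<beta>) (- \<delta>)\<close>: the ratios \<open>\<alpha>\<close>, \<open>\<beta>\<close>, \<open>\<delta>\<close>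
  measure the failure of \<open>x_fun\<close> to be multiplicative.\<close>

lemma hilbert_cocycle_identity:
  assumes nz: "x1 \<noteq> 0" "x2 \<noteq> 0" "x3 \<noteq> 0" "\<alpha> \<noteq> 0" "\<beta> \<noteq> 0" "\<delta> \<noteq> (0::'a)"
    and x: "x12 = x1 * (x2 * \<alpha>)" "x23 = x2 * (x3 * \<beta>)" "x123 = x1 * (x2 * (x3 * \<delta>))"
    and st: "hilbert (\<alpha> * \<beta>) (- \<delta>) = 1"
  shows "(hilbert x1 x2 * hilbert (- x1 * x2) x12) * (hilbert x12 x3 * hilbert (- x12 * x3) x123) =
    (hilbert x1 x23 * hilbert (- x1 * x23) x123) * (hilbert x2 x3 * hilbert (- x2 * x3) x23)"
    (is "?L = ?R")
proof -
  define N :: 'a where "N = -1"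
  have N: "- x = N * x" for x by (simp add: N_def)
  have N0: "N \<noteq> 0" by (simp add: N_def)
  have s: "hilbert x y * (hilbert x y * z) = z" for x y :: 'a and z using hilbert_sq_1[of x y] by (metis mult.assoc mult_1)
  have self: "hilbert x x = hilbert N x" if "x \<noteq> 0" for x :: 'a using hilbert_self[OF that] hilbert_sym N_def by metis
  have "?L * ?R = hilbert (\<alpha> * \<beta>) (- \<delta>)"
    unfolding x mult_minus_left N using nz N0
    by (simp add: hilbert_mult_left hilbert_mult_right s mult_ac hilbert_sym
        self[OF nz(1)] self[OF nz(2)] self[OF nz(3)] self[OF nz(4)] self[OF nz(5)] self[OF nz(6)])
  hence "?L * ?R = 1" using st by simp
  moreover have "?R * ?R = 1" using s by (simp add: mult_ac)
  ultimately show ?thesis by (rule eq_if_involution)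
qed

lemma hilbert_square_cases:
  "a = c\<^sup>2 \<Longrightarrow> c \<noteq> 0 \<Longrightarrow> hilbert a b = 1" "b = c\<^sup>2 \<Longrightarrow> c \<noteq> 0 \<Longrightarrow> hilbert a (b::'a) = 1"
  using hilbert_square_left hilbert_square_right by auto

text \<open>If all three lower left entries are nonzero, the determinant of the middle matrix yields
  D = A B - 1 / c2^2, so A B c2^2 and - D c2^2 add up to 1 and the Steinberg relation applies. In
  the degenerate cases the arguments are negatives of each other up to squares (c1 = 0 or c3 = 0),
  or one of them is a square (c2 = 0, D = 0 or A B = 0).\<close>

lemma cocycle_steinberg:
  fixes g1 g2 g3 :: "'a^2^2"
  assumes det: "det g1 = 1" "det g2 = 1" "det g3 = 1"
  defines "x1 \<equiv> x_fun g1" and "x2 \<equiv> x_fun g2" and "x3 \<equiv> x_fun g3"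
    and "x12 \<equiv> x_fun (g1 ** g2)" and "x23 \<equiv> x_fun (g2 ** g3)" and "x123 \<equiv> x_fun (g1 ** g2 ** g3)"
  shows "hilbert ((x12 / (x1 * x2)) * (x23 / (x2 * x3))) (- (x123 / (x1 * x2 * x3))) = 1"
proof -
  have nz: "x1 \<noteq> 0" "x2 \<noteq> 0" "x3 \<noteq> 0" "x12 \<noteq> 0" "x23 \<noteq> 0" "x123 \<noteq> 0"
    unfolding x1_def x2_def x3_def x12_def x23_def x123_def using det by (auto intro!: x_fun_nz simp: det_mul)
  obtain a1 b1 c1 d1 where g1: "g1 = mat2 a1 b1 c1 d1" by (rule mat2_cases)
  obtain a2 b2 c2 d2 where g2: "g2 = mat2 a2 b2 c2 d2" by (rule mat2_cases)
  obtain a3 b3 c3 d3 where g3: "g3 = mat2 a3 b3 c3 d3" by (rule mat2_cases)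
  have dets: "a1 * d1 - b1 * c1 = 1" "a2 * d2 - b2 * c2 = 1" "a3 * d3 - b3 * c3 = 1"
    using det by (simp_all add: g1 g2 g3 det_mat2)
  have x1: "x1 = (if c1 \<noteq> 0 then c1 else d1)" and x2: "x2 = (if c2 \<noteq> 0 then c2 else d2)" and x3: "x3 = (if c3 \<noteq> 0 then c3 else d3)"
    by (simp_all add: x1_def x2_def x3_def g1 g2 g3)
  define c12 d12 c23 d23 where "c12 = c1 * a2 + d1 * c2" and "d12 = c1 * b2 + d1 * d2"
    and "c23 = c2 * a3 + d2 * c3" and "d23 = c2 * b3 + d2 * d3"
  have x12: "x12 = (if c12 \<noteq> 0 then c12 else d12)" and x23: "x23 = (if c23 \<noteq> 0 then c23 else d23)"
    and x123: "x123 = (if c12 * a3 + d12 * c3 \<noteq> 0 then c12 * a3 + d12 * c3 else c12 * b3 + d12 * d3)"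
    by (simp_all only: x12_def x23_def x123_def g1 g2 g3 mat2_mult x_fun_mat2 c12_def d12_def c23_def d23_def)
  show ?thesis
  proof (cases "c1 = 0")
    case True
    have "d1 \<noteq> 0" using dets(1) True by auto
    have e: "c12 = d1 * c2" "d12 = d1 * d2" "c12 * a3 + d12 * c3 = d1 * c23" "c12 * b3 + d12 * d3 = d1 * d23"
      unfolding c12_def d12_def c23_def d23_def using True by (simp_all add: algebra_simps)
    have "x12 = d1 * x2" "x123 = d1 * x23"
      using \<open>d1 \<noteq> 0\<close> unfolding x12 x123 x2 x23 e(3,4) unfolding e(1,2) by auto
    moreover have "x1 = d1" using True by (simp add: x1)
    ultimately have "(x12 / (x1 * x2)) * (x23 / (x2 * x3)) = x23 / (x2 * x3)" "x123 / (x1 * x2 * x3) = x23 / (x2 * x3)"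
      using nz by (simp_all add: field_simps)
    thus ?thesis using hilbert_minus by simp
  next
    case c1: False
    show ?thesis
    proof (cases "c3 = 0")
      case True
      have "d3 * a3 = 1" using dets(3) True by (simp add: mult.commute)
      hence d3: "d3 \<noteq> 0" "a3 = inverse d3" by (auto simp: inverse_unique)
      \<comment> \<open>An upper triangular right factor scales the two entries among which
        \<open>x_fun\<close> selects by 1 / d3 and d3. These agree up to the square of
        \<open>s\<close>, respectively \<open>s'\<close>.\<close>
      define s where "s = (if c12 \<noteq> 0 then inverse d3 else 1)"
      define s' where "s' = (if c2 \<noteq> 0 then inverse d3 else 1)"
      have s: "s \<noteq> 0" "s' \<noteq> 0" using d3 by (auto simp: s_def s'_def)
      have 1: "x123 = x12 * d3 * s\<^sup>2" unfolding x123 x12 s_def using True d3 by (auto simp: power2_eq_square)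
      have 2: "x23 = x2 * d3 * s'\<^sup>2"
        unfolding x23 x2 s'_def c23_def d23_def using True d3 by (auto simp: power2_eq_square)
      have 3: "x3 = d3" using True by (simp add: x3)
      have 4: "(x12 / (x1 * x2)) * (x23 / (x2 * x3)) = (x12 / (x1 * x2)) * s'\<^sup>2" using nz by (simp add: 2 3 d3)
      have 5: "- (x123 / (x1 * x2 * x3)) = (- (x12 / (x1 * x2))) * s\<^sup>2" using nz by (simp add: 1 3 d3)
      show ?thesis unfolding 4 5 hilbert_sq_left[OF s(2)] hilbert_sq_right[OF s(1)] by (rule hilbert_minus)
    next
      case c3: False
      show ?thesis
      proof (cases "c2 = 0")
        case True
        have "a2 * d2 = 1" using dets(2) True by simp
        hence d2: "d2 \<noteq> 0" "a2 \<noteq> 0" "d2 = inverse a2" by (auto simp: inverse_unique)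
        have "x12 = c1 * a2" "x23 = d2 * c3" using c1 c3 d2 True by (simp_all add: x12 x23 c12_def c23_def)
        hence "(x12 / (x1 * x2)) * (x23 / (x2 * x3)) = a2\<^sup>2"
          using c1 c3 d2 True by (simp add: x1 x2 x3 power2_eq_square divide_inverse)
        thus ?thesis using hilbert_square_cases(1) d2(2) by blast
      next
        case c2: False
        define A B D where "A = c12 / (c1 * c2)" and "B = c23 / (c2 * c3)" and "D = (c12 * a3 + d12 * c3) / (c1 * c2 * c3)"
        have D: "D = A * B - inverse (c2\<^sup>2)"
        proof -
          have b2: "b2 = (a2 * d2 - 1) / c2" using dets(2) c2 by (simp add: field_simps)
          show ?thesis unfolding D_def A_def B_def c12_def c23_def d12_def b2 using c1 c2 c3
            by (simp add: field_simps power2_eq_square)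
        qed
        have A1: "x12 / (x1 * x2) = A" if "A \<noteq> 0"
          using that c1 c2 by (auto simp: x12 x1 x2 A_def)
        have B1: "x23 / (x2 * x3) = B" if "B \<noteq> 0"
          using that c3 c2 by (auto simp: x23 x3 x2 B_def)
        have D1: "x123 / (x1 * x2 * x3) = D" if "D \<noteq> 0"
          using that c1 c2 c3 by (auto simp: x123 x1 x3 x2 D_def)
        have ic: "inverse c2 \<noteq> 0" using c2 by simp
        show ?thesis
        proof (cases "D = 0")
          case True
          hence AB: "A * B = (inverse c2)\<^sup>2" using D by (simp add: power_inverse)
          hence "A \<noteq> 0" "B \<noteq> 0" using ic by auto
          thus ?thesis using A1 B1 AB hilbert_square_cases(1)[OF AB ic] by simp
        next
          case D0: False
          show ?thesis
          proof (cases "A = 0 \<or> B = 0")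
            case True
            hence "- D = (inverse c2)\<^sup>2" using D by (auto simp: power_inverse)
            thus ?thesis using D1[OF D0] hilbert_square_cases(2)[OF _ ic] by metis
          next
            case False
            have "hilbert (A * B * c2\<^sup>2) (- D * c2\<^sup>2) = 1"
              by (rule hilbert_steinberg) (use c2 in \<open>simp add: D algebra_simps\<close>)
            thus ?thesis using False A1 B1 D1[OF D0] hilbert_sq_left[OF c2] hilbert_sq_right[OF c2] by metis
          qed
        qed
      qed
    qed
  qed
qed

lemma cocycle_assoc:
  fixes g1 g2 g3 :: "'a^2^2"
  assumes det: "det g1 = 1" "det g2 = 1" "det g3 = 1"
  shows "cocycle g1 g2 * cocycle (g1 ** g2) g3 = cocycle g1 (g2 ** g3) * cocycle g2 g3"
proof -
  have nz: "x_fun g1 \<noteq> 0" "x_fun g2 \<noteq> 0" "x_fun g3 \<noteq> 0" "x_fun (g1 ** g2) \<noteq> 0" "x_fun (g2 ** g3) \<noteq> 0" "x_fun (g1 ** g2 ** g3) \<noteq> 0"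
    using det by (auto intro!: x_fun_nz simp: det_mul)
  have d: "det (g1 ** g2) = 1" "det (g2 ** g3) = 1" using det by (simp_all add: det_mul)
  have "(hilbert (x_fun g1) (x_fun g2) * hilbert (- x_fun g1 * x_fun g2) (x_fun (g1 ** g2))) *
      (hilbert (x_fun (g1 ** g2)) (x_fun g3) * hilbert (- x_fun (g1 ** g2) * x_fun g3) (x_fun (g1 ** g2 ** g3))) =
     (hilbert (x_fun g1) (x_fun (g2 ** g3)) * hilbert (- x_fun g1 * x_fun (g2 ** g3)) (x_fun (g1 ** g2 ** g3))) *
     (hilbert (x_fun g2) (x_fun g3) * hilbert (- x_fun g2 * x_fun g3) (x_fun (g2 ** g3)))"
    by (rule hilbert_cocycle_identity[OF nz(1,2,3) _ _ _ _ _ _ cocycle_steinberg[OF det]])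
       (use nz in \<open>auto simp: field_simps\<close>)
  thus ?thesis using det d by (simp add: cocycle_hilbert matrix_mul_assoc)
qed

lemma mp_assoc:
  assumes "x \<in> Mp" "y \<in> Mp" "z \<in> (Mp :: 'a mp set)"
  shows "x \<odot> y \<odot> z = x \<odot> (y \<odot> z)"
proof -
  have d: "det (fst x) = 1" "det (fst y) = 1" "det (fst z) = 1" using assms by (auto simp: Mp_iff)
  have "snd x * snd y * cocycle (fst x) (fst y) * snd z * cocycle (fst x ** fst y) (fst z) =
    snd x * snd y * snd z * (cocycle (fst x) (fst y) * cocycle (fst x ** fst y) (fst z))" by simp
  also have "\<dots> = snd x * snd y * snd z * (cocycle (fst x) (fst y ** fst z) * cocycle (fst y) (fst z))"
    unfolding cocycle_assoc[OF d] ..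
  finally show ?thesis by (simp only: mp_mult_def matrix_mul_assoc fst_conv snd_conv mult_ac)
qed

lemma cocycle_n_left: "det h = 1 \<Longrightarrow> cocycle (n_mat b) (h::'a^2^2) = 1"
  using x_fun_nz[of h] by (cases h rule: mat2_cases) (auto simp: cocycle_def n_mat_def mat2_mult split: if_splits)

lemma cocycle_n_right: "det g = 1 \<Longrightarrow> cocycle (g::'a^2^2) (n_mat b) = 1"
  using x_fun_nz[of g] by (cases g rule: mat2_cases) (auto simp: cocycle_def n_mat_def mat2_mult split: if_splits)

lemma cocycle_t_left:
  assumes "det h = 1" "a \<noteq> 0"
  shows "cocycle (t_mat a) (h::'a^2^2) = hilbert a (x_fun h)"
proof -
  have nz: "x_fun h \<noteq> 0" using x_fun_nz assms by blast
  have 1: "x_fun (t_mat a) = inverse a" by (simp add: t_mat_def assms)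
  have 2: "x_fun (t_mat a ** h) = inverse a * x_fun h"
    by (cases h rule: mat2_cases) (simp add: t_mat_def mat2_mult assms)
  have "cocycle (t_mat a) h = hilbert (inverse (x_fun h)) a"
    unfolding cocycle_def 1 2 using nz assms by (simp add: field_simps)
  thus ?thesis using nz assms hilbert_inverse_left[of "x_fun h" a] hilbert_sym[of a] by metis
qed

lemma hilbert_near_1: "w - 1 \<in> prime_power 1 \<Longrightarrow> hilbert w b = 1" "w - 1 \<in> prime_power 1 \<Longrightarrow> hilbert b (w::'a) = 1"
proof -
  assume w: "w - 1 \<in> prime_power 1"
  obtain y where y: "y\<^sup>2 = w" using hensel_sqrt[OF w] by metis
  have "w \<in> integer_units" using units_add_pp[OF units_1 w] by simp
  hence "y \<noteq> 0" using y units_nz by fastforce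
  thus "hilbert w b = 1" using hilbert_square_left y by metis
  thus "hilbert b w = 1" by (simp add: hilbert_sym)
qed

end

section \<open>The splitting\<close>

locale metaplectic = odd_local_field \<pi> for \<pi> :: "'a::nonarch_local_field" +
  fixes \<epsilon> :: nat and \<psi> :: "'a \<Rightarrow> complex"
  assumes eps: "\<epsilon> \<in> {0, 1}" and psi: "has_cond \<psi> (- int \<epsilon>)"
begin

definition p :: 'a where "p = \<pi> ^ \<epsilon>"

lemma p_nz [simp]: "p \<noteq> 0" and oval_p [simp]: "oval p = int \<epsilon>"
  by (auto simp: p_def oval_power)

text \<open>The conjugate by diag(1, p) of the matrix with rows (a, b) and (c, d); it lets both
  values of \<epsilon> be treated with the same integral matrices.\<close>

definition kmat :: "'a \<Rightarrow> 'a \<Rightarrow> 'a \<Rightarrow> 'a \<Rightarrow> 'a^2^2" where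
  "kmat a b c d = mat2 a (b / p) (c * p) d"

text \<open>\<open>SL\<^sub>2(\<O>)\<close>, which is conjugate to \<open>K_grp \<epsilon> 0\<close> by \<open>kmat\<close>.\<close>

definition sl2 :: "'a \<Rightarrow> 'a \<Rightarrow> 'a \<Rightarrow> 'a \<Rightarrow> bool" where
  "sl2 a b c d \<longleftrightarrow> a \<in> prime_power 0 \<and> b \<in> prime_power 0 \<and> c \<in> prime_power 0 \<and> d \<in> prime_power 0 \<and> a * d - b * c = 1"

lemma kmat_nth [simp]: "kmat a b c d $ 1 $ 1 = a" "kmat a b c d $ 2 $ 2 = d" "kmat a b c d $ 1 $ 2 = b / p" "kmat a b c d $ 2 $ 1 = c * p"
  by (simp_all add: kmat_def)

lemma kmat_eq_iff: "kmat a b c d = kmat a' b' c' d' \<longleftrightarrow> a = a' \<and> b = b' \<and> c = c' \<and> d = d'"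
  by (simp add: kmat_def)

lemma kmat_mult: "kmat a b c d ** kmat a' b' c' d' = kmat (a * a' + b * c') (a * b' + b * d') (c * a' + d * c') (c * b' + d * d')"
  by (simp add: kmat_def mat2_mult add_divide_distrib distrib_left mult_ac)

lemma x_fun_kmat [simp]: "x_fun (kmat a b c d) = (if c \<noteq> 0 then c * p else d)"
  by (simp add: kmat_def)

lemma det_kmat [simp]: "det (kmat a b c d) = a * d - b * c"
  by (simp add: kmat_def det_mat2)

lemma kmat_in_K_iff: "kmat a b c d \<in> K_grp \<epsilon> m \<longleftrightarrow> sl2 a b c d \<and> c \<in> prime_power (int m)"
proof -
  have "b / p \<in> prime_power (- int \<epsilon>) \<longleftrightarrow> b \<in> prime_power 0"
    using pp_mult_iff[of p "b / p" 0] by simp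
  moreover have "c * p \<in> prime_power (int (m + \<epsilon>)) \<longleftrightarrow> c \<in> prime_power (int m)"
    using pp_mult_iff[of p c "int (m + \<epsilon>)"] by (simp add: mult.commute)
  ultimately show ?thesis
    using pp_mono[of 0 "int m" c] by (auto simp: K_grp_def ring_of_integers_eq sl2_def)
qed

lemma K_cases:
  assumes "k \<in> K_grp \<epsilon> m"
  obtains a b c d where "k = kmat a b c d" "sl2 a b c d" "c \<in> prime_power (int m)"
proof -
  have "k = kmat (k$1$1) (k$1$2 * p) (k$2$1 / p) (k$2$2)"
    by (subst mat2_expand) (simp add: kmat_def)
  thus ?thesis using that kmat_in_K_iff assms by metis
qed

lemma K_det: "k \<in> K_grp \<epsilon> m \<Longrightarrow> det k = (1::'a)"
  by (simp add: K_grp_def)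

lemma sl2_mult: "sl2 a b c d \<Longrightarrow> sl2 a' b' c' d' \<Longrightarrow> sl2 (a * a' + b * c') (a * b' + b * d') (c * a' + d * c') (c * b' + d * d')"
proof -
  assume *: "sl2 a b c d" "sl2 a' b' c' d'"
  have "(a * a' + b * c') * (c * b' + d * d') - (a * b' + b * d') * (c * a' + d * c') = (a * d - b * c) * (a' * d' - b' * c')"
    by (simp add: algebra_simps)
  also have "\<dots> = 1" using * by (simp add: sl2_def)
  finally show ?thesis using * unfolding sl2_def by (intro conjI pp_add pp_mult_0) auto
qed

lemma K_mult: "k \<in> K_grp \<epsilon> m \<Longrightarrow> l \<in> K_grp \<epsilon> m \<Longrightarrow> k ** l \<in> (K_grp \<epsilon> m :: ('a^2^2) set)"
proof -
  assume "k \<in> K_grp \<epsilon> m" "l \<in> K_grp \<epsilon> m"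
  then obtain a b c d a' b' c' d' where k: "k = kmat a b c d" "sl2 a b c d" "c \<in> prime_power (int m)"
    and l: "l = kmat a' b' c' d'" "sl2 a' b' c' d'" "c' \<in> prime_power (int m)" by (metis K_cases)
  have "c * a' + d * c' \<in> prime_power (int m)"
    using k l pp_mult_0[of a' c "int m"] pp_mult_0[of d c' "int m"] by (intro pp_add) (auto simp: sl2_def mult.commute)
  thus ?thesis unfolding k(1) l(1) kmat_mult kmat_in_K_iff using sl2_mult k l by blast
qed

lemma K_subset: "k \<in> K_grp \<epsilon> m \<Longrightarrow> k \<in> (K_grp \<epsilon> 0 :: ('a^2^2) set)"
  by (metis K_cases kmat_in_K_iff sl2_def of_nat_0)

lemma sl2_n: "b \<in> prime_power 0 \<Longrightarrow> sl2 1 b 0 1" by (simp add: sl2_def)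
lemma sl2_t: "u \<in> integer_units \<Longrightarrow> sl2 u 0 0 (inverse u)"
  using units_nz[of u] units_pp0[of u] units_pp0[of "inverse u"] by (simp add: sl2_def)
lemma sl2_w: "sl2 0 1 (-1) 0" by (simp add: sl2_def)

lemma n_mat_kmat: "n_mat b = kmat 1 (b * p) 0 1" by (simp add: n_mat_def kmat_def)
lemma kmat_n: "kmat 1 b 0 1 = n_mat (b / p)" by (simp add: n_mat_def kmat_def)
lemma t_mat_kmat: "t_mat a = kmat a 0 0 (inverse a)" by (simp add: t_mat_def kmat_def)
lemma nop_mat_kmat: "nop_mat c = kmat 1 0 (c / p) 1" by (simp add: nop_mat_def kmat_def)
lemma w_mat_kmat: "w_mat ** t_mat (\<pi> ^ \<epsilon>) = kmat 0 1 (-1) 0"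
  by (simp add: w_mat_def t_mat_def kmat_def mat2_mult inverse_eq_divide flip: p_def)
lemma mat_1_kmat: "mat 1 = kmat 1 0 0 1" by (simp add: mat_eq_mat2 kmat_def)

text \<open>Bruhat decomposition over the integers. If c is a unit, the matrix is a product n t w n
  with explicit factors. Otherwise a is a unit, w moves it to the lower left corner, and the sign
  w^2 = -1 is undone by the torus. Multiplicativity and uniqueness of the splitting are both checked
  on these generators.\<close>

lemma K_induct [consumes 1, case_names n t w mult]:
  assumes k: "k \<in> K_grp \<epsilon> 0"
    and n: "\<And>b. b \<in> prime_power 0 \<Longrightarrow> P (kmat 1 b 0 1)"
    and t: "\<And>u. u \<in> integer_units \<Longrightarrow> P (kmat u 0 0 (inverse u))"
    and w: "P (kmat 0 1 (-1) 0)"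
    and mult: "\<And>k l. k \<in> K_grp \<epsilon> 0 \<Longrightarrow> l \<in> K_grp \<epsilon> 0 \<Longrightarrow> P k \<Longrightarrow> P l \<Longrightarrow> P (k ** l)"
  shows "P (k::'a^2^2)"
proof -
  have K: "kmat a b c d \<in> K_grp \<epsilon> 0 \<longleftrightarrow> sl2 a b c d" for a b c d by (auto simp: kmat_in_K_iff sl2_def)
  have big: "P (kmat a b c d)" if s: "sl2 a b c d" and c: "c \<in> integer_units" for a b c d
  proof -
    have c0: "c \<noteq> 0" using units_nz c by blast
    have ic: "inverse c \<in> prime_power 0" "- inverse c \<in> integer_units" using c units_pp0[of "inverse c"] by auto
    have n1: "inverse c * a \<in> prime_power 0" "inverse c * d \<in> prime_power 0"
      using s ic by (auto simp: sl2_def intro: pp_mult_0)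
    have e1: "kmat 0 1 (-1) 0 ** kmat 1 (inverse c * d) 0 1 = kmat 0 1 (-1) (- (inverse c * d))" by (simp add: kmat_mult)
    have e2: "kmat (- inverse c) 0 0 (inverse (- inverse c)) ** kmat 0 1 (-1) (- (inverse c * d)) = kmat 0 (- inverse c) c d"
      using c0 by (simp add: kmat_mult kmat_eq_iff flip: mult.assoc)
    have e3: "kmat 1 (inverse c * a) 0 1 ** kmat 0 (- inverse c) c d = kmat a b c d"
      using c0 s by (simp add: kmat_mult kmat_eq_iff sl2_def field_simps)
    have s1: "sl2 0 1 (-1) (- (inverse c * d))" using n1 by (simp add: sl2_def)
    have s2: "sl2 0 (- inverse c) c d" using s ic c0 by (simp add: sl2_def)
    have "P (kmat 0 1 (-1) (- (inverse c * d)))"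
      unfolding e1[symmetric] using n1 sl2_w sl2_n by (intro mult w n) (auto simp: K)
    hence "P (kmat 0 (- inverse c) c d)"
      unfolding e2[symmetric] using ic s1 sl2_t[OF ic(2)] by (intro mult t) (auto simp: K)
    thus ?thesis unfolding e3[symmetric] using n1 s2 sl2_n by (intro mult n) (auto simp: K)
  qed
  obtain a b c d where k: "k = kmat a b c d" "sl2 a b c d" using K_cases[OF k] by metis
  show ?thesis
  proof (cases "c \<in> integer_units")
    case True
    thus ?thesis using big k by blast
  next
    case False
    hence "c \<in> prime_power 1" using k by (auto simp: sl2_def units_iff_pp)
    hence "b * c \<in> prime_power 1" using k by (auto simp: sl2_def intro: pp_mult_0)
    hence "1 + b * c \<in> integer_units" using units_add_pp[OF units_1] by blast
    moreover have "a * d = 1 + b * c" using k by (simp add: sl2_def algebra_simps)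
    ultimately have a: "a \<in> integer_units" using k units_mult_iff[of a d] by (simp add: sl2_def)
    have s: "sl2 c d (- a) (- b)" using k by (simp add: sl2_def algebra_simps)
    hence 1: "P (kmat c d (- a) (- b))" using big a by simp
    have s2: "sl2 (-a) (-b) (-c) (-d)" using k by (simp add: sl2_def)
    have "kmat 0 1 (-1) 0 ** kmat c d (- a) (- b) = kmat (-a) (-b) (-c) (-d)" by (simp add: kmat_mult)
    hence 2: "P (kmat (-a) (-b) (-c) (-d))" using mult[OF _ _ w 1] K s sl2_w by simp
    have "kmat (-1) 0 0 (inverse (-1)) ** kmat (-a) (-b) (-c) (-d) = kmat a b c d" by (simp add: kmat_mult)
    thus ?thesis using mult[OF _ _ t[of "-1"] 2] K s2 sl2_t[of "-1"] k by simp
  qed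
qed

text \<open>The splitting as a function of the bottom row \<open>(c * p, d)\<close>; it is forced by
  \<open>n(b/d) t(1/d) n\<^sup>o\<^sup>p(c/d)\<close> if \<open>d\<close> is a unit, and by invariance under \<open>n(b)\<close> from the right otherwise.\<close>

definition sg :: "'a \<Rightarrow> 'a \<Rightarrow> complex" where
  "sg c d = (if d \<in> integer_units then hilbert d (if c = 0 then p else c) else 1)"

definition spl :: "'a^2^2 \<Rightarrow> complex" where
  "spl k = (if k \<in> K_grp \<epsilon> 0 then sg (k$2$1 / p) (k$2$2) else 1)"

lemma spl_kmat: "sl2 a b c d \<Longrightarrow> spl (kmat a b c d) = sg c d"
  using kmat_in_K_iff[of a b c d 0] by (auto simp: spl_def sl2_def)

lemma sg_cases: "sg c d = 1 \<or> sg c d = -1"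
  using hilbert_cases by (auto simp: sg_def)

lemma spl_cases: "spl k = 1 \<or> spl k = -1"
  using sg_cases by (auto simp: spl_def)

lemma spl_K_mp: "k \<in> K_grp \<epsilon> 0 \<Longrightarrow> (k, spl k) \<in> Mp"
  using spl_cases by (auto simp: Mp_iff K_det)

text \<open>The torus case of \<open>spl_mult\<close>. If d is not a unit, the determinant forces c
  to be one; then the two symbols of u and \<open>p\<close> cancel and that of u and c is 1.\<close>

lemma spl_t_left:
  assumes u: "u \<in> integer_units" and s: "sl2 a b c d"
  shows "sg (inverse u * c) (inverse u * d) = hilbert u p * sg c d * hilbert u (x_fun (kmat a b c d))"
proof -
  have u0: "u \<noteq> 0" using units_nz u by blast
  have d_iff: "inverse u * d \<in> integer_units \<longleftrightarrow> d \<in> integer_units"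
    using s u units_mult_iff[of "inverse u" d] units_pp0[of "inverse u"] by (simp add: sl2_def)
  have h2: "hilbert x y * (hilbert x y * z) = z" for x y :: 'a and z
    using hilbert_sq_1[of x y] by (metis mult.assoc mult_1)
  show ?thesis
  proof (cases "c = 0")
    case True
    have "a * d = 1" using True s by (simp add: sl2_def)
    hence d: "d \<in> integer_units" using s units_mult_iff[of a d] by (simp add: sl2_def)
    hence d0: "d \<noteq> 0" using units_nz by blast
    have "sg (inverse u * c) (inverse u * d) = hilbert (inverse u * d) p" using True d d_iff by (simp add: sg_def)
    also have "\<dots> = hilbert u p * hilbert d p" using u0 d0 by (simp add: hilbert_mult_left hilbert_inverse_left)
    finally show ?thesis using True d u by (simp add: sg_def hilbert_units)
  next
    case c: False
    have x: "hilbert u (x_fun (kmat a b c d)) = hilbert u c * hilbert u p" using c u0 by (simp add: hilbert_mult_right)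
    show ?thesis
    proof (cases "d \<in> integer_units")
      case True
      hence d0: "d \<noteq> 0" using units_nz by blast
      have "sg (inverse u * c) (inverse u * d) = hilbert (inverse u * d) (inverse u * c)" using True c u0 d_iff by (simp add: sg_def)
      also have "\<dots> = hilbert u c * hilbert d c"
        using u0 d0 c u True by (simp add: hilbert_mult_left hilbert_mult_right hilbert_inverse_left hilbert_inverse_right hilbert_units)
      finally show ?thesis unfolding x using True c h2 by (simp add: sg_def mult_ac)
    next
      case False
      hence "d \<in> prime_power 1" using s by (auto simp: sl2_def units_iff_pp)
      hence "a * d - 1 \<notin> prime_power 1" using s pp_mult_0[of a d 1] pp_diff[of "a * d" 1 "a * d - 1"] by (auto simp: sl2_def)
      moreover have "a * d - 1 = b * c" using s by (simp add: sl2_def algebra_simps)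
      ultimately have "c \<in> integer_units" using s pp_mult_0[of b c 1] by (auto simp: sl2_def units_iff_pp)
      thus ?thesis unfolding x using False d_iff u by (simp add: sg_def hilbert_units)
    qed
  qed
qed

text \<open>The case of the factor w in \<open>spl_mult\<close>. With a and c nonzero the cocycle is
  the symbol of a and c. If b and d are units, the Steinberg relation for a d + (- b c) = 1 expands
  to the required identity. If d or b lies in P^1, then - b c or a d, respectively, is congruent to
  1 and hence a square.\<close>

lemma spl_w_left:
  assumes s: "sl2 a b c d"
  shows "sg (- a) (- b) = sg c d * cocycle (kmat 0 1 (-1) 0) (kmat a b c d)"
proof -
  have int: "a \<in> prime_power 0" "b \<in> prime_power 0" "c \<in> prime_power 0" "d \<in> prime_power 0" and det: "a * d - b * c = 1"
    using s by (auto simp: sl2_def)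
  have ad: "a * d = 1 + b * c" using det by (simp add: algebra_simps)
  define N :: 'a where "N = -1"
  have N: "- x = N * x" for x by (simp add: N_def)
  have N0: "N \<noteq> 0" "N \<in> integer_units" by (simp_all add: N_def)
  have self: "hilbert x x = hilbert N x" if "x \<noteq> 0" for x :: 'a using hilbert_self[OF that] hilbert_sym N_def by metis
  have h2: "hilbert x y * (hilbert x y * z) = z" for x y :: 'a and z
    using hilbert_sq_1[of x y] by (metis mult.assoc mult_1)
  have uu: "hilbert x y = 1" if "x \<in> integer_units" "y \<in> integer_units" for x y :: 'a using hilbert_units that .
  have "cocycle (kmat 0 1 (-1) 0) (kmat a b c d) =
     hilbert (- p) (x_fun (kmat a b c d)) * hilbert (p * x_fun (kmat a b c d)) (x_fun (kmat c d (- a) (- b)))"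
    by (subst cocycle_hilbert) (simp_all add: det kmat_mult)
  note coc = this
  show ?thesis
  proof (cases "a = 0")
    case True
    hence bc: "- b * c = 1" using det by simp
    have b0: "b \<noteq> 0" and c0: "c \<noteq> 0" using bc by auto
    have "b * c \<in> integer_units" using bc units_uminus[of "b * c"] by simp
    hence u: "b \<in> integer_units" "c \<in> integer_units" using int units_mult_iff by blast+
    have c: "c = inverse (- b)" using inverse_unique[OF bc] by simp
    have "cocycle (kmat 0 1 (-1) 0) (kmat a b c d) = hilbert (- p) (c * p) * hilbert (p * (c * p)) (- b)"
      unfolding coc using True c0 by simp
    also have "\<dots> = hilbert c p"
      unfolding N using c0 b0 N0 u by (simp add: hilbert_mult_left hilbert_mult_right self[of p] hilbert_sym mult_ac h2 uu)
    also have "\<dots> = hilbert (- b) p" unfolding c using b0 by (intro hilbert_inverse_left) auto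
    finally have 1: "cocycle (kmat 0 1 (-1) 0) (kmat a b c d) = hilbert (- b) p" .
    have "sg c d = 1" using u c0 uu by (simp add: sg_def)
    moreover have "sg (- a) (- b) = hilbert (- b) p" using True u by (simp add: sg_def)
    ultimately show ?thesis using 1 by simp
  next
    case a0: False
    show ?thesis
    proof (cases "c = 0")
      case True
      hence "a * d = 1" using det by simp
      hence u: "a \<in> integer_units" "d \<in> integer_units" using int units_mult_iff[of a d] by auto
      have d: "d = inverse a" using \<open>a * d = 1\<close> by (simp add: inverse_unique)
      have d0: "d \<noteq> 0" using u units_nz by blast
      have "cocycle (kmat 0 1 (-1) 0) (kmat a b c d) = hilbert (- p) d * hilbert (p * d) (- a * p)"
        unfolding coc using True a0 by simp
      also have "\<dots> = hilbert a p"
        unfolding mult_minus_left N using a0 d0 N0 u by (simp add: hilbert_mult_left hilbert_mult_right self[of p] hilbert_sym mult_ac h2 uu)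
      also have "\<dots> = hilbert d p" unfolding d using a0 by (intro hilbert_inverse_left[symmetric]) auto
      finally have "sg c d * cocycle (kmat 0 1 (-1) 0) (kmat a b c d) = 1" using True u by (simp add: sg_def)
      moreover have "sg (- a) (- b) = 1" using a0 u uu by (simp add: sg_def)
      ultimately show ?thesis by simp
    next
      case c0: False
      have 1: "cocycle (kmat 0 1 (-1) 0) (kmat a b c d) = hilbert a c"
      proof -
        have "cocycle (kmat 0 1 (-1) 0) (kmat a b c d) = hilbert (- p) (c * p) * hilbert (p * (c * p)) (- a * p)"
          unfolding coc using c0 a0 by simp
        also have "\<dots> = hilbert a c"
          unfolding mult_minus_left N using a0 c0 N0 by (simp add: hilbert_mult_left hilbert_mult_right self[of p] hilbert_sym mult_ac h2)
        finally show ?thesis .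
      qed
      show ?thesis
      proof (cases "b \<in> integer_units")
        case b: True
        hence b0: "b \<noteq> 0" using units_nz by blast
        have "hilbert (- b) (-1 * a) = hilbert (- b) (-1) * hilbert (- b) a"
          using a0 b0 by (intro hilbert_mult_right) auto
        hence lhs: "sg (- a) (- b) = hilbert (- b) a" using b a0 uu[of "- b" "-1"] by (simp add: sg_def)
        show ?thesis
        proof (cases "d \<in> integer_units")
          case d: True
          hence d0: "d \<noteq> 0" using units_nz by blast
          have "hilbert (a * d) (- b * c) = 1" by (rule hilbert_steinberg) (simp add: ad)
          also have "hilbert (a * d) (- b * c) = hilbert a (- b) * hilbert a c * (hilbert d (- b) * hilbert d c)"
            using a0 b0 c0 d0 hilbert_mult_right[of a "- b" c] hilbert_mult_right[of d "- b" c] hilbert_mult_left[of a d "- b * c"]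
            by (simp only: neg_equal_0_iff_equal mult_eq_0_iff not_False_eq_True de_Morgan_disj simp_thms mult_ac)
          finally have "hilbert (- b) a * (hilbert d c * hilbert a c) = 1"
            using uu[OF d, of "- b"] b by (simp add: mult_ac hilbert_sym[of a])
          moreover have "(hilbert d c * hilbert a c) * (hilbert d c * hilbert a c) = 1" using h2 by (simp add: mult_ac)
          ultimately show ?thesis unfolding lhs 1 using d c0 by (simp add: sg_def eq_if_involution)
        next
          case False
          hence "d \<in> prime_power 1" using int units_iff_pp by blast
          hence "a * d \<in> prime_power 1" using int pp_mult_0 by blast
          hence "- (a * d) \<in> prime_power 1" by (simp only: pp_uminus)
          moreover have "- (a * d) = - b * c - 1" unfolding ad by simp
          ultimately have "- b * c - 1 \<in> prime_power 1" by (simp only:)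
          from hilbert_near_1(2)[OF this, of a] have "hilbert a (- b) * hilbert a c = 1"
            using a0 b0 c0 hilbert_mult_right[of a "- b" c] by simp
          hence "hilbert (- b) a = hilbert a c" unfolding hilbert_sym[of "- b"] by (rule eq_if_involution) simp
          thus ?thesis unfolding lhs 1 using False by (simp add: sg_def)
        qed
      next
        case False
        hence "b \<in> prime_power 1" using int units_iff_pp by blast
        hence bc: "a * d - 1 \<in> prime_power 1" unfolding ad using int pp_mult_0[of c b 1] by (simp add: mult.commute)
        hence "a * d \<in> integer_units" using units_add_pp[OF units_1 bc] by simp
        hence u: "a \<in> integer_units" "d \<in> integer_units" using int units_mult_iff by blast+
        have "hilbert d c * hilbert a c = 1"
          using hilbert_near_1(1)[OF bc, of c] a0 c0 units_nz[OF u(2)] by (simp add: hilbert_mult_left mult.commute)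
        thus ?thesis unfolding 1 using False u c0 by (simp add: sg_def)
      qed
    qed
  qed
qed

text \<open>Induction on the left factor over the generators. The right factor stays universally
  quantified because the product step applies the hypotheses to both \<open>k2 ** l\<close> and
  \<open>l\<close>, after which \<open>cocycle_assoc\<close> closes it.\<close>

lemma spl_mult:
  assumes k: "k \<in> K_grp \<epsilon> 0" and l: "l \<in> K_grp \<epsilon> 0"
  shows "spl (k ** l) = spl k * spl l * cocycle k (l::'a^2^2)"
proof -
  have "\<forall>l\<in>K_grp \<epsilon> 0. spl (k ** l) = spl k * spl l * cocycle k l"
    using k
  proof (induction k rule: K_induct)
    case (n b)
    show ?case
    proof
      fix l :: "'a^2^2" assume l: "l \<in> K_grp \<epsilon> 0"
      then obtain a' b' c' d' where l': "l = kmat a' b' c' d'" "sl2 a' b' c' d'" using K_cases by metis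
      have "cocycle (kmat 1 b 0 1) l = 1" unfolding kmat_n using K_det[OF l] by (rule cocycle_n_left)
      thus "spl (kmat 1 b 0 1 ** l) = spl (kmat 1 b 0 1) * spl l * cocycle (kmat 1 b 0 1) l"
        using spl_kmat[OF l'(2)] spl_kmat[OF sl2_n[OF n]] spl_kmat[OF sl2_mult[OF sl2_n[OF n] l'(2)]]
          hilbert_1_left by (simp add: l'(1) kmat_mult sg_def)
    qed
  next
    case (t u)
    show ?case
    proof
      fix l :: "'a^2^2" assume l: "l \<in> K_grp \<epsilon> 0"
      then obtain a' b' c' d' where l': "l = kmat a' b' c' d'" "sl2 a' b' c' d'" using K_cases by metis
      have u0: "u \<noteq> 0" using units_nz t by blast
      have "cocycle (kmat u 0 0 (inverse u)) l = hilbert u (x_fun l)"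
        unfolding t_mat_kmat[symmetric] using K_det[OF l] u0 by (rule cocycle_t_left)
      moreover have "spl (kmat u 0 0 (inverse u)) = hilbert u p"
        using spl_kmat[OF sl2_t[OF t]] t u0 by (simp add: sg_def hilbert_inverse_left)
      moreover have "spl (kmat u 0 0 (inverse u) ** l) = sg (inverse u * c') (inverse u * d')"
        using spl_kmat[OF sl2_mult[OF sl2_t[OF t] l'(2)]] by (simp add: l'(1) kmat_mult)
      ultimately show "spl (kmat u 0 0 (inverse u) ** l) = spl (kmat u 0 0 (inverse u)) * spl l * cocycle (kmat u 0 0 (inverse u)) l"
        using spl_t_left[OF t l'(2)] spl_kmat[OF l'(2)] l'(1) by simp
    qed
  next
    case w
    show ?case
    proof
      fix l :: "'a^2^2" assume l: "l \<in> K_grp \<epsilon> 0"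
      then obtain a' b' c' d' where l': "l = kmat a' b' c' d'" "sl2 a' b' c' d'" using K_cases by metis
      have "spl (kmat 0 1 (- 1) 0) = 1" using spl_kmat[OF sl2_w] by (simp add: sg_def integer_units_iff)
      moreover have "spl (kmat 0 1 (- 1) 0 ** l) = sg (- a') (- b')"
        using spl_kmat[OF sl2_mult[OF sl2_w l'(2)]] by (simp add: l'(1) kmat_mult)
      ultimately show "spl (kmat 0 1 (- 1) 0 ** l) = spl (kmat 0 1 (- 1) 0) * spl l * cocycle (kmat 0 1 (- 1) 0) l"
        using spl_w_left[OF l'(2)] spl_kmat[OF l'(2)] l'(1) by simp
    qed
  next
    case (mult k1 k2)
    show ?case
    proof
      fix l :: "'a^2^2" assume l: "l \<in> K_grp \<epsilon> 0"
      have "spl (k1 ** k2 ** l) = spl (k1 ** (k2 ** l))" by (simp add: matrix_mul_assoc)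
      also have "\<dots> = spl k1 * (spl k2 * spl l * cocycle k2 l) * cocycle k1 (k2 ** l)"
        using mult l K_mult[OF mult(2) l] by simp
      also have "\<dots> = spl k1 * spl k2 * spl l * (cocycle k1 (k2 ** l) * cocycle k2 l)" by simp
      also have "\<dots> = spl k1 * spl k2 * spl l * (cocycle k1 k2 * cocycle (k1 ** k2) l)"
        using cocycle_assoc[of k1 k2 l] K_det mult(1,2) l by metis
      also have "\<dots> = spl (k1 ** k2) * spl l * cocycle (k1 ** k2) l"
        using mult by simp
      finally show "spl (k1 ** k2 ** l) = spl (k1 ** k2) * spl l * cocycle (k1 ** k2) l" .
    qed
  qed
  thus ?thesis using l by blast
qed

lemma spl_mp_mult: "k \<in> K_grp \<epsilon> 0 \<Longrightarrow> l \<in> K_grp \<epsilon> 0 \<Longrightarrow> (k, spl k) \<odot> (l, spl l) = (k ** l, spl (k ** l))"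
  by (simp add: mp_mult_def spl_mult)

text \<open>A solution of the description is multiplicative up to the cocycle and prescribed on n, t
  and w, so \<open>K_induct\<close> determines it on the compact group; the convention fixes it
  outside. The prescribed torus value agrees with \<open>sg\<close> by
  \<open>weil_ratio_unit\<close>.\<close>

theorem splitting_eq: "splitting \<epsilon> \<psi> \<pi> = spl"
  unfolding splitting_def
proof (rule the_equality, intro conjI ballI allI impI)
  show "spl k \<in> {1, -1}" for k using spl_cases by auto
  show "spl k = 1" if "k \<notin> K_grp \<epsilon> 0" for k using that by (simp add: spl_def)
  show "(k, spl k) \<odot> (l, spl l) = (k ** l, spl (k ** l))" if "k \<in> K_grp \<epsilon> 0" "l \<in> K_grp \<epsilon> 0" for k l
    using that by (rule spl_mp_mult)
  show "spl (n_mat b) = 1" if "b \<in> prime_power (- int \<epsilon>)" for b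
  proof -
    have "b * p \<in> prime_power 0" using that pp_mult_iff[of p b 0] by (simp add: mult.commute)
    thus ?thesis unfolding n_mat_kmat by (subst spl_kmat[OF sl2_n]) (auto simp: sg_def)
  qed
  show "spl (t_mat a) = weil_ratio a \<psi>" if "a \<in> integer_units" for a
    unfolding t_mat_kmat using spl_kmat[OF sl2_t[OF that]] that units_nz[OF that] weil_ratio_unit[OF psi eps that]
    by (simp add: sg_def hilbert_inverse_left p_def)
  show "spl (nop_mat c) = 1" if "c \<in> prime_power (int \<epsilon>)" for c
  proof -
    have "p * (c / p) \<in> prime_power (int \<epsilon>)" using that by simp
    hence "c / p \<in> prime_power 0" using pp_mult_iff[of p "c / p" "int \<epsilon>"] by simp
    hence "sl2 1 0 (c / p) 1" by (simp add: sl2_def)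
    thus ?thesis unfolding nop_mat_kmat using spl_kmat by (simp add: sg_def)
  qed
  show "spl (w_mat ** t_mat (\<pi> ^ \<epsilon>)) = 1"
    unfolding w_mat_kmat using spl_kmat[OF sl2_w] by (simp add: sg_def integer_units_iff)
next
  fix s :: "'a^2^2 \<Rightarrow> complex"
  assume *: "(\<forall>k\<in>K_grp \<epsilon> 0. s k \<in> {1, - 1}) \<and> (\<forall>k. k \<notin> K_grp \<epsilon> 0 \<longrightarrow> s k = 1) \<and>
    (\<forall>k\<in>K_grp \<epsilon> 0. \<forall>l\<in>K_grp \<epsilon> 0. (k, s k) \<odot> (l, s l) = (k ** l, s (k ** l))) \<and>
    (\<forall>b\<in>prime_power (- int \<epsilon>). s (n_mat b) = 1) \<and> (\<forall>a\<in>integer_units. s (t_mat a) = weil_ratio a \<psi>) \<and>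
    (\<forall>c\<in>prime_power (int \<epsilon>). s (nop_mat c) = 1) \<and> s (w_mat ** t_mat (\<pi> ^ \<epsilon>)) = 1"
  have m: "s (k ** l) = s k * s l * cocycle k l" if "k \<in> K_grp \<epsilon> 0" "l \<in> K_grp \<epsilon> 0" for k l
  proof -
    have "(k, s k) \<odot> (l, s l) = (k ** l, s (k ** l))" using * that by blast
    thus ?thesis by (simp add: mp_mult_def)
  qed
  have "s k = spl k" if "k \<in> K_grp \<epsilon> 0" for k
    using that
  proof (induction k rule: K_induct)
    case (n b)
    have "b / p \<in> prime_power (- int \<epsilon>)" using n pp_mult_iff[of p "b / p" 0] by simp
    hence "s (kmat 1 b 0 1) = 1" unfolding kmat_n using * by blast
    thus ?case using spl_kmat[OF sl2_n[OF n]] by (simp add: sg_def)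
  next
    case (t u)
    have "s (t_mat u) = weil_ratio u \<psi>" using * t by blast
    thus ?case unfolding t_mat_kmat using spl_kmat[OF sl2_t[OF t]] t units_nz[OF t] weil_ratio_unit[OF psi eps t]
      by (simp add: sg_def hilbert_inverse_left p_def)
  next
    case w
    have "s (kmat 0 1 (-1) 0) = 1" using * unfolding w_mat_kmat by blast
    thus ?case using spl_kmat[OF sl2_w] by (simp add: sg_def integer_units_iff)
  next
    case (mult k l)
    thus ?case using m spl_mult by simp
  qed
  moreover have "s k = spl k" if "k \<notin> K_grp \<epsilon> 0" for k using * that by (simp add: spl_def)
  ultimately show "s = spl" by blast
qed

end

section \<open>Principal series as functions on primitive rows\<close>

lemma Mp_mult_iff:
  assumes "h \<in> Mp"
  shows "g \<odot> h \<in> Mp \<longleftrightarrow> g \<in> Mp"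
proof
  assume *: "g \<odot> h \<in> Mp"
  have "snd h * snd h = 1" "snd h = 1 \<or> snd h = -1" using assms by (auto simp: Mp_iff)
  moreover have "cocycle (fst g) (fst h) = 1 \<or> cocycle (fst g) (fst h) = -1" by (rule cocycle_cases)
  ultimately show "g \<in> Mp" using * assms by (auto simp: Mp_iff mp_mult_def det_mul minus_equation_iff)
qed (use assms Mp_mult in blast)

locale principal = metaplectic \<pi> \<epsilon> \<psi> for \<pi> :: "'a::nonarch_local_field" and \<epsilon> \<psi> +
  fixes \<mu> :: "'a \<Rightarrow> complex"
  assumes mu: "mult_char_on (- {0}) \<mu>"
begin

lemma mu_mult: "a \<noteq> 0 \<Longrightarrow> b \<noteq> 0 \<Longrightarrow> \<mu> (a * b) = \<mu> a * \<mu> b"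
  using mu by (simp add: mult_char_on_def)

lemma mu_nz: "a \<noteq> 0 \<Longrightarrow> \<mu> a \<noteq> 0"
  using mu by (simp add: mult_char_on_def)

lemma mu_1: "\<mu> 1 = 1"
  using mult_char_1[OF mu] by simp

lemma mu_units: "mult_char_on integer_units \<mu>"
  using mu units_nz continuous_on_subset[of "- {0}" \<mu> integer_units] by (auto simp: mult_char_on_def)

lemma mu_inverse: "a \<noteq> 0 \<Longrightarrow> \<mu> (inverse a) = inverse (\<mu> a)"
  using mu_mult[of a "inverse a"] by (simp add: mu_1 inverse_unique)

text \<open>The factor by which (t(a), 1) acts from the left. By \<open>weil_ratio_mult\<close> it
  is multiplicative up to the Hilbert symbol, which is the defect of the torus in the covering group
  recorded in \<open>bor_bor\<close>.\<close>

definition \<theta> :: "'a \<Rightarrow> complex" where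
  "\<theta> a = of_real (absv a) * \<mu> a * inverse (weil_ratio a \<psi>)"

lemma theta_mult: "a \<noteq> 0 \<Longrightarrow> b \<noteq> 0 \<Longrightarrow> \<theta> (a * b) = \<theta> a * \<theta> b * hilbert a b"
proof -
  assume ab: "a \<noteq> 0" "b \<noteq> 0"
  have "inverse (hilbert a b) = hilbert a b" by (rule inverse_unique) simp
  thus ?thesis unfolding \<theta>_def weil_ratio_mult[OF psi eps ab] mu_mult[OF ab] nlf_absv_mult by simp
qed

lemma theta_unit: "u \<in> integer_units \<Longrightarrow> \<theta> u = \<mu> u * hilbert u p"
proof -
  assume u: "u \<in> integer_units"
  have "inverse (hilbert u p) = hilbert u p" by (rule inverse_unique) simp
  moreover have "absv u = 1" using u by (simp add: integer_units_def)
  ultimately show ?thesis unfolding \<theta>_def weil_ratio_unit[OF psi eps u] by (simp add: p_def)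
qed

lemma theta_1: "\<theta> 1 = 1"
  by (simp add: theta_unit mu_1)

definition bor :: "'a \<Rightarrow> complex \<Rightarrow> 'a \<Rightarrow> 'a mp" where
  "bor a e b = (t_mat a, e) \<odot> (n_mat b, 1)"

lemma tn_mat2: "t_mat a ** n_mat b = mat2 a (a * b) 0 (inverse a)"
  by (simp add: t_mat_def n_mat_def mat2_mult)

lemma det_t: "a \<noteq> 0 \<Longrightarrow> det (t_mat a) = (1::'a)" and det_n: "det (n_mat b) = (1::'a)"
  by (simp_all add: t_mat_def n_mat_def det_mat2)

lemma bor_eq: "a \<noteq> 0 \<Longrightarrow> bor a e b = (t_mat a ** n_mat b, e)"
  using cocycle_n_right[OF det_t] by (simp add: bor_def mp_mult_def)

lemma bor_Mp: "a \<noteq> 0 \<Longrightarrow> e \<in> {1, -1} \<Longrightarrow> bor a e b \<in> Mp"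
  by (auto simp: bor_eq Mp_iff det_mul det_t det_n)

lemma cocycle_tn_left:
  assumes "a \<noteq> (0::'a)" "det g = 1"
  shows "cocycle (t_mat a ** n_mat b) g = hilbert a (x_fun g)"
proof -
  have "cocycle (t_mat a) (n_mat b) * cocycle (t_mat a ** n_mat b) g = cocycle (t_mat a) (n_mat b ** g) * cocycle (n_mat b) g"
    by (rule cocycle_assoc) (use assms det_t det_n in auto)
  moreover have "x_fun (n_mat b ** g) = x_fun g"
    by (cases g rule: mat2_cases) (simp add: n_mat_def mat2_mult)
  ultimately show ?thesis
    using cocycle_n_right[OF det_t[OF assms(1)], of b] cocycle_n_left[OF assms(2), of b]
      cocycle_t_left[of "n_mat b ** g" a] assms by (simp add: det_mul det_n)
qed

lemma bor_mult: "a \<noteq> 0 \<Longrightarrow> det g = 1 \<Longrightarrow> bor a e b \<odot> (g, e') = (t_mat a ** n_mat b ** g, e * e' * hilbert a (x_fun g))"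
  by (simp add: bor_eq mp_mult_def cocycle_tn_left)

text \<open>The new unipotent parameter arises from n(b) t(a') = t(a') n(b / a'^2).\<close>

lemma bor_bor:
  assumes "a \<noteq> 0" "a' \<noteq> 0"
  shows "bor a e b \<odot> bor a' e' b' = bor (a * a') (e * e' * hilbert a a') (b' + b / a'\<^sup>2)"
proof -
  have "det (t_mat a' ** n_mat b') = 1" using assms by (simp add: det_mul det_t det_n)
  moreover have "x_fun (t_mat a' ** n_mat b') = inverse a'" by (simp add: tn_mat2)
  moreover have "t_mat a ** n_mat b ** (t_mat a' ** n_mat b') = t_mat (a * a') ** n_mat (b' + b / a'\<^sup>2)"
    using assms unfolding tn_mat2 mat2_mult by (simp add: field_simps power2_eq_square)
  ultimately show ?thesis
    using assms by (simp add: bor_eq[of a'] bor_mult) (simp add: bor_eq hilbert_inverse_right)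
qed

text \<open>The witness is the upper right entry of g h^-1, which is unipotent because the bottom
  rows agree.\<close>

lemma same_row_matrix:
  fixes g h :: "'a^2^2"
  assumes "det g = 1" "det h = 1" "g$2$1 = h$2$1" "g$2$2 = h$2$2"
  obtains b where "g = n_mat b ** h"
proof -
  obtain A B C D where g: "g = mat2 A B C D" by (rule mat2_cases)
  obtain A' B' C' D' where h: "h = mat2 A' B' C' D'" by (rule mat2_cases)
  have CD: "C' = C" "D' = D" using assms g h by auto
  have d: "A * D - B * C = 1" "A' * D - B' * C = 1" using assms g h CD by (auto simp: det_mat2)
  have "A = A' + (B * A' - A * B') * C" "B = B' + (B * A' - A * B') * D"
  proof -
    have "A' + (B * A' - A * B') * C = A' * (1 + B * C) - A * (B' * C)" by (simp add: algebra_simps)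
    also have "\<dots> = A' * (A * D) - A * (A' * D - 1)" using d by (simp add: algebra_simps)
    finally show "A = A' + (B * A' - A * B') * C" by (simp add: algebra_simps)
    have "B' + (B * A' - A * B') * D = B * (A' * D) + B' * (1 - A * D)" by (simp add: algebra_simps)
    also have "\<dots> = B * (1 + B' * C) + B' * (- (B * C))" using d by (simp add: algebra_simps)
    finally show "B = B' + (B * A' - A * B') * D" by (simp add: algebra_simps)
  qed
  thus ?thesis using that[of "B * A' - A * B'"] by (simp add: g h CD n_mat_def mat2_mult)
qed

definition prim :: "'a \<Rightarrow> 'a \<Rightarrow> bool" where
  "prim c d \<longleftrightarrow> c \<in> prime_power 0 \<and> d \<in> prime_power 0 \<and> (c \<in> integer_units \<or> d \<in> integer_units)"

lemma sl2_prim: "sl2 a b c d \<Longrightarrow> prim c d"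
proof -
  assume s: "sl2 a b c d"
  show "prim c d"
  proof (rule ccontr)
    assume "\<not> prim c d"
    hence "c \<in> prime_power 1" "d \<in> prime_power 1" using s by (auto simp: prim_def sl2_def units_iff_pp)
    hence "a * d - b * c \<in> prime_power 1" using s by (intro pp_diff pp_mult_0) (auto simp: sl2_def)
    thus False using s by (simp add: sl2_def)
  qed
qed

lemma prim_sl2: "prim c d \<Longrightarrow> \<exists>a b. sl2 a b c d"
proof -
  assume c: "prim c d"
  show ?thesis
  proof (cases "d \<in> integer_units")
    case True
    thus ?thesis using c units_nz[OF True] units_pp0[of "inverse d"]
      by (intro exI[of _ "inverse d"] exI[of _ 0]) (auto simp: sl2_def prim_def)
  next
    case False
    hence cu: "c \<in> integer_units" using c by (auto simp: prim_def)
    thus ?thesis using c units_nz[OF cu] units_pp0[of "inverse c"]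
      by (intro exI[of _ 0] exI[of _ "- inverse c"]) (auto simp: sl2_def prim_def)
  qed
qed

lemma prim_scale_unit: "prim c d \<Longrightarrow> prim (v * c) (v * d) \<Longrightarrow> v \<in> integer_units"
proof -
  assume *: "prim c d" "prim (v * c) (v * d)"
  have v0: "v \<noteq> 0" using *(2) by (auto simp: prim_def integer_units_iff)
  have "v \<in> prime_power 0"
  proof -
    have "c \<in> integer_units \<or> d \<in> integer_units" using * by (auto simp: prim_def)
    thus ?thesis using *(2) units_pp_mult_iff[of c v 0] units_pp_mult_iff[of d v 0] by (auto simp: prim_def mult.commute)
  qed
  thus ?thesis using * units_mult_iff[of v c] units_mult_iff[of v d] by (auto simp: prim_def)
qed

lemma ex_prim_scale_aux:
  assumes "d \<noteq> 0" "c = 0 \<or> oval d \<le> oval (c::'a)"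
  shows "prim (c / d) 1"
proof -
  have "d * (c / d) \<in> prime_power (oval d)" using assms by (auto simp: prime_power_iff)
  hence "c / d \<in> prime_power 0" using pp_mult_iff[OF assms(1), of "c / d" "oval d"] by simp
  thus "prim (c / d) 1" by (simp add: prim_def)
qed

lemma ex_prim_scale:
  assumes "(c, d) \<noteq> (0, 0::'a)"
  obtains v c' d' where "v \<noteq> 0" "prim c' d'" "c = v * c'" "d = v * d'"
proof (cases "d \<noteq> 0 \<and> (c = 0 \<or> oval d \<le> oval c)")
  case True
  thus ?thesis using that[of d "c / d" 1] ex_prim_scale_aux[of d c] by simp
next
  case False
  hence c: "c \<noteq> 0 \<and> (d = 0 \<or> oval c \<le> oval d)" using assms by auto
  hence "prim (d / c) 1" using ex_prim_scale_aux by blast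
  hence "prim 1 (d / c)" by (auto simp: prim_def)
  thus ?thesis using that[of c 1 "d / c"] c by simp
qed

text \<open>The bottom row of g, with its first entry divided by \<open>p\<close>, is v times a
  primitive row (c, d). Completing that row to an integral matrix of determinant 1 leaves t(1/v) and
  a unipotent factor on the left.\<close>

lemma iwasawa:
  assumes "g \<in> (Mp :: 'a mp set)"
  obtains a e b a0 b0 c d where "a \<noteq> 0" "e \<in> {1, -1}" "sl2 a0 b0 c d" "g = bor a e b \<odot> (kmat a0 b0 c d, sg c d)"
proof -
  obtain A B C D where g: "fst g = mat2 A B C D" by (rule mat2_cases)
  have det: "A * D - B * C = 1" using assms by (simp add: Mp_iff g det_mat2)
  hence "(C / p, D) \<noteq> (0, 0)" by auto
  then obtain v c d where v: "v \<noteq> 0" "prim c d" "C / p = v * c" "D = v * d" by (rule ex_prim_scale)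
  obtain a0 b0 where s: "sl2 a0 b0 c d" using prim_sl2[OF v(2)] by blast
  define k where "k = kmat a0 b0 c d"
  have dk: "det k = 1" using s by (simp add: k_def sl2_def)
  have C: "C = v * c * p" using v(3) by (simp add: field_simps)
  obtain b where b: "fst g = n_mat b ** (t_mat (inverse v) ** k)"
  proof (rule same_row_matrix)
    show "det (fst g) = 1" using assms by (simp add: Mp_iff)
    show "det (t_mat (inverse v) ** k) = 1" using v dk by (simp add: det_mul det_t)
    show "fst g $ 2 $ 1 = (t_mat (inverse v) ** k) $ 2 $ 1" "fst g $ 2 $ 2 = (t_mat (inverse v) ** k) $ 2 $ 2"
      using v C by (simp_all add: g k_def kmat_def t_mat_def mat2_mult)
  qed
  have nt: "n_mat b ** t_mat (inverse v) = t_mat (inverse v) ** n_mat (b * v\<^sup>2)"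
    using v(1) by (simp add: n_mat_def t_mat_def mat2_mult power2_eq_square)
  have fg: "fst g = t_mat (inverse v) ** n_mat (b * v\<^sup>2) ** k"
    unfolding b by (simp add: matrix_mul_assoc nt)
  \<comment> \<open>The sign is solved for, since symbols and values of \<open>sg\<close> are their
    own inverses.\<close>
  define e where "e = snd g * sg c d * hilbert (inverse v) (x_fun k)"
  have e: "e \<in> {1, -1}" using assms sg_cases[of c d] hilbert_cases[of "inverse v" "x_fun k"] by (auto simp: e_def Mp_iff)
  have "e * sg c d * hilbert (inverse v) (x_fun k) = snd g"
    using sg_cases[of c d] hilbert_cases[of "inverse v" "x_fun k"] by (auto simp: e_def)
  hence "g = bor (inverse v) e (b * v\<^sup>2) \<odot> (k, sg c d)"
    using v(1) dk by (simp add: bor_mult prod_eq_iff fg)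
  thus ?thesis using that[OF _ e s, of "inverse v"] v(1) by (simp add: k_def)
qed

text \<open>Only a unit v can pass between the torus and the compact factor, because both rows are
  primitive. The resulting change of sign is the one that \<open>theta_mult\<close> and
  \<open>theta_unit\<close> produce for \<theta> (a v).\<close>

lemma bor_kmat_unique:
  assumes a: "a \<noteq> 0" "a' \<noteq> 0" and s: "sl2 a0 b0 c d" "sl2 a0' b0' c' d'"
    and eq: "bor a e b \<odot> (kmat a0 b0 c d, sg c d) = bor a' e' b' \<odot> (kmat a0' b0' c' d', sg c' d')"
  obtains v where "v \<in> integer_units" "a' = a * v" "c' = v * c" "d' = v * d" "e = e' * hilbert v p * hilbert a v"
proof -
  have dk: "det (kmat a0 b0 c d) = 1" "det (kmat a0' b0' c' d') = 1" using s by (simp_all add: sl2_def)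
  have m: "t_mat a ** n_mat b ** kmat a0 b0 c d = t_mat a' ** n_mat b' ** kmat a0' b0' c' d'"
    and sn: "e * sg c d * hilbert a (x_fun (kmat a0 b0 c d)) = e' * sg c' d' * hilbert a' (x_fun (kmat a0' b0' c' d'))"
    using eq a dk by (simp_all add: bor_mult)
  define v where "v = a' / a"
  have v0: "v \<noteq> 0" and a': "a' = a * v" using a by (auto simp: v_def)
  have "inverse a * (c * p) = inverse a' * (c' * p)" "inverse a * d = inverse a' * d'"
    using m unfolding tn_mat2 kmat_def mat2_mult by auto
  hence cd: "c' = v * c" "d' = v * d" using a by (simp_all add: v_def field_simps)
  have v: "v \<in> integer_units" using prim_scale_unit sl2_prim[OF s(1)] sl2_prim[OF s(2)] cd by metis
  let ?x = "x_fun (kmat a0 b0 c d)"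
  have x0: "?x \<noteq> 0" using x_fun_nz dk by blast
  have x': "x_fun (kmat a0' b0' c' d') = v * ?x" using v0 by (simp add: cd)
  have "sg c' d' = hilbert v p * sg c d * hilbert v ?x"
    using spl_t_left[OF units_inverse[THEN iffD2, OF v] s(1)] v0 x0 by (simp add: cd hilbert_inverse_left)
  moreover have "hilbert a' (v * ?x) = hilbert a v * hilbert a ?x * hilbert v ?x"
    using a a' v0 x0 hilbert_units[OF v v] by (simp add: hilbert_mult_left hilbert_mult_right)
  ultimately have "e * (sg c d * hilbert a ?x) = (e' * hilbert v p * hilbert a v) * (sg c d * hilbert a ?x)"
    using sn hilbert_cases[of v ?x] unfolding x' by auto
  moreover have "sg c d * hilbert a ?x \<noteq> 0" using sg_cases[of c d] by auto
  ultimately have "e = e' * hilbert v p * hilbert a v" by simp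
  thus ?thesis using that v a' cd by blast
qed

text \<open>A function on primitive rows that is homogeneous of degree \<open>\<mu>\<^sup>-\<^sup>1\<close> under units
  extends uniquely to a function on the covering group with the equivariance of the principal series.\<close>

definition homog :: "('a \<Rightarrow> 'a \<Rightarrow> complex) \<Rightarrow> bool" where
  "homog \<Phi> \<longleftrightarrow> (\<forall>v c d. v \<in> integer_units \<longrightarrow> prim c d \<longrightarrow> \<mu> v * \<Phi> (v * c) (v * d) = \<Phi> c d)"

definition ps_fun :: "('a \<Rightarrow> 'a \<Rightarrow> complex) \<Rightarrow> 'a mp \<Rightarrow> complex" where
  "ps_fun \<Phi> g = (if g \<in> Mp then THE z. \<exists>a e b a0 b0 c d. a \<noteq> 0 \<and> e \<in> {1, -1} \<and> sl2 a0 b0 c d \<and>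
      g = bor a e b \<odot> (kmat a0 b0 c d, sg c d) \<and> z = e * \<theta> a * \<Phi> c d else 0)"

lemma kmat_Mp: "sl2 a b c d \<Longrightarrow> (kmat a b c d, sg c d) \<in> Mp"
  using sg_cases by (auto simp: Mp_iff sl2_def)

text \<open>Independence of the decomposition: the symbols cancel against those of \<theta> (a v),
  and what remains is the homogeneity of \<Phi> under v. This makes the description in
  \<open>ps_fun\<close> well defined.\<close>

lemma ps_fun_eval:
  assumes h: "homog \<Phi>" and a: "a \<noteq> 0" and e: "e \<in> {1, -1}" and s: "sl2 a0 b0 c d"
  shows "ps_fun \<Phi> (bor a e b \<odot> (kmat a0 b0 c d, sg c d)) = e * \<theta> a * \<Phi> c d"
proof -
  let ?g = "bor a e b \<odot> (kmat a0 b0 c d, sg c d)"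
  have "?g \<in> Mp" using bor_Mp[OF a e] kmat_Mp[OF s] by (rule Mp_mult)
  moreover have "(THE z. \<exists>a e b a0 b0 c d. a \<noteq> 0 \<and> e \<in> {1, -1} \<and> sl2 a0 b0 c d \<and>
      ?g = bor a e b \<odot> (kmat a0 b0 c d, sg c d) \<and> z = e * \<theta> a * \<Phi> c d) = e * \<theta> a * \<Phi> c d"
  proof (rule the_equality)
    show "\<exists>a' e' b' a0' b0' c' d'. a' \<noteq> 0 \<and> e' \<in> {1, -1} \<and> sl2 a0' b0' c' d' \<and>
      ?g = bor a' e' b' \<odot> (kmat a0' b0' c' d', sg c' d') \<and> e * \<theta> a * \<Phi> c d = e' * \<theta> a' * \<Phi> c' d'"
      using a e s by blast
    fix z assume "\<exists>a' e' b' a0' b0' c' d'. a' \<noteq> 0 \<and> e' \<in> {1, -1} \<and> sl2 a0' b0' c' d' \<and>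
      ?g = bor a' e' b' \<odot> (kmat a0' b0' c' d', sg c' d') \<and> z = e' * \<theta> a' * \<Phi> c' d'"
    then obtain a' e' b' a0' b0' c' d' where *: "a' \<noteq> 0" "e' \<in> {1, -1}" "sl2 a0' b0' c' d'"
      "?g = bor a' e' b' \<odot> (kmat a0' b0' c' d', sg c' d')" "z = e' * \<theta> a' * \<Phi> c' d'" by blast
    obtain v where v: "v \<in> integer_units" "a' = a * v" "c' = v * c" "d' = v * d" "e = e' * hilbert v p * hilbert a v"
      using bor_kmat_unique[OF a *(1) s *(3,4)] .
    have "z = e' * (\<theta> a * (\<mu> v * hilbert v p) * hilbert a v) * \<Phi> (v * c) (v * d)"
      unfolding *(5) v(2-4) theta_mult[OF a units_nz[OF v(1)]] theta_unit[OF v(1)] ..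
    also have "\<dots> = (e' * hilbert v p * hilbert a v) * \<theta> a * (\<mu> v * \<Phi> (v * c) (v * d))" by simp
    also have "\<dots> = e * \<theta> a * \<Phi> c d"
      unfolding v(5)[symmetric] using h v(1) sl2_prim[OF s] by (simp add: homog_def)
    finally show "z = e * \<theta> a * \<Phi> c d" .
  qed
  ultimately show ?thesis by (simp add: ps_fun_def)
qed

lemma ps_fun_left:
  assumes h: "homog \<Phi>" and a: "a \<noteq> 0" and e: "e \<in> {1, -1}" and g: "g \<in> Mp"
  shows "ps_fun \<Phi> (bor a e b \<odot> g) = e * \<theta> a * ps_fun \<Phi> g"
proof -
  obtain a' e' b' a0 b0 c d where *: "a' \<noteq> 0" "e' \<in> {1, -1}" "sl2 a0 b0 c d" "g = bor a' e' b' \<odot> (kmat a0 b0 c d, sg c d)"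
    using iwasawa[OF g] .
  have "bor a e b \<odot> g = bor (a * a') (e * e' * hilbert a a') (b' + b / a'\<^sup>2) \<odot> (kmat a0 b0 c d, sg c d)"
    unfolding *(4) bor_bor[OF a *(1), symmetric] using * a e kmat_Mp bor_Mp by (intro mp_assoc[symmetric]) auto
  also have "ps_fun \<Phi> \<dots> = (e * e' * hilbert a a') * \<theta> (a * a') * \<Phi> c d"
    using a * e hilbert_cases[of a a'] by (intro ps_fun_eval[OF h]) auto
  also have "\<dots> = e * \<theta> a * (e' * \<theta> a' * \<Phi> c d)"
    using theta_mult[OF a *(1)] by simp
  also have "e' * \<theta> a' * \<Phi> c d = ps_fun \<Phi> g" unfolding *(4) using * by (intro ps_fun_eval[OF h, symmetric]) auto
  finally show ?thesis .
qed

lemma mp_one_right: "(g::'a mp) \<in> Mp \<Longrightarrow> g \<odot> (mat 1, 1) = g"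
proof -
  assume "g \<in> Mp"
  hence "det (fst g) = 1" by (simp add: Mp_iff)
  from cocycle_n_right[OF this, of 0] show ?thesis
    by (simp add: mp_mult_def n_mat_def mat_eq_mat2[of 1, symmetric] prod_eq_iff)
qed

lemma bor_1: "(g::'a mp) \<in> Mp \<Longrightarrow> bor 1 1 0 \<odot> g = g"
  by (cases g) (simp add: Mp_iff bor_mult tn_mat2 mat_eq_mat2[of 1, symmetric])

text \<open>The splitting is a homomorphism, so a right factor from the compact group only moves the
  bottom row; for g outside the covering group both sides are 0.\<close>

lemma ps_fun_right:
  assumes h: "homog \<Phi>" and inv: "\<And>c d. prim c d \<Longrightarrow> \<Phi> (c * a1 + d * c1) (c * b1 + d * d1) = z * \<Phi> c d"
    and s1: "sl2 a1 b1 c1 d1"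
  shows "ps_fun \<Phi> (g \<odot> (kmat a1 b1 c1 d1, sg c1 d1)) = z * ps_fun \<Phi> g"
proof (cases "g \<in> Mp")
  case True
  obtain a e b a0 b0 c d where *: "a \<noteq> 0" "e \<in> {1, -1}" "sl2 a0 b0 c d" "g = bor a e b \<odot> (kmat a0 b0 c d, sg c d)"
    using iwasawa[OF True] .
  have K: "kmat a0 b0 c d \<in> K_grp \<epsilon> 0" "kmat a1 b1 c1 d1 \<in> K_grp \<epsilon> 0"
    using *(3) s1 by (auto simp: kmat_in_K_iff sl2_def)
  note s2 = sl2_mult[OF *(3) s1]
  have "g \<odot> (kmat a1 b1 c1 d1, sg c1 d1) = bor a e b \<odot> ((kmat a0 b0 c d, sg c d) \<odot> (kmat a1 b1 c1 d1, sg c1 d1))"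
    unfolding *(4) using * s1 kmat_Mp bor_Mp by (intro mp_assoc) auto
  also have "(kmat a0 b0 c d, sg c d) \<odot> (kmat a1 b1 c1 d1, sg c1 d1) =
     (kmat (a0 * a1 + b0 * c1) (a0 * b1 + b0 * d1) (c * a1 + d * c1) (c * b1 + d * d1), sg (c * a1 + d * c1) (c * b1 + d * d1))"
    using spl_mp_mult[OF K] spl_kmat[OF *(3)] spl_kmat[OF s1] spl_kmat[OF s2] by (simp add: kmat_mult)
  also have "ps_fun \<Phi> (bor a e b \<odot> \<dots>) = e * \<theta> a * \<Phi> (c * a1 + d * c1) (c * b1 + d * d1)"
    using * s2 by (intro ps_fun_eval[OF h]) auto
  also have "\<dots> = z * (e * \<theta> a * \<Phi> c d)" using inv[OF sl2_prim[OF *(3)]] by simp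
  also have "e * \<theta> a * \<Phi> c d = ps_fun \<Phi> g" unfolding *(4) using * by (intro ps_fun_eval[OF h, symmetric]) auto
  finally show ?thesis .
next
  case False
  thus ?thesis using Mp_mult_iff[OF kmat_Mp[OF s1], of g] by (simp add: ps_fun_def)
qed

section \<open>From the principal series to functions on rows\<close>

abbreviation "R \<equiv> principal_series \<epsilon> \<psi> \<pi> \<mu>"

lemma rep_space_iff:
  "f \<in> rep_space R \<longleftrightarrow> (\<forall>g. g \<notin> Mp \<longrightarrow> f g = 0) \<and>
     (\<forall>g\<in>Mp. \<exists>U. openin (Mp_topology \<epsilon> \<psi> \<pi>) U \<and> g \<in> U \<and> (\<forall>h\<in>U. f h = f g)) \<and>
     (\<forall>a e b g. a \<noteq> 0 \<longrightarrow> e \<in> {1, -1} \<longrightarrow> g \<in> Mp \<longrightarrow> f (bor a e b \<odot> g) = e * \<theta> a * f g)"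
proof -
  have eq: "of_real (absv a) * \<mu> a * chi_psi \<psi> a e = e * \<theta> a" for a e
    by (simp add: chi_psi_def \<theta>_def)
  have aux: "(\<forall>a. P a \<longrightarrow> (\<forall>e\<in>E. \<forall>b. \<forall>g\<in>M. Q a e b g)) \<longleftrightarrow> (\<forall>a e b g. P a \<longrightarrow> e \<in> E \<longrightarrow> g \<in> M \<longrightarrow> Q a e b g)"
    for P :: "'a \<Rightarrow> bool" and E :: "complex set" and M :: "'a mp set" and Q :: "'a \<Rightarrow> complex \<Rightarrow> 'a \<Rightarrow> 'a mp \<Rightarrow> bool"
    by blast
  show ?thesis unfolding principal_series_def crep.simps mem_Collect_eq eq bor_def[symmetric] aux by (rule refl)
qed

lemma rep_space_left: "f \<in> rep_space R \<Longrightarrow> a \<noteq> 0 \<Longrightarrow> e \<in> {1, -1} \<Longrightarrow> g \<in> Mp \<Longrightarrow> f (bor a e b \<odot> g) = e * \<theta> a * f g"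
  unfolding rep_space_iff by blast

lemma rep_space_zero: "f \<in> rep_space R \<Longrightarrow> g \<notin> Mp \<Longrightarrow> f g = 0"
  by (rule conjunct1[OF rep_space_iff[THEN iffD1], rule_format])

text \<open>Restriction to the split compact group, read as a function of the bottom row. Any
  completion of the row serves, as completions differ by a left unipotent factor, under which the
  principal series is invariant.\<close>

definition \<Phi>_of :: "('a mp \<Rightarrow> complex) \<Rightarrow> 'a \<Rightarrow> 'a \<Rightarrow> complex" where
  "\<Phi>_of f c d = (let (a, b) = (SOME (a, b). sl2 a b c d) in f (kmat a b c d, sg c d))"

lemma Phi_of_eq:
  assumes f: "f \<in> rep_space R" and s: "sl2 a b c d"
  shows "f (kmat a b c d, sg c d) = \<Phi>_of f c d"
proof -
  define ab where "ab = (SOME (a, b). sl2 a b c d)"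
  have "case ab of (a, b) \<Rightarrow> sl2 a b c d" unfolding ab_def by (rule someI[of _ "(a, b)"]) (use s in auto)
  then obtain a' b' where ab: "ab = (a', b')" "sl2 a' b' c d" by (cases ab) auto
  have d: "det (kmat a b c d) = 1" "det (kmat a' b' c d) = 1" using s ab by (auto simp: sl2_def)
  then obtain y where y: "kmat a b c d = n_mat y ** kmat a' b' c d"
    by (rule same_row_matrix) auto
  have "t_mat 1 ** n_mat y = n_mat y" by (simp add: t_mat_def n_mat_def mat2_mult)
  hence "(kmat a b c d, sg c d) = bor 1 1 y \<odot> (kmat a' b' c d, sg c d)" using d y by (simp add: bor_mult)
  hence "f (kmat a b c d, sg c d) = f (kmat a' b' c d, sg c d)"
    using rep_space_left[OF f, of 1 1 "(kmat a' b' c d, sg c d)" y] kmat_Mp[OF ab(2)] by (simp add: theta_1)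
  thus ?thesis unfolding \<Phi>_of_def ab_def[symmetric] ab(1) by simp
qed

lemma Phi_of_homog:
  assumes f: "f \<in> rep_space R"
  shows "homog (\<Phi>_of f)"
  unfolding homog_def
proof (intro allI impI)
  fix v c d :: 'a assume v: "v \<in> integer_units" and cd: "prim c d"
  obtain a b where s: "sl2 a b c d" using prim_sl2[OF cd] by blast
  have v0: "v \<noteq> 0" using units_nz v by blast
  have iv: "inverse v \<in> integer_units" using v by simp
  have s': "sl2 (inverse v * a) (inverse v * b) (v * c) (v * d)"
    using sl2_mult[OF sl2_t[OF iv] s] by simp
  have d: "det (kmat a b c d) = 1" using s by (simp add: sl2_def)
  have h1: "inverse v * v = 1" using v0 by simp
  let ?x = "x_fun (kmat a b c d)"
  have x0: "?x \<noteq> 0" using x_fun_nz d by blast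
  have sgv: "sg (v * c) (v * d) = hilbert v p * sg c d * hilbert v ?x"
    using spl_t_left[OF iv s] v0 x0 by (simp add: hilbert_inverse_left)
  have "bor (inverse v) (hilbert v p) 0 \<odot> (kmat a b c d, sg c d) = (kmat (inverse v * a) (inverse v * b) (v * c) (v * d), sg (v * c) (v * d))"
    using v0 d x0 sgv by (simp add: bor_mult tn_mat2 hilbert_inverse_left) (simp add: kmat_def mat2_mult mult_ac)
  moreover have "f (bor (inverse v) (hilbert v p) 0 \<odot> (kmat a b c d, sg c d)) = hilbert v p * \<theta> (inverse v) * f (kmat a b c d, sg c d)"
    using v0 hilbert_cases[of v p] by (intro rep_space_left[OF f] kmat_Mp[OF s]) auto
  moreover have "hilbert v p * \<theta> (inverse v) = \<mu> (inverse v)"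
    using theta_unit[OF iv] v0 hilbert_cases[of v p] by (auto simp: hilbert_inverse_left)
  ultimately have "\<Phi>_of f (v * c) (v * d) = \<mu> (inverse v) * \<Phi>_of f c d"
    using Phi_of_eq[OF f s] Phi_of_eq[OF f s'] by simp
  thus "\<mu> v * \<Phi>_of f (v * c) (v * d) = \<Phi>_of f c d" using mu_inverse[OF v0] mu_nz[OF v0] by simp
qed

lemma rep_space_eq_0I:
  assumes f: "f \<in> rep_space R" and 0: "\<And>c d. prim c d \<Longrightarrow> \<Phi>_of f c d = 0"
  shows "f = (\<lambda>_. 0)"
proof
  fix g show "f g = 0"
  proof (cases "g \<in> Mp")
    case True
    obtain a e b a0 b0 c d where *: "a \<noteq> 0" "e \<in> {1, -1}" "sl2 a0 b0 c d" "g = bor a e b \<odot> (kmat a0 b0 c d, sg c d)"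
      using iwasawa[OF True] .
    have "f g = e * \<theta> a * f (kmat a0 b0 c d, sg c d)" unfolding *(4) by (rule rep_space_left[OF f *(1,2) kmat_Mp[OF *(3)]])
    thus ?thesis using Phi_of_eq[OF f *(3)] 0[OF sl2_prim[OF *(3)]] by simp
  qed (rule rep_space_zero[OF f])
qed

lemma continuous_component: "open (S::'a set) \<Longrightarrow> open {x :: 'a^2^2. x $ i $ j \<in> S}"
proof -
  assume "open S"
  hence "open ((\<lambda>x :: 'a^2^2. x $ i $ j) -` S)" by (intro open_vimage continuous_intros)
  thus ?thesis by (simp add: vimage_def)
qed

lemma open_pp: "open (prime_power n :: 'a set)"
  using open_pp_coset[of 0 n] by simp

text \<open>The set \<open>J\<close> is closed under products, so its lift translated by g is a
  neighbourhood of each of its own points g k. Within the compact group, membership in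
  \<open>J\<close> is an open condition on the bottom row, which supplies the sets \<open>W\<close>
  demanded by the topology.\<close>

lemma locally_constant_if_invariant:
  assumes inv: "\<And>g k. k \<in> K_grp \<epsilon> M \<Longrightarrow> k$2$2 - 1 \<in> prime_power (int M) \<Longrightarrow> f (g \<odot> (k, spl k)) = f g"
    and g: "g \<in> (Mp :: 'a mp set)"
  shows "\<exists>U. openin (Mp_topology \<epsilon> \<psi> \<pi>) U \<and> g \<in> U \<and> (\<forall>h\<in>U. f h = f g)"
proof -
  define J where "J = {k :: 'a^2^2. k \<in> K_grp \<epsilon> M \<and> k$2$2 - 1 \<in> prime_power (int M)}"
  define U where "U = {g \<odot> (k, spl k) | k. k \<in> J}"
  have J_mult: "k ** l \<in> J" if kl: "k \<in> J" "l \<in> J" for k l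
  proof -
    have K: "k \<in> K_grp \<epsilon> M" "l \<in> K_grp \<epsilon> M" using kl by (auto simp: J_def)
    obtain a b c d where k: "k = kmat a b c d" "sl2 a b c d" "c \<in> prime_power (int M)" using K_cases[OF K(1)] .
    obtain a' b' c' d' where l: "l = kmat a' b' c' d'" "sl2 a' b' c' d'" "c' \<in> prime_power (int M)" using K_cases[OF K(2)] .
    have dd: "d - 1 \<in> prime_power (int M)" "d' - 1 \<in> prime_power (int M)" using kl k l by (auto simp: J_def)
    have "c * b' + d * d' - 1 = b' * c + (d * (d' - 1) + (d - 1))" by (simp add: algebra_simps)
    also have "\<dots> \<in> prime_power (int M)"
      using k l dd by (intro pp_add pp_mult_0) (auto simp: sl2_def)
    finally show ?thesis unfolding J_def using K_mult[OF K] by (simp add: k(1) l(1) kmat_mult)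
  qed
  have J0: "k \<in> K_grp \<epsilon> 0" if "k \<in> J" for k using that K_subset by (auto simp: J_def)
  have one: "mat 1 \<in> J" "spl (mat 1) = 1"
    using sl2_n[of 0] spl_kmat[OF sl2_n[of 0]] by (auto simp: J_def mat_1_kmat kmat_in_K_iff sg_def)
  have "openin (Mp_topology \<epsilon> \<psi> \<pi>) U"
    unfolding openin_Mp_topology splitting_eq
  proof (intro conjI ballI)
    show "U \<subseteq> Mp" using Mp_mult[OF g] spl_K_mp J0 by (auto simp: U_def)
    fix h assume "h \<in> U"
    then obtain k where k: "k \<in> J" "h = g \<odot> (k, spl k)" by (auto simp: U_def)
    define W where "W = {x :: 'a^2^2. x $ 2 $ 1 \<in> prime_power (int (M + \<epsilon>))} \<inter> {x. x $ 2 $ 2 \<in> {y. y - 1 \<in> prime_power (int M)}}"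
    have "open W" unfolding W_def by (intro open_Int continuous_component open_pp open_pp_coset)
    moreover have "mat 1 \<in> W" by (simp add: W_def mat_eq_mat2)
    moreover have "h \<odot> (l, spl l) \<in> U" if l: "l \<in> K_grp \<epsilon> 0 \<inter> W" for l
    proof -
      have "l \<in> J" using l by (auto simp: J_def W_def K_grp_def)
      hence "k ** l \<in> J" using J_mult k by blast
      moreover have "h \<odot> (l, spl l) = g \<odot> ((k, spl k) \<odot> (l, spl l))"
        unfolding k(2) by (rule mp_assoc) (use g J0 k \<open>l \<in> J\<close> spl_K_mp in auto)
      moreover have "(k, spl k) \<odot> (l, spl l) = (k ** l, spl (k ** l))"
        by (rule spl_mp_mult) (use J0 k \<open>l \<in> J\<close> in auto)
      ultimately show ?thesis by (auto simp: U_def)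
    qed
    ultimately show "\<exists>W. open W \<and> mat 1 \<in> W \<and> (\<forall>l\<in>K_grp \<epsilon> 0 \<inter> W. h \<odot> (l, spl l) \<in> U)" by blast
  qed
  moreover have "g \<in> U" unfolding U_def using one mp_one_right[OF g] by (metis (mono_tags, lifting) mem_Collect_eq)
  moreover have "\<forall>h\<in>U. f h = f g"
  proof
    fix h assume "h \<in> U"
    then obtain k where "k \<in> K_grp \<epsilon> M" "k$2$2 - 1 \<in> prime_power (int M)" "h = g \<odot> (k, spl k)"
      unfolding U_def J_def by blast
    thus "f h = f g" using inv by (simp only:)
  qed
  ultimately show ?thesis by blast
qed

text \<open>The cocycles of -1 with g on either side are both the symbol of -1 and
  \<open>x_fun (fst g)\<close>. Hence the central element can be moved to the left, where it acts
  through \<theta> (-1); the symbol of -1 and \<open>p\<close> cancels.\<close>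

lemma minus_one_act:
  assumes f: "f \<in> rep_space R"
  shows "f (g \<odot> (mat (-1), weil_ratio (-1) \<psi>)) = \<mu> (-1) * f g"
proof (cases "g \<in> Mp")
  case True
  hence det: "det (fst g) = 1" by (simp add: Mp_iff)
  have minus_one_nz: "(-1::'a) \<noteq> 0" by simp
  have wr: "weil_ratio (-1) \<psi> = hilbert (-1) p" using weil_ratio_unit[OF psi eps, of "-1"] by (simp add: p_def)
  let ?x = "x_fun (fst g)"
  have x0: "?x \<noteq> 0" using x_fun_nz det by blast
  have x1: "x_fun (fst g ** mat (-1)) = - ?x"
    by (cases "fst g" rule: mat2_cases) (simp add: mat_eq_mat2 mat2_mult)
  have m: "t_mat (-1) ** n_mat 0 = mat (-1::'a)" by (simp add: tn_mat2 mat_eq_mat2)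
  have comm: "mat (-1) ** fst g = fst g ** mat (-1)"
    by (cases "fst g" rule: mat2_cases) (simp add: mat_eq_mat2 mat2_mult)
  have "cocycle (fst g) (mat (-1)) = hilbert (-1) (inverse ?x)"
    unfolding cocycle_def x1 using x0 by (simp add: mat_eq_mat2 inverse_eq_divide)
  also have "\<dots> = hilbert (-1) ?x" using x0 by (simp add: hilbert_inverse_right)
  finally have "g \<odot> (mat (-1), weil_ratio (-1) \<psi>) = bor (-1) (hilbert (-1) p) 0 \<odot> (fst g, snd g)"
    unfolding bor_mult[OF minus_one_nz det] m comm by (simp add: mp_mult_def wr)
  hence "g \<odot> (mat (-1), weil_ratio (-1) \<psi>) = bor (-1) (hilbert (-1) p) 0 \<odot> g" by simp
  moreover have "f (bor (-1) (hilbert (-1) p) 0 \<odot> g) = hilbert (-1) p * \<theta> (-1) * f g"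
    using True hilbert_cases[of "-1" p] by (intro rep_space_left[OF f]) auto
  moreover have "hilbert (-1) p * \<theta> (-1) = \<mu> (-1)" using theta_unit[of "-1"] hilbert_cases[of "-1" p] by auto
  ultimately show ?thesis by simp
next
  case False
  have "weil_ratio (-1) \<psi> = hilbert (-1) p" using weil_ratio_unit[OF psi eps, of "-1"] by (simp add: p_def)
  hence "(mat (-1), weil_ratio (-1) \<psi>) \<in> (Mp :: 'a mp set)"
    using hilbert_cases[of "-1" p] by (auto simp: Mp_iff mat_eq_mat2 det_mat2)
  hence "g \<odot> (mat (-1), weil_ratio (-1) \<psi>) \<notin> Mp" using False Mp_mult_iff by blast
  thus ?thesis using False rep_space_zero[OF f] by simp
qed

end

section \<open>Orbits on primitive rows\<close>

lemma sum_fun_apply: "(\<Sum>i\<in>A. f i) x = (\<Sum>i\<in>A. f i x)" for f :: "'i \<Rightarrow> 'g \<Rightarrow> complex"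
  by (induction A rule: infinite_finite_induct) auto

text \<open>The functions \<open>F\<close> are dual to the evaluations at \<open>ev\<close>. Duality
  gives independence, and a function minus its interpolant vanishes at all points, hence is 0, which
  gives spanning.\<close>

lemma has_dim_by_points:
  fixes V :: "('g \<Rightarrow> complex) set" and F :: "'p \<Rightarrow> 'g \<Rightarrow> complex" and ev :: "'p \<Rightarrow> 'g"
  assumes fin: "finite P"
    and V0: "0 \<in> V" and Vadd: "\<And>f g. f \<in> V \<Longrightarrow> g \<in> V \<Longrightarrow> f + g \<in> V"
    and Vsc: "\<And>c f. f \<in> V \<Longrightarrow> fun_scale c f \<in> V"
    and F: "\<And>p. p \<in> P \<Longrightarrow> F p \<in> V" "\<And>p q. p \<in> P \<Longrightarrow> q \<in> P \<Longrightarrow> F p (ev q) = (if p = q then 1 else 0)"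
    and inj: "\<And>f. f \<in> V \<Longrightarrow> (\<And>p. p \<in> P \<Longrightarrow> f (ev p) = 0) \<Longrightarrow> f = 0"
  shows "has_dim fun_scale V (card P)"
proof -
  interpret vector_space "fun_scale :: complex \<Rightarrow> ('g \<Rightarrow> complex) \<Rightarrow> _" by (rule vector_space_fun_scale)
  have injF: "inj_on F P"
  proof (rule inj_onI)
    fix p q assume pq: "p \<in> P" "q \<in> P" "F p = F q"
    have "1 = F q (ev p)" using F(2)[OF pq(1,1)] unfolding pq(3) by simp
    thus "p = q" using F(2)[OF pq(2,1)] by (auto split: if_splits)
  qed
  have val: "(\<Sum>p\<in>P. fun_scale (u p) (F p)) (ev q) = u q" if "q \<in> P" for u q
  proof -
    have "(\<Sum>p\<in>P. fun_scale (u p) (F p)) (ev q) = (\<Sum>p\<in>P. u p * F p (ev q))"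
      by (simp add: sum_fun_apply fun_scale_def)
    also have "\<dots> = (\<Sum>p\<in>P. if p = q then u p else 0)" using F(2) that by (intro sum.cong) auto
    finally show ?thesis using fin that by simp
  qed
  have sub: "subspace V" unfolding subspace_def using V0 Vadd Vsc by auto
  have ind: "\<not> dependent (F ` P)"
  proof
    assume "dependent (F ` P)"
    then obtain u v where u: "v \<in> F ` P" "u v \<noteq> 0" "(\<Sum>v\<in>F ` P. fun_scale (u v) v) = 0"
      using dependent_finite[of "F ` P"] fin by auto
    have "(\<Sum>p\<in>P. fun_scale (u (F p)) (F p)) = 0" using u(3) injF by (simp add: sum.reindex)
    moreover obtain q where q: "q \<in> P" "v = F q" using u(1) by blast
    ultimately have "u (F q) = 0" using val[OF q(1), of "\<lambda>p. u (F p)"] by simp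
    thus False using u q by simp
  qed
  have "span (F ` P) = V"
  proof
    show "span (F ` P) \<subseteq> V" using F(1) sub by (intro span_minimal) auto
    show "V \<subseteq> span (F ` P)"
    proof
      fix f assume f: "f \<in> V"
      let ?s = "\<Sum>p\<in>P. fun_scale (f (ev p)) (F p)"
      have s: "?s \<in> span (F ` P)" by (intro span_sum span_scale span_base) auto
      have "?s \<in> V" using F(1) sub by (intro subspace_sum subspace_scale) auto
      hence "f - ?s \<in> V" using f sub by (intro subspace_diff)
      hence "f - ?s = 0" by (rule inj) (simp add: val)
      thus "f \<in> span (F ` P)" using s by simp
    qed
  qed
  thus ?thesis unfolding has_dim_def using ind fin injF by (intro exI[of _ "F ` P"]) (auto simp: card_image)
qed

lemma char_cong:
  assumes c: "mult_char_on integer_units (\<tau> :: 'a::nonarch_local_field \<Rightarrow> complex)" and "mult_cond \<tau> \<le> n"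
    and u: "u \<in> integer_units" "v \<in> integer_units" "u - v \<in> prime_power (int n)"
  shows "\<tau> u = \<tau> v"
proof -
  have v0: "v \<noteq> 0" using units_nz u by blast
  have "u / v - 1 = inverse v * (u - v)" using v0 by (simp add: field_simps)
  hence "u / v \<in> unit_level n"
    using u units_divide units_pp0[of "inverse v"] pp_mult_0[of "inverse v" "u - v"] by (simp add: unit_level_def)
  hence "\<tau> (u / v) = 1" using assms(2) mult_cond_le_iff[OF c] by blast
  moreover have "\<tau> (u / v * v) = \<tau> (u / v) * \<tau> v" using c u units_divide unfolding mult_char_on_def by blast
  ultimately show ?thesis using v0 by simp
qed

section \<open>Isotypic functions on rows and their orbits\<close>

locale principal_eta = principal \<pi> \<epsilon> \<psi> \<mu> for \<pi> :: "'a::nonarch_local_field" and \<epsilon> \<psi> \<mu> +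
  fixes \<eta> :: "'a \<Rightarrow> complex"
  assumes eta: "mult_char_on integer_units \<eta>"
begin

definition \<Gamma> :: "nat \<Rightarrow> 'a \<Rightarrow> 'a \<Rightarrow> 'a \<Rightarrow> 'a \<Rightarrow> bool" where
  "\<Gamma> m a b c d \<longleftrightarrow> sl2 a b c d \<and> c \<in> prime_power (int m)"

definition etah :: "'a \<Rightarrow> complex" where
  "etah d = (if d \<in> integer_units then \<eta> d else 1)"

lemma eta_mult: "u \<in> integer_units \<Longrightarrow> v \<in> integer_units \<Longrightarrow> \<eta> (u * v) = \<eta> u * \<eta> v"
  using eta by (simp add: mult_char_on_def)

lemma eta_nz: "u \<in> integer_units \<Longrightarrow> \<eta> u \<noteq> 0"
  using eta by (simp add: mult_char_on_def)

lemma eta_1: "\<eta> 1 = 1" using mult_char_1[OF eta] by simp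

lemma Gamma_mult: "\<Gamma> m a b c d \<Longrightarrow> \<Gamma> m a' b' c' d' \<Longrightarrow> \<Gamma> m (a * a' + b * c') (a * b' + b * d') (c * a' + d * c') (c * b' + d * d')"
proof -
  assume *: "\<Gamma> m a b c d" "\<Gamma> m a' b' c' d'"
  have "a' * c + d * c' \<in> prime_power (int m)"
    using * by (intro pp_add pp_mult_0) (auto simp: \<Gamma>_def sl2_def)
  hence "c * a' + d * c' \<in> prime_power (int m)" by (simp add: mult.commute)
  thus ?thesis using * sl2_mult unfolding \<Gamma>_def by blast
qed

lemma Gamma_inv: "\<Gamma> m a b c d \<Longrightarrow> \<Gamma> m d (- b) (- c) a"
  by (simp add: \<Gamma>_def sl2_def mult.commute)

lemma Gamma_1: "\<Gamma> m 1 0 0 1"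
  by (simp add: \<Gamma>_def sl2_def)

lemma Gamma_unit:
  assumes "\<Gamma> m a b c d" "m \<ge> 1"
  shows "a \<in> integer_units" "d \<in> integer_units" "c \<in> prime_power 1"
proof -
  show c: "c \<in> prime_power 1" using assms pp_mono[of 1 "int m" c] by (auto simp: \<Gamma>_def)
  have "b * c \<in> prime_power 1" using assms c by (intro pp_mult_0) (auto simp: \<Gamma>_def sl2_def)
  hence "1 + b * c \<in> integer_units" using units_add_pp[OF units_1] by blast
  moreover have "a * d = 1 + b * c" using assms by (simp add: \<Gamma>_def sl2_def algebra_simps)
  ultimately show "a \<in> integer_units" "d \<in> integer_units" using assms units_mult_iff[of a d] by (auto simp: \<Gamma>_def sl2_def)
qed

lemma eta_trivial: "mult_cond \<eta> = 0 \<Longrightarrow> u \<in> integer_units \<Longrightarrow> \<eta> u = 1"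
  using mult_cond_le_iff[OF eta, of 0] by (simp add: unit_level_0)

text \<open>The term c b' lies in P^m, so \<eta> does not distinguish the new lower right entry from
  d d'. For m = 0 the character is trivial and \<open>etah\<close> is 1 even at non-units.\<close>

lemma etah_mult:
  assumes "mult_cond \<eta> \<le> m" "\<Gamma> m a b c d" "\<Gamma> m a' b' c' d'"
  shows "etah (c * b' + d * d') = etah d * etah d'"
proof (cases "m = 0")
  case True
  hence "etah x = 1" for x using assms(1) eta_trivial by (simp add: etah_def)
  thus ?thesis by simp
next
  case False
  hence u: "d \<in> integer_units" "d' \<in> integer_units" "c * b' + d * d' \<in> integer_units"
    using Gamma_unit(2) Gamma_mult[OF assms(2,3)] assms by (metis less_one linorder_not_le)+
  have "b' * c \<in> prime_power (int m)" using assms by (intro pp_mult_0) (auto simp: \<Gamma>_def sl2_def)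
  hence "(c * b' + d * d') - d * d' \<in> prime_power (int m)" by (simp add: mult.commute)
  hence "\<eta> (c * b' + d * d') = \<eta> (d * d')" using u assms(1) by (intro char_cong[OF eta]) (auto intro: units_mult)
  thus ?thesis using u by (simp add: etah_def eta_mult)
qed

text \<open>Functions on primitive rows corresponding to the isotypic vectors of level \<open>m\<close>.\<close>

definition row_space :: "nat \<Rightarrow> ('a \<Rightarrow> 'a \<Rightarrow> complex) \<Rightarrow> bool" where
  "row_space m \<Phi> \<longleftrightarrow> homog \<Phi> \<and> (\<forall>x y a b c d. prim x y \<longrightarrow> \<Gamma> m a b c d \<longrightarrow> \<Phi> (x * a + y * c) (x * b + y * d) = etah d * \<Phi> x y)"

text \<open>The row (x, y) is v (X, 1) times the matrix. The witnesses stay explicit because the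
  value of an isotypic function at (x, y) is expressed through v and d.\<close>

definition orb :: "nat \<Rightarrow> 'a \<Rightarrow> 'a \<Rightarrow> 'a \<Rightarrow> 'a \<Rightarrow> 'a \<Rightarrow> 'a \<Rightarrow> 'a \<Rightarrow> 'a \<Rightarrow> bool" where
  "orb m X x y v a b c d \<longleftrightarrow> v \<in> integer_units \<and> \<Gamma> m a b c d \<and> x = v * (X * a + c) \<and> y = v * (X * b + d)"

text \<open>A stabilising matrix multiplies the value of an isotypic function at (X, 1) by \<eta>
  (d), while homogeneity multiplies it by the inverse of \<mu> v. A nonzero value demands that the
  two agree on the whole stabiliser.\<close>

definition adm :: "nat \<Rightarrow> 'a \<Rightarrow> bool" where
  "adm m X \<longleftrightarrow> (\<forall>v a b c d. v \<in> integer_units \<longrightarrow> \<Gamma> m a b c d \<longrightarrow> X * a + c = v * X \<longrightarrow> X * b + d = v \<longrightarrow> etah d * \<mu> v = 1)"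

definition orb_fun :: "nat \<Rightarrow> 'a \<Rightarrow> 'a \<Rightarrow> 'a \<Rightarrow> complex" where
  "orb_fun m X x y = (if \<exists>v a b c d. orb m X x y v a b c d
     then THE z. \<exists>v a b c d. orb m X x y v a b c d \<and> z = inverse (\<mu> v) * etah d else 0)"

lemma prim_X1: "X \<in> prime_power 0 \<Longrightarrow> prim X 1"
  by (simp add: prim_def)

lemma orb_prim:
  assumes "X \<in> prime_power 0" "\<Gamma> m a b c d"
  shows "prim (X * a + c) (X * b + d)"
proof -
  have "sl2 1 0 X 1" using assms by (simp add: sl2_def)
  from sl2_prim[OF sl2_mult[OF this]] assms(2) show ?thesis unfolding \<Gamma>_def by fastforce
qed

lemma row_space_orb:
  assumes W: "row_space m \<Phi>" and X: "X \<in> prime_power 0" and o: "orb m X x y v a b c d"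
  shows "\<Phi> x y = inverse (\<mu> v) * (etah d * \<Phi> X 1)"
proof -
  have v: "v \<in> integer_units" "v \<noteq> 0" and G: "\<Gamma> m a b c d" using o units_nz by (auto simp: orb_def)
  have "\<mu> v * \<Phi> (v * (X * a + c)) (v * (X * b + d)) = \<Phi> (X * a + c) (X * b + d)"
    using W v orb_prim[OF X G] by (simp add: row_space_def homog_def)
  also have "\<dots> = etah d * \<Phi> X 1"
    using W prim_X1[OF X] G unfolding row_space_def by (metis mult_1)
  finally show ?thesis using o mu_nz[OF v(2)] unfolding orb_def by (simp add: field_simps)
qed

lemma row_space_nonadm:
  assumes W: "row_space m \<Phi>" and X: "X \<in> prime_power 0" and n: "\<not> adm m X"
  shows "\<Phi> X 1 = 0"
proof -
  obtain v a b c d where *: "v \<in> integer_units" "\<Gamma> m a b c d" "X * a + c = v * X" "X * b + d = v" "etah d * \<mu> v \<noteq> 1"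
    using n by (auto simp: adm_def)
  have v0: "v \<noteq> 0" using * units_nz by blast
  have iv: "\<mu> (inverse v) = inverse (\<mu> v)" by (rule mu_inverse[OF v0])
  have "orb m X X 1 (inverse v) a b c d" unfolding orb_def *(3,4) using * v0 by simp
  from row_space_orb[OF W X this] have "\<Phi> X 1 = \<mu> v * etah d * \<Phi> X 1" by (simp add: iv)
  moreover have "\<mu> v * etah d \<noteq> 1" using *(5) by (simp add: mult.commute)
  ultimately show ?thesis by (simp add: mult_ac)
qed

text \<open>The first matrix times the inverse of the second fixes (X, 1) up to w = v2 / v1, so
  admissibility compares the two values.\<close>

lemma orb_unique:
  assumes ad: "adm m X" and e: "mult_cond \<eta> \<le> m" and o: "orb m X x y v1 a1 b1 c1 d1" "orb m X x y v2 a2 b2 c2 d2"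
  shows "inverse (\<mu> v1) * etah d1 = inverse (\<mu> v2) * etah d2"
proof -
  have v: "v1 \<in> integer_units" "v2 \<in> integer_units" "v1 \<noteq> 0" "v2 \<noteq> 0" using o units_nz by (auto simp: orb_def)
  have G: "\<Gamma> m a1 b1 c1 d1" "\<Gamma> m a2 b2 c2 d2" using o by (auto simp: orb_def)
  have d2: "a2 * d2 - b2 * c2 = 1" using G by (simp add: \<Gamma>_def sl2_def)
  define a b c d where "a = a1 * d2 + b1 * - c2" and "b = a1 * - b2 + b1 * a2" and "c = c1 * d2 + d1 * - c2" and "d = c1 * - b2 + d1 * a2"
  have Gm: "\<Gamma> m a b c d" unfolding a_def b_def c_def d_def by (rule Gamma_mult[OF G(1) Gamma_inv[OF G(2)]])
  define w where "w = v2 / v1"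
  have w: "w \<in> integer_units" "w \<noteq> 0" using v units_divide by (auto simp: w_def)
  have e1: "X * a1 + c1 = w * (X * a2 + c2)" "X * b1 + d1 = w * (X * b2 + d2)"
    using o v by (auto simp: orb_def w_def field_simps)
  have "X * a + c = (X * a1 + c1) * d2 - (X * b1 + d1) * c2" by (simp add: a_def c_def algebra_simps)
  also have "\<dots> = w * X * (a2 * d2 - b2 * c2)" unfolding e1 by (simp add: algebra_simps)
  finally have f1: "X * a + c = w * X" by (simp add: d2)
  have "X * b + d = (X * b1 + d1) * a2 - (X * a1 + c1) * b2" by (simp add: b_def d_def algebra_simps)
  also have "\<dots> = w * (a2 * d2 - b2 * c2)" unfolding e1 by (simp add: algebra_simps)
  finally have f2: "X * b + d = w" by (simp add: d2)
  have 1: "etah d * \<mu> w = 1" using ad w Gm f1 f2 by (simp add: adm_def)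
  have "c * b2 + d * d2 = d1 * (a2 * d2 - b2 * c2)" by (simp add: c_def d_def algebra_simps)
  hence "etah d1 = etah d * etah d2" using etah_mult[OF e Gm G(2)] d2 by simp
  moreover have "\<mu> v2 = \<mu> w * \<mu> v1" using mu_mult[OF w(2) v(3)] v by (simp add: w_def)
  ultimately show ?thesis using 1 mu_nz[OF w(2)] mu_nz[OF v(3)] by (simp add: field_simps)
qed

lemma orb_fun_eval:
  assumes ad: "adm m X" and e: "mult_cond \<eta> \<le> m" and o: "orb m X x y v a b c d"
  shows "orb_fun m X x y = inverse (\<mu> v) * etah d"
proof -
  have "(THE z. \<exists>v a b c d. orb m X x y v a b c d \<and> z = inverse (\<mu> v) * etah d) = inverse (\<mu> v) * etah d"
    by (rule the_equality) (use o orb_unique[OF ad e _ o] in blast)+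
  thus ?thesis using o by (auto simp: orb_fun_def)
qed

lemma orb_scale: "w \<in> integer_units \<Longrightarrow> orb m X x y v a b c d \<Longrightarrow> orb m X (w * x) (w * y) (w * v) a b c d"
  by (auto simp: orb_def units_mult)

lemma orb_right: "\<Gamma> m a' b' c' d' \<Longrightarrow> orb m X x y v a b c d \<Longrightarrow>
    orb m X (x * a' + y * c') (x * b' + y * d') v (a * a' + b * c') (a * b' + b * d') (c * a' + d * c') (c * b' + d * d')"
  unfolding orb_def by (elim conjE, intro conjI Gamma_mult) (simp_all add: algebra_simps)

lemma orb_fun_row_space:
  assumes ad: "adm m X" and e: "mult_cond \<eta> \<le> m"
  shows "row_space m (orb_fun m X)"
  unfolding row_space_def homog_def
proof (intro conjI allI impI)
  fix w x y :: 'a assume w: "w \<in> integer_units"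
  hence w0: "w \<noteq> 0" using units_nz by blast
  show "\<mu> w * orb_fun m X (w * x) (w * y) = orb_fun m X x y"
  proof (cases "\<exists>v a b c d. orb m X x y v a b c d")
    case True
    then obtain v a b c d where o: "orb m X x y v a b c d" by blast
    have "v \<noteq> 0" using o units_nz by (auto simp: orb_def)
    thus ?thesis using orb_fun_eval[OF ad e o] orb_fun_eval[OF ad e orb_scale[OF w o]] w0 mu_nz[OF w0]
      by (simp add: mu_mult)
  next
    case False
    have "\<nexists>v a b c d. orb m X (w * x) (w * y) v a b c d"
    proof
      assume "\<exists>v a b c d. orb m X (w * x) (w * y) v a b c d"
      then obtain v a b c d where "orb m X (w * x) (w * y) v a b c d" by blast
      from orb_scale[OF units_inverse[THEN iffD2, OF w] this] show False using w0 False by (simp flip: mult.assoc)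
    qed
    thus ?thesis using False by (simp add: orb_fun_def)
  qed
next
  fix x y a' b' c' d' :: 'a assume G: "\<Gamma> m a' b' c' d'"
  hence det: "a' * d' - b' * c' = 1" by (simp add: \<Gamma>_def sl2_def)
  show "orb_fun m X (x * a' + y * c') (x * b' + y * d') = etah d' * orb_fun m X x y"
  proof (cases "\<exists>v a b c d. orb m X x y v a b c d")
    case True
    then obtain v a b c d where o: "orb m X x y v a b c d" by blast
    hence "\<Gamma> m a b c d" by (simp add: orb_def)
    thus ?thesis using orb_fun_eval[OF ad e o] orb_fun_eval[OF ad e orb_right[OF G o]] etah_mult[OF e _ G] by simp
  next
    case False
    have "\<nexists>v a b c d. orb m X (x * a' + y * c') (x * b' + y * d') v a b c d"
    proof
      assume "\<exists>v a b c d. orb m X (x * a' + y * c') (x * b' + y * d') v a b c d"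
      then obtain v a b c d where o: "orb m X (x * a' + y * c') (x * b' + y * d') v a b c d" by blast
      have "(x * a' + y * c') * d' + (x * b' + y * d') * - c' = x * (a' * d' - b' * c')"
        "(x * a' + y * c') * - b' + (x * b' + y * d') * a' = y * (a' * d' - b' * c')" by (simp_all add: algebra_simps)
      with orb_right[OF Gamma_inv[OF G] o] show False using False by (simp add: det)
    qed
    thus ?thesis using False by (simp add: orb_fun_def)
  qed
qed

lemma orb_fun_self: "adm m X \<Longrightarrow> mult_cond \<eta> \<le> m \<Longrightarrow> orb_fun m X X 1 = 1"
  using orb_fun_eval[of m X X 1 1 1 0 0 1] Gamma_1 by (simp add: orb_def mu_1 etah_def eta_1)

definition nonsq :: 'a where "nonsq = (SOME u. u \<in> integer_units \<and> rho u = -1)"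

lemma nonsq: "nonsq \<in> integer_units" "rho nonsq = -1" "\<nexists>y. nonsq = y\<^sup>2"
proof -
  show 1: "nonsq \<in> integer_units" "rho nonsq = -1"
    using someI_ex[OF ex_nonsquare_unit] unfolding nonsq_def by blast+
  show "\<nexists>y. nonsq = y\<^sup>2" using 1(2) by (auto simp: rho_def split: if_splits)
qed

text \<open>Representatives \<open>(X, 1)\<close> of the orbits of the congruence subgroup and the units on primitive rows.\<close>

definition pt :: "nat \<Rightarrow> nat \<times> bool \<Rightarrow> 'a" where
  "pt m = (\<lambda>(i, t). if i = m then 0 else \<pi> ^ i * (if t then nonsq else 1))"

text \<open>Units modulo squares distinguish orbits only strictly between the ends. For m >= 1 all
  rows with unit first entry form the orbit of (1, 1), and level m belongs to (0, 1); for m = 0 the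
  orbit of (0, 1) is the only one.\<close>

definition idx :: "nat \<Rightarrow> (nat \<times> bool) set" where
  "idx m = (\<lambda>i. (i, False)) ` {..m} \<union> (\<lambda>i. (i, True)) ` {0<..<m}"

lemma pt_props:
  assumes "(i, t) \<in> idx m"
  shows "i \<le> m" "pt m (i, t) \<in> prime_power (int i)" "i < m \<Longrightarrow> pt m (i, t) \<noteq> 0" "i < m \<Longrightarrow> oval (pt m (i, t)) = int i"
    "pt m (i, t) \<in> prime_power 0"
proof -
  show "i \<le> m" using assms by (auto simp: idx_def)
  show 1: "i < m \<Longrightarrow> pt m (i, t) \<noteq> 0" "i < m \<Longrightarrow> oval (pt m (i, t)) = int i"
    using nonsq(1) by (auto simp: pt_def oval_mult oval_power integer_units_iff)
  show 2: "pt m (i, t) \<in> prime_power (int i)"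
    using 1 \<open>i \<le> m\<close> by (cases "i < m") (auto simp: prime_power_iff pt_def)
  show "pt m (i, t) \<in> prime_power 0" using 2 pp_mono[of 0 "int i"] by simp
qed

lemma orbits_cover:
  assumes xy: "prim x y"
  shows "\<exists>q\<in>idx m. \<exists>v a b c d. orb m (pt m q) x y v a b c d"
proof (cases "m = 0")
  case True
  obtain a b where "sl2 a b x y" using prim_sl2[OF xy] by blast
  hence "orb m (pt m (0, False)) x y 1 a b x y" using True by (auto simp: orb_def \<Gamma>_def pt_def sl2_def)
  moreover have "(0, False) \<in> idx m" by (auto simp: idx_def)
  ultimately show ?thesis by blast
next
  case m: False
  show ?thesis
  proof (cases "x \<in> integer_units")
    case True
    have "orb m (pt m (0, False)) x y 1 x (y - inverse x) 0 (inverse x)"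
      using m True units_nz[OF True] units_pp0[OF True] units_pp0[of "inverse x"] xy
      by (auto simp: orb_def \<Gamma>_def pt_def sl2_def prim_def intro: pp_diff)
    moreover have "(0, False) \<in> idx m" by (auto simp: idx_def)
    ultimately show ?thesis by blast
  next
    case False
    hence y: "y \<in> integer_units" "y \<noteq> 0" and x0: "x \<in> prime_power 0" using xy units_nz by (auto simp: prim_def)
    have x1: "x \<in> prime_power 1" using False x0 units_iff_pp by blast
    show ?thesis
    proof (cases "x \<in> prime_power (int m)")
      case True
      have "orb m (pt m (m, False)) x y 1 (inverse y) 0 x y"
        using True x0 y units_pp0[OF y(1)] units_pp0[of "inverse y"] by (auto simp: orb_def \<Gamma>_def pt_def sl2_def)
      moreover have "(m, False) \<in> idx m" by (auto simp: idx_def)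
      ultimately show ?thesis by blast
    next
      case xm: False
      hence xn: "x \<noteq> 0" "oval x < int m" by (auto simp: prime_power_iff)
      hence ov: "1 \<le> oval x" using x1 by (simp add: prime_power_iff)
      define i where "i = nat (oval x)"
      have i: "0 < i" "i < m" "int i = oval x" using ov xn by (auto simp: i_def)
      \<comment> \<open>A diagonal matrix with entries z and 1/z together with the scalar y z
        multiplies X by y z^2 and 1 by y, so only the square class of the unit \<open>w\<close>
        matters.\<close>
      define w where "w = x / (y * \<pi> ^ i)"
      have w: "w \<in> integer_units" "x = y * \<pi> ^ i * w"
        using xn y i by (auto simp: w_def integer_units_iff oval_divide oval_mult oval_power)
      have main: "\<exists>q\<in>idx m. \<exists>v a b c d. orb m (pt m q) x y v a b c d"
        if z: "w = (if t then nonsq else 1) * z\<^sup>2" "z \<in> integer_units" for t z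
      proof -
        have z0: "z \<noteq> 0" using z units_nz by blast
        have "orb m (pt m (i, t)) x y (y * z) z 0 0 (inverse z)"
          using y z z0 w i units_pp0[OF z(2)] units_pp0[of "inverse z"] units_mult[OF y(1) z(2)]
          by (auto simp: orb_def \<Gamma>_def pt_def sl2_def power2_eq_square)
        moreover have "(i, t) \<in> idx m" using i by (cases t) (auto simp: idx_def)
        ultimately show ?thesis by blast
      qed
      show ?thesis
      proof (cases "\<exists>z. w = z\<^sup>2")
        case True
        then obtain z where "w = z\<^sup>2" by blast
        thus ?thesis using main[of False z] square_root_unit[OF w(1)] by simp
      next
        case False
        then obtain z where z: "w * nonsq = z\<^sup>2" using nonsquare_mult[OF w(1) False nonsq(1,3)] by blast
        have zu: "z \<in> integer_units" using square_root_unit[OF units_mult[OF w(1) nonsq(1)] z] .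
        have n0: "nonsq \<noteq> 0" using nonsq units_nz by blast
        have "w = nonsq * (z / nonsq)\<^sup>2" using z n0 by (simp add: power2_eq_square field_simps)
        thus ?thesis using main[of True "z / nonsq"] units_divide[OF zu nonsq(1)] by simp
      qed
    qed
  qed
qed

text \<open>As c lies in P^m, a valuation of X below m is preserved. Strictly between the ends, v is
  congruent to a modulo P^1, and therefore \<open>s t'\<close> is congruent to
  \<open>s t * a\<^sup>2\<close>, so the square classes agree too.\<close>

lemma orbits_distinct:
  assumes q: "(i, t) \<in> idx m" "(i', t') \<in> idx m" and o: "orb m (pt m (i, t)) (pt m (i', t')) 1 v a b c d"
  shows "(i, t) = (i', t')"
proof (cases "m = 0")
  case True
  thus ?thesis using q by (auto simp: idx_def)
next
  case m: False
  define X X' where "X = pt m (i, t)" and "X' = pt m (i', t')"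
  note P = pt_props[OF q(1), folded X_def] and P' = pt_props[OF q(2), folded X'_def]
  have v: "v \<in> integer_units" and G: "\<Gamma> m a b c d" and e: "X' = v * (X * a + c)" "1 = v * (X * b + d)"
    using o by (auto simp: orb_def X_def X'_def)
  have u: "a \<in> integer_units" "d \<in> integer_units" using Gamma_unit[OF G] m by auto
  have cm: "c \<in> prime_power (int m)" using G by (simp add: \<Gamma>_def)
  have v0: "v \<noteq> 0" "oval v = 0" and a0: "a \<noteq> 0" "oval a = 0" using v u by (auto simp: integer_units_iff)
  have ii: "i = i'"
  proof (cases "i < m")
    case True
    have Xa: "X * a \<noteq> 0" "oval (X * a) = int i" using P True a0 by (auto simp: oval_mult)
    have "c \<in> prime_power (oval (X * a) + 1)" using pp_mono[OF _ cm, of "int i + 1"] True Xa by simp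
    from oval_add_eq[OF this Xa(1)] have "X * a + c \<noteq> 0" "oval (X * a + c) = int i" using Xa by (auto simp: add.commute)
    hence X': "X' \<noteq> 0" "oval X' = int i" using e(1) v0 by (auto simp: oval_mult)
    have "i' \<noteq> m" using X' by (auto simp: X'_def pt_def)
    hence "i' < m" using P' by simp
    thus ?thesis using P'(4) X' by simp
  next
    case False
    hence "i = m" using P by simp
    hence "X' = v * c" using e by (simp add: X_def pt_def)
    hence "X' \<in> prime_power (int m)" using pp_mult_0[OF units_pp0[OF v] cm] by simp
    hence "\<not> i' < m" using P'(3,4) by (cases "i' < m") (auto simp: prime_power_iff)
    thus ?thesis using \<open>i = m\<close> P' by simp
  qed
  show ?thesis
  proof (rule ccontr)
    assume ne: "(i, t) \<noteq> (i', t')"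
    hence tt: "t \<noteq> t'" using ii by auto
    hence im: "0 < i" "i < m" using q ii by (auto simp: idx_def)
    define s where "s t = (if t then nonsq else 1)" for t
    have su: "s t \<in> integer_units" for t using nonsq by (simp add: s_def)
    have XX: "X = \<pi> ^ i * s t" "X' = \<pi> ^ i * s t'" using im ii by (auto simp: X_def X'_def pt_def s_def)
    have "\<pi> ^ i * (c / \<pi> ^ i) \<in> prime_power (int m)" using cm by simp
    hence "c / \<pi> ^ i \<in> prime_power (int m - int i)" using pp_mult_iff[of "\<pi> ^ i" "c / \<pi> ^ i"] by (simp add: oval_power)
    hence c1: "c / \<pi> ^ i \<in> prime_power 1" using pp_mono[of 1 "int m - int i"] im by simp
    have st: "s t' - v * (s t * a) = v * (c / \<pi> ^ i)"
    proof -
      have "\<pi> ^ i * s t' = \<pi> ^ i * (v * (s t * a) + v * (c / \<pi> ^ i))" using e(1) XX by (simp add: field_simps)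
      thus ?thesis by simp
    qed
    have 1: "s t' - v * (s t * a) \<in> prime_power 1" unfolding st using pp_mult_0[OF units_pp0[OF v] c1] .
    have ad: "a * d = 1 + b * c" using G by (simp add: \<Gamma>_def sl2_def algebra_simps)
    have X1: "X \<in> prime_power 1" using P(2) pp_mono[of 1 "int i"] im by simp
    have b0: "b \<in> prime_power 0" using G by (simp add: \<Gamma>_def sl2_def)
    have "v - a = v * ((1 - a * d) - a * (b * X))"
    proof -
      have "v * ((1 - a * d) - a * (b * X)) = v - a * (v * (X * b + d))" by (simp add: algebra_simps)
      thus ?thesis using e(2) by simp
    qed
    moreover have "1 - a * d = - (b * c)" using ad by simp
    moreover have "- (b * c) \<in> prime_power 1" "a * (b * X) \<in> prime_power 1"
      using pp_mult_0[OF b0 Gamma_unit(3)[OF G]] pp_mult_0[OF units_pp0[OF u(1)] pp_mult_0[OF b0 X1]] m by auto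
    ultimately have 2: "v - a \<in> prime_power 1" using pp_mult_0[OF units_pp0[OF v]] pp_diff by metis
    have 3: "v * (s t * a) - s t * a\<^sup>2 \<in> prime_power 1"
    proof -
      have "v * (s t * a) - s t * a\<^sup>2 = (s t * a) * (v - a)" by (simp add: power2_eq_square algebra_simps)
      thus ?thesis using pp_mult_0[OF units_pp0[OF units_mult[OF su u(1)]] 2] by simp
    qed
    have "s t' - s t * a\<^sup>2 \<in> prime_power 1" using pp_trans[OF 1 3] .
    hence "rho (s t') = rho (s t * a\<^sup>2)" using su u by (intro rho_cong units_mult units_power) auto
    also have "\<dots> = rho (s t)"
      using rho_mult[OF su units_power[OF u(1), of 2], of t] by (auto simp: rho_def)
    finally have "rho (s t') = rho (s t)" .
    thus False using tt nonsq(2) rho_1 by (cases t; cases t') (auto simp: s_def)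
  qed
qed

end

section \<open>Admissible orbits\<close>

text \<open>Admissibility of the orbits of level \<open>i\<close>: the stabiliser of \<open>(X, 1)\<close> with \<open>X\<close> of valuation \<open>i\<close> is
  parametrised by the eigenvalue \<open>v\<close>, and its lower right entry is close to \<open>v\<^sup>-\<^sup>1\<close> if \<open>i \<le> m - i\<close> and to \<open>v\<close>
  if \<open>m - i \<le> i\<close>.\<close>

definition level_cond :: "nat \<Rightarrow> nat \<Rightarrow> nat \<Rightarrow> nat \<Rightarrow> nat \<Rightarrow> bool" where
  "level_cond e c1 c2 m i \<longleftrightarrow> (i \<le> m - i \<longrightarrow> e \<le> m - i \<and> c2 \<le> i) \<and> (m - i \<le> i \<longrightarrow> e \<le> i \<and> c1 \<le> m - i)"

context principal_eta
begin

abbreviation "\<chi>1 \<equiv> \<lambda>x. \<eta> x * \<mu> x"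
abbreviation "\<chi>2 \<equiv> \<lambda>x. \<eta> x * inverse (\<mu> x)"

lemma chi1: "mult_char_on integer_units (\<lambda>x. \<eta> x * \<mu> x)"
  using eta mu_units unfolding mult_char_on_def by (auto intro: continuous_on_mult)

lemma chi2: "mult_char_on integer_units (\<lambda>x. \<eta> x * inverse (\<mu> x))"
  using eta mu_units unfolding mult_char_on_def by (auto intro!: continuous_on_mult continuous_on_inverse)

text \<open>This is where the parity condition enters. For n > 0 one of the factors of (u - 1) (u +
  1) is a unit because 2 is, so u is congruent to 1 or to -1 modulo P^n.\<close>

lemma char_plus_minus:
  assumes c: "mult_char_on integer_units \<tau>" and m1: "\<tau> (-1) = 1" and n: "mult_cond \<tau> \<le> n"
    and u: "u \<in> integer_units" "u - inverse u \<in> prime_power (int n)"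
  shows "\<tau> (u::'a) = 1"
proof -
  have t1: "\<tau> 1 = 1" using mult_char_1[OF c] by simp
  have "n = 0 \<or> u - 1 \<in> prime_power (int n) \<or> u + 1 \<in> prime_power (int n)"
  proof (cases "n = 0")
    case False
    have "(u - 1) * (u + 1) = u * (u - inverse u)" using units_nz[OF u(1)] by (simp add: field_simps)
    hence p: "(u - 1) * (u + 1) \<in> prime_power (int n)" using pp_mult_0[OF units_pp0[OF u(1)] u(2)] by simp
    show ?thesis
    proof (cases "u - 1 \<in> integer_units")
      case True
      thus ?thesis using p units_pp_mult_iff[OF True] by blast
    next
      case F: False
      have "u - 1 \<in> prime_power 0" using pp_diff[OF units_pp0[OF u(1)], of 1] by simp
      hence "u - 1 \<in> prime_power 1" using F units_iff_pp by blast
      hence "2 + (u - 1) \<in> integer_units" by (rule units_add_pp[OF unit_2])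
      hence "u + 1 \<in> integer_units" by (simp add: algebra_simps)
      thus ?thesis using p units_pp_mult_iff[of "u + 1" "u - 1"] by (simp add: mult.commute)
    qed
  qed simp
  thus ?thesis
  proof (elim disjE)
    assume "n = 0"
    thus ?thesis using u n mult_cond_le_iff[OF c, of n] by (simp add: unit_level_0)
  next
    assume "u - 1 \<in> prime_power (int n)"
    thus ?thesis using char_cong[OF c n u(1) units_1] t1 by simp
  next
    assume "u + 1 \<in> prime_power (int n)"
    thus ?thesis using char_cong[OF c n u(1), of "-1"] m1 by simp
  qed
qed

text \<open>The stabiliser of (X, 1) up to scalars, parametrised by v and b: the second coordinate
  gives d = v - X b, the determinant gives a = 1/v + X b, and the first coordinate then gives the
  entry c required to lie in P^m.\<close>

lemma adm_use:
  assumes ad: "adm m X" and v: "v \<in> integer_units" and b: "b \<in> prime_power 0" and X: "X \<in> prime_power 0"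
    and c: "X * (v - inverse v) - X\<^sup>2 * b \<in> prime_power (int m)"
  shows "etah (v - X * b) * \<mu> v = 1"
proof -
  have v0: "v \<noteq> 0" using units_nz v by blast
  have Xb: "X * b \<in> prime_power 0" using pp_mult_0[OF X b] .
  have c0: "X * (v - inverse v) - X\<^sup>2 * b \<in> prime_power 0" using c pp_mono[of 0 "int m"] by simp
  have "\<Gamma> m (inverse v + X * b) b (X * (v - inverse v) - X\<^sup>2 * b) (v - X * b)"
    unfolding \<Gamma>_def sl2_def
  proof (intro conjI)
    show "inverse v + X * b \<in> prime_power 0" "v - X * b \<in> prime_power 0"
      using v Xb units_pp0[of v] units_pp0[of "inverse v"] pp_add pp_diff by auto
    show "(inverse v + X * b) * (v - X * b) - b * (X * (v - inverse v) - X\<^sup>2 * b) = 1"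
      using v0 by (simp add: field_simps power2_eq_square)
  qed (use b c c0 in auto)
  moreover have "X * (inverse v + X * b) + (X * (v - inverse v) - X\<^sup>2 * b) = v * X"
    by (simp add: algebra_simps power2_eq_square)
  moreover have "X * b + (v - X * b) = v" by simp
  ultimately show ?thesis using ad v unfolding adm_def by blast
qed

lemma eta_mu_minus_one:
  assumes "\<eta> (-1) = \<mu> (-1)"
  shows "\<eta> (-1) * \<mu> (-1) = 1" "\<eta> (-1) * inverse (\<mu> (-1)) = 1"
proof -
  have "\<mu> (-1) * \<mu> (-1) = 1" using mu_mult[of "-1" "-1"] mu_1 by simp
  thus "\<eta> (-1) * \<mu> (-1) = 1" "\<eta> (-1) * inverse (\<mu> (-1)) = 1" using assms mu_nz[of "-1"] by auto
qed

text \<open>In \<eta> (d) \<mu> (v) the entry d is replaced by 1/a and then by 1/v if i <= m - i,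
  and directly by v otherwise. The bounds on the conductor of \<eta> license these replacements, and
  \<open>char_plus_minus\<close> disposes of the remaining value at v.\<close>

lemma level_cond_adm:
  assumes q: "(i, t) \<in> idx m" and m: "m \<ge> 1" and e: "mult_cond \<eta> \<le> m" and par: "\<eta> (-1) = \<mu> (-1)"
    and A: "level_cond (mult_cond \<eta>) (mult_cond \<chi>1) (mult_cond \<chi>2) m i"
  shows "adm m (pt m (i, t))"
  unfolding adm_def
proof (intro allI impI)
  define X where "X = pt m (i, t)"
  note P = pt_props[OF q, folded X_def]
  fix v a b c d assume v: "v \<in> integer_units" and G: "\<Gamma> m a b c d"
    and "pt m (i, t) * a + c = v * pt m (i, t)" and "pt m (i, t) * b + d = v"
  hence e1: "X * a + c = v * X" and e2: "X * b + d = v" by (simp_all add: X_def)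
  have det: "a * d - b * c = 1" and b0: "b \<in> prime_power 0" and cm: "c \<in> prime_power (int m)" using G by (auto simp: \<Gamma>_def sl2_def)
  have u: "a \<in> integer_units" "d \<in> integer_units" using Gamma_unit[OF G m] by auto
  have v0: "v \<noteq> 0" and a0: "a \<noteq> 0" using units_nz v u by auto
  have "v * (a - X * b) = 1"
  proof -
    have "v * (a - X * b) = a * (X * b + d) - b * (v * X)" unfolding e2 by (simp add: algebra_simps)
    also have "\<dots> = a * d - b * c" unfolding e1[symmetric] by (simp add: algebra_simps)
    finally show ?thesis using det by simp
  qed
  hence iv: "inverse v = a - X * b" by (simp add: inverse_unique)
  have "X * (v - a) = c" using e1 by (simp add: algebra_simps)
  have va: "v - a \<in> prime_power (int (m - i))"
  proof (cases "i < m")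
    case True
    have "X * (v - a) \<in> prime_power (int m)" using cm \<open>X * (v - a) = c\<close> by simp
    thus ?thesis using pp_mult_iff[OF P(3)[OF True], of "v - a" "int m"] P(4)[OF True] True by (simp add: of_nat_diff)
  next
    case False
    thus ?thesis using P(1) pp_diff[OF units_pp0[OF v] units_pp0[OF u(1)]] by simp
  qed
  have Xb: "X * b \<in> prime_power (int i)" using pp_mult_0[OF b0 P(2)] by (simp add: mult.commute)
  have vv: "v - inverse v = (v - a) + X * b" unfolding iv by simp
  have "etah d * \<mu> v = 1"
  proof (cases "i \<le> m - i")
    case True
    hence A': "mult_cond \<eta> \<le> m - i" "mult_cond \<chi>2 \<le> i" using A by (auto simp: level_cond_def)
    have "v - inverse v \<in> prime_power (int i)" unfolding vv using True by (intro pp_add Xb pp_mono[OF _ va]) simp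
    from char_plus_minus[OF chi2 eta_mu_minus_one(2)[OF par] A'(2) v this] have 1: "\<eta> v * inverse (\<mu> v) = 1" .
    have "d - inverse a = inverse a * (b * c)" using a0 det by (simp add: field_simps)
    hence "d - inverse a \<in> prime_power (int m)" using pp_mult_0[OF _ pp_mult_0[OF b0 cm], of "inverse a"] u units_pp0[of "inverse a"] by simp
    hence "\<eta> d = \<eta> (inverse a)" using u by (intro char_cong[OF eta e]) auto
    also have "\<dots> = inverse (\<eta> a)" by (rule mult_char_inverse[OF eta u(1)])
    also have "\<eta> a = \<eta> v" using char_cong[OF eta A'(1) v u(1) va] by simp
    finally have "\<eta> d = inverse (\<mu> v)" using 1 mu_nz[OF v0] by (simp add: field_simps)
    thus ?thesis using u mu_nz[OF v0] by (simp add: etah_def)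
  next
    case False
    hence A': "mult_cond \<eta> \<le> i" "mult_cond \<chi>1 \<le> m - i" and le: "m - i \<le> i" using A by (auto simp: level_cond_def)
    have "v - inverse v \<in> prime_power (int (m - i))" unfolding vv using le by (intro pp_add va pp_mono[OF _ Xb]) simp
    from char_plus_minus[OF chi1 eta_mu_minus_one(1)[OF par] A'(2) v this] have 1: "\<eta> v * \<mu> v = 1" .
    have "v - d = X * b" using e2 by (simp add: algebra_simps)
    hence "\<eta> v = \<eta> d" using char_cong[OF eta A'(1) v u(2)] Xb by simp
    thus ?thesis using 1 u by (simp add: etah_def)
  qed
  thus "etah d * \<mu> v = 1" .
qed

text \<open>Each bound comes from special stabilisers in \<open>adm_use\<close>. Taking v = 1 and b
  = (1 - u) / X gives d = u and tests \<eta>; b = (v - 1/v) / X gives c = 0 and d = 1/v and tests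
  \<open>\<chi>2\<close>; b = 0 gives d = v and tests \<open>\<chi>1\<close>.\<close>

lemma adm_level_cond:
  assumes q: "(i, t) \<in> idx m" and m: "m \<ge> 1" and e: "mult_cond \<eta> \<le> m" and ad: "adm m (pt m (i, t))"
  shows "level_cond (mult_cond \<eta>) (mult_cond \<chi>1) (mult_cond \<chi>2) m i"
proof -
  define X where "X = pt m (i, t)"
  note P = pt_props[OF q, folded X_def]
  have ad: "adm m X" using ad by (simp add: X_def)
  have eta_le: "mult_cond \<eta> \<le> n" if n: "n \<le> m" "m \<le> n + i" "i \<le> n" and im: "i < m" for n
    unfolding mult_cond_le_iff[OF eta]
  proof
    fix u :: 'a assume "u \<in> unit_level n"
    hence u: "u \<in> integer_units" "u - 1 \<in> prime_power (int n)" by (auto simp: unit_level_def)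
    define b where "b = (1 - u) / X"
    have Xb: "X * b = 1 - u" using P(3)[OF im] by (simp add: b_def)
    have s: "1 - u \<in> prime_power (int n)" using u(2) by (simp add: pp_diff_commute)
    hence "X * b \<in> prime_power (int i)" unfolding Xb using pp_mono[of "int i" "int n"] n by simp
    hence b0: "b \<in> prime_power 0" using pp_mult_iff[OF P(3)[OF im], of b "int i"] P(4)[OF im] by simp
    have "X * (1 - inverse 1) - X\<^sup>2 * b = - (X * (1 - u))" unfolding Xb[symmetric] by (simp add: power2_eq_square)
    moreover have "X * (1 - u) \<in> prime_power (int m)" using pp_mult[OF P(2) s] pp_mono[of "int m" "int i + int n"] n by simp
    ultimately have "etah (1 - X * b) * \<mu> 1 = 1" by (intro adm_use[OF ad units_1 b0 P(5)]) simp
    thus "\<eta> u = 1" using u by (simp add: Xb mu_1 etah_def)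
  qed
  show ?thesis
    unfolding level_cond_def
  proof (intro conjI impI)
    assume le: "i \<le> m - i"
    hence im: "i < m" using m by simp
    show "mult_cond \<eta> \<le> m - i" using le im by (intro eta_le) auto
    show "mult_cond \<chi>2 \<le> i"
      unfolding mult_cond_le_iff[OF chi2]
    proof
      fix v :: 'a assume "v \<in> unit_level i"
      hence v: "v \<in> integer_units" "v - 1 \<in> prime_power (int i)" by (auto simp: unit_level_def)
      have v0: "v \<noteq> 0" using units_nz v by blast
      have "v - inverse v = (v - 1) + inverse v * (v - 1)" using v0 by (simp add: field_simps)
      also have "\<dots> \<in> prime_power (int i)" using v units_pp0[of "inverse v"] by (intro pp_add pp_mult_0) auto
      finally have vi: "v - inverse v \<in> prime_power (int i)" .
      define b where "b = (v - inverse v) / X"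
      have Xb: "X * b = v - inverse v" using P(3)[OF im] by (simp add: b_def)
      hence b0: "b \<in> prime_power 0" using vi pp_mult_iff[OF P(3)[OF im], of b "int i"] P(4)[OF im] by simp
      have "X * (v - inverse v) - X\<^sup>2 * b = 0" unfolding Xb[symmetric] by (simp add: power2_eq_square)
      hence "etah (v - X * b) * \<mu> v = 1" by (intro adm_use[OF ad v(1) b0 P(5)]) simp
      hence "\<eta> (inverse v) * \<mu> v = 1" using v by (simp add: Xb etah_def)
      hence "inverse (\<eta> v) * \<mu> v = 1" using mult_char_inverse[OF eta v(1)] by simp
      thus "\<eta> v * inverse (\<mu> v) = 1" using eta_nz[OF v(1)] mu_nz[OF v0] by (simp add: field_simps)
    qed
  next
    assume le: "m - i \<le> i"
    show "mult_cond \<eta> \<le> i"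
    proof (cases "i < m")
      case True
      thus ?thesis using le by (intro eta_le) auto
    qed (use e P(1) in simp)
    show "mult_cond \<chi>1 \<le> m - i"
      unfolding mult_cond_le_iff[OF chi1]
    proof
      fix v :: 'a assume "v \<in> unit_level (m - i)"
      hence v: "v \<in> integer_units" "v - 1 \<in> prime_power (int (m - i))" by (auto simp: unit_level_def)
      have v0: "v \<noteq> 0" using units_nz v by blast
      have "v - inverse v = (v - 1) + inverse v * (v - 1)" using v0 by (simp add: field_simps)
      also have "\<dots> \<in> prime_power (int (m - i))" using v units_pp0[of "inverse v"] by (intro pp_add pp_mult_0) auto
      finally have "X * (v - inverse v) \<in> prime_power (int i + int (m - i))" by (rule pp_mult[OF P(2)])
      hence "X * (v - inverse v) - X\<^sup>2 * 0 \<in> prime_power (int m)" using P(1) by (simp add: of_nat_diff)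
      hence "etah (v - X * 0) * \<mu> v = 1" by (intro adm_use[OF ad v(1) _ P(5)]) simp_all
      thus "\<eta> v * \<mu> v = 1" using v by (simp add: etah_def)
    qed
  qed
qed

lemma adm_iff:
  assumes q: "(i, t) \<in> idx m" and e: "mult_cond \<eta> \<le> m" and par: "\<eta> (-1) = \<mu> (-1)"
  shows "adm m (pt m (i, t)) \<longleftrightarrow> level_cond (mult_cond \<eta>) (mult_cond \<chi>1) (mult_cond \<chi>2) m i"
proof (cases "m = 0")
  case False
  thus ?thesis using adm_level_cond[OF q _ e] level_cond_adm[OF q _ e par] by auto
next
  case True
  have i: "i = 0" using q True by (auto simp: idx_def)
  have e0: "mult_cond \<eta> = 0" using e True by simp
  have X: "pt m (i, t) = 0" by (simp add: pt_def i True)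
  have eh: "etah d = 1" for d using eta_trivial[OF e0] by (simp add: etah_def)
  \<comment> \<open>For trivial \<eta> and m = 0 every unit v occurs as an eigenvalue, so
    admissibility says that \<mu> is unramified; \<open>\<chi>1\<close> and \<open>\<chi>2\<close>
    have conductor 0 in exactly this case.\<close>
  have "adm m 0 \<longleftrightarrow> (\<forall>v\<in>integer_units. \<mu> v = 1)"
  proof
    assume ad: "adm m 0"
    show "\<forall>v\<in>integer_units. \<mu> v = 1"
    proof
      fix v :: 'a assume "v \<in> integer_units"
      thus "\<mu> v = 1" using adm_use[OF ad, of v 0] by (simp add: eh)
    qed
  qed (auto simp: adm_def eh)
  moreover have "mult_cond \<chi>1 = 0 \<longleftrightarrow> (\<forall>v\<in>integer_units. \<mu> v = 1)"
    using mult_cond_le_iff[OF chi1, of 0] eta_trivial[OF e0] by (simp add: unit_level_0)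
  moreover have "mult_cond \<chi>2 = 0 \<longleftrightarrow> (\<forall>v\<in>integer_units. \<mu> v = 1)"
    using mult_cond_le_iff[OF chi2, of 0] eta_trivial[OF e0] by (simp add: unit_level_0)
  ultimately show ?thesis unfolding X level_cond_def using e0 i True by simp
qed

section \<open>Isotypic spaces and their dimension\<close>

abbreviation "V \<equiv> isotypic \<epsilon> \<psi> \<pi> R \<eta>"

lemma isotypic_iff:
  assumes "mult_cond \<eta> \<le> m"
  shows "f \<in> V m \<longleftrightarrow> f \<in> rep_space R \<and> (\<forall>a b c d g. \<Gamma> m a b c d \<longrightarrow> f (g \<odot> (kmat a b c d, sg c d)) = etah d * f g)"
proof -
  have ra: "rep_act R h f = (\<lambda>g. f (g \<odot> h))" and rs: "rep_scale R = fun_scale" for h f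
    by (simp_all add: principal_series_def)
  have "f \<in> V m \<longleftrightarrow> f \<in> rep_space R \<and> (\<forall>k\<in>K_grp \<epsilon> m. \<forall>g. f (g \<odot> (k, spl k)) = etah (k$2$2) * f g)"
    using assms by (simp add: isotypic_def splitting_eq ra rs fun_scale_def etah_def fun_eq_iff)
  moreover have "(\<forall>k\<in>K_grp \<epsilon> m. \<forall>g. f (g \<odot> (k, spl k)) = etah (k$2$2) * f g) \<longleftrightarrow>
     (\<forall>a b c d g. \<Gamma> m a b c d \<longrightarrow> f (g \<odot> (kmat a b c d, sg c d)) = etah d * f g)"
  proof (intro iffI allI impI ballI)
    fix a b c d g assume *: "\<forall>k\<in>K_grp \<epsilon> m. \<forall>g. f (g \<odot> (k, spl k)) = etah (k$2$2) * f g" and G: "\<Gamma> m a b c d"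
    have "kmat a b c d \<in> K_grp \<epsilon> m" using G by (simp add: kmat_in_K_iff \<Gamma>_def)
    hence "f (g \<odot> (kmat a b c d, spl (kmat a b c d))) = etah (kmat a b c d $ 2 $ 2) * f g" using * by blast
    thus "f (g \<odot> (kmat a b c d, sg c d)) = etah d * f g" using spl_kmat G by (simp add: \<Gamma>_def)
  next
    fix k :: "'a^2^2" and g assume *: "\<forall>a b c d g. \<Gamma> m a b c d \<longrightarrow> f (g \<odot> (kmat a b c d, sg c d)) = etah d * f g" and "k \<in> K_grp \<epsilon> m"
    then obtain a b c d where k: "k = kmat a b c d" "sl2 a b c d" "c \<in> prime_power (int m)" using K_cases by metis
    hence "\<Gamma> m a b c d" by (simp add: \<Gamma>_def)
    hence "f (g \<odot> (kmat a b c d, sg c d)) = etah d * f g" using * by blast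
    thus "f (g \<odot> (k, spl k)) = etah (k$2$2) * f g" using spl_kmat[OF k(2)] k(1) by simp
  qed
  ultimately show ?thesis by simp
qed

lemma Phi_of_row_space:
  assumes e: "mult_cond \<eta> \<le> m" and f: "f \<in> V m"
  shows "row_space m (\<Phi>_of f)"
  unfolding row_space_def
proof (intro conjI allI impI)
  have fr: "f \<in> rep_space R" using f isotypic_iff[OF e] by blast
  show "homog (\<Phi>_of f)" by (rule Phi_of_homog[OF fr])
  fix x y a b c d assume xy: "prim x y" and G: "\<Gamma> m a b c d"
  obtain a0 b0 where s: "sl2 a0 b0 x y" using prim_sl2[OF xy] by blast
  have s1: "sl2 a b c d" using G by (simp add: \<Gamma>_def)
  have K: "kmat a0 b0 x y \<in> K_grp \<epsilon> 0" "kmat a b c d \<in> K_grp \<epsilon> 0"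
    using s s1 by (auto simp: kmat_in_K_iff sl2_def)
  note s2 = sl2_mult[OF s s1]
  have "(kmat a0 b0 x y, sg x y) \<odot> (kmat a b c d, sg c d) =
     (kmat (a0 * a + b0 * c) (a0 * b + b0 * d) (x * a + y * c) (x * b + y * d), sg (x * a + y * c) (x * b + y * d))"
    using spl_mp_mult[OF K] spl_kmat[OF s] spl_kmat[OF s1] spl_kmat[OF s2] by (simp add: kmat_mult)
  hence "\<Phi>_of f (x * a + y * c) (x * b + y * d) = f ((kmat a0 b0 x y, sg x y) \<odot> (kmat a b c d, sg c d))"
    using Phi_of_eq[OF fr s2] by simp
  also have "\<dots> = etah d * f (kmat a0 b0 x y, sg x y)" using f isotypic_iff[OF e] G by blast
  finally show "\<Phi>_of f (x * a + y * c) (x * b + y * d) = etah d * \<Phi>_of f x y" using Phi_of_eq[OF fr s] by simp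
qed

lemma ps_fun_isotypic:
  assumes e: "mult_cond \<eta> \<le> m" and W: "row_space m \<Phi>"
  shows "ps_fun \<Phi> \<in> V m"
proof -
  have h: "homog \<Phi>" using W by (simp add: row_space_def)
  have right: "ps_fun \<Phi> (g \<odot> (kmat a b c d, sg c d)) = etah d * ps_fun \<Phi> g" if G: "\<Gamma> m a b c d" for a b c d g
    by (rule ps_fun_right[OF h]) (use W G in \<open>auto simp: row_space_def \<Gamma>_def\<close>)
  \<comment> \<open>The maximum with 1 makes every d congruent to 1 a unit even for m = 0. At this
    level \<eta> (d) = 1, so equivariance becomes invariance.\<close>
  define M where "M = max 1 m"
  have inv: "ps_fun \<Phi> (g \<odot> (k, spl k)) = ps_fun \<Phi> g"
    if k: "k \<in> K_grp \<epsilon> M" "k$2$2 - 1 \<in> prime_power (int M)" for g k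
  proof -
    obtain a b c d where k': "k = kmat a b c d" "sl2 a b c d" "c \<in> prime_power (int M)" using K_cases[OF k(1)] .
    have "\<Gamma> m a b c d" using k' pp_mono[of "int m" "int M" c] by (simp add: \<Gamma>_def M_def)
    moreover have d1: "d - 1 \<in> prime_power (int M)" using k k' by simp
    have "1 + (d - 1) \<in> integer_units" using d1 pp_mono[of 1 "int M"] by (intro units_add_pp) (auto simp: M_def)
    hence du: "d \<in> integer_units" by simp
    moreover have "\<eta> d = 1"
      using char_cong[OF eta _ du units_1 d1] e eta_1 by (simp add: M_def)
    ultimately show ?thesis using right[of a b c d g] k' spl_kmat[OF k'(2)] by (simp add: etah_def)
  qed
  have "ps_fun \<Phi> \<in> rep_space R"
    unfolding rep_space_iff
  proof (intro conjI allI impI ballI)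
    show "ps_fun \<Phi> g = 0" if "g \<notin> Mp" for g using that by (simp add: ps_fun_def)
    show "\<exists>U. openin (Mp_topology \<epsilon> \<psi> \<pi>) U \<and> g \<in> U \<and> (\<forall>h\<in>U. ps_fun \<Phi> h = ps_fun \<Phi> g)" if "g \<in> Mp" for g
      by (rule locally_constant_if_invariant[OF inv that])
    show "ps_fun \<Phi> (bor a e b \<odot> g) = e * \<theta> a * ps_fun \<Phi> g" if "a \<noteq> 0" "e \<in> {1, -1}" "g \<in> Mp" for a e b g
      using ps_fun_left[OF h that] .
  qed
  thus ?thesis using isotypic_iff[OF e] right by blast
qed

lemma zero_rep: "(\<lambda>_. 0) \<in> rep_space R"
  unfolding rep_space_iff
proof (intro conjI allI impI ballI)
  fix g :: "'a mp" assume g: "g \<in> Mp"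
  have "\<exists>U. openin (Mp_topology \<epsilon> \<psi> \<pi>) U \<and> g \<in> U \<and> (\<forall>h\<in>U. (\<lambda>_. 0 :: complex) h = (\<lambda>_. 0) g)"
    by (rule locally_constant_if_invariant[OF _ g, of 0]) simp
  thus "\<exists>U. openin (Mp_topology \<epsilon> \<psi> \<pi>) U \<and> g \<in> U \<and> (\<forall>h\<in>U. (0 :: complex) = 0)" by simp
qed auto

lemma ev_pt:
  assumes "X \<in> prime_power 0"
  shows "sl2 1 0 X 1" "sg X 1 = 1"
  using assms by (auto simp: sl2_def sg_def)

lemma rep_eq_0_if_points:
  assumes e: "mult_cond \<eta> \<le> m" and f: "f \<in> V m"
    and 0: "\<And>q. q \<in> idx m \<Longrightarrow> adm m (pt m q) \<Longrightarrow> f (kmat 1 0 (pt m q) 1, 1) = 0"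
  shows "f = (\<lambda>_. 0)"
proof (rule rep_space_eq_0I)
  show fr: "f \<in> rep_space R" using f isotypic_iff[OF e] by blast
  have W: "row_space m (\<Phi>_of f)" by (rule Phi_of_row_space[OF e f])
  fix x y assume xy: "prim x y"
  obtain q v a b c d where q: "q \<in> idx m" and o: "orb m (pt m q) x y v a b c d" using orbits_cover[OF xy] by blast
  have X: "pt m q \<in> prime_power 0" using pt_props(5)[of "fst q" "snd q"] q by simp
  have "\<Phi>_of f (pt m q) 1 = 0"
  proof (cases "adm m (pt m q)")
    case True
    thus ?thesis using 0[OF q] Phi_of_eq[OF fr ev_pt(1)[OF X]] ev_pt(2)[OF X] by simp
  next
    case False
    thus ?thesis by (rule row_space_nonadm[OF W X])
  qed
  thus "\<Phi>_of f x y = 0" using row_space_orb[OF W X o] by simp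
qed

text \<open>The orbit functions are dual to the evaluations at (X, 1), as distinct representatives
  lie in distinct orbits. Vanishing at the admissible representatives implies vanishing everywhere,
  because the other orbits carry no nonzero value.\<close>

lemma isotypic_dim:
  assumes e: "mult_cond \<eta> \<le> m" and par: "\<eta> (-1) = \<mu> (-1)"
  shows "has_dim fun_scale (V m) (card {q \<in> idx m. level_cond (mult_cond \<eta>) (mult_cond \<chi>1) (mult_cond \<chi>2) m (fst q)})"
proof -
  define P where "P = {q \<in> idx m. adm m (pt m q)}"
  have P: "P = {q \<in> idx m. level_cond (mult_cond \<eta>) (mult_cond \<chi>1) (mult_cond \<chi>2) m (fst q)}"
    unfolding P_def using adm_iff[OF _ e par] by force
  have X: "pt m q \<in> prime_power 0" if "q \<in> P" for q using pt_props(5)[of "fst q" "snd q"] that by (simp add: P_def)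
  have "has_dim fun_scale (V m) (card P)"
  proof (rule has_dim_by_points[where F = "\<lambda>q. ps_fun (orb_fun m (pt m q))" and ev = "\<lambda>q. (kmat 1 0 (pt m q) 1, 1)"])
    show "finite P" by (simp add: P_def idx_def)
    show "0 \<in> V m" using zero_rep isotypic_iff[OF e] by (simp add: zero_fun_def)
    show "f + g \<in> V m" if fg: "f \<in> V m" "g \<in> V m" for f g
    proof -
      have r: "f \<in> rep_space R" "g \<in> rep_space R" using fg isotypic_iff[OF e] by blast+
      have "f + g \<in> rep_space R"
        unfolding rep_space_iff
      proof (intro conjI allI impI ballI)
        fix h :: "'a mp" assume h: "h \<in> Mp"
        obtain U where U: "openin (Mp_topology \<epsilon> \<psi> \<pi>) U" "h \<in> U" "\<forall>x\<in>U. f x = f h" using r(1) h unfolding rep_space_iff by blast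
        obtain U' where U': "openin (Mp_topology \<epsilon> \<psi> \<pi>) U'" "h \<in> U'" "\<forall>x\<in>U'. g x = g h" using r(2) h unfolding rep_space_iff by blast
        have "(f + g) x = (f + g) h" if "x \<in> U \<inter> U'" for x
          unfolding plus_fun_apply using bspec[OF U(3)] bspec[OF U'(3)] that by (intro arg_cong2[where f = "(+)"]) blast+
        thus "\<exists>U. openin (Mp_topology \<epsilon> \<psi> \<pi>) U \<and> h \<in> U \<and> (\<forall>x\<in>U. (f + g) x = (f + g) h)"
          using openin_Int[OF U(1) U'(1)] U(2) U'(2) by blast
      next
        show "(f + g) h = 0" if "h \<notin> Mp" for h
          using rep_space_zero[OF r(1) that] rep_space_zero[OF r(2) that] by simp
        show "(f + g) (bor a e b \<odot> h) = e * \<theta> a * (f + g) h" if "a \<noteq> 0" "e \<in> {1, -1}" "h \<in> Mp" for a e b h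
          using rep_space_left[OF r(1) that] rep_space_left[OF r(2) that] by (simp add: distrib_left)
      qed
      moreover have "(f + g) (h \<odot> (kmat a b c d, sg c d)) = etah d * (f + g) h" if "\<Gamma> m a b c d" for a b c d h
      proof -
        have "f (h \<odot> (kmat a b c d, sg c d)) = etah d * f h" "g (h \<odot> (kmat a b c d, sg c d)) = etah d * g h"
          using fg isotypic_iff[OF e] that by blast+
        thus ?thesis by (simp add: distrib_left)
      qed
      ultimately show ?thesis using isotypic_iff[OF e] by blast
    qed
    show "fun_scale z f \<in> V m" if f: "f \<in> V m" for z f
    proof -
      have r: "f \<in> rep_space R" using f isotypic_iff[OF e] by blast
      have "fun_scale z f \<in> rep_space R"
        unfolding rep_space_iff
      proof (intro conjI allI impI ballI)
        fix h :: "'a mp" assume h: "h \<in> Mp"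
        obtain U where U: "openin (Mp_topology \<epsilon> \<psi> \<pi>) U" "h \<in> U" "\<forall>x\<in>U. f x = f h" using r h unfolding rep_space_iff by blast
        have "fun_scale z f x = fun_scale z f h" if "x \<in> U" for x
          unfolding fun_scale_def bspec[OF U(3) that] ..
        thus "\<exists>U. openin (Mp_topology \<epsilon> \<psi> \<pi>) U \<and> h \<in> U \<and> (\<forall>x\<in>U. fun_scale z f x = fun_scale z f h)"
          using U(1,2) by blast
      next
        show "fun_scale z f h = 0" if "h \<notin> Mp" for h
          using rep_space_zero[OF r that] by (simp add: fun_scale_def)
        show "fun_scale z f (bor a e b \<odot> h) = e * \<theta> a * fun_scale z f h" if "a \<noteq> 0" "e \<in> {1, -1}" "h \<in> Mp" for a e b h
          using rep_space_left[OF r that] by (simp add: fun_scale_def)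
      qed
      moreover have "fun_scale z f (h \<odot> (kmat a b c d, sg c d)) = etah d * fun_scale z f h" if "\<Gamma> m a b c d" for a b c d h
      proof -
        have "f (h \<odot> (kmat a b c d, sg c d)) = etah d * f h"
          using f isotypic_iff[OF e] that by blast
        thus ?thesis by (simp add: fun_scale_def)
      qed
      ultimately show ?thesis using isotypic_iff[OF e] by blast
    qed
    show "ps_fun (orb_fun m (pt m q)) \<in> V m" if "q \<in> P" for q
      using that by (intro ps_fun_isotypic[OF e] orb_fun_row_space[OF _ e]) (simp add: P_def)
    show "ps_fun (orb_fun m (pt m q)) (kmat 1 0 (pt m r) 1, 1) = (if q = r then 1 else 0)" if qr: "q \<in> P" "r \<in> P" for q r
    proof -
      have ad: "adm m (pt m q)" using qr by (simp add: P_def)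
      have h: "homog (orb_fun m (pt m q))" using orb_fun_row_space[OF ad e] by (simp add: row_space_def)
      have "ps_fun (orb_fun m (pt m q)) (bor 1 1 0 \<odot> (kmat 1 0 (pt m r) 1, sg (pt m r) 1)) = 1 * \<theta> 1 * orb_fun m (pt m q) (pt m r) 1"
        by (rule ps_fun_eval[OF h _ _ ev_pt(1)[OF X[OF qr(2)]]]) auto
      hence 1: "ps_fun (orb_fun m (pt m q)) (kmat 1 0 (pt m r) 1, 1) = orb_fun m (pt m q) (pt m r) 1"
        using bor_1[OF kmat_Mp[OF ev_pt(1)[OF X[OF qr(2)]]]] ev_pt(2)[OF X[OF qr(2)]] by (simp add: theta_1)
      show ?thesis
      proof (cases "q = r")
        case True
        thus ?thesis using 1 orb_fun_self[OF ad e] by simp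
      next
        case False
        have "\<nexists>v a b c d. orb m (pt m q) (pt m r) 1 v a b c d"
          using orbits_distinct[of "fst q" "snd q" m "fst r" "snd r"] qr False by (auto simp: P_def)
        thus ?thesis using 1 False by (simp add: orb_fun_def)
      qed
    qed
    show "f = 0" if f: "f \<in> V m" "\<And>q. q \<in> P \<Longrightarrow> f (kmat 1 0 (pt m q) 1, 1) = 0" for f
      using rep_eq_0_if_points[OF e f(1)] f(2) by (simp add: P_def zero_fun_def)
  qed
  thus ?thesis by (simp add: P)
qed

text \<open>The matrix -1 lies in every \<open>K_grp\<close>, where it acts by \<eta> (-1), while
  \<open>minus_one_act\<close> gives \<mu> (-1).\<close>

lemma isotypic_parity:
  assumes "\<eta> (-1) \<noteq> \<mu> (-1)"
  shows "V m = {0}"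
proof (cases "mult_cond \<eta> \<le> m")
  case False
  thus ?thesis by (simp add: isotypic_def)
next
  case e: True
  have "f = 0" if f: "f \<in> V m" for f
  proof
    fix g :: "'a mp"
    have fr: "f \<in> rep_space R" using f isotypic_iff[OF e] by blast
    have G: "\<Gamma> m (-1) 0 0 (-1)" by (simp add: \<Gamma>_def sl2_def)
    have "sg 0 (-1) = weil_ratio (-1) \<psi>" using weil_ratio_unit[OF psi eps, of "-1"] by (simp add: sg_def p_def)
    moreover have "kmat (-1) 0 0 (-1) = mat (-1)" by (simp add: kmat_def mat_eq_mat2)
    ultimately have "\<mu> (-1) * f g = etah (-1) * f g"
      using minus_one_act[OF fr, of g] f isotypic_iff[OF e] G by metis
    thus "f g = 0 g" using assms by (simp add: etah_def zero_fun_def)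
  qed
  moreover have "0 \<in> V m" using zero_rep isotypic_iff[OF e] by (simp add: zero_fun_def)
  ultimately show ?thesis by blast
qed

text \<open>Of \<eta>, \<mu> and either of \<open>\<chi>1\<close> and \<open>\<chi>2\<close>, each
  is a product of the other two up to inverses. So the largest of the three conductors occurs at
  least twice, and this is the only information about the characters that
  \<open>count_orbits\<close> receives besides e <= m.\<close>

lemma cond_relations:
  "mult_cond \<eta> \<le> max (mult_cond \<mu>) (mult_cond \<chi>1)" "mult_cond \<eta> \<le> max (mult_cond \<mu>) (mult_cond \<chi>2)"
  "mult_cond \<mu> \<le> max (mult_cond \<eta>) (mult_cond \<chi>1)" "mult_cond \<mu> \<le> max (mult_cond \<eta>) (mult_cond \<chi>2)"
  "mult_cond \<chi>1 \<le> max (mult_cond \<eta>) (mult_cond \<mu>)" "mult_cond \<chi>2 \<le> max (mult_cond \<eta>) (mult_cond \<mu>)"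
proof -
  have t: "\<tau> u = 1" if "mult_char_on integer_units \<tau>" "mult_cond \<tau> \<le> n" "u \<in> unit_level n" for \<tau> n and u :: 'a
    using that mult_cond_le_iff by blast
  show "mult_cond \<eta> \<le> max (mult_cond \<mu>) (mult_cond \<chi>1)"
    unfolding mult_cond_le_iff[OF eta]
  proof
    fix u :: 'a assume u: "u \<in> unit_level (max (mult_cond \<mu>) (mult_cond \<chi>1))"
    show "\<eta> u = 1" using t[OF mu_units max.cobounded1 u] t[OF chi1 max.cobounded2 u] by simp
  qed
  show "mult_cond \<eta> \<le> max (mult_cond \<mu>) (mult_cond \<chi>2)"
    unfolding mult_cond_le_iff[OF eta]
  proof
    fix u :: 'a assume u: "u \<in> unit_level (max (mult_cond \<mu>) (mult_cond \<chi>2))"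
    show "\<eta> u = 1" using t[OF mu_units max.cobounded1 u] t[OF chi2 max.cobounded2 u] by simp
  qed
  show "mult_cond \<mu> \<le> max (mult_cond \<eta>) (mult_cond \<chi>1)"
    unfolding mult_cond_le_iff[OF mu_units]
  proof
    fix u :: 'a assume u: "u \<in> unit_level (max (mult_cond \<eta>) (mult_cond \<chi>1))"
    show "\<mu> u = 1" using t[OF eta max.cobounded1 u] t[OF chi1 max.cobounded2 u] by simp
  qed
  show "mult_cond \<mu> \<le> max (mult_cond \<eta>) (mult_cond \<chi>2)"
    unfolding mult_cond_le_iff[OF mu_units]
  proof
    fix u :: 'a assume u: "u \<in> unit_level (max (mult_cond \<eta>) (mult_cond \<chi>2))"
    show "\<mu> u = 1" using t[OF eta max.cobounded1 u] t[OF chi2 max.cobounded2 u] by simp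
  qed
  show "mult_cond \<chi>1 \<le> max (mult_cond \<eta>) (mult_cond \<mu>)"
    unfolding mult_cond_le_iff[OF chi1]
  proof
    fix u :: 'a assume u: "u \<in> unit_level (max (mult_cond \<eta>) (mult_cond \<mu>))"
    show "\<eta> u * \<mu> u = 1" using t[OF eta max.cobounded1 u] t[OF mu_units max.cobounded2 u] by simp
  qed
  show "mult_cond \<chi>2 \<le> max (mult_cond \<eta>) (mult_cond \<mu>)"
    unfolding mult_cond_le_iff[OF chi2]
  proof
    fix u :: 'a assume u: "u \<in> unit_level (max (mult_cond \<eta>) (mult_cond \<mu>))"
    show "\<eta> u * inverse (\<mu> u) = 1" using t[OF eta max.cobounded1 u] t[OF mu_units max.cobounded2 u] by simp
  qed
qed

lemma card_idx:
  "card {q \<in> idx m. Q (fst q)} = card {i. i \<le> m \<and> Q i} + card {i. 0 < i \<and> i < m \<and> Q i}"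
proof -
  have "{q \<in> idx m. Q (fst q)} = (\<lambda>i. (i, False)) ` {i. i \<le> m \<and> Q i} \<union> (\<lambda>i. (i, True)) ` {i. 0 < i \<and> i < m \<and> Q i}"
    by (auto simp: idx_def)
  also have "card \<dots> = card ((\<lambda>i. (i, False)) ` {i. i \<le> m \<and> Q i}) + card ((\<lambda>i. (i, True)) ` {i. 0 < i \<and> i < m \<and> Q i})"
    by (rule card_Un_disjoint) auto
  finally show ?thesis by (simp add: card_image inj_on_def)
qed

end

lemma card_inner:
  assumes "m \<ge> 1"
  shows "card {i::nat. i \<le> m \<and> Q i} = card {i. 0 < i \<and> i < m \<and> Q i} + (if Q 0 then 1 else 0) + (if Q m then 1 else 0)"
proof -
  have "{i. i \<le> m \<and> Q i} = {i. 0 < i \<and> i < m \<and> Q i} \<union> ({i. i = 0 \<and> Q i} \<union> {i. i = m \<and> Q i})"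
    using assms by (auto simp: le_less)
  also have "card \<dots> = card {i. 0 < i \<and> i < m \<and> Q i} + card ({i. i = 0 \<and> Q i} \<union> {i. i = m \<and> Q i})"
    by (rule card_Un_disjoint) auto
  also have "card ({i. i = 0 \<and> Q i} \<union> {i. i = m \<and> Q i}) = card {i. i = 0 \<and> Q i} + card {i. i = m \<and> Q i}"
    using assms by (intro card_Un_disjoint) auto
  moreover have "card {i. i = j \<and> Q i} = (if Q j then 1 else 0)" for j :: nat
  proof -
    have "{i. i = j \<and> Q i} = (if Q j then {j} else {})" by auto
    thus ?thesis by simp
  qed
  ultimately show ?thesis by simp
qed

text \<open>\<open>k\<close> and \<open>e\<close> stand for the conductors of \<open>\<mu>\<close> and \<open>\<eta>\<close>, \<open>c1\<close> and \<open>c2\<close> for those of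
  \<open>\<eta>\<mu>\<close> and \<open>\<eta>\<mu>\<^sup>-\<^sup>1\<close>. An orbit of level \<open>i\<close> splits in two unless \<open>i = 0\<close> or \<open>i = m\<close>, whence the two terms of \<open>N\<close>.\<close>

lemma count_orbits:
  fixes e k c1 c2 m :: nat
  assumes r: "e \<le> max k c1" "e \<le> max k c2" "k \<le> max e c1" "k \<le> max e c2" "c1 \<le> max e k" "c2 \<le> max e k"
    and e: "e \<le> m"
  defines "N \<equiv> card {i. i \<le> m \<and> level_cond e c1 c2 m i} + card {i. 0 < i \<and> i < m \<and> level_cond e c1 c2 m i}"
  shows "k = 0 \<Longrightarrow> e = 0 \<Longrightarrow> m = 0 \<Longrightarrow> N = 1"
    and "m < k \<Longrightarrow> N = 0"
    and "k \<le> m \<Longrightarrow> m < 2 * k \<Longrightarrow> int N = 2 * (max 0 (int m - int k - int c1 + 1) + max 0 (int m - int k - int c2 + 1))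
      - (if c1 = 0 then 1 else 0) - (if c2 = 0 then 1 else 0)"
    and "2 * k \<le> m \<Longrightarrow> m \<ge> 1 \<Longrightarrow> int N = 2 * max 0 (int m - int c1 - int c2 + 1)
      - (if c1 = 0 then 1 else 0) - (if c2 = 0 then 1 else 0)"
proof -
  let ?Q = "level_cond e c1 c2 m"
  show "N = 1" if z: "k = 0" "e = 0" "m = 0"
  proof -
    have "c1 = 0" "c2 = 0" using r z by auto
    hence "{i. i \<le> m \<and> ?Q i} = {0}" "{i. 0 < i \<and> i < m \<and> ?Q i} = {}" using z by (auto simp: level_cond_def)
    thus ?thesis by (simp add: N_def)
  qed
  show "N = 0" if z: "m < k"
  proof -
    \<comment> \<open>From e <= m < k one gets c1 = c2 = k, which exceeds both i and m - i.\<close>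
    have "\<not> ?Q i" if "i \<le> m" for i
      using r e z that unfolding level_cond_def max_def by (auto split: if_splits)
    hence "{i. i \<le> m \<and> ?Q i} = {}" "{i. 0 < i \<and> i < m \<and> ?Q i} = {}" by auto
    thus ?thesis by (simp only: N_def card.empty)
  qed
  have N2: "int N = 2 * int (card {i. i \<le> m \<and> ?Q i}) - (if ?Q 0 then 1 else 0) - (if ?Q m then 1 else 0)" if "m \<ge> 1"
    using card_inner[OF that, of ?Q] by (simp add: N_def)
  show "int N = 2 * (max 0 (int m - int k - int c1 + 1) + max 0 (int m - int k - int c2 + 1))
      - (if c1 = 0 then 1 else 0) - (if c2 = 0 then 1 else 0)" if z: "k \<le> m" "m < 2 * k"
  proof -
    \<comment> \<open>The two ranges correspond to the lower and upper half of the levels; they are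
      disjoint because m < 2 k means m - k < k.\<close>
    have Q: "?Q i \<longleftrightarrow> c2 \<le> i \<and> i \<le> m - k \<or> k \<le> i \<and> i \<le> m - c1" if "i \<le> m" for i
      using r e z that unfolding level_cond_def max_def by (auto split: if_splits)
    have c: "c1 \<le> m" "c2 \<le> m" using r e z by auto
    have "{i. i \<le> m \<and> ?Q i} = {c2..m - k} \<union> {k..m - c1}" using Q by auto
    also have "card \<dots> = card {c2..m - k} + card {k..m - c1}" using z by (intro card_Un_disjoint) auto
    finally have 1: "int (card {i. i \<le> m \<and> ?Q i}) = max 0 (int m - int k - int c1 + 1) + max 0 (int m - int k - int c2 + 1)"
      using z c by (auto simp: of_nat_diff)
    have "?Q 0 \<longleftrightarrow> c2 = 0" "?Q m \<longleftrightarrow> c1 = 0" using Q[of 0] Q[of m] z c by auto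
    thus ?thesis using N2 1 z by simp
  qed
  show "int N = 2 * max 0 (int m - int c1 - int c2 + 1)
      - (if c1 = 0 then 1 else 0) - (if c2 = 0 then 1 else 0)" if z: "2 * k \<le> m" "m \<ge> 1"
  proof -
    \<comment> \<open>Here the bounds on e follow from the others: if e <= k they hold because 2 k
      <= m, and if e > k then c1 = c2 = e. So both halves merge into one interval.\<close>
    have Q: "?Q i \<longleftrightarrow> c2 \<le> i \<and> i \<le> m - c1" if "i \<le> m" for i
      using r e z that unfolding level_cond_def max_def by (auto split: if_splits)
    have c: "c1 \<le> m" "c2 \<le> m" using r e z by auto
    have "{i. i \<le> m \<and> ?Q i} = {c2..m - c1}" using Q by auto
    hence 1: "int (card {i. i \<le> m \<and> ?Q i}) = max 0 (int m - int c1 - int c2 + 1)"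
      using c by (auto simp: of_nat_diff)
    have "?Q 0 \<longleftrightarrow> c2 = 0" "?Q m \<longleftrightarrow> c1 = 0" using Q[of 0] Q[of m] z c by auto
    thus ?thesis using N2 1 z by simp
  qed
qed

section \<open>Dimensions and conductors\<close>

lemma has_dim_0_iff:
  assumes "has_dim fun_scale (W :: ('g \<Rightarrow> complex) set) n"
  shows "W = {0} \<longleftrightarrow> n = 0"
proof -
  interpret vector_space "fun_scale :: complex \<Rightarrow> ('g \<Rightarrow> complex) \<Rightarrow> _" by (rule vector_space_fun_scale)
  obtain B where B: "finite B" "independent B" "span B = W" "card B = n"
    using assms unfolding has_dim_def by blast
  show ?thesis
  proof
    assume W: "W = {0}"
    have "B = {}"
    proof (rule ccontr)
      assume "B \<noteq> {}"
      then obtain b where b: "b \<in> B" by blast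
      hence "b = 0" using span_base[OF b] B(3) W by simp
      thus False using dependent_zero[of B] b B(2) by simp
    qed
    thus "n = 0" using B by simp
  next
    assume "n = 0"
    hence "B = {}" using B by simp
    thus "W = {0}" using B(3) by simp
  qed
qed

lemma has_dim_zero: "has_dim fun_scale {0 :: 'g \<Rightarrow> complex} 0"
proof -
  interpret vector_space "fun_scale :: complex \<Rightarrow> ('g \<Rightarrow> complex) \<Rightarrow> _" by (rule vector_space_fun_scale)
  show ?thesis unfolding has_dim_def by (intro exI[of _ "{}"]) (simp add: independent_empty)
qed

definition dim_formula :: "nat \<Rightarrow> nat \<Rightarrow> nat \<Rightarrow> nat \<Rightarrow> nat \<Rightarrow> int" where
  "dim_formula k e c1 c2 m = (if k = 0 \<and> e = 0 \<and> m = 0 then 1 else if m < k then 0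
     else if m < 2 * k then 2 * (max 0 (int m - int k - int c1 + 1) + max 0 (int m - int k - int c2 + 1))
       - (if c1 = 0 then 1 else 0) - (if c2 = 0 then 1 else 0)
     else 2 * max 0 (int m - int c1 - int c2 + 1) - (if c1 = 0 then 1 else 0) - (if c2 = 0 then 1 else 0))"

context principal_eta
begin

lemma isotypic_dim_formula:
  assumes par: "\<eta> (-1) = \<mu> (-1)"
  shows "\<exists>d. has_dim fun_scale (V m) d \<and> int d = dim_formula (mult_cond \<mu>) (mult_cond \<eta>) (mult_cond \<chi>1) (mult_cond \<chi>2) m"
proof -
  define k e c1 c2 where "k = mult_cond \<mu>" and "e = mult_cond \<eta>" and "c1 = mult_cond \<chi>1" and "c2 = mult_cond \<chi>2"
  note kec = k_def[symmetric] e_def[symmetric] c1_def[symmetric] c2_def[symmetric]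
  note rel = cond_relations[unfolded kec]
  show ?thesis
    unfolding kec
  proof (cases "e \<le> m")
    case True
    define N where "N = card {i. i \<le> m \<and> level_cond e c1 c2 m i} + card {i. 0 < i \<and> i < m \<and> level_cond e c1 c2 m i}"
    note c = count_orbits[OF rel True, folded N_def]
    have m1: "m \<ge> 1" if "2 * k \<le> m" "\<not> (k = 0 \<and> e = 0 \<and> m = 0)" using that True by (cases m) auto
    have "has_dim fun_scale (V m) N"
      using isotypic_dim[OF True[unfolded e_def] par] unfolding card_idx kec N_def .
    moreover have "int N = dim_formula k e c1 c2 m"
    proof -
      consider "k = 0 \<and> e = 0 \<and> m = 0" | "m < k" | "k \<le> m" "m < 2 * k" | "2 * k \<le> m" "\<not> (k = 0 \<and> e = 0 \<and> m = 0)"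
        by linarith
      thus ?thesis
      proof cases
        case 1 thus ?thesis using c(1) by (simp add: dim_formula_def)
      next
        case 2 thus ?thesis using c(2) by (simp add: dim_formula_def)
      next
        case 3
        hence "\<not> (k = 0 \<and> e = 0 \<and> m = 0)" "\<not> m < k" by auto
        thus ?thesis unfolding dim_formula_def using c(3)[OF 3] 3(2) by (simp only: if_False if_True)
      next
        case 4
        hence "\<not> m < k" "\<not> m < 2 * k" by auto
        thus ?thesis unfolding dim_formula_def using c(4)[OF 4(1) m1[OF 4]] 4(2) by (simp only: if_False)
      qed
    qed
    ultimately show "\<exists>d. has_dim fun_scale (V m) d \<and> int d = dim_formula k e c1 c2 m" by blast
  next
    case False
    hence "V m = {0}" by (simp add: isotypic_def e_def)
    \<comment> \<open>Below the conductor of \<eta> the formula vanishes too: if k <= m < e, then c1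
      = c2 = e exceeds m.\<close>
    moreover have "dim_formula k e c1 c2 m = 0"
      using False rel by (auto simp: dim_formula_def max_def split: if_splits)
    ultimately show "\<exists>d. has_dim fun_scale (V m) d \<and> int d = dim_formula k e c1 c2 m"
      using has_dim_zero by (intro exI[of _ 0]) simp
  qed
qed

lemma isotypic_eq_0_iff:
  assumes "\<eta> (-1) = \<mu> (-1)"
  shows "V m = {0} \<longleftrightarrow> dim_formula (mult_cond \<mu>) (mult_cond \<eta>) (mult_cond \<chi>1) (mult_cond \<chi>2) m = 0"
proof -
  obtain d where "has_dim fun_scale (V m) d" "int d = dim_formula (mult_cond \<mu>) (mult_cond \<eta>) (mult_cond \<chi>1) (mult_cond \<chi>2) m"
    using isotypic_dim_formula[OF assms] by metis
  thus ?thesis using has_dim_0_iff[of "V m" d] of_nat_eq_0_iff[of d, where 'a=int] by metis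
qed

lemma isotypic_below: "m < mult_cond \<mu> \<Longrightarrow> V m = {0}"
proof (cases "\<eta> (-1) = \<mu> (-1)")
  case True
  assume "m < mult_cond \<mu>"
  thus ?thesis unfolding isotypic_eq_0_iff[OF True] by (simp add: dim_formula_def)
qed (use isotypic_parity in blast)

text \<open>At m = k > 0 the formula collapses to the number of vanishing conductors among those of
  \<open>\<chi>1\<close> and \<open>\<chi>2\<close>. For k = 0 both equal the conductor of \<eta>,
  and the exceptional value 1 at m = 0 takes effect.\<close>

lemma isotypic_at_cond:
  assumes par: "\<eta> (-1) = \<mu> (-1)"
  shows "V (mult_cond \<mu>) \<noteq> {0} \<longleftrightarrow> mult_cond \<chi>1 = 0 \<or> mult_cond \<chi>2 = 0"
proof (cases "mult_cond \<mu> = 0")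
  case True
  hence "mult_cond \<chi>1 = mult_cond \<eta>" "mult_cond \<chi>2 = mult_cond \<eta>" using cond_relations by auto
  thus ?thesis unfolding isotypic_eq_0_iff[OF par] using True by (simp add: dim_formula_def)
next
  case False
  thus ?thesis unfolding isotypic_eq_0_iff[OF par] by (auto simp: dim_formula_def)
qed

section \<open>Conductors of the principal series\<close>

lemma cond_eta_ge: "enat (mult_cond \<mu>) \<le> cond_eta \<epsilon> \<psi> \<pi> R \<eta>"
  unfolding cond_eta_def
proof (rule Inf_greatest)
  fix x assume "x \<in> {enat m |m. V m \<noteq> {0}}"
  then obtain m where "x = enat m" "V m \<noteq> {0}" by blast
  thus "enat (mult_cond \<mu>) \<le> x" using isotypic_below[of m] by (cases "m < mult_cond \<mu>") auto
qed

lemma cond_eta_eq_iff: "cond_eta \<epsilon> \<psi> \<pi> R \<eta> = enat (mult_cond \<mu>) \<longleftrightarrow> V (mult_cond \<mu>) \<noteq> {0}"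
proof
  assume *: "V (mult_cond \<mu>) \<noteq> {0}"
  have "cond_eta \<epsilon> \<psi> \<pi> R \<eta> \<le> enat (mult_cond \<mu>)"
    unfolding cond_eta_def by (rule Inf_lower) (use * in blast)
  thus "cond_eta \<epsilon> \<psi> \<pi> R \<eta> = enat (mult_cond \<mu>)" using cond_eta_ge by (rule antisym)
next
  assume *: "cond_eta \<epsilon> \<psi> \<pi> R \<eta> = enat (mult_cond \<mu>)"
  show "V (mult_cond \<mu>) \<noteq> {0}"
  proof
    assume V: "V (mult_cond \<mu>) = {0}"
    have "enat (Suc (mult_cond \<mu>)) \<le> cond_eta \<epsilon> \<psi> \<pi> R \<eta>"
      unfolding cond_eta_def
    proof (rule Inf_greatest)
      fix x assume "x \<in> {enat m |m. V m \<noteq> {0}}"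
      then obtain m where m: "x = enat m" "V m \<noteq> {0}" by blast
      hence "m \<noteq> mult_cond \<mu>" "\<not> m < mult_cond \<mu>" using V isotypic_below[of m] by metis+
      thus "enat (Suc (mult_cond \<mu>)) \<le> x" using m(1) by simp
    qed
    thus False using * by simp
  qed
qed

lemma chi_cond_0_iff:
  "mult_cond \<chi>1 = 0 \<longleftrightarrow> (\<forall>u\<in>integer_units. \<eta> u = inverse (\<mu> u))"
  "mult_cond \<chi>2 = 0 \<longleftrightarrow> (\<forall>u\<in>integer_units. \<eta> u = \<mu> u)"
proof -
  have "\<eta> u * \<mu> u = 1 \<longleftrightarrow> \<eta> u = inverse (\<mu> u)" "\<eta> u * inverse (\<mu> u) = 1 \<longleftrightarrow> \<eta> u = \<mu> u"
    if "u \<in> integer_units" for u using mu_nz[OF units_nz[OF that]] by (auto simp: field_simps)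
  thus "mult_cond \<chi>1 = 0 \<longleftrightarrow> (\<forall>u\<in>integer_units. \<eta> u = inverse (\<mu> u))"
    "mult_cond \<chi>2 = 0 \<longleftrightarrow> (\<forall>u\<in>integer_units. \<eta> u = \<mu> u)"
    using mult_cond_le_iff[OF chi1, of 0] mult_cond_le_iff[OF chi2, of 0] by (simp_all add: unit_level_0)
qed

end

context principal
begin

text \<open>The choice \<eta> = \<mu> attains the lower bound; it also supplies a nonzero vector for
  \<open>central_sign_eq\<close>.\<close>

lemma cond_eta_mu: "cond_eta \<epsilon> \<psi> \<pi> R \<mu> = enat (mult_cond \<mu>)" "isotypic \<epsilon> \<psi> \<pi> R \<mu> (mult_cond \<mu>) \<noteq> {0}"
proof -
  interpret mu: principal_eta \<pi> \<epsilon> \<psi> \<mu> \<mu> by unfold_locales (rule mu_units)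
  show "isotypic \<epsilon> \<psi> \<pi> R \<mu> (mult_cond \<mu>) \<noteq> {0}"
    by (rule mu.isotypic_at_cond[OF refl, THEN iffD2], rule disjI2, unfold mu.chi_cond_0_iff(2)) simp
  thus "cond_eta \<epsilon> \<psi> \<pi> R \<mu> = enat (mult_cond \<mu>)" by (rule mu.cond_eta_eq_iff[THEN iffD2])
qed

text \<open>The description of the sign has a unique solution because the space contains a nonzero
  vector.\<close>

lemma central_sign_eq: "central_sign \<psi> R = \<mu> (-1)"
proof -
  have ra: "rep_act R h f = (\<lambda>g. f (g \<odot> h))" and rs: "rep_scale R = fun_scale" for h f
    by (simp_all add: principal_series_def)
  have act: "rep_act R (mat (-1), weil_ratio (-1) \<psi>) f = fun_scale (\<mu> (-1)) f" if "f \<in> rep_space R" for f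
    unfolding ra fun_scale_def using minus_one_act[OF that] by simp
  interpret mu: principal_eta \<pi> \<epsilon> \<psi> \<mu> \<mu> by unfold_locales (rule mu_units)
  have "0 \<in> isotypic \<epsilon> \<psi> \<pi> R \<mu> (mult_cond \<mu>)"
    using mu.zero_rep mu.isotypic_iff[OF order.refl] by (simp add: zero_fun_def)
  then obtain f where f: "f \<in> isotypic \<epsilon> \<psi> \<pi> R \<mu> (mult_cond \<mu>)" "f \<noteq> 0" using cond_eta_mu(2) by blast
  have fr: "f \<in> rep_space R" using f(1) mu.isotypic_iff[OF order.refl] by blast
  obtain g where g: "f g \<noteq> 0" using f(2) by (auto simp: fun_eq_iff)
  show ?thesis
    unfolding central_sign_def rs
  proof (rule the_equality)
    show "\<forall>f\<in>rep_space R. rep_act R (mat (-1), weil_ratio (-1) \<psi>) f = fun_scale (\<mu> (-1)) f" using act by blast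
    fix z assume "\<forall>f\<in>rep_space R. rep_act R (mat (-1), weil_ratio (-1) \<psi>) f = fun_scale z f"
    hence "fun_scale (\<mu> (-1)) f = fun_scale z f" using act[OF fr] fr by simp
    hence "fun_scale (\<mu> (-1)) f g = fun_scale z f g" by simp
    thus "z = \<mu> (-1)" using g by (simp add: fun_scale_def)
  qed
qed

lemma cond_min_eq: "cond_min \<epsilon> \<psi> \<pi> R = enat (mult_cond \<mu>)"
proof (rule antisym)
  show "cond_min \<epsilon> \<psi> \<pi> R \<le> enat (mult_cond \<mu>)"
    unfolding cond_min_def cond_eta_mu(1)[symmetric]
    by (rule Inf_lower) (use mu_units central_sign_eq in auto)
  show "enat (mult_cond \<mu>) \<le> cond_min \<epsilon> \<psi> \<pi> R"
    unfolding cond_min_def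
  proof (rule Inf_greatest)
    fix x assume "x \<in> {cond_eta \<epsilon> \<psi> \<pi> R \<eta> |\<eta>. mult_char_on integer_units \<eta> \<and> \<eta> (- 1) = central_sign \<psi> R}"
    then obtain \<eta> where \<eta>: "x = cond_eta \<epsilon> \<psi> \<pi> R \<eta>" "mult_char_on integer_units \<eta>" by blast
    interpret eta: principal_eta \<pi> \<epsilon> \<psi> \<mu> \<eta> by unfold_locales (rule \<eta>(2))
    show "enat (mult_cond \<mu>) \<le> x" unfolding \<eta>(1) by (rule eta.cond_eta_ge)
  qed
qed

end

context principal_eta
begin

lemma minimal_conductor_iff:
  "\<eta> (-1) = central_sign \<psi> R \<and> cond_min \<epsilon> \<psi> \<pi> R = cond_eta \<epsilon> \<psi> \<pi> R \<eta> \<longleftrightarrow>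
    (\<forall>u\<in>integer_units. \<eta> u = \<mu> u) \<or> (\<forall>u\<in>integer_units. \<eta> u = inverse (\<mu> u))"
proof -
  \<comment> \<open>As \<mu> (-1) is its own inverse, both \<eta> = \<mu> and \<eta> = \<mu>^-1 on
    units satisfy the parity condition on the left-hand side.\<close>
  have "\<mu> (-1) * \<mu> (-1) = 1" using mu_mult[of "-1" "-1"] mu_1 by simp
  hence m: "inverse (\<mu> (-1)) = \<mu> (-1)" by (rule inverse_unique)
  have "\<eta> (-1) = \<mu> (-1)" if "(\<forall>u\<in>integer_units. \<eta> u = \<mu> u) \<or> (\<forall>u\<in>integer_units. \<eta> u = inverse (\<mu> u))"
  proof -
    have "(-1::'a) \<in> integer_units" by simp
    thus ?thesis using that m by metis
  qed
  moreover have "cond_min \<epsilon> \<psi> \<pi> R = cond_eta \<epsilon> \<psi> \<pi> R \<eta> \<longleftrightarrow>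
      (\<forall>u\<in>integer_units. \<eta> u = \<mu> u) \<or> (\<forall>u\<in>integer_units. \<eta> u = inverse (\<mu> u))" if "\<eta> (-1) = \<mu> (-1)"
    unfolding cond_min_eq eq_commute[of "enat (mult_cond \<mu>)"] cond_eta_eq_iff isotypic_at_cond[OF that] chi_cond_0_iff
    by (rule disj_commute)
  ultimately show ?thesis unfolding central_sign_eq by blast
qed

end

theorem theorem4p1:
  fixes \<epsilon> :: nat and \<pi> :: "'a::nonarch_local_field" and \<psi> \<mu> \<eta> :: "'a \<Rightarrow> complex"
  assumes "odd (residue_char TYPE('a))"
    and "uniformizer \<pi>"
    and "\<epsilon> \<in> {0, 1}"
    and "add_char \<psi>" and "\<exists>x. \<psi> x \<noteq> 1" and "add_cond \<psi> = - int \<epsilon>"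
    and "mult_char_on (- {0}) \<mu>"
    and "mult_char_on integer_units \<eta>"
  shows
   "let R = principal_series \<epsilon> \<psi> \<pi> \<mu>;
        V = isotypic \<epsilon> \<psi> \<pi> R \<eta>;
        c = (\<lambda>\<nu>. int (mult_cond \<nu>));
        c1 = c (\<lambda>x. \<eta> x * \<mu> x);
        c2 = c (\<lambda>x. \<eta> x * inverse (\<mu> x));
        pos = (\<lambda>r::int. max 0 r);
        \<delta> = (\<lambda>s::int. if s = 0 then 1 else 0 :: int);
        dim_is = (\<lambda>m (r::int). \<exists>d. has_dim fun_scale (V m) d \<and> int d = r)
    in
      (\<eta> (-1) \<noteq> \<mu> (-1) \<longrightarrow> (\<forall>m. V m = {0})) \<and>
      (\<eta> (-1) = \<mu> (-1) \<longrightarrow> (\<forall>m.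
         if c \<mu> = 0 \<and> c \<eta> = 0 \<and> m = 0 then dim_is m 1
         else if int m < c \<mu> then dim_is m 0
         else if int m < 2 * c \<mu> then
           dim_is m (2 * (pos (int m - c \<mu> - c1 + 1) + pos (int m - c \<mu> - c2 + 1)) - \<delta> c1 - \<delta> c2)
         else dim_is m (2 * pos (int m - c1 - c2 + 1) - \<delta> c1 - \<delta> c2))) \<and>
      (\<eta> (-1) = central_sign \<psi> R \<and> cond_min \<epsilon> \<psi> \<pi> R = cond_eta \<epsilon> \<psi> \<pi> R \<eta> \<longleftrightarrow>
         (\<forall>u\<in>integer_units. \<eta> u = \<mu> u) \<or> (\<forall>u\<in>integer_units. \<eta> u = inverse (\<mu> u))) \<and>
      cond_min \<epsilon> \<psi> \<pi> R = enat (mult_cond \<mu>)"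
proof -
  interpret odd_local_field \<pi> using assms(1,2) by unfold_locales
  have "has_cond \<psi> (- int \<epsilon>)"
    using add_cond_spec[OF assms(4,5)] assms(4,6) by (simp add: has_cond_def)
  then interpret principal_eta \<pi> \<epsilon> \<psi> \<mu> \<eta>
    using assms(3,7,8) by unfold_locales
  show ?thesis
    unfolding Let_def
  proof (intro conjI impI allI)
    show "V m = {0}" if "\<eta> (-1) \<noteq> \<mu> (-1)" for m by (rule isotypic_parity[OF that])
    show "\<eta> (- 1) = central_sign \<psi> R \<and> cond_min \<epsilon> \<psi> \<pi> R = cond_eta \<epsilon> \<psi> \<pi> R \<eta> \<longleftrightarrow>
         (\<forall>u\<in>integer_units. \<eta> u = \<mu> u) \<or> (\<forall>u\<in>integer_units. \<eta> u = inverse (\<mu> u))"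
      by (rule minimal_conductor_iff)
    show "cond_min \<epsilon> \<psi> \<pi> R = enat (mult_cond \<mu>)" by (rule cond_min_eq)
    fix m assume "\<eta> (-1) = \<mu> (-1)"
    then obtain d where d: "has_dim fun_scale (V m) d"
      "int d = dim_formula (mult_cond \<mu>) (mult_cond \<eta>) (mult_cond \<chi>1) (mult_cond \<chi>2) m"
      using isotypic_dim_formula by metis
    have if_intro: "if P then A else B" if "P \<Longrightarrow> A" "\<not> P \<Longrightarrow> B" for P A B using that by simp
    have ex: "\<exists>d. has_dim fun_scale (V m) d \<and> int d = x"
      if "dim_formula (mult_cond \<mu>) (mult_cond \<eta>) (mult_cond \<chi>1) (mult_cond \<chi>2) m = x" for x
      using d that by blast
    show "if int (mult_cond \<mu>) = 0 \<and> int (mult_cond \<eta>) = 0 \<and> m = 0 then \<exists>d. has_dim fun_scale (V m) d \<and> int d = 1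
      else if int m < int (mult_cond \<mu>) then \<exists>d. has_dim fun_scale (V m) d \<and> int d = 0
      else if int m < 2 * int (mult_cond \<mu>) then \<exists>d. has_dim fun_scale (V m) d \<and>
        int d = 2 * (max 0 (int m - int (mult_cond \<mu>) - int (mult_cond \<chi>1) + 1) + max 0 (int m - int (mult_cond \<mu>) - int (mult_cond \<chi>2) + 1))
          - (if int (mult_cond \<chi>1) = 0 then 1 else 0) - (if int (mult_cond \<chi>2) = 0 then 1 else 0)
      else \<exists>d. has_dim fun_scale (V m) d \<and> int d = 2 * max 0 (int m - int (mult_cond \<chi>1) - int (mult_cond \<chi>2) + 1)
          - (if int (mult_cond \<chi>1) = 0 then 1 else 0) - (if int (mult_cond \<chi>2) = 0 then 1 else 0)"
      by (intro if_intro; intro ex; simp add: dim_formula_def)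
  qed
qed

end
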